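(* The following decision problem is $\mathcal{NP}$-hard: given a finite simple undirected graph $G$, decide whether $G$ admits a straight-line RAC drawing.
   Context: A straight-line drawing of a graph $G=(V,E)$ maps the vertices to distinct points of the plane and each edge $(u,v)$ to the straight-line segment joining the images of $u$ and $v$; no edge passes through the image of a vertex other than its endpoints, and no two edges overlap. Two edges cross if their segments meet at a point interior to both. A straight-line RAC (right-angle crossing) drawing is a straight-line drawing in which every pair of crossing edges is perpendicular. *)

theory Defs
  imports "HOL-Analysis.Analysis" "HOL-Computational_Algebra.Polynomial"
begin

section \<open>Straight-line RAC drawings\<close>

definition simple_graph :: "'a set \<Rightarrow> 'a set set \<Rightarrow> bool" where
  "simple_graph V E \<longleftrightarrow> finite V \<and> (\<forall>e\<in>E. e \<subseteq> V \<and> card e = 2)"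

definition straight_line_drawing :: "'a set \<Rightarrow> 'a set set \<Rightarrow> ('a \<Rightarrow> real ^ 2) \<Rightarrow> bool" where
  "straight_line_drawing V E f \<longleftrightarrow>
     inj_on f V \<and>
     (\<forall>u v w. {u, v} \<in> E \<and> w \<in> V - {u, v} \<longrightarrow> f w \<notin> closed_segment (f u) (f v)) \<and>
     (\<forall>u v x y. {u, v} \<in> E \<and> {x, y} \<in> E \<and> {u, v} \<noteq> {x, y} \<longrightarrow>
        \<not> (\<exists>a b. a \<noteq> b \<and>
             closed_segment a b \<subseteq> closed_segment (f u) (f v) \<inter> closed_segment (f x) (f y)))"

definition RAC_drawing :: "'a set \<Rightarrow> 'a set set \<Rightarrow> ('a \<Rightarrow> real ^ 2) \<Rightarrow> bool" where
  "RAC_drawing V E f \<longleftrightarrow>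
     straight_line_drawing V E f \<and>
     (\<forall>u v x y. {u, v} \<in> E \<and> {x, y} \<in> E \<and> {u, v} \<noteq> {x, y} \<and>
        open_segment (f u) (f v) \<inter> open_segment (f x) (f y) \<noteq> {} \<longrightarrow>
        orthogonal (f u - f v) (f x - f y))"

definition admits_RAC_drawing :: "'a set \<Rightarrow> 'a set set \<Rightarrow> bool" where
  "admits_RAC_drawing V E \<longleftrightarrow> (\<exists>f. RAC_drawing V E f)"

text \<open>The row-major adjacency matrix of a graph with vertex set \<open>{..<n}\<close>. Its length \<open>n * n\<close>
  determines \<open>n\<close>, so no separators are needed.\<close>

definition adjacency_word :: "nat \<Rightarrow> nat set set \<Rightarrow> bool list" where
  "adjacency_word n E = concat (map (\<lambda>i. map (\<lambda>j. {i, j} \<in> E) [0..<n]) [0..<n])"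

section \<open>Multi-tape Turing machines\<close>

datatype head_move = MoveLeft | Stay | MoveRight

text \<open>States and tape symbols are natural numbers. A transition \<open>((q, rs), (q', ws))\<close> applies in
  state \<open>q\<close> if \<open>rs ! i\<close> is the symbol under the head of tape \<open>i\<close>; it switches to state \<open>q'\<close>
  and on tape \<open>i\<close> performs the write and head movement \<open>ws ! i\<close>. Since the transition relation is
  required to be finite, only finitely many states and symbols can be used.
  State 0 is initial, state 1 is accepting; symbol 0 is the blank, 1 and 2 represent the bits.\<close>

record turing_machine =
  tapes :: nat
  trans :: "((nat \<times> nat list) \<times> (nat \<times> (nat \<times> head_move) list)) set"

definition well_formed :: "turing_machine \<Rightarrow> bool" where
  "well_formed M \<longleftrightarrow> tapes M \<ge> 1 \<and> finite (trans M) \<and>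
     (\<forall>((q, rs), (q', ws)) \<in> trans M. length rs = tapes M \<and> length ws = tapes M)"

text \<open>Two-way infinite tape contents together with the head position.\<close>

type_synonym tape = "(int \<Rightarrow> nat) \<times> int"

type_synonym config = "nat \<times> tape list"

fun read_tape :: "tape \<Rightarrow> nat" where
  "read_tape (t, h) = t h"

fun shift :: "head_move \<Rightarrow> int" where
  "shift MoveLeft = -1"
| "shift Stay = 0"
| "shift MoveRight = 1"

fun update_tape :: "nat \<times> head_move \<Rightarrow> tape \<Rightarrow> tape" where
  "update_tape (s, m) (t, h) = (t(h := s), h + shift m)"

definition step :: "turing_machine \<Rightarrow> (config \<times> config) set" where
  "step M = {((q, ts), (q', map2 update_tape ws ts)) | q ts q' ws.
               ((q, map read_tape ts), (q', ws)) \<in> trans M}"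

definition word_content :: "bool list \<Rightarrow> int \<Rightarrow> nat" where
  "word_content w i =
     (if 0 \<le> i \<and> i < int (length w) then (if w ! nat i then 2 else 1) else 0)"

definition initial :: "turing_machine \<Rightarrow> bool list \<Rightarrow> config" where
  "initial M w = (0, (word_content w, 0) # replicate (tapes M - 1) (\<lambda>_. 0, 0))"

text \<open>Every computation, along every nondeterministic branch, halts within the bound.\<close>

definition polynomial_time :: "turing_machine \<Rightarrow> bool" where
  "polynomial_time M \<longleftrightarrow>
     (\<exists>p :: nat poly. \<forall>w k c. (initial M w, c) \<in> step M ^^ k \<longrightarrow> k \<le> poly p (length w))"

definition halts_in :: "turing_machine \<Rightarrow> bool list \<Rightarrow> config \<Rightarrow> bool" where
  "halts_in M w c \<longleftrightarrow> (initial M w, c) \<in> (step M)\<^sup>* \<and> c \<notin> Domain (step M)"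

definition accepts :: "turing_machine \<Rightarrow> bool list \<Rightarrow> bool" where
  "accepts M w \<longleftrightarrow> (\<exists>c. halts_in M w c \<and> fst c = 1)"

text \<open>The output is the content of the last tape, regardless of its head position.\<close>

definition computes :: "turing_machine \<Rightarrow> (bool list \<Rightarrow> bool list) \<Rightarrow> bool" where
  "computes M f \<longleftrightarrow> (\<forall>w. \<exists>c. halts_in M w c \<and> fst (last (snd c)) = word_content (f w))"

section \<open>NP-hardness\<close>

definition NP :: "bool list set set" where
  "NP = {L. \<exists>M. well_formed M \<and> polynomial_time M \<and> L = {w. accepts M w}}"

definition polynomial_time_computable :: "(bool list \<Rightarrow> bool list) \<Rightarrow> bool" where
  "polynomial_time_computable f \<longleftrightarrow>
     (\<exists>M. well_formed M \<and> single_valued (trans M) \<and> polynomial_time M \<and> computes M f)"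

definition polynomial_time_reducible :: "bool list set \<Rightarrow> bool list set \<Rightarrow> bool" where
  "polynomial_time_reducible A B \<longleftrightarrow>
     (\<exists>f. polynomial_time_computable f \<and> (\<forall>w. w \<in> A \<longleftrightarrow> f w \<in> B))"

definition NP_hard :: "bool list set \<Rightarrow> bool" where
  "NP_hard B \<longleftrightarrow> (\<forall>A\<in>NP. polynomial_time_reducible A B)"

end

theory Submission
  imports Defs
begin

text \<open>Acceptance by a nondeterministic machine is expressed as satisfiability, satisfiability as bin
  packing with numbers of polynomial size, and bin packing by a graph with two hubs \<open>u\<close>, \<open>v\<close> and many
  \<^emph>\<open>layers\<close>, the common neighbours of \<open>u\<close> and \<open>v\<close>. Two disjoint crossing edges are perpendicular, so an
  edge crosses at most one edge of a star; by Thales' theorem at most one pair of layers on either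
  side of the line \<open>uv\<close> has crossing spokes. Hence, up to a bounded number of exceptions, the layers
  \<open>x\<close> give nested triangles \<open>u v x\<close>, cyclically ordered around the segment \<open>uv\<close>, and every other edge
  crosses at most one of them. An item of size \<open>s\<close> is a block of \<open>s\<close> layers, consecutive ones joined by
  nine paths of length two, so that nothing can come between them. Long blocks serve as walls, and the walls
  bounding a bin are joined by a path which has to cross all layers placed in the bin, one layer per edge; its
  length therefore bounds the total size of these items. Conversely, a packing is drawn with all layers on a line
  perpendicular to \<open>uv\<close> and each path crossing the spokes of one hub at right angles. Multiplying all
  sizes by ten absorbs the exceptional layers.\<close>

section \<open>Counter programs and Turing machines\<close>

text \<open>Crossings are allowed, so a closed curve of spokes separates nothing outright. All
  arguments count how often an edge can cross the spokes of two layers \<open>x\<close> and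
  \<open>y\<close>, which form the quadrilateral \<open>u x v y\<close>.

  A connection of nine paths survives because two ends, two hubs and two layers leave room for only
  2 * 2 * 2 = 8 crossed paths. The factor ten has a similar origin: five layers may be exceptional
  in a drawing, and each of the two end edges of a path ends in a layer and may cross two layers
  instead of one, so a bin can exceed its capacity by at most 5 + 4 = 9.

  Item sizes are numbers of layers, that is, unary, so bin packing is needed with polynomially
  bounded sizes. The difficulty is that sizes alone must tell an item which two bins it may use. The
  item of the pair (p, q) therefore carries the coefficients of ((p - X) * (q - X))^2, as a
  polynomial in X, as digits in a polynomially large base. If the contents of bin o match its
  capacity in all these digits, the sum of the squares at X = o is zero.\<close>

datatype oper = Inc nat | Dec nat | Rd nat nat | InR | InL | OutR nat

datatype prog = Op oper | Seq prog prog (infixr ";;" 60) | While nat prog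

text \<open>Registers, position of the head on the input, and the output written so far.\<close>

type_synonym mem = "(nat \<Rightarrow> nat) \<times> int \<times> bool list"

fun oper_sem :: "bool list \<Rightarrow> oper \<Rightarrow> mem \<Rightarrow> mem" where
  "oper_sem w (Inc r) (s, i, out) = (s(r := s r + 1), i, out)"
| "oper_sem w (Dec r) (s, i, out) = (s(r := s r - 1), i, out)"
| "oper_sem w (Rd a r) (s, i, out) = (s(r := s r + (if word_content w i = a then 1 else 0)), i, out)"
| "oper_sem w InR (s, i, out) = (s, i + 1, out)"
| "oper_sem w InL (s, i, out) = (s, i - 1, out)"
| "oper_sem w (OutR r) (s, i, out) = (s, i, out @ [s r \<noteq> 0])"

fun oper_below :: "nat \<Rightarrow> oper \<Rightarrow> bool" where
  "oper_below m (Inc r) \<longleftrightarrow> r < m"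
| "oper_below m (Dec r) \<longleftrightarrow> r < m"
| "oper_below m (Rd a r) \<longleftrightarrow> r < m"
| "oper_below m (OutR r) \<longleftrightarrow> r < m"
| "oper_below m _ \<longleftrightarrow> True"

fun prog_below :: "nat \<Rightarrow> prog \<Rightarrow> bool" where
  "prog_below m (Op a) \<longleftrightarrow> oper_below m a"
| "prog_below m (P ;; Q) \<longleftrightarrow> prog_below m P \<and> prog_below m Q"
| "prog_below m (While r P) \<longleftrightarrow> r < m \<and> prog_below m P"

text \<open>The time is the exact number of machine steps of the compiled code. The two extra units
  of a loop iteration are the test at its head and the jump back.\<close>

inductive exec :: "bool list \<Rightarrow> prog \<Rightarrow> mem \<Rightarrow> nat \<Rightarrow> mem \<Rightarrow> bool" for w where
  exec_op: "exec w (Op a) x 1 (oper_sem w a x)"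
| exec_seq: "exec w P x t y \<Longrightarrow> exec w Q y t' z \<Longrightarrow> exec w (P ;; Q) x (t + t') z"
| exec_done: "fst x r = 0 \<Longrightarrow> exec w (While r P) x 1 x"
| exec_loop: "fst x r \<noteq> 0 \<Longrightarrow> exec w P x t y \<Longrightarrow> exec w (While r P) y t' z \<Longrightarrow>
    exec w (While r P) x (1 + (t + (1 + t'))) z"

datatype instr = Do oper | Jz nat nat | Jmp nat

text \<open>\<open>b\<close> is the address at which the code will be placed. Jump targets are
  absolute, and a loop is left to the address just after its closing \<open>Jmp\<close>.\<close>

fun compile :: "nat \<Rightarrow> prog \<Rightarrow> instr list" where
  "compile b (Op a) = [Do a]"
| "compile b (P ;; Q) = compile b P @ compile (b + length (compile b P)) Q"
| "compile b (While r P) = Jz r (b + length (compile (b + 1) P) + 2) # compile (b + 1) P @ [Jmp b]"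

text \<open>A register tape shows the marker 1 exactly if the register is zero. \<open>Dec\<close>
  then stays in place, which agrees with truncated subtraction. All other tapes write back what they
  read.\<close>

fun action :: "nat \<Rightarrow> oper \<Rightarrow> nat list \<Rightarrow> (nat \<times> head_move) list" where
  "action m (Inc r) rs = (map (\<lambda>a. (a, Stay)) rs)[r + 1 := (rs ! (r + 1), MoveRight)]"
| "action m (Dec r) rs = (map (\<lambda>a. (a, Stay)) rs)
     [r + 1 := (rs ! (r + 1), if rs ! (r + 1) = 1 then Stay else MoveLeft)]"
| "action m (Rd a r) rs = (map (\<lambda>a. (a, Stay)) rs)
     [r + 1 := (rs ! (r + 1), if rs ! 0 = a then MoveRight else Stay)]"
| "action m InR rs = (map (\<lambda>a. (a, Stay)) rs)[0 := (rs ! 0, MoveRight)]"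
| "action m InL rs = (map (\<lambda>a. (a, Stay)) rs)[0 := (rs ! 0, MoveLeft)]"
| "action m (OutR r) rs = (map (\<lambda>a. (a, Stay)) rs)
     [m + 1 := (if rs ! (r + 1) = 1 then 1 else 2, MoveRight)]"

fun instr_next :: "nat \<Rightarrow> nat \<Rightarrow> instr \<Rightarrow> nat list \<Rightarrow> nat \<times> (nat \<times> head_move) list" where
  "instr_next m pc (Do a) rs = (pc + 1, action m a rs)"
| "instr_next m pc (Jz r l) rs = (if rs ! (r + 1) = 1 then l else pc + 1, map (\<lambda>a. (a, Stay)) rs)"
| "instr_next m pc (Jmp l) rs = (l, map (\<lambda>a. (a, Stay)) rs)"

text \<open>States 0 and 1 have a fixed meaning, so the program counter \<open>pc\<close> becomes
  the state \<open>pc + 2\<close>. State 0 only writes the markers.\<close>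

definition delta :: "nat \<Rightarrow> instr list \<Rightarrow> nat \<Rightarrow> nat list \<Rightarrow> nat \<times> (nat \<times> head_move) list" where
  "delta m is q rs =
     (if q = 0 then (2, (rs ! 0, Stay) # replicate m (1, Stay) @ [(0, Stay)])
      else let (pc, ws) = instr_next m (q - 2) (is ! (q - 2)) rs in (pc + 2, ws))"

definition symbol_lists :: "nat \<Rightarrow> nat list set" where
  "symbol_lists n = {rs. set rs \<subseteq> {0, 1, 2} \<and> length rs = n}"

text \<open>Tape \<open>0\<close> is the input, tape \<open>r + 1\<close> stores register \<open>r\<close> as the distance of its head from a
  marker at cell \<open>0\<close>, and tape \<open>m + 1\<close> is the output. The marker is written by the first step.\<close>

definition machine :: "nat \<Rightarrow> instr list \<Rightarrow> turing_machine" where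
  "machine m is = \<lparr>tapes = m + 2, trans = (\<lambda>(q, rs). ((q, rs), delta m is q rs)) `
     (({0} \<union> {2..<length is + 2}) \<times> symbol_lists (m + 2))\<rparr>"

definition tape_of :: "nat \<Rightarrow> bool list \<Rightarrow> mem \<Rightarrow> nat \<Rightarrow> tape" where
  "tape_of m w x j = (case x of (s, i, out) \<Rightarrow>
     if j = 0 then (word_content w, i)
     else if j \<le> m then ((\<lambda>_. 0)(0 := 1), int (s (j - 1)))
     else (word_content out, int (length out)))"

definition conf :: "nat \<Rightarrow> bool list \<Rightarrow> nat \<Rightarrow> mem \<Rightarrow> config" where
  "conf m w pc x = (pc + 2, map (tape_of m w x) [0..<m + 2])"

section \<open>Simulation of counter programs by Turing machines\<close>

lemma word_content_le_2: "word_content w i \<in> {0, 1, 2}"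
  by (simp add: word_content_def)

lemma word_content_snoc:
  "(word_content u)(int (length u) := if b then 2 else 1) = word_content (u @ [b])"
  by (rule ext) (auto simp: word_content_def nth_append)

lemma finite_symbol_lists: "finite (symbol_lists n)"
  unfolding symbol_lists_def by (rule finite_lists_length_eq) simp

lemma length_action [simp]: "length (action m a rs) = length rs"
  by (cases a) auto

lemma length_delta: "length rs = m + 2 \<Longrightarrow> length (snd (delta m is q rs)) = m + 2"
  by (cases "is ! (q - 2)") (auto simp: delta_def Let_def split: prod.splits)

lemma well_formed_machine: "well_formed (machine m is)"
proof -
  have "length rs = m + 2 \<and> length ws = m + 2"
    if "((q, rs), (q', ws)) \<in> trans (machine m is)" for q rs q' ws
  proof -
    from that have "length rs = m + 2" "delta m is q rs = (q', ws)"
      by (auto simp: machine_def symbol_lists_def)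
    then show ?thesis using length_delta[of rs m "is" q] by simp
  qed
  moreover have "tapes (machine m is) = m + 2" "finite (trans (machine m is))"
    by (auto simp: machine_def finite_symbol_lists)
  ultimately show ?thesis unfolding well_formed_def by auto
qed

lemma single_valued_machine: "single_valued (trans (machine m is))"
proof (rule single_valuedI)
  fix x y z assume "(x, y) \<in> trans (machine m is)" "(x, z) \<in> trans (machine m is)"
  then have "y = delta m is (fst x) (snd x)" "z = delta m is (fst x) (snd x)"
    by (auto simp: machine_def)
  then show "y = z" by simp
qed

lemma machine_step:
  assumes "q \<in> {0} \<union> {2..<length is + 2}" "map read_tape ts \<in> symbol_lists (m + 2)"
    "delta m is q (map read_tape ts) = (q', ws)"
  shows "((q, ts), (q', map2 update_tape ws ts)) \<in> step (machine m is)"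
proof -
  have "((q, map read_tape ts), (q', ws)) \<in> trans (machine m is)"
    using assms by (auto simp: machine_def image_iff intro!: bexI[of _ "(q, map read_tape ts)"])
  then show ?thesis unfolding step_def by blast
qed

lemma read_tape_of:
  "read_tape (tape_of m w (s, i, out) j) =
    (if j = 0 then word_content w i else if j \<le> m then (if s (j - 1) = 0 then 1 else 0) else 0)"
  by (auto simp: tape_of_def word_content_def)

lemma read_tapes_in: "map read_tape (map (tape_of m w x) [0..<m + 2]) \<in> symbol_lists (m + 2)"
  using word_content_le_2 by (cases x) (auto simp: symbol_lists_def read_tape_of word_content_def)

lemma update_Stay: "update_tape (read_tape tp, Stay) tp = tp"
  by (cases tp) auto

lemma step_Do:
  assumes pc: "pc < length is" "is ! pc = Do a" and a: "oper_below m a"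
  shows "(conf m w pc x, conf m w (pc + 1) (oper_sem w a x)) \<in> step (machine m is)"
proof -
  let ?ts = "map (tape_of m w x) [0..<m + 2]" and ?rs = "map read_tape (map (tape_of m w x) [0..<m + 2])"
  obtain s i out where x: "x = (s, i, out)" by (cases x)
  have "map2 update_tape (action m a ?rs) ?ts = map (tape_of m w (oper_sem w a x)) [0..<m + 2]"
  proof (rule nth_equalityI)
    fix j assume "j < length (map2 update_tape (action m a ?rs) ?ts)"
    then have j: "j < m + 2" by simp
    have "map2 update_tape (action m a ?rs) ?ts ! j = update_tape (action m a ?rs ! j) (tape_of m w x j)"
      using j by (simp del: upt_Suc)
    also have "\<dots> = tape_of m w (oper_sem w a x) j"
      using a j word_content_snoc[of out True] word_content_snoc[of out False] unfolding x
      by (cases a)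
         (auto simp: nth_list_update update_Stay read_tape_of simp del: upt_Suc,
          auto simp: tape_of_def fun_upd_idem word_content_def)
    finally show "map2 update_tape (action m a ?rs) ?ts ! j =
        map (tape_of m w (oper_sem w a x)) [0..<m + 2] ! j" using j by (simp del: upt_Suc)
  qed simp
  moreover have "delta m is (pc + 2) ?rs = (pc + 1 + 2, action m a ?rs)"
    using pc by (simp add: delta_def)
  ultimately show ?thesis
    unfolding conf_def using machine_step[of "pc + 2" "is" ?ts m "pc + 1 + 2" "action m a ?rs"]
      read_tapes_in[of m w x] pc by simp
qed

lemma step_jump:
  assumes pc: "pc < length is" and
    l: "(is ! pc = Jmp l) \<or> (\<exists>r k. r < m \<and> is ! pc = Jz r k \<and> l = (if fst x r = 0 then k else pc + 1))"
  shows "(conf m w pc x, conf m w l x) \<in> step (machine m is)"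
proof -
  let ?ts = "map (tape_of m w x) [0..<m + 2]" and ?rs = "map read_tape (map (tape_of m w x) [0..<m + 2])"
  obtain s i out where x: "x = (s, i, out)" by (cases x)
  have "map2 update_tape (map (\<lambda>a. (a, Stay)) ?rs) ?ts = ?ts"
    by (rule nth_equalityI) (auto simp: update_Stay simp del: upt_Suc)
  moreover have "delta m is (pc + 2) ?rs = (l + 2, map (\<lambda>a. (a, Stay)) ?rs)"
    using l by (auto simp: delta_def x read_tape_of simp del: upt_Suc)
  ultimately show ?thesis
    unfolding conf_def using machine_step[of "pc + 2" "is" ?ts m "l + 2"]
      read_tapes_in[of m w x] pc by simp
qed

text \<open>Allowing the code to sit at any address \<open>b\<close> of a larger program is what the
  induction needs for sequences and loop bodies.\<close>

lemma exec_compile: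
  assumes "exec w P x t y" "prog_below m P" "b + length (compile b P) \<le> length is"
    "\<forall>j < length (compile b P). is ! (b + j) = compile b P ! j"
  shows "(conf m w b x, conf m w (b + length (compile b P)) y) \<in> step (machine m is) ^^ t"
  using assms
proof (induction arbitrary: b rule: exec.induct)
  case (exec_op a x)
  then show ?case using step_Do[of b "is" a m w x] by auto
next
  case (exec_seq P x t y Q t' z)
  let ?b = "b + length (compile b P)"
  have 1: "(conf m w b x, conf m w ?b y) \<in> step (machine m is) ^^ t"
    using exec_seq.prems by (intro exec_seq.IH(1)) (auto simp: nth_append)
  have 2: "(conf m w ?b y, conf m w (?b + length (compile ?b Q)) z) \<in> step (machine m is) ^^ t'"
  proof (rule exec_seq.IH(2))
    show "\<forall>j<length (compile ?b Q). is ! (?b + j) = compile ?b Q ! j"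
    proof (intro allI impI)
      fix j assume "j < length (compile ?b Q)"
      then show "is ! (?b + j) = compile ?b Q ! j"
        using exec_seq.prems(3)[rule_format, of "length (compile b P) + j"]
        by (simp add: nth_append add.assoc)
    qed
  qed (use exec_seq.prems in auto)
  show ?case using 1 2 by (auto simp: relpow_add add.assoc)
next
  case (exec_done x r P)
  have "is ! b = Jz r (b + length (compile (b + 1) P) + 2)"
    using exec_done.prems(3)[rule_format, of 0] by simp
  then have "(conf m w b x, conf m w (b + length (compile (b + 1) P) + 2) x) \<in> step (machine m is)"
    using exec_done by (intro step_jump) auto
  then show ?case by (auto simp: add.assoc)
next
  case (exec_loop x r P t y t' z)
  let ?C = "compile (b + 1) P"
  have "is ! b = Jz r (b + length ?C + 2)"
    using exec_loop.prems(3)[rule_format, of 0] by simp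
  then have "(conf m w b x, conf m w (b + 1) x) \<in> step (machine m is)"
    using exec_loop by (intro step_jump) auto
  then have 1: "(conf m w b x, conf m w (b + 1) x) \<in> step (machine m is) ^^ 1" by auto
  have 2: "(conf m w (b + 1) x, conf m w (b + 1 + length ?C) y) \<in> step (machine m is) ^^ t"
  proof (rule exec_loop.IH(1))
    show "\<forall>j<length ?C. is ! (b + 1 + j) = ?C ! j"
    proof (intro allI impI)
      fix j assume "j < length ?C"
      then show "is ! (b + 1 + j) = ?C ! j"
        using exec_loop.prems(3)[rule_format, of "Suc j"] by (simp add: nth_append)
    qed
  qed (use exec_loop.prems in auto)
  have "is ! (b + 1 + length ?C) = Jmp b"
    using exec_loop.prems(3)[rule_format, of "Suc (length ?C)"] by (simp add: nth_append)
  then have "(conf m w (b + 1 + length ?C) y, conf m w b y) \<in> step (machine m is)"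
    using exec_loop.prems by (intro step_jump) auto
  then have 3: "(conf m w (b + 1 + length ?C) y, conf m w b y) \<in> step (machine m is) ^^ 1" by auto
  have 4: "(conf m w b y, conf m w (b + length (compile b (While r P))) z) \<in> step (machine m is) ^^ t'"
    using exec_loop.prems by (intro exec_loop.IH(2)) auto
  show ?case using 1 2 3 4 unfolding relpow_add by blast
qed

text \<open>\<open>polynomial_time\<close> speaks of all runs, including unfinished ones. In a
  deterministic machine they are all prefixes of the one halting run, so timing that run is
  enough.\<close>

lemma halting_run_bound:
  assumes sv: "single_valued R" and "(a, b) \<in> R ^^ t" "b \<notin> Domain R" "(a, c) \<in> R ^^ k"
  shows "k \<le> t"
proof (rule ccontr)
  assume "\<not> k \<le> t"
  then obtain j where k: "k = t + Suc j" by (metis less_iff_Suc_add not_le add_Suc_right)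
  then obtain b' where b': "(a, b') \<in> R ^^ t" "(b', c) \<in> R ^^ Suc j"
    using assms(4) by (auto simp: relpow_add)
  have "single_valued (R ^^ n)" for n
    by (induction n) (auto intro!: single_valued_relcomp sv single_valued_Id)
  then have "b' = b" using b'(1) assms(2) by (auto dest: single_valuedD)
  then show False using b'(2) assms(3) by (metis Domain.DomainI relpow_Suc_E2)
qed

lemma single_valued_step:
  assumes "single_valued (trans M)"
  shows "single_valued (step M)"
proof (rule single_valuedI)
  fix x y z assume "(x, y) \<in> step M" "(x, z) \<in> step M"
  then obtain q' ws q'' ws' where
    "y = (q', map2 update_tape ws (snd x))" "((fst x, map read_tape (snd x)), (q', ws)) \<in> trans M"
    "z = (q'', map2 update_tape ws' (snd x))" "((fst x, map read_tape (snd x)), (q'', ws')) \<in> trans M"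
    by (auto simp: step_def)
  then show "y = z" using assms by (metis prod.inject single_valuedD)
qed

lemma prog_computable:
  assumes P: "prog_below m P"
    and run: "\<And>w. \<exists>t s i. t \<le> poly p (length w) \<and> exec w P (\<lambda>_. 0, 0, []) t (s, i, f w)"
  shows "polynomial_time_computable f"
proof -
  define code where "code = compile 0 P"
  let ?M = "machine m code"
  have run': "\<exists>t c. t \<le> poly p (length w) + 1 \<and> (initial ?M w, c) \<in> step ?M ^^ t \<and>
      c \<notin> Domain (step ?M) \<and> fst (last (snd c)) = word_content (f w)" for w
  proof -
    obtain t s i where t: "t \<le> poly p (length w)" "exec w P (\<lambda>_. 0, 0, []) t (s, i, f w)"
      using run by blast
    let ?x0 = "(\<lambda>_. 0, 0, []) :: mem" and ?c = "conf m w (length code) (s, i, f w)"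
    let ?ts = "(word_content w, 0) # replicate (m + 1) (\<lambda>_. 0, 0) :: tape list"
    have rt: "map read_tape ?ts = word_content w 0 # replicate (m + 1) 0" by simp
    have "map read_tape ?ts \<in> symbol_lists (m + 2)"
      using word_content_le_2[of w 0] by (auto simp: symbol_lists_def)
    then have "((0, ?ts), (2, map2 update_tape ((word_content w 0, Stay) # replicate m (1, Stay) @ [(0, Stay)]) ?ts))
        \<in> step ?M"
      by (intro machine_step) (auto simp: delta_def rt)
    moreover have "map2 update_tape ((word_content w 0, Stay) # replicate m (1, Stay) @ [(0, Stay)]) ?ts
        = map (tape_of m w ?x0) [0..<m + 2]"
    proof (rule nth_equalityI)
      fix j assume "j < length (map2 update_tape ((word_content w 0, Stay) # replicate m (1, Stay) @ [(0, Stay)]) ?ts)"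
      then have "j < m + 2" by simp
      then show "map2 update_tape ((word_content w 0, Stay) # replicate m (1, Stay) @ [(0, Stay)]) ?ts ! j
          = map (tape_of m w ?x0) [0..<m + 2] ! j"
        by (auto simp: nth_Cons' nth_append tape_of_def word_content_def simp del: upt_Suc replicate_Suc)
    qed simp
    ultimately have "(initial ?M w, conf m w 0 ?x0) \<in> step ?M"
      by (simp add: initial_def conf_def machine_def numeral_2_eq_2)
    then have "(initial ?M w, conf m w 0 ?x0) \<in> step ?M ^^ 1" by auto
    moreover have "(conf m w 0 ?x0, ?c) \<in> step ?M ^^ t"
      using exec_compile[OF t(2) P, of 0 code] by (simp add: code_def)
    ultimately have "(initial ?M w, ?c) \<in> step ?M ^^ (1 + t)"
      unfolding relpow_add by blast
    \<comment> \<open>The state behind the last instruction has no transitions, so leaving the code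
      is halting.\<close>
    moreover have "?c \<notin> Domain (step ?M)"
      by (auto simp: step_def machine_def conf_def)
    moreover have "fst (last (snd ?c)) = word_content (f w)"
      by (simp add: conf_def tape_of_def)
    ultimately show ?thesis using t(1) by (intro exI[of _ "1 + t"] exI[of _ ?c]) auto
  qed
  have "polynomial_time ?M"
    unfolding polynomial_time_def
  \<comment> \<open>The additional step is the one that writes the markers.\<close>
  proof (intro exI[of _ "p + 1"] allI impI)
    fix w k c assume "(initial ?M w, c) \<in> step ?M ^^ k"
    moreover obtain t c' where "t \<le> poly p (length w) + 1" "(initial ?M w, c') \<in> step ?M ^^ t"
        "c' \<notin> Domain (step ?M)"
      using run'[of w] by blast
    ultimately have "k \<le> t"
      using halting_run_bound[OF single_valued_step[OF single_valued_machine]] by blast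
    with \<open>t \<le> _\<close> show "k \<le> poly (p + 1) (length w)" by simp
  qed
  moreover have "computes ?M f"
    unfolding computes_def halts_in_def using run' relpow_imp_rtrancl by blast
  ultimately show ?thesis
    unfolding polynomial_time_computable_def
    using well_formed_machine single_valued_machine by blast
qed

section \<open>Functions computable in polynomial time\<close>

definition runs :: "bool list \<Rightarrow> prog \<Rightarrow> mem \<Rightarrow> nat \<Rightarrow> mem \<Rightarrow> bool" where
  "runs w P x T y \<longleftrightarrow> (\<exists>t\<le>T. exec w P x t y)"

lemma runs_op: "runs w (Op a) x 1 (oper_sem w a x)"
  unfolding runs_def using exec_op by blast

lemma runs_seq: "runs w P x T y \<Longrightarrow> runs w Q y T' z \<Longrightarrow> runs w (P ;; Q) x (T + T') z"
  unfolding runs_def by (meson add_mono exec_seq)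

lemma runs_mono: "runs w P x T y \<Longrightarrow> y = y' \<Longrightarrow> T \<le> T' \<Longrightarrow> runs w P x T' y'"
  unfolding runs_def by (meson le_trans)

lemma runs_op2: "runs w (Op a ;; Op b) x 2 (oper_sem w b (oper_sem w a x))"
  using runs_seq[OF runs_op runs_op] by (simp add: numeral_2_eq_2)

lemma runs_op3: "runs w (Op a ;; Op b ;; Op c) x 3 (oper_sem w c (oper_sem w b (oper_sem w a x)))"
  using runs_seq[OF runs_op runs_op2] by (simp add: numeral_3_eq_3 numeral_2_eq_2)

lemma runs_skip: "fst x r = 0 \<Longrightarrow> runs w (While r P) x 1 x"
  unfolding runs_def using exec_done by blast

text \<open>\<open>S i\<close> is the memory with \<open>i\<close> iterations to go. Register
  \<open>r\<close> need not contain \<open>i\<close>; only whether it vanishes matters, so it may be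
  a mere flag.\<close>

lemma runs_loop:
  assumes "\<And>i. i < n \<Longrightarrow> runs w P (S (Suc i)) T (S i)" "\<And>i. i \<le> n \<Longrightarrow> fst (S i) r = 0 \<longleftrightarrow> i = 0"
  shows "runs w (While r P) (S n) (n * (T + 2) + 1) (S 0)"
  using assms
proof (induction n)
  case 0
  then show ?case using runs_skip[of "S 0" r w P] by simp
next
  case (Suc n)
  have "runs w (While r P) (S n) (n * (T + 2) + 1) (S 0)" using Suc by auto
  then obtain t' where t': "t' \<le> n * (T + 2) + 1" "exec w (While r P) (S n) t' (S 0)"
    by (auto simp: runs_def)
  obtain t where t: "t \<le> T" "exec w P (S (Suc n)) t (S n)"
    using Suc.prems(1)[of n] by (auto simp: runs_def)
  have "exec w (While r P) (S (Suc n)) (1 + (t + (1 + t'))) (S 0)"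
    using Suc.prems(2)[of "Suc n"] t t' by (intro exec_loop) auto
  moreover have "1 + (t + (1 + t')) \<le> Suc n * (T + 2) + 1" using t t' by simp
  ultimately show ?case unfolding runs_def by blast
qed

text \<open>A single power suffices as a bound: the base is at least 2, so constants and sums are
  absorbed by a larger exponent, and the bound is monotone, as composition requires.\<close>

definition poly_bounded :: "(nat \<Rightarrow> nat) \<Rightarrow> bool" where
  "poly_bounded q \<longleftrightarrow> (\<exists>k. \<forall>B. q B \<le> (B + 2) ^ k)"

lemma poly_bounded_id: "poly_bounded (\<lambda>B. B)"
  unfolding poly_bounded_def by (intro exI[of _ 1]) simp

lemma poly_bounded_const: "poly_bounded (\<lambda>_. c)"
proof -
  have "c \<le> (B + 2) ^ c" for B
    using less_exp[of c] power_mono[of 2 "B + 2" c] by linarith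
  then show ?thesis unfolding poly_bounded_def by blast
qed

lemma poly_bounded_add:
  assumes "poly_bounded f" "poly_bounded g" shows "poly_bounded (\<lambda>B. f B + g B)"
proof -
  obtain k l where *: "\<And>B. f B \<le> (B + 2) ^ k" "\<And>B. g B \<le> (B + 2) ^ l"
    using assms by (auto simp: poly_bounded_def)
  have "f B + g B \<le> (B + 2) ^ (Suc (k + l))" for B
  proof -
    have "f B \<le> (B + 2) ^ (k + l)" "g B \<le> (B + 2) ^ (k + l)"
      using order_trans[OF *(1)[of B], of "(B + 2) ^ (k + l)"]
        order_trans[OF *(2)[of B], of "(B + 2) ^ (k + l)"] by (simp_all add: power_increasing)
    then have "f B + g B \<le> 2 * (B + 2) ^ (k + l)" by simp
    also have "\<dots> \<le> (B + 2) * (B + 2) ^ (k + l)" by (intro mult_right_mono) auto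
    finally show ?thesis by simp
  qed
  then show ?thesis unfolding poly_bounded_def by blast
qed

lemma poly_bounded_mult:
  assumes "poly_bounded f" "poly_bounded g" shows "poly_bounded (\<lambda>B. f B * g B)"
proof -
  obtain k l where *: "\<And>B. f B \<le> (B + 2) ^ k" "\<And>B. g B \<le> (B + 2) ^ l"
    using assms by (auto simp: poly_bounded_def)
  have "f B * g B \<le> (B + 2) ^ (k + l)" for B
    using mult_mono[OF * , of B B] by (simp add: power_add)
  then show ?thesis unfolding poly_bounded_def by blast
qed

lemma poly_bounded_comp:
  assumes "poly_bounded f" "poly_bounded g" shows "poly_bounded (\<lambda>B. f (g B))"
proof -
  have "poly_bounded (\<lambda>B. g B + 2)" by (intro poly_bounded_add assms poly_bounded_const)
  then obtain k l where *: "\<And>B. f B \<le> (B + 2) ^ k" "\<And>B. g B + 2 \<le> (B + 2) ^ l"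
    using assms by (auto simp: poly_bounded_def)
  have "f (g B) \<le> (B + 2) ^ (l * k)" for B
  proof -
    have "f (g B) \<le> (g B + 2) ^ k" by (rule *)
    also have "\<dots> \<le> ((B + 2) ^ l) ^ k" by (intro power_mono *) auto
    finally show ?thesis by (simp add: power_mult)
  qed
  then show ?thesis unfolding poly_bounded_def by blast
qed

lemmas poly_bounded_intros =
  poly_bounded_id poly_bounded_const poly_bounded_add poly_bounded_mult

text \<open>A program for level \<open>d\<close> reads its arguments from registers below \<open>d\<close> as directed by \<open>\<rho>\<close> and
  returns the value in register \<open>d\<close>; all registers from \<open>d\<close> on are zero before, and all above \<open>d\<close>
  are zero again afterwards.\<close>

definition realizes ::
  "(bool list \<Rightarrow> (nat \<Rightarrow> nat) \<Rightarrow> nat) \<Rightarrow> (nat \<Rightarrow> nat) \<Rightarrow> nat \<Rightarrow> prog \<Rightarrow> (nat \<Rightarrow> nat) \<Rightarrow> bool" where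
  "realizes f \<rho> d P q \<longleftrightarrow> (\<forall>w s out B. (\<forall>r\<ge>d. s r = 0) \<longrightarrow> (\<forall>j. s (\<rho> j) \<le> B) \<longrightarrow>
     f w (\<lambda>j. s (\<rho> j)) \<le> q B \<and>
     runs w P (s, 0, out) (q B) (s(d := f w (\<lambda>j. s (\<rho> j))), 0, out))"

text \<open>Time is polynomial in the values of the arguments, not in their lengths. This unary
  notion suffices because all numbers of the reduction have polynomial size, and it admits loops
  over all values below a computed bound. Quantifying over \<open>\<rho>\<close> and
  \<open>d\<close> lets a program be used as a subprogram at any level.\<close>

definition feasible :: "(bool list \<Rightarrow> (nat \<Rightarrow> nat) \<Rightarrow> nat) \<Rightarrow> bool" where
  "feasible f \<longleftrightarrow> (\<forall>\<rho> d. (\<forall>j. \<rho> j < d) \<longrightarrow>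
     (\<exists>P m q. prog_below m P \<and> poly_bounded q \<and> realizes f \<rho> d P q))"

lemma feasibleE:
  assumes "feasible f" "\<And>j. \<rho> j < d"
  obtains P m q where "prog_below m P" "poly_bounded q" "realizes f \<rho> d P q"
  using assms unfolding feasible_def by blast

lemma feasibleI:
  assumes "\<And>\<rho> d. (\<And>j. \<rho> j < d) \<Longrightarrow>
     \<exists>P m q. prog_below m P \<and> poly_bounded q \<and> realizes f \<rho> d P q"
  shows "feasible f"
  unfolding feasible_def using assms by blast

lemma realizesD:
  assumes "realizes f \<rho> d P q" "\<forall>r\<ge>d. s r = 0" "\<forall>j. s (\<rho> j) \<le> B"
  shows "f w (\<lambda>j. s (\<rho> j)) \<le> q B"
    "runs w P (s, 0, out) (q B) (s(d := f w (\<lambda>j. s (\<rho> j))), 0, out)"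
  using assms unfolding realizes_def by blast+

section \<open>Counter programs for arithmetic and bounded sums\<close>

lemma prog_below_mono: "prog_below m P \<Longrightarrow> m \<le> m' \<Longrightarrow> prog_below m' P"
proof (induction P)
  case (Op a)
  then show ?case by (cases a) auto
qed auto

text \<open>A register can only be read by counting it down. It is therefore copied twice, and the
  second loop restores it from one of the copies.\<close>

lemma feasible_var: "feasible (\<lambda>w e. e j)"
proof (rule feasibleI)
  fix \<rho> :: "nat \<Rightarrow> nat" and d assume "\<And>j. \<rho> j < (d :: nat)"
  then have r: "\<rho> j < d" .
  let ?r = "\<rho> j"
  let ?P = "While ?r (Op (Dec ?r) ;; Op (Inc d) ;; Op (Inc (Suc d))) ;;
            While (Suc d) (Op (Dec (Suc d)) ;; Op (Inc ?r))"
  let ?q = "\<lambda>B. B * (3 + 2) + 1 + (B * (2 + 2) + 1)"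
  have "s ?r \<le> ?q B \<and> runs w ?P (s, 0, out) (?q B) (s(d := s ?r), 0, out)"
    if z: "\<forall>r\<ge>d. s r = 0" and B: "\<forall>j. s (\<rho> j) \<le> B" for w s out B
  proof -
    let ?n = "s ?r"
    let ?S = "\<lambda>i. (s(?r := i, d := ?n - i, Suc d := ?n - i), 0, out) :: mem"
    let ?S' = "\<lambda>i. (s(?r := ?n - i, d := ?n, Suc d := i), 0, out) :: mem"
    have "runs w (While ?r (Op (Dec ?r) ;; Op (Inc d) ;; Op (Inc (Suc d)))) (?S ?n) (?n * (3 + 2) + 1) (?S 0)"
    proof (rule runs_loop)
      fix i assume "i < ?n"
      then show "runs w (Op (Dec ?r) ;; Op (Inc d) ;; Op (Inc (Suc d))) (?S (Suc i)) 3 (?S i)"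
        using r by (intro runs_mono[OF runs_op3]) (auto simp: fun_eq_iff)
    qed (use r in auto)
    then have 1: "runs w (While ?r (Op (Dec ?r) ;; Op (Inc d) ;; Op (Inc (Suc d)))) (s, 0, out) (?n * (3 + 2) + 1) (?S' ?n)"
      using r z by (auto elim!: back_subst[of "\<lambda>x. runs w _ x _ _"] simp: fun_eq_iff)
    have 2: "runs w (While (Suc d) (Op (Dec (Suc d)) ;; Op (Inc ?r))) (?S' ?n) (?n * (2 + 2) + 1) (?S' 0)"
    proof (rule runs_loop)
      fix i assume "i < ?n"
      then show "runs w (Op (Dec (Suc d)) ;; Op (Inc ?r)) (?S' (Suc i)) 2 (?S' i)"
        using r by (intro runs_mono[OF runs_op2]) (auto simp: fun_eq_iff)
    qed (use r in auto)
    have n: "?n \<le> B" using B by auto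
    have "?S' 0 = (s(d := ?n), 0, out)" using r z by (auto simp: fun_eq_iff)
    then have "runs w ?P (s, 0, out) (?q B) (s(d := ?n), 0, out)"
      using n by (intro runs_mono[OF runs_seq[OF 1 2]]) auto
    then show ?thesis using n by simp
  qed
  moreover have "prog_below (d + 2) ?P" using r by auto
  moreover have "poly_bounded ?q" by (intro poly_bounded_intros)
  ultimately show "\<exists>P m q. prog_below m P \<and> poly_bounded q \<and> realizes (\<lambda>w e. e j) \<rho> d P q"
    unfolding realizes_def
    by blast
qed

lemma feasible_0: "feasible (\<lambda>w e. 0)"
proof (rule feasibleI)
  fix \<rho> :: "nat \<Rightarrow> nat" and d assume "\<And>j. \<rho> j < d"
  \<comment> \<open>There is no empty program; a loop on the zero register \<open>d\<close> is never
    entered and serves as one.\<close>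
  have "runs w (While d (Op (Inc d))) (s, 0, out) 1 (s(d := 0), 0, out)" if "s d = 0" for w s out
    using that by (intro runs_mono[OF runs_skip]) auto
  then show "\<exists>P m q. prog_below m P \<and> poly_bounded q \<and> realizes (\<lambda>w e. 0) \<rho> d P q"
    unfolding realizes_def
    by (intro exI[of _ "While d (Op (Inc d))"] exI[of _ "d + 1"] exI[of _ "\<lambda>_. 1"])
       (auto intro: poly_bounded_const)
qed

lemma feasible_1: "feasible (\<lambda>w e. 1)"
proof (rule feasibleI)
  fix \<rho> :: "nat \<Rightarrow> nat" and d assume "\<And>j. \<rho> j < d"
  have "runs w (Op (Inc d)) (s, 0, out) 1 (s(d := 1), 0, out)" if "s d = 0" for w s out
    using that by (intro runs_mono[OF runs_op]) auto
  then show "\<exists>P m q. prog_below m P \<and> poly_bounded q \<and> realizes (\<lambda>w e. 1) \<rho> d P q"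
    unfolding realizes_def
    by (intro exI[of _ "Op (Inc d)"] exI[of _ "d + 1"] exI[of _ "\<lambda>_. 1"])
       (auto intro: poly_bounded_const)
qed

text \<open>Addition and truncated subtraction are both iterations controlled by the second
  argument, which is counted down; \<open>inc\<close> selects between them.\<close>

lemma feasible_arith:
  assumes f: "feasible f" and g: "feasible g"
    and h: "\<And>a b. h a 0 = a" "\<And>a b. h a (Suc b) = (if inc then h a b + 1 else h a b - 1)"
  shows "feasible (\<lambda>w e. h (f w e) (g w e))"
proof (rule feasibleI)
  fix \<rho> :: "nat \<Rightarrow> nat" and d assume r: "\<And>j. \<rho> j < (d :: nat)"
  then have r': "\<And>j. \<rho> j < Suc d" using less_SucI by blast
  obtain P m q where P: "prog_below m P" "poly_bounded q"
    "realizes f \<rho> d P q"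
    using feasibleE[where \<rho> = "\<rho>" and d = "d", OF f r] by blast
  obtain P' m' q' where P': "prog_below m' P'" "poly_bounded q'"
    "realizes g \<rho> (Suc d) P' q'"
    using feasibleE[where \<rho> = "\<rho>" and d = "Suc d", OF g r'] by blast
  let ?o = "if inc then Inc d else Dec d"
  let ?L = "While (Suc d) (Op (Dec (Suc d)) ;; Op ?o)"
  let ?q = "\<lambda>B. q B + (q' B + (q' B * (2 + 2) + 1))"
  have le: "h a b \<le> a + b" for a b by (induction b) (auto simp: h)
  have "h (f w (\<lambda>j. s (\<rho> j))) (g w (\<lambda>j. s (\<rho> j))) \<le> ?q B \<and>
      runs w (P ;; P' ;; ?L) (s, 0, out) (?q B) (s(d := h (f w (\<lambda>j. s (\<rho> j))) (g w (\<lambda>j. s (\<rho> j)))), 0, out)"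
    if z: "\<forall>r\<ge>d. s r = 0" and B: "\<forall>j. s (\<rho> j) \<le> B" for w s out B
  proof -
    let ?e = "\<lambda>j. s (\<rho> j)"
    let ?a = "f w ?e" and ?b = "g w ?e"
    let ?s1 = "s(d := ?a)"
    have e: "(\<lambda>j. ?s1 (\<rho> j)) = ?e" using r by (auto simp: fun_eq_iff less_imp_neq)
    have z1: "\<forall>r\<ge>Suc d. ?s1 r = 0" and B1: "\<forall>j. ?s1 (\<rho> j) \<le> B"
      using z B less_imp_neq[OF r] by auto
    have 1: "runs w P (s, 0, out) (q B) (?s1, 0, out)" using realizesD(2)[OF P(3) z B] .
    have 2: "runs w P' (?s1, 0, out) (q' B) (?s1(Suc d := ?b), 0, out)"
      using realizesD(2)[OF P'(3), of ?s1 B w out] z1 B1 e by simp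
    let ?S = "\<lambda>i. (s(d := h ?a (?b - i), Suc d := i), 0, out) :: mem"
    have "runs w ?L (?S ?b) (?b * (2 + 2) + 1) (?S 0)"
    proof (rule runs_loop)
      fix i assume "i < ?b"
      then have "h ?a (?b - i) = (if inc then h ?a (?b - Suc i) + 1 else h ?a (?b - Suc i) - 1)"
        by (metis Suc_diff_Suc h(2))
      then show "runs w (Op (Dec (Suc d)) ;; Op ?o) (?S (Suc i)) 2 (?S i)"
        by (intro runs_mono[OF runs_op2]) (auto simp: fun_eq_iff)
    qed auto
    then have 3: "runs w ?L (?s1(Suc d := ?b), 0, out) (?b * (2 + 2) + 1) (?S 0)" by (simp add: h)
    have "?b \<le> q' B" using realizesD(1)[OF P'(3) z1 B1, of w] e by simp
    moreover have "?a \<le> q B" using realizesD(1)[OF P(3) z B] .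
    moreover have "?S 0 = (s(d := h ?a ?b), 0, out)" using z by (auto simp: fun_eq_iff)
    ultimately show ?thesis
      using runs_mono[OF runs_seq[OF 1 runs_seq[OF 2 3]], of "(s(d := h ?a ?b), 0, out)" "?q B"] le[of ?a ?b]
      by auto
  qed
  moreover have "prog_below (m + m' + d + 2) (P ;; P' ;; ?L)"
    using P(1) P'(1) by (auto intro: prog_below_mono)
  moreover have "poly_bounded ?q" by (intro poly_bounded_intros P P')
  ultimately show "\<exists>P m q. prog_below m P \<and> poly_bounded q \<and> realizes (\<lambda>w e. h (f w e) (g w e)) \<rho> d P q"
    unfolding realizes_def
    by blast
qed

lemma feasible_add: "feasible f \<Longrightarrow> feasible g \<Longrightarrow> feasible (\<lambda>w e. f w e + g w e)"
  by (rule feasible_arith[where h = "(+)" and inc = True]) auto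

lemma feasible_diff: "feasible f \<Longrightarrow> feasible g \<Longrightarrow> feasible (\<lambda>w e. f w e - g w e)"
  by (rule feasible_arith[where h = "(-)" and inc = False]) auto

lemma feasible_const: "feasible (\<lambda>w e. c)"
  by (induction c) (use feasible_0 feasible_add[OF _ feasible_1] in auto)

text \<open>Variables are de Bruijn indices: inside the summand, variable 0 is the summation index
  and all others are shifted. This is the only form of iteration; products, quotients and bounded
  quantifiers are reduced to it.\<close>

lemma feasible_sum:
  assumes f: "feasible f" and g: "feasible (\<lambda>w e. g w (e 0) (\<lambda>j. e (Suc j)))"
  shows "feasible (\<lambda>w e. \<Sum>i<f w e. g w i e)"
proof (rule feasibleI)
  fix \<rho> :: "nat \<Rightarrow> nat" and d assume r: "\<And>j. \<rho> j < (d :: nat)"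
  then have r1: "\<And>j. \<rho> j < Suc d" using less_SucI by blast
  let ?\<rho> = "case_nat (Suc d) \<rho>"
  have r2: "\<And>j. ?\<rho> j < Suc (Suc d)" using r1 by (simp add: less_SucI split: nat.split)
  obtain P m q where P: "prog_below m P" "poly_bounded q"
    "realizes f \<rho> (Suc d) P q"
    using feasibleE[where \<rho> = "\<rho>" and d = "Suc d", OF f r1] by blast
  obtain P' m' q' where P': "prog_below m' P'" "poly_bounded q'"
    "realizes (\<lambda>w e. g w (e 0) (\<lambda>j. e (Suc j))) ?\<rho> (Suc (Suc d)) P' q'"
    using feasibleE[where \<rho> = "?\<rho>" and d = "Suc (Suc d)", OF g r2] by blast
  let ?d = "Suc d" and ?dd = "Suc (Suc d)"
  let ?L = "While ?dd (Op (Dec ?dd) ;; Op (Inc d))"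
  let ?body = "Op (Dec ?d) ;; P' ;; ?L"
  \<comment> \<open>The summation index is below \<open>q B\<close>, so all arguments of the summand
    are bounded by \<open>B + q B\<close>.\<close>
  let ?Q = "\<lambda>B. q' (B + q B)"
  let ?T = "\<lambda>B. 1 + (?Q B + (?Q B * (2 + 2) + 1))"
  let ?q = "\<lambda>B. q B + (q B * (?T B + 2) + 1)"
  have "(\<Sum>i<f w (\<lambda>j. s (\<rho> j)). g w i (\<lambda>j. s (\<rho> j))) \<le> ?q B \<and>
      runs w (P ;; While ?d ?body) (s, 0, out) (?q B)
        (s(d := \<Sum>i<f w (\<lambda>j. s (\<rho> j)). g w i (\<lambda>j. s (\<rho> j))), 0, out)"
    if z: "\<forall>r\<ge>d. s r = 0" and B: "\<forall>j. s (\<rho> j) \<le> B" for w s out B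
  proof -
    let ?e = "\<lambda>j. s (\<rho> j)"
    let ?n = "f w ?e" and ?g = "\<lambda>i. g w i ?e"
    have z1: "\<forall>r\<ge>Suc d. s r = 0" using z by auto
    have n: "?n \<le> q B" using realizesD(1)[OF P(3) z1 B] .
    have 1: "runs w P (s, 0, out) (q B) (s(?d := ?n), 0, out)" using realizesD(2)[OF P(3) z1 B] .
    let ?s = "\<lambda>i. s(d := \<Sum>k=i..<?n. ?g k, ?d := i)"
    let ?S = "\<lambda>i. (?s i, 0, out) :: mem"
    have body: "?g i \<le> ?Q B \<and> runs w ?body (?S (Suc i)) (?T B) (?S i)" if i: "i < ?n" for i
    proof -
      let ?s' = "s(d := \<Sum>k=Suc i..<?n. ?g k, ?d := i)"
      have e: "(\<lambda>j. ?s' (\<rho> j)) = ?e" using r1 r by (auto simp: fun_eq_iff less_imp_neq)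
      have b: "\<forall>j. ?s' (?\<rho> j) \<le> B + q B"
        using B i n less_imp_neq[OF r] less_imp_neq[OF r1] by (auto split: nat.split simp: trans_le_add1)
      have zz: "\<forall>r\<ge>?dd. ?s' r = 0" using z by auto
      have a: "runs w (Op (Dec ?d)) (?S (Suc i)) 1 (?s', 0, out)"
        by (intro runs_mono[OF runs_op]) (auto simp: fun_eq_iff)
      have b': "runs w P' (?s', 0, out) (?Q B) (?s'(?dd := ?g i), 0, out)"
        using realizesD(2)[OF P'(3) zz b, of w out] by (simp only: nat.case e fun_upd_same)
      have gi: "?g i \<le> ?Q B" using realizesD(1)[OF P'(3) zz b, of w] by (simp only: nat.case e fun_upd_same)
      let ?A = "\<Sum>k=Suc i..<?n. ?g k"
      let ?S' = "\<lambda>k. (s(d := ?A + (?g i - k), ?d := i, ?dd := k), 0, out) :: mem"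
      have "runs w ?L (?S' (?g i)) (?g i * (2 + 2) + 1) (?S' 0)"
      proof (rule runs_loop)
        fix k assume "k < ?g i"
        then show "runs w (Op (Dec ?dd) ;; Op (Inc d)) (?S' (Suc k)) 2 (?S' k)"
          by (intro runs_mono[OF runs_op2]) (auto simp: fun_eq_iff)
      qed auto
      then have "runs w ?L (?s'(?dd := ?g i), 0, out) (?g i * (2 + 2) + 1) (?S' 0)" by simp
      moreover have "?S' 0 = ?S i"
        using z i by (auto simp: fun_eq_iff sum.atLeast_Suc_lessThan)
      ultimately have c: "runs w ?L (?s'(?dd := ?g i), 0, out) (?Q B * (2 + 2) + 1) (?S i)"
        using gi by (elim runs_mono) auto
      show ?thesis using runs_seq[OF a runs_seq[OF b' c]] gi by simp
    qed
    have "runs w (While ?d ?body) (?S ?n) (?n * (?T B + 2) + 1) (?S 0)"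
    proof (rule runs_loop)
      show "runs w ?body (?S (Suc i)) (?T B) (?S i)" if "i < ?n" for i using body[OF that] by blast
    qed auto
    moreover have "?S ?n = (s(?d := ?n), 0, out)" using z by (auto simp: fun_eq_iff)
    moreover have "?S 0 = (s(d := \<Sum>i<?n. ?g i), 0, out)"
      using z by (auto simp: fun_eq_iff atLeast0LessThan)
    ultimately have 2: "runs w (While ?d ?body) (s(?d := ?n), 0, out) (?n * (?T B + 2) + 1)
        (s(d := \<Sum>i<?n. ?g i), 0, out)" by simp
    have le: "?n * (?T B + 2) + 1 \<le> q B * (?T B + 2) + 1" by (intro add_mono mult_right_mono n) auto
    have "(\<Sum>i<?n. ?g i) \<le> (\<Sum>i<?n. ?Q B)" using body by (intro sum_mono) auto
    also have "\<dots> = ?n * ?Q B" by simp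
    also have "\<dots> \<le> q B * (?T B + 2)" by (intro mult_mono n) auto
    finally have "(\<Sum>i<?n. ?g i) \<le> ?q B" by simp
    then show ?thesis
      using runs_mono[OF runs_seq[OF 1 2] refl] le by (meson add_left_mono)
  qed
  moreover have "prog_below (m + m' + d + 3) (P ;; While ?d ?body)"
    using P(1) P'(1) by (auto intro: prog_below_mono)
  moreover have "poly_bounded ?Q"
    by (rule poly_bounded_comp[OF P'(2)]) (intro poly_bounded_intros P)
  then have "poly_bounded ?q" by (intro poly_bounded_intros P)
  ultimately show "\<exists>P m q. prog_below m P \<and> poly_bounded q \<and> realizes (\<lambda>w e. \<Sum>i<f w e. g w i e) \<rho> d P q"
    unfolding realizes_def
    by blast
qed

lemma feasible_symbol:
  assumes f: "feasible f"
  shows "feasible (\<lambda>w e. word_content w (int (f w e)))"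
proof (rule feasibleI)
  fix \<rho> :: "nat \<Rightarrow> nat" and d assume r: "\<And>j. \<rho> j < (d :: nat)"
  then have r1: "\<And>j. \<rho> j < Suc d" using less_SucI by blast
  let ?d = "Suc d" and ?dd = "Suc (Suc d)"
  obtain P m q where P: "prog_below m P" "poly_bounded q"
    "realizes f \<rho> (Suc d) P q"
    using feasibleE[where \<rho> = "\<rho>" and d = "Suc d", OF f r1] by blast
  let ?L1 = "While ?d (Op (Dec ?d) ;; Op (Inc ?dd) ;; Op InR)"
  \<comment> \<open>Reading the symbol 2 twice makes the register equal to the symbol
    itself.\<close>
  let ?R = "Op (Rd 1 d) ;; Op (Rd 2 d) ;; Op (Rd 2 d)"
  let ?L2 = "While ?dd (Op (Dec ?dd) ;; Op InL)"
  let ?q = "\<lambda>B. q B + ((q B * (3 + 2) + 1) + (3 + (q B * (2 + 2) + 1)))"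
  have "word_content w (int (f w (\<lambda>j. s (\<rho> j)))) \<le> ?q B \<and>
     runs w (P ;; ?L1 ;; ?R ;; ?L2) (s, 0, out) (?q B) (s(d := word_content w (int (f w (\<lambda>j. s (\<rho> j))))), 0, out)"
    if z: "\<forall>r\<ge>d. s r = 0" and B: "\<forall>j. s (\<rho> j) \<le> B" for w s out B
  proof -
    let ?n = "f w (\<lambda>j. s (\<rho> j))"
    let ?c = "word_content w (int ?n)"
    have z1: "\<forall>r\<ge>Suc d. s r = 0" using z by auto
    have n: "?n \<le> q B" using realizesD(1)[OF P(3) z1 B] .
    have 1: "runs w P (s, 0, out) (q B) (s(?d := ?n), 0, out)" using realizesD(2)[OF P(3) z1 B] .
    let ?S = "\<lambda>i. (s(?d := i, ?dd := ?n - i), int (?n - i), out) :: mem"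
    have "runs w ?L1 (?S ?n) (?n * (3 + 2) + 1) (?S 0)"
    proof (rule runs_loop)
      fix i assume "i < ?n"
      then show "runs w (Op (Dec ?d) ;; Op (Inc ?dd) ;; Op InR) (?S (Suc i)) 3 (?S i)"
        by (intro runs_mono[OF runs_op3]) (auto simp: fun_eq_iff)
    qed auto
    moreover have "?S ?n = (s(?d := ?n), 0, out)" using z by (auto simp: fun_eq_iff)
    ultimately have 2: "runs w ?L1 (s(?d := ?n), 0, out) (?n * (3 + 2) + 1) (?S 0)" by simp
    let ?S' = "\<lambda>i. (s(d := ?c, ?dd := i), int i, out) :: mem"
    have 3: "runs w ?R (?S 0) 3 (?S' ?n)"
      using z word_content_le_2[of w "int ?n"]
      by (intro runs_mono[OF runs_op3]) (auto simp: fun_eq_iff)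
    have 4: "runs w ?L2 (?S' ?n) (?n * (2 + 2) + 1) (?S' 0)"
    proof (rule runs_loop)
      fix i assume "i < ?n"
      then show "runs w (Op (Dec ?dd) ;; Op InL) (?S' (Suc i)) 2 (?S' i)"
        by (intro runs_mono[OF runs_op2]) (auto simp: fun_eq_iff)
    qed auto
    have "?S' 0 = (s(d := ?c), 0, out)" using z by (auto simp: fun_eq_iff)
    moreover have "?c \<le> ?q B" using word_content_le_2[of w "int ?n"] by auto
    ultimately show ?thesis
      using runs_mono[OF runs_seq[OF 1 runs_seq[OF 2 runs_seq[OF 3 4]]], of "(s(d := ?c), 0, out)" "?q B"] n
      by simp
  qed
  moreover have "prog_below (m + d + 3) (P ;; ?L1 ;; ?R ;; ?L2)"
    using P(1) by (auto intro: prog_below_mono)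
  moreover have "poly_bounded ?q" by (intro poly_bounded_intros P)
  ultimately show "\<exists>P m q. prog_below m P \<and> poly_bounded q \<and> realizes (\<lambda>w e. word_content w (int (f w e))) \<rho> d P q"
    unfolding realizes_def
    by blast
qed


section \<open>Programs that print a matrix\<close>

lemma poly_bounded_poly:
  assumes "poly_bounded q" shows "\<exists>p :: nat poly. \<forall>n. q n \<le> poly p n"
proof -
  obtain k where "\<And>B. q B \<le> (B + 2) ^ k" using assms by (auto simp: poly_bounded_def)
  then show ?thesis by (intro exI[of _ "[:2, 1:] ^ k"]) (simp add: poly_power add.commute)
qed

text \<open>Register 0 counts the bits, register 1 is a flag for a bit under the head, and register
  2 remembers how far the head has to walk back.\<close>

definition length_prog :: prog where
  "length_prog = (Op (Rd 1 1) ;; Op (Rd 2 1)) ;;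
     While 1 ((Op (Dec 1) ;; Op (Inc 0) ;; Op (Inc 2)) ;; (Op InR ;; Op (Rd 1 1) ;; Op (Rd 2 1))) ;;
     While 2 (Op (Dec 2) ;; Op InL)"

lemma runs_length_prog:
  "runs w length_prog (\<lambda>_. 0, 0, []) (2 + ((length w * (6 + 2) + 1) + (length w * (2 + 2) + 1)))
     ((\<lambda>_. 0)(0 := length w), 0, [])"
proof -
  let ?n = "length w"
  let ?S = "\<lambda>i. ((\<lambda>_. 0)(0 := ?n - i, 1 := (if i = 0 then 0 else 1), 2 := ?n - i), int (?n - i), []) :: mem"
  let ?S' = "\<lambda>i. ((\<lambda>_. 0)(0 := ?n, 2 := i), int i, []) :: mem"
  have 1: "runs w (Op (Rd 1 1) ;; Op (Rd 2 1)) (\<lambda>_. 0, 0, []) 2 (?S ?n)"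
    by (intro runs_mono[OF runs_op2]) (auto simp: fun_eq_iff word_content_def)
  have 2: "runs w (While 1 ((Op (Dec 1) ;; Op (Inc 0) ;; Op (Inc 2)) ;; (Op InR ;; Op (Rd 1 1) ;; Op (Rd 2 1))))
      (?S ?n) (?n * (6 + 2) + 1) (?S 0)"
  proof (rule runs_loop)
    fix i assume "i < ?n"
    then show "runs w ((Op (Dec 1) ;; Op (Inc 0) ;; Op (Inc 2)) ;; (Op InR ;; Op (Rd 1 1) ;; Op (Rd 2 1)))
      (?S (Suc i)) 6 (?S i)"
      by (intro runs_mono[OF runs_seq[OF runs_op3 runs_op3]]) (auto simp: fun_eq_iff word_content_def)
  qed auto
  have "?S 0 = ?S' ?n" by (auto simp: fun_eq_iff)
  moreover have "runs w (While 2 (Op (Dec 2) ;; Op InL)) (?S' ?n) (?n * (2 + 2) + 1) (?S' 0)"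
  proof (rule runs_loop)
    fix i assume "i < ?n"
    then show "runs w (Op (Dec 2) ;; Op InL) (?S' (Suc i)) 2 (?S' i)"
      by (intro runs_mono[OF runs_op2]) (auto simp: fun_eq_iff)
  qed auto
  ultimately have 3: "runs w (While 2 (Op (Dec 2) ;; Op InL)) (?S 0) (?n * (2 + 2) + 1) (?S' 0)" by simp
  have "?S' 0 = ((\<lambda>_. 0)(0 := ?n), 0, [])" by (auto simp: fun_eq_iff)
  then show ?thesis using runs_seq[OF 1 runs_seq[OF 2 3]] by (simp add: length_prog_def)
qed

text \<open>The loops count down, so the matrix is traversed in reverse order.\<close>

lemma feasible_matrix_computable:
  assumes n: "feasible (\<lambda>w e. n w (e 0))"
    and h: "feasible (\<lambda>w e. h w (e 0) (e 1) (e 2))"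
  shows "polynomial_time_computable (\<lambda>w. let L = length w; N = n w L in
    concat (map (\<lambda>i. map (\<lambda>j. h w j i L \<noteq> 0) (rev [0..<N])) (rev [0..<N])))"
proof -
  \<comment> \<open>The entry is computed from the column in register 2, the row in register 1 and
    the input length in register 0.\<close>
  let ?\<rho> = "case_nat 2 (case_nat 1 (\<lambda>_. 0)) :: nat \<Rightarrow> nat"
  have r: "?\<rho> j < 3" for j by (auto split: nat.split)
  obtain P m q where P: "prog_below m P" "poly_bounded q" "realizes (\<lambda>w e. n w (e 0)) (\<lambda>_. 0) 1 P q"
    using feasibleE[where \<rho> = "\<lambda>_. 0" and d = 1, OF n] by blast
  obtain P' m' q' where P': "prog_below m' P'" "poly_bounded q'" "realizes (\<lambda>w e. n w (e 0)) (\<lambda>_. 0) 2 P' q'"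
    using feasibleE[where \<rho> = "\<lambda>_. 0" and d = 2, OF n pos2] by blast
  obtain P'' m'' q'' where P'': "prog_below m'' P''" "poly_bounded q''"
      "realizes (\<lambda>w e. h w (e 0) (e 1) (e 2)) ?\<rho> 3 P'' q''"
    using feasibleE[where \<rho> = ?\<rho> and d = 3, OF h r] by blast
  let ?cell = "Op (Dec 2) ;; P'' ;; Op (OutR 3) ;; While 3 (Op (Dec 3))"
  \<comment> \<open>The number of columns is recomputed for each row, because counting down register
    2 destroys it.\<close>
  let ?row = "Op (Dec 1) ;; P' ;; While 2 ?cell"
  let ?prog = "length_prog ;; P ;; While 1 ?row"
  let ?T0 = "\<lambda>L. 2 + ((L * (6 + 2) + 1) + (L * (2 + 2) + 1)) :: nat"
  let ?qh = "\<lambda>L. q'' (L + q L)"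
  let ?Tc = "\<lambda>L. 1 + (?qh L + (1 + (?qh L * (1 + 2) + 1)))"
  let ?Tr = "\<lambda>L. 1 + (q' L + (q L * (?Tc L + 2) + 1))"
  let ?T = "\<lambda>L. ?T0 L + (q L + (q L * (?Tr L + 2) + 1))"
  let ?f = "\<lambda>w. concat (map (\<lambda>i. map (\<lambda>j. h w j i (length w) \<noteq> 0) (rev [0..<n w (length w)])) (rev [0..<n w (length w)]))"
  have main: "\<exists>s i. runs w ?prog (\<lambda>_. 0, 0, []) (?T (length w)) (s, i, ?f w)" for w
  proof -
    let ?L = "length w"
    let ?N = "n w ?L"
    let ?s0 = "(\<lambda>_. 0)(0 := ?L) :: nat \<Rightarrow> nat"
    have N: "?N \<le> q ?L" "runs w P (?s0, 0, []) (q ?L) (?s0(1 := ?N), 0, [])"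
      using realizesD(1)[OF P(3), of ?s0 ?L w] realizesD(2)[OF P(3), of ?s0 ?L w "[]"] by auto
    let ?r = "\<lambda>i l. map (\<lambda>j. h w j i ?L \<noteq> 0) (rev [l..<?N])"
    let ?R = "\<lambda>i. concat (map (\<lambda>i. ?r i 0) (rev [i..<?N]))"
    let ?S = "\<lambda>i. (?s0(1 := i), 0, ?R i) :: mem"
    have "runs w (While 1 ?row) (?S ?N) (?N * (?Tr ?L + 2) + 1) (?S 0)"
    proof (rule runs_loop)
      fix i assume i: "i < ?N"
      let ?s1 = "?s0(1 := i)"
      have a: "runs w (Op (Dec 1)) (?S (Suc i)) 1 (?s1, 0, ?R (Suc i))"
        by (intro runs_mono[OF runs_op]) (auto simp: fun_eq_iff)
      have b: "runs w P' (?s1, 0, ?R (Suc i)) (q' ?L) (?s1(2 := ?N), 0, ?R (Suc i))"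
        using realizesD(2)[OF P'(3), of ?s1 ?L w "?R (Suc i)"] by auto
      let ?C = "\<lambda>j. (?s1(2 := j), 0, ?R (Suc i) @ ?r i j) :: mem"
      have "runs w (While 2 ?cell) (?C ?N) (?N * (?Tc ?L + 2) + 1) (?C 0)"
      proof (rule runs_loop)
        fix j assume j: "j < ?N"
        let ?s2 = "?s1(2 := j)" and ?o = "?R (Suc i) @ ?r i (Suc j)"
        let ?h = "h w j i ?L"
        have z: "\<forall>r\<ge>3. ?s2 r = 0" by auto
        have B: "\<forall>k. ?s2 (?\<rho> k) \<le> ?L + q ?L" using i j N(1) by (auto split: nat.split)
        have a: "runs w (Op (Dec 2)) (?C (Suc j)) 1 (?s2, 0, ?o)"
          by (intro runs_mono[OF runs_op]) (auto simp: fun_eq_iff)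
        have e: "?s2 (?\<rho> 0) = j" "?s2 (?\<rho> 1) = i" "?s2 (?\<rho> 2) = ?L" by (simp_all add: numeral_2_eq_2)
        have h: "?h \<le> ?qh ?L" "runs w P'' (?s2, 0, ?o) (?qh ?L) (?s2(3 := ?h), 0, ?o)"
          using realizesD(1)[OF P''(3) z B, of w] realizesD(2)[OF P''(3) z B, of w ?o]
          by (simp_all only: e)
        have c: "runs w (Op (OutR 3)) (?s2(3 := ?h), 0, ?o) 1 (?s2(3 := ?h), 0, ?o @ [?h \<noteq> 0])"
          by (intro runs_mono[OF runs_op]) auto
        let ?D = "\<lambda>k. (?s2(3 := k), 0, ?o @ [?h \<noteq> 0]) :: mem"
        have "runs w (While 3 (Op (Dec 3))) (?D ?h) (?h * (1 + 2) + 1) (?D 0)"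
          by (rule runs_loop) (auto intro!: runs_mono[OF runs_op] simp: fun_eq_iff)
        moreover have "?D 0 = ?C j" using j by (auto simp: fun_eq_iff upt_conv_Cons)
        ultimately have d: "runs w (While 3 (Op (Dec 3))) (?s2(3 := ?h), 0, ?o @ [?h \<noteq> 0]) (?qh ?L * (1 + 2) + 1) (?C j)"
          using h(1) by (auto elim!: runs_mono)
        show "runs w ?cell (?C (Suc j)) (?Tc ?L) (?C j)"
          using runs_seq[OF a runs_seq[OF h(2) runs_seq[OF c d]]] by simp
      qed auto
      moreover have "?C ?N = (?s1(2 := ?N), 0, ?R (Suc i))" by simp
      moreover have "?C 0 = ?S i" using i by (auto simp: fun_eq_iff upt_conv_Cons)
      ultimately have c: "runs w (While 2 ?cell) (?s1(2 := ?N), 0, ?R (Suc i)) (q ?L * (?Tc ?L + 2) + 1) (?S i)"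
        using N(1) mult_right_mono[OF N(1), of "?Tc ?L + 2"] by (auto elim!: runs_mono)
      show "runs w ?row (?S (Suc i)) (?Tr ?L) (?S i)"
        using runs_seq[OF a runs_seq[OF b c]] by simp
    qed auto
    moreover have "?S ?N = (?s0(1 := ?N), 0, [])" by simp
    ultimately have R: "runs w (While 1 ?row) (?s0(1 := ?N), 0, []) (q ?L * (?Tr ?L + 2) + 1) (?S 0)"
      using mult_right_mono[OF N(1), of "?Tr ?L + 2"] by (auto elim!: runs_mono)
    from runs_seq[OF runs_length_prog runs_seq[OF N(2) R]] show ?thesis by (intro exI)
  qed
  have "poly_bounded ?qh"
    by (rule poly_bounded_comp[OF P''(2)]) (intro poly_bounded_intros P)
  then have "poly_bounded ?T" by (intro poly_bounded_intros P P')
  then obtain p where p: "\<forall>k. ?T k \<le> poly p k" using poly_bounded_poly by blast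
  have "prog_below (m + m' + m'' + 4) ?prog"
    using P(1) P'(1) P''(1) by (auto intro: prog_below_mono simp: length_prog_def)
  then show ?thesis
    unfolding Let_def
  proof (rule prog_computable)
    fix w
    show "\<exists>t s i. t \<le> poly p (length w) \<and> exec w ?prog (\<lambda>_. 0, 0, []) t (s, i, ?f w)"
      using main[of w] order_trans[OF _ p[rule_format]] unfolding runs_def by blast
  qed
qed

section \<open>RAC drawings with two hubs\<close>

text \<open>The form in which RAC drawings of simple graphs are used
  (\<open>RAC_drawing_rac\<close>, \<open>rac_RAC_drawing\<close>). For disjoint edges closed
  segments may replace open ones, since no vertex lies on an edge of others. Edges with a common end
  meet only there (\<open>adjacent_edges_meet\<close>).\<close>

definition rac :: "'a set \<Rightarrow> 'a set set \<Rightarrow> ('a \<Rightarrow> complex) \<Rightarrow> bool" where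
  "rac V E g \<longleftrightarrow> inj_on g V \<and>
     (\<forall>a b c. {a, b} \<in> E \<and> c \<in> V - {a, b} \<longrightarrow> g c \<notin> closed_segment (g a) (g b)) \<and>
     (\<forall>a b c d. {a, b} \<in> E \<and> {c, d} \<in> E \<and> {a, b} \<inter> {c, d} = {} \<and>
        closed_segment (g a) (g b) \<inter> closed_segment (g c) (g d) \<noteq> {} \<longrightarrow>
        inner (g a - g b) (g c - g d) = 0)"

text \<open>The side of \<open>z\<close> with respect to the line through 0 and \<open>x\<close>,
  and for \<open>det1\<close> through 1 and \<open>x\<close>. For \<open>Im x > 0\<close> the signs
  are chosen so that the other hub lies on the positive side.\<close>

definition det0 :: "complex \<Rightarrow> complex \<Rightarrow> real" where
  "det0 x z = Re z * Im x - Re x * Im z"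

definition det1 :: "complex \<Rightarrow> complex \<Rightarrow> real" where
  "det1 x z = (1 - Re z) * Im x - (1 - Re x) * Im z"

text \<open>For points of the upper half-plane: \<open>z\<close> lies in the triangle with corners \<open>0\<close>, \<open>1\<close>, \<open>x\<close>.\<close>

definition tri :: "complex \<Rightarrow> complex \<Rightarrow> bool" where
  "tri x z \<longleftrightarrow> det0 x z \<ge> 0 \<and> det1 x z \<ge> 0"

section \<open>Plane geometry of spokes and triangles\<close>

lemma perp_parallel:
  fixes D X Y :: complex
  assumes "D \<noteq> 0" "X \<noteq> 0" "inner D X = 0" "inner D Y = 0"
  shows "\<exists>l. Y = l *\<^sub>R X"
proof -
  define f where "f Z = (Im Z * Re D - Re Z * Im D) / (Re D ^ 2 + Im D ^ 2)" for Z
  have D: "Re D ^ 2 + Im D ^ 2 \<noteq> 0" using assms(1) by (simp add: complex_eq_iff sum_power2_eq_zero_iff)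
  have *: "Z = f Z *\<^sub>R (\<i> * D)" if "inner D Z = 0" for Z
  proof -
    have i: "Re D * Re Z + Im D * Im Z = 0" using that by (simp add: inner_complex_def)
    have "(Re D ^ 2 + Im D ^ 2) * Re Z = - (Im Z * Re D - Re Z * Im D) * Im D"
      "(Re D ^ 2 + Im D ^ 2) * Im Z = (Im Z * Re D - Re Z * Im D) * Re D"
      using i by algebra+
    then show ?thesis using D by (auto simp: complex_eq_iff f_def field_simps)
  qed
  have "f X \<noteq> 0" using *[OF assms(3)] assms(2) by auto
  then have "Y = (f Y / f X) *\<^sub>R X"
    using *[OF assms(3)] *[OF assms(4)] by (metis nonzero_eq_divide_eq scaleR_scaleR)
  then show ?thesis by blast
qed

lemma in_segment_scale: "0 \<le> l \<Longrightarrow> l \<le> 1 \<Longrightarrow> (p :: complex) + l *\<^sub>R (q - p) \<in> closed_segment p q"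
  unfolding in_segment by (intro exI[of _ l]) (auto simp: algebra_simps)

lemma in_segmentE:
  assumes "(r :: complex) \<in> closed_segment p q"
  obtains l where "0 \<le> l" "l \<le> 1" "r = p + l *\<^sub>R (q - p)"
proof -
  obtain l where "0 \<le> l" "l \<le> 1" "r = (1 - l) *\<^sub>R p + l *\<^sub>R q" using assms by (auto simp: in_segment)
  then show thesis by (intro that[of l]) (auto simp: algebra_simps)
qed

lemma det_affine:
  "det0 x (p + l *\<^sub>R (q - p)) = (1 - l) * det0 x p + l * det0 x q"
  "det1 x (p + l *\<^sub>R (q - p)) = (1 - l) * det1 x p + l * det1 x q"
  "Im (p + l *\<^sub>R (q - p)) = (1 - l) * Im p + l * Im q"
  by (simp_all add: det0_def det1_def algebra_simps)

lemma det_sym: "det0 y x = - det0 x y" "det1 y x = - det1 x y"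
  by (simp_all add: det0_def det1_def)

lemma on_spoke0:
  assumes "Im x > 0" "Im r \<ge> 0" "det0 x r = 0" "det1 x r \<ge> 0"
  shows "r \<in> closed_segment 0 x"
proof -
  define l where "l = Im r / Im x"
  have r: "r = l *\<^sub>R x" using assms by (auto simp: l_def det0_def complex_eq_iff field_simps)
  have "Im x * l \<le> Im x * 1" using assms(4) unfolding r det1_def by (simp add: algebra_simps)
  then have "l \<le> 1" using assms(1) by simp
  moreover have "0 \<le> l" using assms by (simp add: l_def)
  ultimately show ?thesis using in_segment_scale[of l 0 x] r by simp
qed

lemma on_spoke1:
  assumes "Im x > 0" "Im r \<ge> 0" "det1 x r = 0" "det0 x r \<ge> 0"
  shows "r \<in> closed_segment 1 x"
proof -
  define l where "l = Im r / Im x"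
  have r: "r = 1 + l *\<^sub>R (x - 1)" using assms by (auto simp: l_def det1_def complex_eq_iff field_simps)
  have "Im x * l \<le> Im x * 1" using assms(4) unfolding r det0_def by (simp add: algebra_simps)
  then have "l \<le> 1" using assms(1) by simp
  moreover have "0 \<le> l" using assms by (simp add: l_def)
  ultimately show ?thesis using in_segment_scale[of l 1 x] r by simp
qed

lemma affine_zero:
  fixes a b :: real assumes "a \<ge> 0" "b < 0"
  obtains t where "0 \<le> t" "t \<le> 1" "(1 - t) * a + t * b = 0"
proof (rule that[of "a / (a - b)"])
  show "(1 - a / (a - b)) * a + a / (a - b) * b = 0" using assms by (simp add: field_simps)
qed (use assms in \<open>auto simp: field_simps\<close>)

text \<open>If the second affine function is already negative where the first one vanishes, its own
  zero comes earlier, and there the first one is still nonnegative.\<close>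

lemma first_exit_aux:
  fixes a b c d :: real
  assumes "a \<ge> 0" "c \<ge> 0" "b < 0"
  shows "\<exists>t. 0 \<le> t \<and> t \<le> 1 \<and>
    (((1 - t) * a + t * b = 0 \<and> (1 - t) * c + t * d \<ge> 0) \<or>
     ((1 - t) * c + t * d = 0 \<and> (1 - t) * a + t * b \<ge> 0))"
proof -
  obtain t where t: "0 \<le> t" "t \<le> 1" "(1 - t) * a + t * b = 0" by (rule affine_zero[OF assms(1,3)])
  show ?thesis
  proof (cases "(1 - t) * c + t * d \<ge> 0")
    case True
    then show ?thesis using t by blast
  next
    case False
    then have "(1 - t) * c + t * d < 0" by simp
    then obtain s where s: "0 \<le> s" "s \<le> 1" "(1 - s) * c + s * ((1 - t) * c + t * d) = 0"
      by (rule affine_zero[OF assms(2)])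
    have e: "(1 - s * t) * c + s * t * d = 0" using s(3) by (simp add: algebra_simps)
    have "(1 - s * t) * a + s * t * b = (1 - s) * a + s * ((1 - t) * a + t * b)"
      by (simp add: algebra_simps)
    also have "\<dots> \<ge> 0" using t(3) s assms(1) by simp
    finally show ?thesis using e s t by (intro exI[of _ "s * t"]) (simp add: mult_le_one)
  qed
qed

lemma first_exit:
  fixes a b c d :: real
  assumes "a \<ge> 0" "c \<ge> 0" "b < 0 \<or> d < 0"
  shows "\<exists>t. 0 \<le> t \<and> t \<le> 1 \<and>
    (((1 - t) * a + t * b = 0 \<and> (1 - t) * c + t * d \<ge> 0) \<or>
     ((1 - t) * c + t * d = 0 \<and> (1 - t) * a + t * b \<ge> 0))"
  using first_exit_aux[of a c b d] first_exit_aux[of c a d b] assms by blast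

text \<open>Within the closed upper half-plane a segment cannot leave through the base of the
  triangle, so it leaves through one of the two spokes.\<close>

lemma half_plane_exit:
  assumes x: "Im x > 0" and p: "Im p \<ge> 0" "tri x p" and q: "Im q \<ge> 0" "\<not> tri x q"
  shows "closed_segment p q \<inter> (closed_segment 0 x \<union> closed_segment 1 x) \<noteq> {}"
proof -
  obtain t where t: "0 \<le> t" "t \<le> 1" and
    c: "((1 - t) * det0 x p + t * det0 x q = 0 \<and> (1 - t) * det1 x p + t * det1 x q \<ge> 0) \<or>
        ((1 - t) * det1 x p + t * det1 x q = 0 \<and> (1 - t) * det0 x p + t * det0 x q \<ge> 0)"
    using first_exit[of "det0 x p" "det1 x p" "det0 x q" "det1 x q"] p(2) q(2)
    unfolding tri_def not_le de_Morgan_conj by blast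
  define r where "r = p + t *\<^sub>R (q - p)"
  have "Im r \<ge> 0"
    unfolding r_def det_affine(3) using t p q by (intro add_nonneg_nonneg mult_nonneg_nonneg) auto
  then have "r \<in> closed_segment 0 x \<union> closed_segment 1 x"
    using c on_spoke0[OF x, of r] on_spoke1[OF x, of r] by (auto simp: r_def det_affine)
  moreover have "r \<in> closed_segment p q" using t in_segment_scale by (simp add: r_def)
  ultimately show ?thesis by blast
qed

lemma half_plane_same:
  assumes "Im x > 0" "Im p \<ge> 0" "Im q \<ge> 0"
    "closed_segment p q \<inter> closed_segment 0 x = {}" "closed_segment p q \<inter> closed_segment 1 x = {}"
  shows "tri x p \<longleftrightarrow> tri x q"
  using half_plane_exit[of x p q] half_plane_exit[of x q p] assms
  by (auto simp: closed_segment_commute)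

lemma tri_real: "Im x > 0 \<Longrightarrow> Im m = 0 \<Longrightarrow> tri x m \<longleftrightarrow> 0 \<le> Re m \<and> Re m \<le> 1"
  by (auto simp: tri_def det0_def det1_def zero_le_mult_iff)

text \<open>The real axis is assigned to the upper half-plane. A segment crossing the base then
  leaves all triangles of one side and enters all those of the other at once.\<close>

definition in_triangle :: "complex \<Rightarrow> complex \<Rightarrow> bool" where
  "in_triangle x z \<longleftrightarrow> (if Im x > 0 then Im z \<ge> 0 \<and> tri x z else Im z < 0 \<and> tri (cnj x) (cnj z))"

lemma cnj_segment: "closed_segment (cnj a) (cnj b) = cnj ` closed_segment a b"
  by (rule closed_segment_linear_image) (simp add: bounded_linear.linear bounded_linear_cnj)

lemma cnj_segment_disjoint:
  "closed_segment (cnj a) (cnj b) \<inter> closed_segment (cnj c) (cnj d) = {} \<longleftrightarrow>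
   closed_segment a b \<inter> closed_segment c d = {}"
  unfolding cnj_segment by (auto simp: inj_image_mem_iff)

lemma real_point:
  assumes "Im p \<ge> 0" "Im q < 0"
  obtains m where "m \<in> closed_segment p q" "Im m = 0"
proof -
  obtain t where "0 \<le> t" "t \<le> 1" "(1 - t) * Im p + t * Im q = 0" using affine_zero assms by blast
  then show thesis using that[of "p + t *\<^sub>R (q - p)"] in_segment_scale[of t p q] by (simp add: algebra_simps)
qed

text \<open>\<open>b\<close> says whether the segment meets the real axis between the hubs. This
  does not depend on \<open>x\<close>, because the base belongs to all triangles.\<close>

lemma in_triangle_mixed:
  assumes p: "Im p \<ge> 0" "Im q < 0"
  obtains b where "\<And>x. Im x \<noteq> 0 \<Longrightarrow> closed_segment p q \<inter> closed_segment 0 x = {} \<Longrightarrow>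
    closed_segment p q \<inter> closed_segment 1 x = {} \<Longrightarrow>
    (in_triangle x p \<longleftrightarrow> b \<and> Im x > 0) \<and> (in_triangle x q \<longleftrightarrow> b \<and> Im x < 0)"
proof -
  obtain m where m: "m \<in> closed_segment p q" "Im m = 0" using real_point[OF p] .
  have sub: "closed_segment p m \<subseteq> closed_segment p q" "closed_segment q m \<subseteq> closed_segment p q"
    using m by (auto simp: subset_closed_segment)
  show thesis
  proof (rule that[of "0 \<le> Re m \<and> Re m \<le> 1"])
    fix x assume x: "Im x \<noteq> 0" "closed_segment p q \<inter> closed_segment 0 x = {}"
      "closed_segment p q \<inter> closed_segment 1 x = {}"
    show "(in_triangle x p \<longleftrightarrow> (0 \<le> Re m \<and> Re m \<le> 1) \<and> Im x > 0) \<and>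
        (in_triangle x q \<longleftrightarrow> (0 \<le> Re m \<and> Re m \<le> 1) \<and> Im x < 0)"
    proof (cases "Im x > 0")
      case True
      have "tri x p \<longleftrightarrow> tri x m"
        using x sub m p by (intro half_plane_same True) auto
      then show ?thesis using True p tri_real[OF True m(2)] by (auto simp: in_triangle_def)
    next
      case False
      then have neg: "Im (cnj x) > 0" using x by simp
      have "closed_segment (cnj q) (cnj m) \<inter> closed_segment (cnj 0) (cnj x) = {}"
        "closed_segment (cnj q) (cnj m) \<inter> closed_segment (cnj 1) (cnj x) = {}"
        unfolding cnj_segment_disjoint using x sub by auto
      then have "tri (cnj x) (cnj q) \<longleftrightarrow> tri (cnj x) (cnj m)"
        using p m by (intro half_plane_same neg) auto
      then show ?thesis using False neg p m tri_real[OF neg, of "cnj m"] by (auto simp: in_triangle_def)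
    qed
  qed
qed

lemma in_triangle_upper:
  assumes "Im p \<ge> 0" "Im q \<ge> 0" "closed_segment p q \<inter> closed_segment 0 x = {}"
    "closed_segment p q \<inter> closed_segment 1 x = {}"
  shows "in_triangle x p \<longleftrightarrow> in_triangle x q"
  using half_plane_same[of x p q] assms by (auto simp: in_triangle_def)

lemma in_triangle_lower:
  assumes "Im p < 0" "Im q < 0" "Im x \<noteq> 0" "closed_segment p q \<inter> closed_segment 0 x = {}"
    "closed_segment p q \<inter> closed_segment 1 x = {}"
  shows "in_triangle x p \<longleftrightarrow> in_triangle x q"
proof -
  have "closed_segment (cnj p) (cnj q) \<inter> closed_segment (cnj 0) (cnj x) = {}"
    "closed_segment (cnj p) (cnj q) \<inter> closed_segment (cnj 1) (cnj x) = {}"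
    unfolding cnj_segment_disjoint using assms by auto
  then show ?thesis using half_plane_same[of "cnj x" "cnj p" "cnj q"] assms by (auto simp: in_triangle_def)
qed

text \<open>Crossing the real axis changes both membership values at once, so their difference survives.\<close>

lemma in_triangle_difference:
  assumes "Im x \<noteq> 0" "Im y \<noteq> 0"
    "closed_segment p q \<inter> closed_segment 0 x = {}" "closed_segment p q \<inter> closed_segment 1 x = {}"
    "closed_segment p q \<inter> closed_segment 0 y = {}" "closed_segment p q \<inter> closed_segment 1 y = {}"
  shows "(in_triangle x p \<noteq> in_triangle y p) \<longleftrightarrow> (in_triangle x q \<noteq> in_triangle y q)"
proof -
  have mixed: "(in_triangle x p \<noteq> in_triangle y p) \<longleftrightarrow> (in_triangle x q \<noteq> in_triangle y q)"
    if im: "Im p \<ge> 0" "Im q < 0" and disj: "closed_segment p q \<inter> closed_segment 0 x = {}" "closed_segment p q \<inter> closed_segment 1 x = {}"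
    "closed_segment p q \<inter> closed_segment 0 y = {}" "closed_segment p q \<inter> closed_segment 1 y = {}" for p q
  proof -
    obtain b where b: "\<And>x. Im x \<noteq> 0 \<Longrightarrow> closed_segment p q \<inter> closed_segment 0 x = {} \<Longrightarrow>
      closed_segment p q \<inter> closed_segment 1 x = {} \<Longrightarrow>
      (in_triangle x p \<longleftrightarrow> b \<and> Im x > 0) \<and> (in_triangle x q \<longleftrightarrow> b \<and> Im x < 0)"
      using in_triangle_mixed[OF im] by blast
    show ?thesis
      using b[OF assms(1) disj(1,2)] b[OF assms(2) disj(3,4)] assms(1,2) by auto
  qed
  consider "Im p \<ge> 0" "Im q \<ge> 0" | "Im p < 0" "Im q < 0" | "Im p \<ge> 0" "Im q < 0" | "Im p < 0" "Im q \<ge> 0"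
    by linarith
  then show ?thesis
  proof cases
    case 1 then show ?thesis using in_triangle_upper assms by blast
  next
    case 2 then show ?thesis using in_triangle_lower assms by blast
  next
    case 3 then show ?thesis using mixed assms by blast
  next
    case 4 then show ?thesis using mixed[of q p] assms by (auto simp: closed_segment_commute)
  qed
qed

text \<open>The determinants are antisymmetric, so equal signs put one apex into the other triangle.
  With opposite signs \<open>y\<close> lies beyond just one side of the triangle of
  \<open>x\<close>, and its spoke from the opposite hub crosses that side.\<close>

lemma nested_or_meet:
  assumes "Im x > 0" "Im y > 0" "closed_segment 0 x \<inter> closed_segment 1 y = {}"
    "closed_segment 0 y \<inter> closed_segment 1 x = {}"
  shows "tri x y \<or> tri y x"
proof -
  have *: False if x: "Im x > 0" "Im y > 0" and d: "det0 x y \<ge> 0" "det1 x y < 0"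
    and disj: "closed_segment 0 y \<inter> closed_segment 1 x = {}" for x y
  proof -
    have "det1 x 0 \<ge> 0" using x by (simp add: det1_def)
    then obtain t where t: "0 \<le> t" "t \<le> 1" "(1 - t) * det1 x 0 + t * det1 x y = 0"
      using affine_zero d by blast
    define r where "r = t *\<^sub>R y"
    have "det1 x r = (1 - t) * det1 x 0 + t * det1 x y" "det0 x r = t * det0 x y" "Im r = t * Im y"
      by (simp_all add: r_def det1_def det0_def algebra_simps)
    then have "r \<in> closed_segment 1 x"
      using x t d by (intro on_spoke1) auto
    moreover have "r \<in> closed_segment 0 y" using in_segment_scale[of t 0 y] t by (simp add: r_def)
    ultimately show False using disj by blast
  qed
  consider "det0 x y \<ge> 0 \<and> det1 x y \<ge> 0" | "det0 x y \<ge> 0 \<and> det1 x y < 0" |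
    "det0 x y < 0 \<and> det1 x y > 0" | "det0 x y < 0 \<and> det1 x y \<le> 0" by linarith
  then show ?thesis
  proof cases
    case 2 then show ?thesis using *[OF assms(1,2) _ _ assms(4)] by blast
  next
    case 3 then show ?thesis using *[OF assms(2,1) _ _ assms(3)] by (simp add: det_sym[of y x])
  qed (auto simp: tri_def det_sym[of y x])
qed


text \<open>By \<open>ang\<close> the ray from 0 to \<open>k\<close> makes the larger angle with the
  real axis, so the foot \<open>t' k\<close> of the perpendicular from 1 lies further along the
  Thales circle than the foot \<open>t x\<close>. The segment from 1 to \<open>t' k\<close>
  therefore cuts the spoke of \<open>x\<close> no later than \<open>t x\<close>.\<close>

lemma thales_meet:
  assumes x: "Im x > 0" and k: "Im k > 0" and ang: "Re k * Im x \<le> Re x * Im k"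
    and t: "0 \<le> t" "t \<le> 1" "0 \<le> s" "t *\<^sub>R x = 1 + s *\<^sub>R (y - 1)" "inner x (y - 1) = 0" "t \<noteq> 0"
    and t': "0 \<le> t'" "0 < s'" "s' \<le> 1" "t' *\<^sub>R k = 1 + s' *\<^sub>R (l - 1)" "inner k (l - 1) = 0" "t' \<noteq> 0"
  obtains c where "0 \<le> c" "c \<le> t" "c *\<^sub>R x \<in> closed_segment 1 l" "inner (c *\<^sub>R x - 1) k = 0"
proof -
  define a b where "a = Re x" "b = Im x"
  define e d where "e = Re k" "d = Im k"
  note D = a_b_def e_d_def
  have n: "a\<^sup>2 + b\<^sup>2 > 0" "e\<^sup>2 + d\<^sup>2 > 0" using x k by (auto simp: D intro: pos_add_strict add_nonneg_pos)
  have "inner x (t *\<^sub>R x - 1) = 0" unfolding t(4) using t(5) by simp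
  then have ta: "t * (a\<^sup>2 + b\<^sup>2) = a" by (simp add: inner_complex_def D power2_eq_square algebra_simps)
  have "inner k (t' *\<^sub>R k - 1) = 0" unfolding t'(4) using t'(5) by simp
  then have te: "t' * (e\<^sup>2 + d\<^sup>2) = e" by (simp add: inner_complex_def D power2_eq_square algebra_simps)
  have a: "a > 0" using ta n t by (metis less_eq_real_def mult_pos_pos)
  have e: "e > 0" using te n t' by (metis less_eq_real_def mult_pos_pos)
  have b: "b > 0" "d > 0" using x k by (auto simp: D)
  have g: "e * b \<le> a * d" using ang by (simp add: D)
  have q: "a * e + b * d > 0" using a b e by (simp add: add_pos_pos)
  \<comment> \<open>The cut point is \<open>c x\<close> on the spoke of \<open>x\<close>, and
    \<open>w\<close> is its parameter on the segment from 1 to \<open>t' k\<close>.\<close>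
  define c where "c = e / (a * e + b * d)"
  define w where "w = b * (e\<^sup>2 + d\<^sup>2) / (d * (a * e + b * d))"
  have "e * (a\<^sup>2 + b\<^sup>2) \<le> a * (a * e + b * d)"
    using mult_left_mono[OF g, of b] b by (simp add: power2_eq_square algebra_simps)
  then have "c \<le> a / (a\<^sup>2 + b\<^sup>2)" using n q by (simp add: c_def field_simps)
  also have "\<dots> = t" using ta n by (metis less_irrefl nonzero_eq_divide_eq)
  finally have ct: "c \<le> t" .
  have c0: "c \<ge> 0" using e q by (simp add: c_def)
  have "b * (e\<^sup>2 + d\<^sup>2) \<le> d * (a * e + b * d)"
    using mult_left_mono[OF g, of e] e by (simp add: power2_eq_square algebra_simps)
  then have w1: "w \<le> 1" using b q by (simp add: w_def)
  have w0: "w \<ge> 0" using b q n by (simp add: w_def)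
  have tt: "t' = e / (e\<^sup>2 + d\<^sup>2)" using te n by (metis less_irrefl nonzero_eq_divide_eq)
  have qe: "a * e + b * d \<noteq> 0" "e\<^sup>2 + d\<^sup>2 \<noteq> 0" "d \<noteq> 0" using q n b by auto
  have F: "e / Q * b = b * N / (d * Q) * (e / N * d)" "- (b * d) / Q = b * N / (d * Q) * (- d\<^sup>2 / N)"
    if "Q \<noteq> 0" "N \<noteq> 0" for Q N
    using that qe(3) by (simp_all add: field_simps power2_eq_square)
  have "c * b = w * (t' * d)" unfolding c_def w_def tt using F qe by blast
  moreover have "c * a - 1 = w * (t' * e - 1)"
  proof -
    have "c * a - 1 = - (b * d) / (a * e + b * d)" unfolding c_def using qe by (simp add: field_simps)
    moreover have "t' * e - 1 = - d\<^sup>2 / (e\<^sup>2 + d\<^sup>2)" unfolding tt using qe by (simp add: field_simps power2_eq_square)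
    ultimately show ?thesis unfolding w_def using F(2)[OF qe(1,2)] by simp
  qed
  ultimately have "c *\<^sub>R x - 1 = w *\<^sub>R (t' *\<^sub>R k - 1)" by (simp add: complex_eq_iff D)
  also have "\<dots> = (w * s') *\<^sub>R (l - 1)" unfolding t'(4) by simp
  finally have cl: "c *\<^sub>R x = 1 + (w * s') *\<^sub>R (l - 1)" by (simp add: algebra_simps)
  have "c *\<^sub>R x \<in> closed_segment 1 l"
    unfolding cl using w0 w1 t' by (intro in_segment_scale) (auto simp: mult_le_one)
  moreover have "inner (c *\<^sub>R x - 1) k = 0" using cl t'(5) by (simp add: inner_commute)
  ultimately show thesis using that c0 ct by blast
qed

section \<open>Edges in RAC drawings\<close>

locale rac_drawn =
  fixes V :: "'a set" and E :: "'a set set" and g :: "'a \<Rightarrow> complex"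
  assumes graph: "simple_graph V E" and drawing: "rac V E g"
begin

lemma edgeD: assumes "{a, b} \<in> E" shows "a \<in> V" "b \<in> V" "a \<noteq> b"
proof -
  have "{a, b} \<subseteq> V" "card {a, b} = 2" using graph assms by (auto simp: simple_graph_def)
  then show "a \<in> V" "b \<in> V" "a \<noteq> b" by auto
qed

lemma g_inj: "a \<in> V \<Longrightarrow> b \<in> V \<Longrightarrow> g a = g b \<longleftrightarrow> a = b"
  using drawing by (auto simp: rac_def inj_on_def)

lemma not_on_edge: "{a, b} \<in> E \<Longrightarrow> c \<in> V \<Longrightarrow> c \<noteq> a \<Longrightarrow> c \<noteq> b \<Longrightarrow> g c \<notin> closed_segment (g a) (g b)"
  using drawing by (auto simp: rac_def)

abbreviation meets :: "'a \<Rightarrow> 'a \<Rightarrow> 'a \<Rightarrow> 'a \<Rightarrow> bool" where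
  "meets a b c d \<equiv> closed_segment (g a) (g b) \<inter> closed_segment (g c) (g d) \<noteq> {}"

lemma meets_perp:
  "{a, b} \<in> E \<Longrightarrow> {c, d} \<in> E \<Longrightarrow> {a, b} \<inter> {c, d} = {} \<Longrightarrow> meets a b c d \<Longrightarrow> inner (g a - g b) (g c - g d) = 0"
  using drawing unfolding rac_def by blast

text \<open>Otherwise the nearer of the two ends would lie on the longer edge.\<close>

lemma same_ray:
  assumes "{p, t} \<in> E" "{p, t'} \<in> E" "g t' - g p = l *\<^sub>R (g t - g p)" "l > 0"
  shows "t = t'"
proof (rule ccontr)
  assume ne: "t \<noteq> t'"
  note V = edgeD[OF assms(1)] edgeD[OF assms(2)]
  show False
  proof (cases "l \<le> 1")
    case True
    then have "g p + l *\<^sub>R (g t - g p) \<in> closed_segment (g p) (g t)" using assms by (intro in_segment_scale) auto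
    moreover have "g t' = g p + l *\<^sub>R (g t - g p)" using assms(3) by (simp add: algebra_simps)
    ultimately show False using not_on_edge[OF assms(1), of t'] V ne by auto
  next
    case False
    have "g p + (1 / l) *\<^sub>R (g t' - g p) \<in> closed_segment (g p) (g t')"
      using assms False by (intro in_segment_scale) auto
    moreover have "g t = g p + (1 / l) *\<^sub>R (g t' - g p)" using assms(3,4) by simp
    ultimately show False using not_on_edge[OF assms(2), of t] V ne by auto
  qed
qed

text \<open>Both edges at \<open>p\<close> are perpendicular to \<open>c d\<close>, hence on one
  line. The difference of the two crossing points lies along \<open>c d\<close> and also
  perpendicular to it, so the points coincide and both edges leave \<open>p\<close> in the same
  direction.\<close>

lemma fan:
  assumes e: "{c, d} \<in> E" "{p, t} \<in> E" "{p, t'} \<in> E"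
    and ne: "c \<notin> {p, t, t'}" "d \<notin> {p, t, t'}" and m: "meets c d p t" "meets c d p t'"
  shows "t = t'"
proof -
  let ?D = "g c - g d" and ?X = "g t - g p" and ?Y = "g t' - g p"
  note V = edgeD[OF e(1)] edgeD[OF e(2)] edgeD[OF e(3)]
  have D: "?D \<noteq> 0" "?X \<noteq> 0" "?Y \<noteq> 0" using V g_inj by auto
  have "inner ?D (g p - g t) = 0" "inner ?D (g p - g t') = 0"
    using meets_perp[OF e(1,2) _ m(1)] meets_perp[OF e(1,3) _ m(2)] ne by auto
  then have DX: "inner ?D ?X = 0" "inner ?D ?Y = 0" by (simp_all add: inner_diff_right)
  then obtain l where l: "?Y = l *\<^sub>R ?X" using perp_parallel D by blast
  obtain r where r: "r \<in> closed_segment (g c) (g d)" "r \<in> closed_segment (g p) (g t)" using m by blast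
  obtain r' where r': "r' \<in> closed_segment (g c) (g d)" "r' \<in> closed_segment (g p) (g t')" using m by blast
  obtain i where i: "0 \<le> i" "r = g p + i *\<^sub>R ?X" using in_segmentE[OF r(2)] by metis
  obtain j where j: "0 \<le> j" "r' = g p + j *\<^sub>R ?Y" using in_segmentE[OF r'(2)] by metis
  obtain a where a: "r = g c + a *\<^sub>R (g d - g c)" using in_segmentE[OF r(1)] by metis
  obtain b where b: "r' = g c + b *\<^sub>R (g d - g c)" using in_segmentE[OF r'(1)] by metis
  have "r - r' = (b - a) *\<^sub>R ?D" unfolding a b by (simp add: algebra_simps)
  moreover have rr: "r - r' = (i - j * l) *\<^sub>R ?X" unfolding i j l by (simp add: algebra_simps)
  ultimately have "(b - a) * inner ?D ?D = (i - j * l) * inner ?D ?X"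
    by (metis inner_scaleR_right)
  then have "b - a = 0" using D DX by simp
  then have "(i - j * l) *\<^sub>R ?X = 0" using a b rr by simp
  then have ij: "i = j * l" using D by simp
  have "i \<noteq> 0" using r(1) i not_on_edge[OF e(1), of p] V ne by auto
  then have "l > 0" using ij i(1) j(1) by (metis less_eq_real_def mult_eq_0_iff zero_less_mult_pos)
  then show ?thesis using same_ray[OF e(2,3) l] by blast
qed

end

text \<open>A similarity (\<open>rac_similarity\<close>) brings any drawing into this
  position.\<close>

locale hub_drawing = rac_drawn +
  fixes u v :: 'a
  assumes hubs: "u \<in> V" "v \<in> V" "g u = 0" "g v = 1"
begin

section \<open>Layers and the crossings of their spokes\<close>

definition lay :: "'a \<Rightarrow> bool" where
  "lay x \<longleftrightarrow> {u, x} \<in> E \<and> {v, x} \<in> E"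

lemma layD: assumes "lay x" shows "x \<in> V" "x \<noteq> u" "x \<noteq> v" "{u, x} \<in> E" "{v, x} \<in> E"
  using assms edgeD[of u x] edgeD[of v x] unfolding lay_def by auto

lemma uv: "u \<noteq> v" using hubs by auto

definition met :: "'a \<Rightarrow> 'a \<Rightarrow> 'a \<Rightarrow> bool" where
  "met c d x \<longleftrightarrow> meets c d u x \<or> meets c d v x"

text \<open>A layer on the line \<open>uv\<close> lies on the positive side of \<open>u\<close>, as
  otherwise \<open>u\<close> would be on its spoke from \<open>v\<close>. All such layers are thus
  on one ray from \<open>u\<close>.\<close>

lemma real_layer_unique:
  assumes "lay x" "lay y" "Im (g x) = 0" "Im (g y) = 0"
  shows "x = y"
proof -
  note X = layD[OF assms(1)] and Y = layD[OF assms(2)]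
  have r: "Re (g z) > 0" if "lay z" "Im (g z) = 0" for z
  proof (rule ccontr)
    assume "\<not> Re (g z) > 0"
    then have le: "Re (g z) \<le> 0" by simp
    define l where "l = 1 / (1 - Re (g z))"
    have "1 + l *\<^sub>R (g z - 1) \<in> closed_segment 1 (g z)"
      using le by (intro in_segment_scale) (auto simp: l_def)
    moreover have "1 + l *\<^sub>R (g z - 1) = 0" using that le by (auto simp: complex_eq_iff l_def field_simps)
    ultimately show False
      using not_on_edge[OF layD(5)[OF that(1)] hubs(1)] uv layD[OF that(1)] hubs by auto
  qed
  have "g y - g u = (Re (g y) / Re (g x)) *\<^sub>R (g x - g u)"
    using r[OF assms(1,3)] assms hubs by (auto simp: complex_eq_iff)
  then show ?thesis using same_ray[OF X(4) Y(4)] divide_pos_pos[OF r[OF assms(2,4)] r[OF assms(1,3)]] by blast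
qed

lemma det_nonzero:
  assumes "lay x" "lay y" "Im (g x) > 0" "Im (g y) > 0" "x \<noteq> y"
  shows "det0 (g x) (g y) \<noteq> 0" "det1 (g x) (g y) \<noteq> 0"
proof -
  note X = layD[OF assms(1)] and Y = layD[OF assms(2)]
  let ?l = "Im (g y) / Im (g x)"
  have l: "?l > 0" using assms by simp
  show "det0 (g x) (g y) \<noteq> 0"
  proof
    assume "det0 (g x) (g y) = 0"
    then have "g y - g u = ?l *\<^sub>R (g x - g u)"
      using assms hubs by (auto simp: det0_def complex_eq_iff field_simps)
    then show False using same_ray[OF X(4) Y(4) _ l] assms(5) by blast
  qed
  show "det1 (g x) (g y) \<noteq> 0"
  proof
    assume "det1 (g x) (g y) = 0"
    then have "g y - g v = ?l *\<^sub>R (g x - g v)"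
      using assms hubs by (auto simp: det1_def complex_eq_iff field_simps)
    then show False using same_ray[OF X(5) Y(5) _ l] assms(5) by blast
  qed
qed


lemma spoke_pairD:
  assumes "lay x" "lay y" "x \<noteq> y" "meets u x v y"
  obtains t s where "0 < t" "t \<le> 1" "0 < s" "s \<le> 1" "t *\<^sub>R g x = 1 + s *\<^sub>R (g y - 1)" "inner (g x) (g y - 1) = 0"
proof -
  note X = layD[OF assms(1)] and Y = layD[OF assms(2)]
  obtain r where r: "r \<in> closed_segment 0 (g x)" "r \<in> closed_segment 1 (g y)" using assms(4) hubs by auto
  obtain t where t: "0 \<le> t" "t \<le> 1" "r = t *\<^sub>R g x" using in_segmentE[OF r(1)] by (metis add_0 diff_0_right)
  obtain s where s: "0 \<le> s" "s \<le> 1" "r = 1 + s *\<^sub>R (g y - 1)" using in_segmentE[OF r(2)] by metis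
  have "t \<noteq> 0" using t r(2) not_on_edge[OF Y(5), of u] hubs uv Y by auto
  moreover have "s \<noteq> 0" using s r(1) not_on_edge[OF X(4), of v] hubs uv X by auto
  moreover have "inner (g u - g x) (g v - g y) = 0"
    using meets_perp[OF X(4) Y(5) _ assms(4)] assms(3) uv X Y by auto
  then have "inner (g x) (g y - 1) = 0" using hubs by (simp add: inner_diff_right)
  ultimately show thesis using that[of t s] t s by auto
qed

text \<open>Perpendicular spokes from the two hubs meet on the circle with diameter \<open>[0, 1]\<close>; two such
  crossings on one side would force a third, non-perpendicular one.\<close>

lemma cross_unique_aux:
  assumes L: "lay x" "lay y" "lay k" "lay l" and im: "Im (g x) > 0" "Im (g k) > 0"
    and ne: "x \<noteq> y" "k \<noteq> l" and m: "meets u x v y" "meets u k v l"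
    and ang: "Re (g k) * Im (g x) \<le> Re (g x) * Im (g k)"
  shows "x = k"
proof (rule ccontr)
  assume xk: "x \<noteq> k"
  note X = layD[OF L(1)] and Y = layD[OF L(2)] and K = layD[OF L(3)] and Ll = layD[OF L(4)]
  obtain t s where t: "0 < t" "t \<le> 1" "0 < s" "s \<le> 1" "t *\<^sub>R g x = 1 + s *\<^sub>R (g y - 1)" "inner (g x) (g y - 1) = 0"
    using spoke_pairD[OF L(1,2) ne(1) m(1)] by metis
  obtain t' s' where t': "0 < t'" "t' \<le> 1" "0 < s'" "s' \<le> 1" "t' *\<^sub>R g k = 1 + s' *\<^sub>R (g l - 1)" "inner (g k) (g l - 1) = 0"
    using spoke_pairD[OF L(3,4) ne(2) m(2)] by metis
  obtain c where c: "0 \<le> c" "c \<le> t" "c *\<^sub>R g x \<in> closed_segment 1 (g l)" "inner (c *\<^sub>R g x - 1) (g k) = 0"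
    using thales_meet[OF im ang, of t s "g y" t' s' "g l"] t t' by (metis less_eq_real_def less_irrefl)
  have cx: "c *\<^sub>R g x \<in> closed_segment 0 (g x)" using in_segment_scale[of c 0 "g x"] c t by simp
  show False
  proof (cases "x = l")
    case True
    have "inner (c *\<^sub>R g x - 1) (g k) - inner (g x - 1) (g k) = (c - 1) * inner (g x) (g k)"
      by (simp add: inner_diff_left algebra_simps)
    then have "(c - 1) * inner (g x) (g k) = 0" using c(4) t'(6) True by (simp add: inner_commute)
    moreover have "inner (g x) (g k) > 0"
    proof -
      have "inner (g x) (g x) * t = Re (g x)"
      proof -
        have "inner (g x) (t *\<^sub>R g x - 1) = 0" unfolding t(5) using t(6) by simp
        then show ?thesis by (simp add: inner_complex_def algebra_simps)
      qed
      then have "Re (g x) > 0" using t im by (metis inner_gt_zero_iff less_irrefl mult_pos_pos zero_complex.sel(2))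
      moreover have "inner (g k) (g k) * t' = Re (g k)"
      proof -
        have "inner (g k) (t' *\<^sub>R g k - 1) = 0" unfolding t'(5) using t'(6) by simp
        then show ?thesis by (simp add: inner_complex_def algebra_simps)
      qed
      then have "Re (g k) > 0" using t' im by (metis inner_gt_zero_iff less_irrefl mult_pos_pos zero_complex.sel(2))
      ultimately show ?thesis using im by (simp add: inner_complex_def add_pos_pos)
    qed
    ultimately have "c = 1" by simp
    then have "t = 1" using c t by simp
    then have "g x \<in> closed_segment (g v) (g y)"
      using in_segment_scale[of s 1 "g y"] t hubs by simp
    then show False using not_on_edge[OF Y(5) X(1)] X ne by auto
  next
    case False
    \<comment> \<open>The spoke of \<open>l\<close> is perpendicular to the spokes of
      \<open>x\<close> and of \<open>k\<close>, which puts both on one ray from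
      \<open>u\<close>.\<close>
    have "meets u x v l" using cx c(3) hubs by auto
    then have "inner (g u - g x) (g v - g l) = 0"
      using meets_perp[OF X(4) Ll(5)] False uv X Ll by auto
    then have "inner (g l - 1) (g x) = 0" using hubs by (simp add: inner_diff_right inner_commute)
    moreover have "inner (g l - 1) (g k) = 0" using t' by (simp add: inner_commute)
    moreover have "g l - 1 \<noteq> 0" "g x \<noteq> 0" using g_inj[OF Ll(1) hubs(2)] hubs Ll im by auto
    ultimately obtain a where a: "g k = a *\<^sub>R g x" using perp_parallel by blast
    then have "a > 0" using im by (simp add: zero_less_mult_iff)
    then show False using same_ray[OF X(4) K(4), of a] a hubs xk by simp
  qed
qed

lemma cross_unique:
  assumes L: "lay x" "lay y" "lay k" "lay l" and im: "Im (g x) > 0" "Im (g k) > 0"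
    and ne: "x \<noteq> y" "k \<noteq> l" and m: "meets u x v y" "meets u k v l"
  shows "x = k"
  using cross_unique_aux[OF L im ne m] cross_unique_aux[OF L(3,4,1,2) im(2,1) ne(2,1) m(2,1)]
    linear[of "Re (g k) * Im (g x)" "Re (g x) * Im (g k)"] by blast

definition upper :: "'a set" where
  "upper = {x. lay x \<and> Im (g x) > 0}"

text \<open>By \<open>cross_unique\<close> all crossing pairs share the layer whose spoke comes from
  \<open>u\<close>, so discarding this one layer is enough.\<close>

lemma uncrossed_layers:
  obtains R where "card R \<le> 1" "finite R"
    "\<And>x y. x \<in> upper - R \<Longrightarrow> y \<in> upper - R \<Longrightarrow> x \<noteq> y \<Longrightarrow> \<not> meets u x v y"
proof (cases "\<exists>x\<in>upper. \<exists>y\<in>upper. x \<noteq> y \<and> meets u x v y")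
  case True
  then obtain x y where xy: "x \<in> upper" "y \<in> upper" "x \<noteq> y" "meets u x v y" by blast
  show thesis
  proof (rule that[of "{x}"])
    fix k l assume kl: "k \<in> upper - {x}" "l \<in> upper - {x}" "k \<noteq> l"
    then show "\<not> meets u k v l" using cross_unique[of x y k l] xy by (auto simp: upper_def)
  qed auto
next
  case False
  then show thesis by (intro that[of "{}"]) auto
qed

lemma nested:
  assumes "x \<in> upper" "y \<in> upper" "x \<noteq> y" "\<not> meets u x v y" "\<not> meets u y v x"
  shows "tri (g x) (g y) \<noteq> tri (g y) (g x)"
proof -
  have "tri (g x) (g y) \<or> tri (g y) (g x)"
    using nested_or_meet[of "g x" "g y"] assms hubs by (simp add: upper_def)
  moreover have "\<not> (tri (g x) (g y) \<and> tri (g y) (g x))"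
    using det_nonzero[of x y] assms det_sym[of "g y" "g x"] by (auto simp: tri_def upper_def)
  ultimately show ?thesis by blast
qed

text \<open>Two spokes of one hub are excluded by \<open>fan\<close>. Crossed spokes of different
  hubs would be parallel, and then neither triangle contains the apex of the other, against
  \<open>nested\<close>.\<close>

lemma met_once_per_side:
  assumes e: "{c, d} \<in> E" "c \<notin> {u, v, x, y}" "d \<notin> {u, v, x, y}"
    and x: "x \<in> upper" "y \<in> upper" "\<not> meets u x v y" "\<not> meets u y v x" and m: "met c d x" "met c d y"
  shows "x = y"
proof (rule ccontr)
  assume ne: "x \<noteq> y"
  have par: False if "x \<in> upper" "y \<in> upper" "\<not> meets u x v y" "\<not> meets u y v x" "x \<noteq> y"
    "c \<notin> {u, v, x, y}" "d \<notin> {u, v, x, y}" and m: "meets c d u x" "meets c d v y" for x y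
  proof -
    have L: "lay x" "lay y" "Im (g x) > 0" "Im (g y) > 0" using that by (auto simp: upper_def)
    note X = layD[OF L(1)] and Y = layD[OF L(2)]
    have "inner (g c - g d) (g u - g x) = 0" "inner (g c - g d) (g v - g y) = 0"
      using meets_perp[OF e(1) X(4) _ m(1)] meets_perp[OF e(1) Y(5) _ m(2)] that by auto
    then have "inner (g c - g d) (g x) = 0" "inner (g c - g d) (g y - 1) = 0"
      using hubs by (simp_all add: inner_diff_right)
    moreover have "g c - g d \<noteq> 0" "g x \<noteq> 0" using edgeD[OF e(1)] g_inj L by auto
    ultimately obtain l where l: "g y - 1 = l *\<^sub>R g x" using perp_parallel by blast
    then have "Im (g y) = l * Im (g x)" "Re (g y) = 1 + l * Re (g x)" by (auto simp: complex_eq_iff)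
    then have "det0 (g y) (g x) = - Im (g x)" "det1 (g x) (g y) = - Im (g y)"
      by (simp_all add: det0_def det1_def algebra_simps)
    then have "\<not> tri (g y) (g x)" "\<not> tri (g x) (g y)" using L by (auto simp: tri_def)
    then show False using nested[OF that(1,2,5,3,4)] by blast
  qed
  have L: "lay x" "lay y" using x by (auto simp: upper_def)
  note X = layD[OF L(1)] and Y = layD[OF L(2)]
  consider "meets c d u x" "meets c d u y" | "meets c d v x" "meets c d v y" |
    "meets c d u x" "meets c d v y" | "meets c d v x" "meets c d u y"
    using m unfolding met_def by blast
  then show False
  proof cases
    case 1 then show ?thesis using fan[OF e(1) X(4) Y(4)] e ne by auto
  next
    case 2 then show ?thesis using fan[OF e(1) X(5) Y(5)] e ne by auto
  next
    case 3 then show ?thesis using par[of x y] e x ne by auto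
  next
    case 4 then show ?thesis using par[of y x] e x ne by auto
  qed
qed

lemma met_point_upper:
  assumes "{c, d} \<in> E" "c \<notin> {u, v, x}" "d \<notin> {u, v, x}" "x \<in> upper" "met c d x"
  obtains r s h where "r \<in> closed_segment (g c) (g d)" "Im r > 0" "0 < s" "s \<le> 1"
    "h = 0 \<or> h = 1" "r = h + s *\<^sub>R (g x - h)"
proof -
  obtain r h where r: "r \<in> closed_segment (g c) (g d)" "r \<in> closed_segment h (g x)" "h = g u \<or> h = g v"
    using assms(5) by (auto simp: met_def)
  obtain s where s: "0 \<le> s" "s \<le> 1" "r = h + s *\<^sub>R (g x - h)" using in_segmentE[OF r(2)] by metis
  have "s \<noteq> 0" using s r not_on_edge[OF assms(1) hubs(1)] not_on_edge[OF assms(1) hubs(2)] assms by auto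
  moreover have "Im r = s * Im (g x)" using s r(3) hubs by auto
  ultimately show thesis using that[of r s h] r s assms(4) hubs by (auto simp: upper_def)
qed


text \<open>Edges that change sides meet only the innermost or only the outermost layer.\<close>

definition switching :: "'a set \<Rightarrow> bool \<Rightarrow> 'a set" where
  "switching U b = {x \<in> U. \<exists>c d m. {c, d} \<in> E \<and> c \<notin> {u, v} \<and> d \<notin> {u, v} \<and> \<not> lay c \<and> \<not> lay d \<and>
     m \<in> closed_segment (g c) (g d) \<and> Im m = 0 \<and> (b \<longleftrightarrow> 0 \<le> Re m \<and> Re m \<le> 1) \<and> met c d x}"

text \<open>Between its point on a spoke of \<open>x\<close> and its point on the axis, the edge
  meets no other layer of \<open>U\<close>. The point on the spoke is therefore in all other
  triangles if the axis is crossed between the hubs (\<open>b\<close>), and in none of them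
  otherwise. In a nested family only the innermost, respectively the outermost, layer allows
  this.\<close>

lemma switching_unique:
  assumes U: "U \<subseteq> upper" "\<And>x y. x \<in> U \<Longrightarrow> y \<in> U \<Longrightarrow> x \<noteq> y \<Longrightarrow> \<not> meets u x v y"
    and x: "x \<in> switching U b" "y \<in> switching U b"
  shows "x = y"
proof (rule ccontr)
  assume ne: "x \<noteq> y"
  have point: "\<exists>s h. 0 < s \<and> s \<le> 1 \<and> (h = 0 \<or> h = 1) \<and> (tri (g y) (h + s *\<^sub>R (g x - h)) \<longleftrightarrow> b)"
    if x: "x \<in> switching U b" and y: "y \<in> U" and ne: "x \<noteq> y" for x y
  proof -
    obtain c d m where e: "x \<in> U" "{c, d} \<in> E" "c \<notin> {u, v}" "d \<notin> {u, v}" "\<not> lay c" "\<not> lay d"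
      "m \<in> closed_segment (g c) (g d)" "Im m = 0" "b \<longleftrightarrow> 0 \<le> Re m \<and> Re m \<le> 1" "met c d x"
      using x unfolding switching_def by blast
    have up: "x \<in> upper" "y \<in> upper" "lay x" "lay y" "Im (g y) > 0" using e y U by (auto simp: upper_def)
    then have cd: "c \<notin> {u, v, x, y}" "d \<notin> {u, v, x, y}" using e by auto
    obtain r s h where r: "r \<in> closed_segment (g c) (g d)" "Im r > 0" "0 < s" "s \<le> 1"
      "h = 0 \<or> h = 1" "r = h + s *\<^sub>R (g x - h)"
      using met_point_upper[OF e(2) _ _ up(1) e(10)] cd by (metis insert_iff)
    have "\<not> met c d y"
      using met_once_per_side[OF e(2) cd up(1,2)] U(2) e y ne by metis
    moreover have "closed_segment r m \<subseteq> closed_segment (g c) (g d)"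
      using r e by (simp add: subset_closed_segment)
    ultimately have "closed_segment r m \<inter> closed_segment 0 (g y) = {}" "closed_segment r m \<inter> closed_segment 1 (g y) = {}"
      using hubs unfolding met_def by auto
    then have "tri (g y) r \<longleftrightarrow> tri (g y) m" using up r e by (intro half_plane_same) auto
    then show ?thesis using tri_real[OF up(5) e(8)] e(9) r by blast
  qed
  have key: False if x: "x \<in> switching U b" and y: "y \<in> switching U b" and ne: "x \<noteq> y" and n: "tri (g y) (g x)" for x y
  proof -
    have xy: "x \<in> U" "y \<in> U" using x y by (auto simp: switching_def)
    then have L: "lay x" "lay y" "Im (g x) > 0" "Im (g y) > 0" using U by (auto simp: upper_def)
    obtain s h where s: "0 < s" "s \<le> 1" "h = 0 \<or> h = 1" "tri (g y) (h + s *\<^sub>R (g x - h)) \<longleftrightarrow> b"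
      using point[OF x xy(2) ne] by blast
    have "tri (g y) h" using s(3) L by (auto simp: tri_def det0_def det1_def)
    then have "tri (g y) (h + s *\<^sub>R (g x - h))"
      using n s unfolding tri_def det_affine by (auto intro!: add_nonneg_nonneg mult_nonneg_nonneg)
    then have b using s by blast
    obtain s' h' where s': "0 < s'" "s' \<le> 1" "h' = 0 \<or> h' = 1" "tri (g x) (h' + s' *\<^sub>R (g y - h')) \<longleftrightarrow> b"
      using point[OF y xy(1) ne[symmetric]] by blast
    then have t: "tri (g x) (h' + s' *\<^sub>R (g y - h'))" using \<open>b\<close> by blast
    have "det0 (g y) (g x) > 0" "det1 (g y) (g x) > 0"
      using n det_nonzero[OF L(2,1,4,3)] ne by (auto simp: tri_def less_le)
    then have neg: "det0 (g x) (g y) < 0" "det1 (g x) (g y) < 0"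
      using det_sym[of "g y" "g x"] by auto
    from s'(3) show False
    proof
      assume "h' = 0"
      then have "det0 (g x) (h' + s' *\<^sub>R (g y - h')) = s' * det0 (g x) (g y)" by (simp add: det0_def algebra_simps)
      then show False using t neg s' by (auto simp: tri_def zero_le_mult_iff)
    next
      assume "h' = 1"
      then have "det1 (g x) (h' + s' *\<^sub>R (g y - h')) = s' * det1 (g x) (g y)" by (simp add: det1_def algebra_simps)
      then show False using t neg s' by (auto simp: tri_def zero_le_mult_iff)
    qed
  qed
  have xy: "x \<in> U" "y \<in> U" using x by (auto simp: switching_def)
  then have "tri (g x) (g y) \<noteq> tri (g y) (g x)" using U ne by (intro nested) auto
  then show False using key[of x y] key[of y x] x ne by blast
qed

lemma card_switching:
  assumes "U \<subseteq> upper" "\<And>x y. x \<in> U \<Longrightarrow> y \<in> U \<Longrightarrow> x \<noteq> y \<Longrightarrow> \<not> meets u x v y"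
  shows "card (switching U b) \<le> 1"
proof (cases "switching U b = {}")
  case False
  then obtain x where "x \<in> switching U b" by blast
  then have "switching U b \<subseteq> {x}" using switching_unique[OF assms] by blast
  then show ?thesis by (metis card.empty card_mono finite.emptyI finite.insertI is_singletonI is_singleton_altdef)
qed auto

section \<open>Removal of the exceptional layers\<close>

lemma finite_lay: "finite {x. lay x}"
  using graph layD(1) by (auto simp: simple_graph_def intro: finite_subset[of _ V])

text \<open>Reflection carries the results about \<open>upper\<close> over to the lower
  half-plane.\<close>

lemma cnj_drawing: "hub_drawing V E (\<lambda>z. cnj (g z)) u v"
proof
  have "inner (cnj a) (cnj b) = inner a b" for a b by (simp add: inner_complex_def)
  then have i: "inner (cnj a - cnj b) (cnj c - cnj d) = inner (a - b) (c - d)" for a b c d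
    by (metis complex_cnj_diff)
  have "cnj z \<in> closed_segment (cnj a) (cnj b) \<longleftrightarrow> z \<in> closed_segment a b" for z a b
    unfolding cnj_segment by (auto simp: inj_image_mem_iff)
  then show "rac V E (\<lambda>z. cnj (g z))"
    using drawing unfolding rac_def i cnj_segment_disjoint inj_on_def by simp
qed (use graph hubs in auto)

text \<open>The five exceptions are one layer on the axis, one layer per side with crossing spokes,
  and the two upper layers met by edges that change sides. Removing switching layers on the upper
  side suffices, because such an edge is then left with lower layers only.\<close>

lemma good_layers:
  obtains L where "L \<subseteq> {x. lay x}" "card ({x. lay x} - L) \<le> 5" "\<And>x. x \<in> L \<Longrightarrow> Im (g x) \<noteq> 0"
    "\<And>x y. x \<in> L \<Longrightarrow> y \<in> L \<Longrightarrow> x \<noteq> y \<Longrightarrow> Im (g x) > 0 \<longleftrightarrow> Im (g y) > 0 \<Longrightarrow>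
       in_triangle (g x) (g y) \<noteq> in_triangle (g y) (g x)"
    "\<And>x y. x \<in> L \<Longrightarrow> y \<in> L \<Longrightarrow> (Im (g x) > 0) \<noteq> (Im (g y) > 0) \<Longrightarrow> \<not> in_triangle (g x) (g y)"
    "\<And>c d x y. {c, d} \<in> E \<Longrightarrow> c \<notin> {u, v, x, y} \<Longrightarrow> d \<notin> {u, v, x, y} \<Longrightarrow> x \<in> L \<Longrightarrow> y \<in> L \<Longrightarrow>
       Im (g x) > 0 \<longleftrightarrow> Im (g y) > 0 \<Longrightarrow> met c d x \<Longrightarrow> met c d y \<Longrightarrow> x = y"
    "\<And>c d x y. {c, d} \<in> E \<Longrightarrow> c \<notin> {u, v} \<Longrightarrow> d \<notin> {u, v} \<Longrightarrow> \<not> lay c \<Longrightarrow> \<not> lay d \<Longrightarrow>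
       x \<in> L \<Longrightarrow> y \<in> L \<Longrightarrow> met c d x \<Longrightarrow> met c d y \<Longrightarrow> x = y"
proof -
  interpret c: hub_drawing V E "\<lambda>z. cnj (g z)" u v by (rule cnj_drawing)
  have cmeets: "c.meets a b k l \<longleftrightarrow> meets a b k l" for a b k l
    by (simp add: cnj_segment_disjoint)
  have cmet: "c.met a b x \<longleftrightarrow> met a b x" for a b x by (simp add: c.met_def met_def cnj_segment_disjoint)
  obtain R where R: "card R \<le> 1" "finite R"
    "\<And>x y. x \<in> upper - R \<Longrightarrow> y \<in> upper - R \<Longrightarrow> x \<noteq> y \<Longrightarrow> \<not> meets u x v y" using uncrossed_layers by metis
  obtain R' where R': "card R' \<le> 1" "finite R'"
    "\<And>x y. x \<in> c.upper - R' \<Longrightarrow> y \<in> c.upper - R' \<Longrightarrow> x \<noteq> y \<Longrightarrow> \<not> c.meets u x v y" using c.uncrossed_layers by metis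
  define U where "U = upper - R"
  define X where "X = switching U True \<union> switching U False"
  define Z where "Z = {x. lay x \<and> Im (g x) = 0}"
  have "card (switching U b) \<le> 1" for b using R(3) by (intro card_switching) (auto simp: U_def)
  then have X: "card X \<le> 2" using card_Un_le[of "switching U True" "switching U False"]
    unfolding X_def by (metis add_mono le_trans one_add_one)
  have Z: "card Z \<le> 1"
  proof (cases "Z = {}")
    case False
    then obtain x where "x \<in> Z" by blast
    then have "Z \<subseteq> {x}" using real_layer_unique by (auto simp: Z_def)
    then show ?thesis by (metis card.empty card_mono finite.emptyI finite.insertI is_singletonI is_singleton_altdef)
  qed auto
  define L where "L = {x. lay x} - (Z \<union> R \<union> R' \<union> X)"
  have fin: "finite Z" "finite X"
    using finite_lay by (auto simp: Z_def X_def switching_def U_def upper_def)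
  have "card ({x. lay x} - L) \<le> card (Z \<union> R \<union> R' \<union> X)"
    using fin R R' by (intro card_mono) (auto simp: L_def)
  also have "\<dots> \<le> card Z + card R + card R' + card X"
    by (meson add_mono card_Un_le le_refl le_trans)
  finally have c5: "card ({x. lay x} - L) \<le> 5" using X Z R(1) R'(1) by linarith
  have Im: "Im (g x) \<noteq> 0" if "x \<in> L" for x using that by (auto simp: L_def Z_def)
  have up: "x \<in> U" if "x \<in> L" "Im (g x) > 0" for x using that by (auto simp: L_def U_def upper_def)
  have low: "x \<in> c.upper - R'" if "x \<in> L" "\<not> Im (g x) > 0" for x
    using that Im[OF that(1)] by (auto simp: L_def c.upper_def)
  have nest: "in_triangle (g x) (g y) \<noteq> in_triangle (g y) (g x)"
    if "x \<in> L" "y \<in> L" "x \<noteq> y" "Im (g x) > 0 \<longleftrightarrow> Im (g y) > 0" for x y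
  proof (cases "Im (g x) > 0")
    case True
    then show ?thesis using nested[of x y] R(3) up that by (auto simp: U_def in_triangle_def)
  next
    case False
    then have "tri (cnj (g x)) (cnj (g y)) \<noteq> tri (cnj (g y)) (cnj (g x))"
      using low that R'(3) by (intro c.nested) auto
    then show ?thesis using False that Im by (auto simp: in_triangle_def less_le)
  qed
  have opp: "\<not> in_triangle (g x) (g y)" if "x \<in> L" "y \<in> L" "(Im (g x) > 0) \<noteq> (Im (g y) > 0)" for x y
    using that Im[OF that(1)] Im[OF that(2)] by (auto simp: in_triangle_def)
  have one: "x = y" if "{c, d} \<in> E" "c \<notin> {u, v, x, y}" "d \<notin> {u, v, x, y}" "x \<in> L" "y \<in> L"
       "Im (g x) > 0 \<longleftrightarrow> Im (g y) > 0" "met c d x" "met c d y" for c d x y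
  proof (rule ccontr)
    assume ne: "x \<noteq> y"
    show False
    proof (cases "Im (g x) > 0")
      case True
      then have "x \<in> upper - R" "y \<in> upper - R" using up that by (auto simp: U_def)
      then show False
        using met_once_per_side[OF that(1-3) _ _ _ _ that(7,8)] R(3)[of x y] R(3)[of y x] ne by blast
    next
      case False
      then have "x \<in> c.upper - R'" "y \<in> c.upper - R'" using low that by auto
      then show False
        using c.met_once_per_side[OF that(1-3)] that(7,8) R'(3)[of x y] R'(3)[of y x] ne cmet by blast
    qed
  qed
  have sw: False if e: "{c, d} \<in> E" "c \<notin> {u, v}" "d \<notin> {u, v}" "\<not> lay c" "\<not> lay d"
       "x \<in> L" "y \<in> L" "met c d x" "met c d y" "Im (g x) > 0" "\<not> Im (g y) > 0" for c d x y
  proof -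
    have xy: "x \<in> upper" "y \<in> c.upper" "lay x" "lay y" "x \<in> U"
      using up[OF e(6,10)] low[OF e(7,11)] e by (auto simp: U_def L_def)
    have cd: "c \<notin> {u, v, x, y}" "d \<notin> {u, v, x, y}" using e xy by auto
    obtain r where r: "r \<in> closed_segment (g c) (g d)" "Im r > 0"
      using met_point_upper[OF e(1) _ _ xy(1) e(8)] cd by (metis insert_iff)
    have "c.met c d y" using e cmet by blast
    then obtain r' where "r' \<in> closed_segment (cnj (g c)) (cnj (g d))" "Im r' > 0"
      using c.met_point_upper[OF e(1) _ _ xy(2)] cd by (metis insert_iff)
    then obtain r'' where r'': "r'' \<in> closed_segment (g c) (g d)" "Im r'' < 0"
      unfolding cnj_segment by auto
    obtain m where m: "m \<in> closed_segment r r''" "Im m = 0"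
      using real_point[of r r''] r r'' by (metis less_eq_real_def)
    have "m \<in> closed_segment (g c) (g d)" using m r r'' subset_closed_segment by blast
    then have "x \<in> switching U (0 \<le> Re m \<and> Re m \<le> 1)" using e xy m unfolding switching_def by blast
    then have "x \<in> X" unfolding X_def by (cases "0 \<le> Re m \<and> Re m \<le> 1") auto
    then show False using e by (auto simp: L_def)
  qed
  have nonlay: "x = y" if e: "{c, d} \<in> E" "c \<notin> {u, v}" "d \<notin> {u, v}" "\<not> lay c" "\<not> lay d"
       "x \<in> L" "y \<in> L" "met c d x" "met c d y" for c d x y
  proof -
    have "lay x" "lay y" using e by (auto simp: L_def)
    then have cd: "c \<notin> {u, v, x, y}" "d \<notin> {u, v, x, y}" using e by auto
    show ?thesis
      using one[OF e(1) cd e(6,7) _ e(8,9)] sw[OF e] sw[OF e(1-5,7,6,9,8)] by blast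
  qed
  show thesis
    by (rule that[OF _ c5 Im nest opp one nonlay]) (auto simp: L_def)
qed

end

section \<open>From drawings to packings\<close>

context hub_drawing
begin

definition thick :: "'a \<Rightarrow> 'a \<Rightarrow> bool" where
  "thick p q \<longleftrightarrow> (\<exists>T. card T = 9 \<and> (\<forall>t\<in>T. {p, t} \<in> E \<and> {q, t} \<in> E \<and> t \<notin> {u, v} \<and> \<not> lay t))"

text \<open>The side of \<open>z\<close> with respect to the closed curve \<open>u x v y\<close>.
  Unlike membership in one triangle, it does not change when the segment between the hubs is
  crossed.\<close>

definition differ :: "'a \<Rightarrow> 'a \<Rightarrow> 'a \<Rightarrow> bool" where
  "differ x y z \<longleftrightarrow> in_triangle (g x) (g z) \<noteq> in_triangle (g y) (g z)"

text \<open>For layers this says that the pairs \<open>x y\<close> and \<open>a b\<close> interleave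
  in the cyclic order.\<close>

definition sep :: "'a \<Rightarrow> 'a \<Rightarrow> 'a \<Rightarrow> 'a \<Rightarrow> bool" where
  "sep x y a b \<longleftrightarrow> differ x y a \<noteq> differ x y b"

section \<open>Connections that cannot be separated\<close>

lemma not_sep_edge:
  assumes "Im (g x) \<noteq> 0" "Im (g y) \<noteq> 0" "\<not> met c d x" "\<not> met c d y"
  shows "\<not> sep x y c d"
  using in_triangle_difference[OF assms(1,2), of "g c" "g d"] assms(3,4) hubs
  unfolding sep_def differ_def met_def by simp

text \<open>Separation would force each of the nine paths to cross a spoke of \<open>x\<close> or
  \<open>y\<close>. For each of the eight choices of an end of the path and one of the four spokes,
  \<open>fan\<close> allows a single path.\<close>

lemma not_sep_thick:
  assumes th: "thick p q" and p: "p \<notin> {u, v}" "q \<notin> {u, v}" and x: "lay x" "lay y" "x \<notin> {p, q}" "y \<notin> {p, q}"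
    and im: "Im (g x) \<noteq> 0" "Im (g y) \<noteq> 0"
  shows "\<not> sep x y p q"
proof
  assume sep: "sep x y p q"
  obtain T where T: "card T = 9" "\<And>t. t \<in> T \<Longrightarrow> {p, t} \<in> E \<and> {q, t} \<in> E \<and> t \<notin> {u, v} \<and> \<not> lay t"
    using th unfolding thick_def by blast
  define A where "A = (\<lambda>(a, h, z). {t \<in> T. meets a t h z})"
  let ?I = "{p, q} \<times> {u, v} \<times> {x, y}"
  have fT: "finite T" using T(1) card.infinite by fastforce
  have "card (A i) \<le> 1" if i: "i \<in> ?I" for i
  proof -
    obtain a h z where ahz: "i = (a, h, z)" "a \<in> {p, q}" "h \<in> {u, v}" "z \<in> {x, y}" using i by auto
    have hz: "{h, z} \<in> E" using ahz x unfolding lay_def by auto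
    have lz: "lay z" using ahz x by auto
    have "t = t'" if "t \<in> A i" "t' \<in> A i" for t t'
    proof (rule fan[OF hz, of a])
      show "{a, t} \<in> E" "{a, t'} \<in> E" using that ahz T(2) by (auto simp: A_def)
      show "h \<notin> {a, t, t'}" using that ahz T(2) p by (auto simp: A_def)
      show "z \<notin> {a, t, t'}" using that ahz T(2) x lz by (auto simp: A_def)
      show "meets h z a t" "meets h z a t'" using that ahz by (auto simp: A_def Int_commute)
    qed
    moreover have "finite (A i)" using fT ahz by (simp add: A_def)
    ultimately show ?thesis by (simp add: card_le_Suc0_iff_eq)
  qed
  then have "(\<Sum>i\<in>?I. card (A i)) \<le> (\<Sum>i\<in>?I. 1)" by (intro sum_mono) auto
  also have "\<dots> = card ?I" by simp
  also have "\<dots> \<le> 2 * (2 * 2)"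
    unfolding card_cartesian_product by (intro mult_mono) (auto simp: card_insert_if)
  finally have "card (\<Union>i\<in>?I. A i) \<le> 8"
    using card_UN_le[of ?I A] by simp
  moreover have "T \<subseteq> (\<Union>i\<in>?I. A i)"
  proof
    fix t assume t: "t \<in> T"
    have "sep x y p t \<or> sep x y q t" using sep unfolding sep_def by blast
    then have "met p t x \<or> met p t y \<or> met q t x \<or> met q t y" using not_sep_edge[OF im] by blast
    then obtain a z where "a \<in> {p, q}" "z \<in> {x, y}" "met a t z" by blast
    then obtain h where "a \<in> {p, q}" "h \<in> {u, v}" "z \<in> {x, y}" "meets a t h z" by (auto simp: met_def)
    then show "t \<in> (\<Union>i\<in>?I. A i)" using t by (intro UN_I[of "(a, h, z)"]) (auto simp: A_def)
  qed
  then have "card T \<le> card (\<Union>i\<in>?I. A i)" using fT by (intro card_mono) (auto simp: A_def)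
  ultimately show False using T(1) by simp
qed

lemma not_sep_chain:
  assumes th: "\<And>k. i \<le> k \<Longrightarrow> k < j \<Longrightarrow> thick (w k) (w (Suc k))" and "i \<le> j"
    and w: "\<And>k. i \<le> k \<Longrightarrow> k \<le> j \<Longrightarrow> w k \<notin> {u, v, x, y}"
    and x: "lay x" "lay y" "Im (g x) \<noteq> 0" "Im (g y) \<noteq> 0"
  shows "\<not> sep x y (w i) (w j)"
  using assms(2)
proof (induction rule: inc_induct)
  case base
  then show ?case by (simp add: sep_def)
next
  case (step k)
  have "\<not> sep x y (w k) (w (Suc k))"
    using step w[of k] w[of "Suc k"] by (intro not_sep_thick th x) auto
  then show ?case using step.IH by (auto simp: sep_def)
qed

end

text \<open>\<open>W j\<close> are the layers of wall \<open>j\<close>, \<open>It i\<close> those of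
  item \<open>i\<close>, and \<open>Pt j\<close> is the path spanning the bin between walls
  \<open>j\<close> and \<open>j + 1\<close>; \<open>wrap\<close> closes the walls to a cycle. By the
  last assumption a wall contains more disjoint triples of consecutive layers than there are layers
  that can behave badly.\<close>

locale frame = hub_drawing +
  fixes n m La :: nat and B s :: "nat \<Rightarrow> nat" and W It Pt :: "nat \<Rightarrow> nat \<Rightarrow> 'a"
  assumes n: "n \<ge> 1"
    and layW: "\<And>j k. j \<le> n \<Longrightarrow> k < La \<Longrightarrow> lay (W j k)"
    and layI: "\<And>i k. i < m \<Longrightarrow> k < s i \<Longrightarrow> lay (It i k)"
    and injW: "\<And>j k j' k'. j \<le> n \<Longrightarrow> k < La \<Longrightarrow> j' \<le> n \<Longrightarrow> k' < La \<Longrightarrow> W j k = W j' k' \<Longrightarrow> j = j' \<and> k = k'"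
    and injI: "\<And>i k i' k'. i < m \<Longrightarrow> k < s i \<Longrightarrow> i' < m \<Longrightarrow> k' < s i' \<Longrightarrow> It i k = It i' k' \<Longrightarrow> i = i' \<and> k = k'"
    and WI: "\<And>j k i l. j \<le> n \<Longrightarrow> k < La \<Longrightarrow> i < m \<Longrightarrow> l < s i \<Longrightarrow> W j k \<noteq> It i l"
    and Pt: "\<And>j k. j < n \<Longrightarrow> k \<le> B j \<Longrightarrow> Pt j k \<notin> {u, v} \<and> \<not> lay (Pt j k)"
    and thW: "\<And>j k. j \<le> n \<Longrightarrow> Suc k < La \<Longrightarrow> thick (W j k) (W j (Suc k))"
    and thI: "\<And>i k. i < m \<Longrightarrow> Suc k < s i \<Longrightarrow> thick (It i k) (It i (Suc k))"
    and wrap: "thick (W n (La - 1)) (W 0 0)"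
    and path: "\<And>j k. j < n \<Longrightarrow> k < B j \<Longrightarrow> {Pt j k, Pt j (Suc k)} \<in> E"
    and first: "\<And>j. j < n \<Longrightarrow> {W j (La - 1), Pt j 0} \<in> E"
    and last: "\<And>j. j < n \<Longrightarrow> {Pt j (B j), W (Suc j) 0} \<in> E"
    and La: "La \<ge> 3 * ((\<Sum>j<n. B j + 4) + 6)"
begin

theorem packing:
  "\<exists>\<beta>. (\<forall>i<m. \<beta> i < n) \<and> (\<forall>j<n. (\<Sum>i | i < m \<and> \<beta> i = j. s i) \<le> B j + 9)"
proof -
  obtain L where L: "L \<subseteq> {x. lay x}" "card ({x. lay x} - L) \<le> 5" and Im: "\<And>x. x \<in> L \<Longrightarrow> Im (g x) \<noteq> 0"
    and nest: "\<And>x y. x \<in> L \<Longrightarrow> y \<in> L \<Longrightarrow> x \<noteq> y \<Longrightarrow> Im (g x) > 0 \<longleftrightarrow> Im (g y) > 0 \<Longrightarrow>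
       in_triangle (g x) (g y) \<noteq> in_triangle (g y) (g x)"
    and opp: "\<And>x y. x \<in> L \<Longrightarrow> y \<in> L \<Longrightarrow> (Im (g x) > 0) \<noteq> (Im (g y) > 0) \<Longrightarrow> \<not> in_triangle (g x) (g y)"
    and side: "\<And>c d x y. {c, d} \<in> E \<Longrightarrow> c \<notin> {u, v, x, y} \<Longrightarrow> d \<notin> {u, v, x, y} \<Longrightarrow> x \<in> L \<Longrightarrow> y \<in> L \<Longrightarrow>
       Im (g x) > 0 \<longleftrightarrow> Im (g y) > 0 \<Longrightarrow> met c d x \<Longrightarrow> met c d y \<Longrightarrow> x = y"
    and once: "\<And>c d x y. {c, d} \<in> E \<Longrightarrow> c \<notin> {u, v} \<Longrightarrow> d \<notin> {u, v} \<Longrightarrow> \<not> lay c \<Longrightarrow> \<not> lay d \<Longrightarrow>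
       x \<in> L \<Longrightarrow> y \<in> L \<Longrightarrow> met c d x \<Longrightarrow> met c d y \<Longrightarrow> x = y"
    by (rule good_layers) (rule that, assumption+)
  have lay: "lay x" if "x \<in> L" for x using L that by blast
  have finL: "finite L" using L(1) finite_lay finite_subset by blast
  have La0: "La \<ge> 18" using order_trans[OF _ La, of 18] by simp
  \<comment> \<open>On one side of the axis nesting makes membership antisymmetric; across the axis
    it is false both ways.\<close>
  have flip: "in_triangle (g y) (g x) \<longleftrightarrow> (in_triangle (g x) (g y) \<noteq> (Im (g x) > 0 \<longleftrightarrow> Im (g y) > 0))"
    if "x \<in> L" "y \<in> L" "x \<noteq> y" for x y
    using nest[OF that] opp[OF that(1,2)] opp[OF that(2,1)] by blast
  \<comment> \<open>Exchanging the pairs flips each of the four memberships according to sides, and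
    these corrections cancel in pairs.\<close>
  have sep_swap: "sep x y a b \<longleftrightarrow> sep a b x y"
    if "x \<in> L" "y \<in> L" "a \<in> L" "b \<in> L" "x \<noteq> a" "x \<noteq> b" "y \<noteq> a" "y \<noteq> b" for x y a b
    unfolding sep_def differ_def flip[OF that(1,3,5)] flip[OF that(1,4,6)] flip[OF that(2,3,7)] flip[OF that(2,4,8)]
    by argo
  \<comment> \<open>Of the three ways to split four layers into two pairs, one is
    interleaved.\<close>
  have quad: "sep a d b c" if "a \<in> L" "b \<in> L" "c \<in> L" "d \<in> L" "b \<noteq> c" "b \<noteq> d" "c \<noteq> d"
    "\<not> sep a b c d" "\<not> sep a c b d" for a b c d
    using that(8,9) unfolding sep_def differ_def flip[OF that(2,3,5)] flip[OF that(2,4,6)] flip[OF that(3,4,7)]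
    by argo
  \<comment> \<open>The end edges are treated apart: one of their ends is a layer, so only
    \<open>side\<close> applies and each may meet one layer on either side. This gives the 4 in
    \<open>cQ\<close>.\<close>
  define Q where "Q j = (\<Union>k<B j. {x \<in> L. met (Pt j k) (Pt j (Suc k)) x}) \<union>
      {x \<in> L - {W j (La - 1)}. met (W j (La - 1)) (Pt j 0) x} \<union>
      {x \<in> L - {W (Suc j) 0}. met (Pt j (B j)) (W (Suc j) 0) x}" for j
  have cQ: "card (Q j) \<le> B j + 4" if j: "j < n" for j
  proof -
    have "card {x \<in> L. met (Pt j k) (Pt j (Suc k)) x} \<le> 1" if k: "k < B j" for k
    proof -
      have "Pt j k \<notin> {u, v}" "\<not> lay (Pt j k)" "Pt j (Suc k) \<notin> {u, v}" "\<not> lay (Pt j (Suc k))"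
        using Pt[OF j, of k] Pt[OF j, of "Suc k"] k by simp_all
      then have "x = y" if "x \<in> {x \<in> L. met (Pt j k) (Pt j (Suc k)) x}"
        "y \<in> {x \<in> L. met (Pt j k) (Pt j (Suc k)) x}" for x y
        using once[OF path[OF j k], of x y] that by blast
      moreover have "finite {x \<in> L. met (Pt j k) (Pt j (Suc k)) x}" using finL by simp
      ultimately show ?thesis by (simp add: card_le_Suc0_iff_eq)
    qed
    then have "(\<Sum>k<B j. card {x \<in> L. met (Pt j k) (Pt j (Suc k)) x}) \<le> (\<Sum>k<B j. 1)"
      by (intro sum_mono) auto
    then have 1: "card (\<Union>k<B j. {x \<in> L. met (Pt j k) (Pt j (Suc k)) x}) \<le> B j"
      using card_UN_le[of "{..<B j}" "\<lambda>k. {x \<in> L. met (Pt j k) (Pt j (Suc k)) x}"] by simp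
    have two: "card S \<le> 2" if S: "S \<subseteq> L" and
      u: "\<And>x y. x \<in> S \<Longrightarrow> y \<in> S \<Longrightarrow> Im (g x) > 0 \<longleftrightarrow> Im (g y) > 0 \<Longrightarrow> x = y" for S
    proof -
      have f: "finite S" using S finL finite_subset by blast
      have "card {x \<in> S. Im (g x) > 0} \<le> 1" "card {x \<in> S. \<not> Im (g x) > 0} \<le> 1"
        using f u by (auto simp: card_le_Suc0_iff_eq)
      moreover have "S = {x \<in> S. Im (g x) > 0} \<union> {x \<in> S. \<not> Im (g x) > 0}" by blast
      ultimately show ?thesis
        by (metis (no_types, lifting) add_mono card_Un_le le_trans one_add_one)
    qed
    have lw: "lay (W j (La - 1))" "lay (W (Suc j) 0)" using layW j La0 by auto
    have 2: "card {x \<in> L - {W j (La - 1)}. met (W j (La - 1)) (Pt j 0) x} \<le> 2"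
    proof (rule two)
      fix x y assume "x \<in> {x \<in> L - {W j (La - 1)}. met (W j (La - 1)) (Pt j 0) x}"
        "y \<in> {x \<in> L - {W j (La - 1)}. met (W j (La - 1)) (Pt j 0) x}" "Im (g x) > 0 \<longleftrightarrow> Im (g y) > 0"
      then show "x = y"
        using side[OF first[OF j], of x y] layD[OF lw(1)] Pt[OF j, of 0] lay[of x] lay[of y] by auto
    qed auto
    have 3: "card {x \<in> L - {W (Suc j) 0}. met (Pt j (B j)) (W (Suc j) 0) x} \<le> 2"
    proof (rule two)
      fix x y assume "x \<in> {x \<in> L - {W (Suc j) 0}. met (Pt j (B j)) (W (Suc j) 0) x}"
        "y \<in> {x \<in> L - {W (Suc j) 0}. met (Pt j (B j)) (W (Suc j) 0) x}" "Im (g x) > 0 \<longleftrightarrow> Im (g y) > 0"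
      then show "x = y"
        using side[OF last[OF j], of x y] layD[OF lw(2)] Pt[OF j, of "B j"] lay[of x] lay[of y] by auto
    qed auto
    show ?thesis
      unfolding Q_def using 1 2 3
      by (intro order_trans[OF card_Un_le] order_trans[OF add_mono[OF card_Un_le order_refl]]) linarith
  qed
  have finQ: "finite (Q j)" for j using finL by (auto simp: Q_def)
  have walk: "\<not> sep x y (W j (La - 1)) (W (Suc j) 0)"
    if j: "j < n" and x: "x \<in> L" "y \<in> L" "x \<notin> Q j" "y \<notin> Q j"
      "x \<notin> {W j (La - 1), W (Suc j) 0}" "y \<notin> {W j (La - 1), W (Suc j) 0}" for x y j
  proof -
    have "\<not> sep x y (Pt j 0) (Pt j k)" if "k \<le> B j" for k
      using that
    proof (induction k)
      case (Suc k)
      then have "\<not> met (Pt j k) (Pt j (Suc k)) x" "\<not> met (Pt j k) (Pt j (Suc k)) y"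
        using x(1-4) by (auto simp: Q_def)
      then have "\<not> sep x y (Pt j k) (Pt j (Suc k))" using not_sep_edge Im x by blast
      then show ?case using Suc by (auto simp: sep_def)
    qed (simp add: sep_def)
    then have "\<not> sep x y (Pt j 0) (Pt j (B j))" by blast
    moreover have "\<not> sep x y (W j (La - 1)) (Pt j 0)"
      using x by (intro not_sep_edge Im) (auto simp: Q_def)
    moreover have "\<not> sep x y (Pt j (B j)) (W (Suc j) 0)"
      using x by (intro not_sep_edge Im) (auto simp: Q_def)
    ultimately show ?thesis by (auto simp: sep_def)
  qed
  define Bad where "Bad = ({x. lay x} - L) \<union> (\<Union>j<n. Q j)"
  let ?N = "(\<Sum>j<n. B j + 4) + 6"
  have finB: "finite Bad" using finite_lay finQ by (simp add: Bad_def)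
  have "card (\<Union>j<n. Q j) \<le> (\<Sum>j<n. card (Q j))" by (rule card_UN_le) simp
  also have "\<dots> \<le> (\<Sum>j<n. B j + 4)" by (intro sum_mono cQ) auto
  finally have cB: "card Bad < ?N"
    using card_Un_le[of "{x. lay x} - L" "\<Union>j<n. Q j"] L(2) unfolding Bad_def by linarith
  \<comment> \<open>Wall 0 has \<open>?N\<close> disjoint triples of consecutive layers and there
    are fewer bad layers, so one triple is entirely good.\<close>
  obtain q where q: "q < ?N" "\<And>e. e < 3 \<Longrightarrow> W 0 (3 * q + e) \<notin> Bad"
  proof (rule ccontr)
    assume "\<not> thesis"
    then have "\<forall>q<?N. \<exists>e<3. W 0 (3 * q + e) \<in> Bad" using that by blast
    then obtain e where e: "\<And>q. q < ?N \<Longrightarrow> e q < 3 \<and> W 0 (3 * q + e q) \<in> Bad" by metis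
    have "inj_on (\<lambda>q. W 0 (3 * q + e q)) {..<?N}"
    proof (rule inj_onI)
      fix a b assume ab: "a \<in> {..<?N}" "b \<in> {..<?N}" "W 0 (3 * a + e a) = W 0 (3 * b + e b)"
      then have "3 * a + e a < La" "3 * b + e b < La" using e[of a] e[of b] La by auto
      then have "3 * a + e a = 3 * b + e b" using injW[of 0 "3 * a + e a" 0 "3 * b + e b"] ab by auto
      then show "a = b" using e[of a] e[of b] ab by auto
    qed
    then have "card {..<?N} \<le> card Bad" using finB e by (intro card_inj_on_le) auto
    then show False using cB by simp
  qed
  define r where "r = 3 * q + 1"
  have "1 \<le> r" "r + 1 < La" using q(1) La by (auto simp: r_def)
  then have r: "1 \<le> r" "r + 1 < La" "r < La" "r - Suc 0 < La" "r - Suc 0 \<noteq> r" "r - Suc 0 \<noteq> Suc r" "Suc (r - Suc 0) = r" "La - Suc 0 \<noteq> r"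
    by auto
  \<comment> \<open>The cyclic order is cut open at \<open>y\<close>, whose two neighbours in the
    wall are good as well.\<close>
  define y where "y = W 0 r"
  have notBad: "x \<in> L \<and> (\<forall>j<n. x \<notin> Q j)" if "x \<notin> Bad" "lay x" for x using that by (auto simp: Bad_def)
  have y: "y \<in> L" "\<And>j. j < n \<Longrightarrow> y \<notin> Q j" "W 0 (r - 1) \<in> L" "W 0 (r + 1) \<in> L"
    using notBad[OF q(2)[of 1]] notBad[OF q(2)[of 0]] notBad[OF q(2)[of 2]] layW r
    by (auto simp: y_def r_def)
  have yW: "y \<noteq> W j k" if "j \<le> n" "k < La" "j \<noteq> 0 \<or> k \<noteq> r" for j k
    using injW[of 0 r j k] that r by (auto simp: y_def)
  have hub: "W j k \<notin> {u, v}" if "j \<le> n" "k < La" for j k using layD[OF layW[OF that]] by auto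
  have wall: "\<not> sep x z (W j k) (W j k')" if "j \<le> n" "k \<le> k'" "k' < La" "x \<in> L" "z \<in> L"
      "\<And>l. k \<le> l \<Longrightarrow> l \<le> k' \<Longrightarrow> W j l \<notin> {x, z}" for x z j k k'
  proof (rule not_sep_chain)
    show "W j l \<notin> {u, v, x, z}" if "k \<le> l" "l \<le> k'" for l
      using that \<open>k' < La\<close> \<open>j \<le> n\<close> hub[of j l] \<open>\<And>l. k \<le> l \<Longrightarrow> l \<le> k' \<Longrightarrow> W j l \<notin> {x, z}\<close>[of l] by auto
  qed (use that thW lay Im in auto)
  \<comment> \<open>Nothing lies between \<open>y\<close> and its neighbours. The walk along the
    walls from one neighbour round the cycle to the other therefore passes \<open>x\<close>, and
    neither a wall nor the closing connection can be passed, only a bin.\<close>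
  have separated: "\<exists>j<n. sep x y (W j (La - 1)) (W (Suc j) 0)"
    if x: "x \<in> L" "i < m" "k < s i" "x = It i k" for x i k
  proof (rule ccontr)
    assume no: "\<not> ?thesis"
    have xW: "x \<noteq> W j l" if "j \<le> n" "l < La" for j l using WI[OF that x(2,3)] x(4) by auto
    have xy: "x \<noteq> y" using xW[of 0 r] r by (auto simp: y_def)
    have wallx: "\<not> sep x y (W j a) (W j b)" if w: "j \<le> n" "a \<le> b" "b < La" "j \<noteq> 0 \<or> r < a \<or> b < r" for j a b
    proof (rule wall[OF w(1,2,3) x(1) y(1)])
      fix l assume l: "a \<le> l" "l \<le> b"
      then have "l < La" "j \<noteq> 0 \<or> l \<noteq> r" using w by auto
      then show "W j l \<notin> {x, y}" using xW[OF w(1), of l] yW[OF w(1), of l] by auto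
    qed
    let ?a = "W 0 (r - 1)" and ?b = "W 0 (r + 1)"
    have ab: "?a \<noteq> ?b" "?a \<noteq> y" "?b \<noteq> y" using yW[of 0 "r - 1"] yW[of 0 "r + 1"] injW[of 0 "r - 1" 0 "r + 1"] r by auto
    have t: "thick ?a y" "thick y ?b" using thW[of 0 "r - 1"] thW[of 0 r] r by (auto simp: y_def)
    have hy: "y \<notin> {u, v}" using hub[of 0 r] r by (auto simp: y_def)
    have 1: "\<not> sep x ?b ?a y"
      using x xy y r hub[of 0 "r - 1"] hy ab xW[of 0 "r - 1"] by (intro not_sep_thick t lay Im) auto
    have 2: "\<not> sep x ?a y ?b"
      using x xy y r hub[of 0 "r + 1"] hy ab xW[of 0 "r + 1"] by (intro not_sep_thick t lay Im) auto
    have "sep x y ?b ?a"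
      using ab 1 2 x y by (intro quad) (auto simp: sep_def)
    moreover have "\<not> sep x y ?b (W 0 (La - 1))"
      using r by (intro wallx) auto
    moreover have "\<not> sep x y (W 0 0) ?a"
      using r by (intro wallx) auto
    moreover have "\<not> sep x y (W n (La - 1)) (W 0 0)"
      using x y r xW[of n "La - 1"] xW[of 0 0] yW[of n "La - 1"] yW[of 0 0] hub[of n "La - 1"] hub[of 0 0] n La0
      by (intro not_sep_thick wrap lay Im) auto
    moreover have "\<not> sep x y (W 0 (La - 1)) (W j (La - 1))" if "j \<le> n" for j
      using that
    proof (induction j)
      case (Suc j)
      have "\<not> sep x y (W j (La - 1)) (W (Suc j) 0)" using no Suc by auto
      moreover have "\<not> sep x y (W (Suc j) 0) (W (Suc j) (La - 1))"
        using Suc La0 by (intro wallx) auto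
      ultimately show ?case using Suc by (auto simp: sep_def)
    qed (simp add: sep_def)
    then have "\<not> sep x y (W 0 (La - 1)) (W n (La - 1))" by blast
    ultimately show False unfolding sep_def by argo
  qed
  have member: "\<exists>k<La. W j k \<in> L" if "j \<le> n" for j
  proof (rule ccontr)
    assume "\<not> ?thesis"
    then have "W j ` {..<La} \<subseteq> {x. lay x} - L" using layW that by auto
    then have "card (W j ` {..<La}) \<le> 5"
      using card_mono[of "{x. lay x} - L" "W j ` {..<La}"] finite_lay L(2) by auto
    moreover have "inj_on (W j) {..<La}" using injW that by (auto simp: inj_on_def)
    ultimately show False using La0 by (simp add: card_image)
  qed
  \<comment> \<open>Layers of one item lie in the same gaps: two wall layers cannot separate them,
    and \<open>sep_swap\<close> turns this round. The ends of the walls may be exceptional, so the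
    argument goes through good layers \<open>l\<close> and \<open>l'\<close> of the two
    walls.\<close>
  have uniform: "sep x y (W j (La - 1)) (W (Suc j) 0) \<longleftrightarrow> sep x' y (W j (La - 1)) (W (Suc j) 0)"
    if j: "j < n" and i: "i < m" and k: "k < s i" "k' < s i" "x = It i k" "x' = It i k'" "k \<le> k'" and x: "x \<in> L" "x' \<in> L"
    for x x' i j k k'
  proof -
    obtain l l' where l: "l < La" "W j l \<in> L" "l' < La" "W (Suc j) l' \<in> L"
      using member[of j] member[of "Suc j"] j by auto
    have IW: "It i a \<noteq> W b c" if "a < s i" "b \<le> n" "c < La" for a b c using WI[OF that(2,3) i that(1)] by auto
    have "\<not> sep (W j l) (W (Suc j) l') (It i k) (It i k')"
    proof (rule not_sep_chain)
      show "It i a \<notin> {u, v, W j l, W (Suc j) l'}" if "k \<le> a" "a \<le> k'" for a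
        using that k(2) layD[OF layI[OF i, of a]] IW[of a j l] IW[of a "Suc j" l'] l j by auto
    qed (use k i thI l lay Im in auto)
    then have "\<not> sep x x' (W j l) (W (Suc j) l')"
      using sep_swap[of x x' "W j l" "W (Suc j) l'"] x l IW k j by auto
    moreover have wallx: "\<not> sep x x' (W b a) (W b c)" if w: "b \<le> n" "a \<le> c" "c < La" for b a c
    proof (rule wall[OF w x])
      fix e assume "a \<le> e" "e \<le> c"
      then show "W b e \<notin> {x, x'}" using IW[OF k(1) w(1), of e] IW[OF k(2) w(1), of e] w(3) k(3,4) by auto
    qed
    have "\<not> sep x x' (W j l) (W j (La - 1))" "\<not> sep x x' (W (Suc j) 0) (W (Suc j) l')"
      using l j wallx[of j l "La - 1"] wallx[of "Suc j" 0 l'] by auto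
    ultimately have "\<not> sep x x' (W j (La - 1)) (W (Suc j) 0)" unfolding sep_def by argo
    then show ?thesis unfolding sep_def differ_def by argo
  qed
  \<comment> \<open>If one good layer of the item lies in gap \<open>j\<close>, then so do all its
    good layers, and each must be met by path \<open>j\<close> because otherwise \<open>walk\<close>
    would apply. An item without good layers may go anywhere and is put into bin 0.\<close>
  have bin: "\<exists>j<n. \<forall>k<s i. It i k \<in> L \<longrightarrow> It i k \<in> Q j" if i: "i < m" for i
  proof (cases "\<exists>k<s i. It i k \<in> L")
    case True
    then obtain k where k: "k < s i" "It i k \<in> L" by blast
    obtain j where j: "j < n" "sep (It i k) y (W j (La - 1)) (W (Suc j) 0)"
      using separated[OF k(2) i k(1)] by blast
    have "It i k' \<in> Q j" if k': "k' < s i" "It i k' \<in> L" for k'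
    proof (rule ccontr)
      assume "It i k' \<notin> Q j"
      then have "\<not> sep (It i k') y (W j (La - 1)) (W (Suc j) 0)"
        using k' y j La0 WI[of j "La - 1" i k'] WI[of "Suc j" 0 i k'] yW[of j "La - 1"] yW[of "Suc j" 0] i r
        by (intro walk) auto
      moreover have "sep (It i k) y (W j (La - 1)) (W (Suc j) 0) \<longleftrightarrow> sep (It i k') y (W j (La - 1)) (W (Suc j) 0)"
        using uniform[OF j(1) i k(1) k'(1) refl refl _ k(2) k'(2)]
          uniform[OF j(1) i k'(1) k(1) refl refl _ k'(2) k(2)] linear[of k k'] by blast
      ultimately show False using j(2) by blast
    qed
    then show ?thesis using j(1) by blast
  qed (use n in \<open>auto intro!: exI[of _ 0]\<close>)
  then obtain \<beta> where \<beta>: "\<And>i. i < m \<Longrightarrow> \<beta> i < n \<and> (\<forall>k<s i. It i k \<in> L \<longrightarrow> It i k \<in> Q (\<beta> i))" by metis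
  \<comment> \<open>Layers of items in bin \<open>j\<close> are met by its path, at most
    \<open>B j + 4\<close> of them, or among the five exceptions.\<close>
  have "(\<Sum>i | i < m \<and> \<beta> i = j. s i) \<le> B j + 9" if j: "j < n" for j
  proof -
    let ?I = "{i. i < m \<and> \<beta> i = j}"
    let ?S = "SIGMA i:?I. {..<s i}"
    have 1: "(\<Sum>i\<in>?I. s i) = card ?S" by (simp add: card_SigmaI)
    have "inj_on (\<lambda>(i, k). It i k) ?S"
    proof (rule inj_onI, clarify)
      fix i k i' k' assume "i < m" "k < s i" "i' < m" "k' < s i'" "It i k = It i' k'"
      then show "i = i' \<and> k = k'" by (rule injI)
    qed
    then have "card ?S = card ((\<lambda>(i, k). It i k) ` ?S)" by (rule card_image[symmetric])
    also have "\<dots> \<le> card (Q j \<union> ({x. lay x} - L))"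
    proof (rule card_mono)
      show "finite (Q j \<union> ({x. lay x} - L))" using finQ finite_lay by simp
      show "(\<lambda>(i, k). It i k) ` ?S \<subseteq> Q j \<union> ({x. lay x} - L)"
      proof
        fix z assume "z \<in> (\<lambda>(i, k). It i k) ` ?S"
        then obtain i k where "i < m" "\<beta> i = j" "k < s i" "z = It i k" by auto
        then show "z \<in> Q j \<union> ({x. lay x} - L)" using \<beta>[of i] layI[of i k] by blast
      qed
    qed
    also have "\<dots> \<le> card (Q j) + card ({x. lay x} - L)" by (rule card_Un_le)
    finally show ?thesis using 1 cQ[OF j] L(2) by linarith
  qed
  then show ?thesis using \<beta> by blast
qed

end

section \<open>From packings to drawings\<close>

text \<open>A tag followed by indices, so that a vertex can be coded as a number with four digits
  (\<open>vcode\<close>).\<close>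

type_synonym vert = "nat \<times> nat \<times> nat \<times> nat"

definition HubU :: vert where "HubU = (0, 0, 0, 0)"
definition HubV :: vert where "HubV = (1, 0, 0, 0)"
definition Lay :: "nat \<Rightarrow> nat \<Rightarrow> vert" where "Lay b k = (2, b, k, 0)"
definition Th :: "nat \<Rightarrow> nat \<Rightarrow> nat \<Rightarrow> vert" where "Th b k r = (3, b, k, r)"
definition Pt :: "nat \<Rightarrow> nat \<Rightarrow> vert" where "Pt j k = (4, j, k, 0)"

lemmas vert_defs = HubU_def HubV_def Lay_def Th_def Pt_def

text \<open>Blocks below \<open>m\<close> are the items, blocks \<open>m, \<dots>, m + n\<close> are walls of length \<open>La\<close>; the path \<open>Pt j\<close>
  spans bin \<open>j\<close>, which lies between walls \<open>m + j\<close> and \<open>m + j + 1\<close>. The vertices \<open>Th (m + n + 1) 0 r\<close>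
  join the last wall to the first one.\<close>

locale packing_graph =
  fixes n m La :: nat and B s :: "nat \<Rightarrow> nat"
begin

definition blen :: "nat \<Rightarrow> nat" where
  "blen b = (if b < m then s b else if b \<le> m + n then La else 0)"

definition gadj :: "vert \<Rightarrow> vert \<Rightarrow> bool" where
  "gadj x y \<longleftrightarrow>
     (\<exists>b k. k < blen b \<and> x = Lay b k \<and> (y = HubU \<or> y = HubV)) \<or>
     (\<exists>b k r. k + 1 < blen b \<and> r < 9 \<and> (x = Lay b k \<or> x = Lay b (k + 1)) \<and> y = Th b k r) \<or>
     (\<exists>r<9. (x = Lay m 0 \<or> x = Lay (m + n) (La - 1)) \<and> y = Th (m + n + 1) 0 r) \<or>
     (\<exists>j<n. \<exists>k<B j. x = Pt j k \<and> y = Pt j (k + 1)) \<or>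
     (\<exists>j<n. x = Lay (m + j) (La - 1) \<and> y = Pt j 0) \<or>
     (\<exists>j<n. x = Lay (m + j + 1) 0 \<and> y = Pt j (B j))"

definition gedges :: "vert set set" where
  "gedges = {{x, y} |x y. gadj x y}"

lemma gedges_iff: "{x, y} \<in> gedges \<longleftrightarrow> gadj x y \<or> gadj y x"
proof -
  have "{x, y} \<in> gedges \<longleftrightarrow> (\<exists>a b. {x, y} = {a, b} \<and> gadj a b)" unfolding gedges_def by blast
  then show ?thesis unfolding doubleton_eq_iff by blast
qed

lemma gadj_neq: "gadj x y \<Longrightarrow> x \<noteq> y"
  by (auto simp: gadj_def vert_defs)

end

text \<open>Excluding the ends from a crossing is what later yields that no vertex lies on an
  edge.\<close>

definition ok :: "complex \<Rightarrow> complex \<Rightarrow> complex \<Rightarrow> complex \<Rightarrow> bool" where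
  "ok a b c d \<longleftrightarrow> closed_segment a b \<inter> closed_segment c d = {} \<or>
     (inner (a - b) (c - d) = 0 \<and> a \<notin> closed_segment c d \<and> b \<notin> closed_segment c d \<and>
      c \<notin> closed_segment a b \<and> d \<notin> closed_segment a b)"

lemma ok_sym: "ok a b c d \<Longrightarrow> ok b a c d" "ok a b c d \<Longrightarrow> ok a b d c" "ok a b c d \<Longrightarrow> ok c d a b"
  by (auto simp: ok_def closed_segment_commute inner_commute inner_diff_left inner_diff_right algebra_simps)

text \<open>The two neighbours of \<open>c\<close> given by \<open>nbr\<close> are not adjacent, so
  one of them is outside any edge \<open>{a, b}\<close> that avoids \<open>c\<close>. The edge from
  \<open>c\<close> to it is disjoint from \<open>{a, b}\<close>, and \<open>ok\<close> keeps
  \<open>c\<close> off \<open>{a, b}\<close>.\<close>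

lemma racI:
  assumes inj: "inj_on g V"
    and ok: "\<And>a b c d. {a, b} \<in> E \<Longrightarrow> {c, d} \<in> E \<Longrightarrow> {a, b} \<inter> {c, d} = {} \<Longrightarrow> ok (g a) (g b) (g c) (g d)"
    and nbr: "\<And>c. c \<in> V \<Longrightarrow> \<exists>d d'. {c, d} \<in> E \<and> {c, d'} \<in> E \<and> d \<noteq> d' \<and> d \<noteq> c \<and> d' \<noteq> c \<and> {d, d'} \<notin> E"
  shows "rac V E g"
  unfolding rac_def
proof (intro conjI allI impI)
  show "inj_on g V" by (rule inj)
next
  fix a b c assume a: "{a, b} \<in> E \<and> c \<in> V - {a, b}"
  obtain d d' where d: "{c, d} \<in> E" "{c, d'} \<in> E" "d \<noteq> d'" "{d, d'} \<notin> E" using nbr a by blast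
  have "d \<notin> {a, b} \<or> d' \<notin> {a, b}" using d a by (auto simp: insert_commute)
  then obtain e where e: "{c, e} \<in> E" "e \<notin> {a, b}" using d by blast
  then have "ok (g c) (g e) (g a) (g b)" using a by (intro ok) auto
  then show "g c \<notin> closed_segment (g a) (g b)" unfolding ok_def by auto
next
  fix a b c d assume "{a, b} \<in> E \<and> {c, d} \<in> E \<and> {a, b} \<inter> {c, d} = {} \<and>
    closed_segment (g a) (g b) \<inter> closed_segment (g c) (g d) \<noteq> {}"
  then show "inner (g a - g b) (g c - g d) = 0" using ok[of a b c d] by (auto simp: ok_def)
qed

section \<open>Separating lines\<close>

definition functional :: "(complex \<Rightarrow> real) \<Rightarrow> bool" where
  "functional D \<longleftrightarrow> (\<exists>\<alpha> \<beta> \<gamma>. \<forall>z. D z = \<alpha> * Re z + \<beta> * Im z + \<gamma>)"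

lemma functional_segment:
  assumes "functional D" "z \<in> closed_segment a b"
  obtains t where "0 \<le> t" "t \<le> 1" "z = (1 - t) *\<^sub>R a + t *\<^sub>R b" "D z = (1 - t) * D a + t * D b"
proof -
  obtain t where t: "0 \<le> t" "t \<le> 1" "z = (1 - t) *\<^sub>R a + t *\<^sub>R b" using assms(2) by (auto simp: in_segment)
  moreover have "D z = (1 - t) * D a + t * D b"
    using assms(1) unfolding functional_def t(3) by (auto simp: algebra_simps)
  ultimately show thesis using that by blast
qed

text \<open>Only \<open>b\<close> and \<open>c\<close> may lie on the line \<open>D = 0\<close>, so
  a common point of the segments would be equal to both.\<close>

lemma separated_by:
  assumes D: "functional D" and a: "D a < 0" "D b \<le> 0" and c: "D c \<ge> 0" "D d > 0" and ne: "b \<noteq> c"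
  shows "ok a b c d"
proof -
  have False if z: "z \<in> closed_segment a b" "z \<in> closed_segment c d" for z
  proof -
    obtain t where t: "0 \<le> t" "t \<le> 1" "z = (1 - t) *\<^sub>R a + t *\<^sub>R b" "D z = (1 - t) * D a + t * D b"
      using functional_segment[OF D z(1)] by metis
    obtain t' where t': "0 \<le> t'" "t' \<le> 1" "z = (1 - t') *\<^sub>R c + t' *\<^sub>R d" "D z = (1 - t') * D c + t' * D d"
      using functional_segment[OF D z(2)] by metis
    have i: "(1 - t) * D a \<le> 0" "t * D b \<le> 0" "(1 - t') * D c \<ge> 0" "t' * D d \<ge> 0"
      using t t' a c by (auto simp: mult_nonneg_nonpos)
    then have "(1 - t) * D a = 0" "t' * D d = 0" using t(4) t'(4) by linarith+
    then have "t = 1" "t' = 0" using a c by auto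
    then show False using t t' ne by simp
  qed
  then show ?thesis unfolding ok_def by blast
qed

lemma separated_strict:
  assumes D: "functional D" and a: "D a = 0" "D b = 0" and c: "D c > 0 \<and> D d > 0 \<or> D c < 0 \<and> D d < 0"
  shows "ok a b c d"
proof -
  have False if z: "z \<in> closed_segment a b" "z \<in> closed_segment c d" for z
  proof -
    obtain t where "D z = (1 - t) * D a + t * D b" using functional_segment[OF D z(1)] by metis
    then have "D z = 0" using a by simp
    moreover obtain t' where t': "0 \<le> t'" "t' \<le> 1" "D z = (1 - t') * D c + t' * D d"
      using functional_segment[OF D z(2)] by metis
    ultimately have "(1 - t') * D c + t' * D d = 0" by simp
    from c show False
    proof
      assume p: "D c > 0 \<and> D d > 0"
      then have "(1 - t') * D c \<ge> 0" "t' * D d \<ge> 0" using t' by auto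
      then have "(1 - t') * D c = 0" "t' * D d = 0" using \<open>_ + _ = 0\<close> by linarith+
      then show False using p by auto
    next
      assume p: "D c < 0 \<and> D d < 0"
      then have "(1 - t') * D c \<le> 0" "t' * D d \<le> 0" using t' by (auto simp: mult_nonneg_nonpos)
      then have "(1 - t') * D c = 0" "t' * D d = 0" using \<open>_ + _ = 0\<close> by linarith+
      then show False using p by auto
    qed
  qed
  then show ?thesis unfolding ok_def by blast
qed

section \<open>Order of the layers given by a packing\<close>

locale packed = packing_graph +
  fixes \<beta> :: "nat \<Rightarrow> nat"
  assumes La2: "La \<ge> 2" and n1: "n \<ge> 1" and bin: "\<And>i. i < m \<Longrightarrow> \<beta> i < n"
    and fits: "\<And>j. j < n \<Longrightarrow> (\<Sum>i | i < m \<and> \<beta> i = j. s i) \<le> B j"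
begin

text \<open>Layers get consecutive positions: wall \<open>j\<close> begins at \<open>off j\<close>
  and is followed by the \<open>B j\<close> slots of bin \<open>j\<close>, some of which may stay
  empty.\<close>

definition off :: "nat \<Rightarrow> nat" where
  "off j = (\<Sum>i<j. La + B i)"

definition start :: "nat \<Rightarrow> nat" where
  "start i = off (\<beta> i) + La + (\<Sum>i' | i' < i \<and> \<beta> i' = \<beta> i. s i')"

definition pos :: "nat \<Rightarrow> nat \<Rightarrow> nat" where
  "pos b k = (if b < m then start b + k else off (b - m) + k)"

text \<open>\<open>Pt j k\<close> is drawn between the positions \<open>cell j k\<close> and
  \<open>cell j k + 1\<close>, so each inner edge of the path passes exactly one slot.\<close>

definition cell :: "nat \<Rightarrow> nat \<Rightarrow> nat" where
  "cell j k = off j + (La - 1) + k"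

definition total :: nat where
  "total = off n + La"

lemma off_Suc: "off (Suc j) = off j + La + B j"
  by (simp add: off_def)

lemma off_mono: "i \<le> j \<Longrightarrow> off i \<le> off j"
  unfolding off_def by (intro sum_mono2) auto

lemma off_less: "i < j \<Longrightarrow> off i + La + B i \<le> off j"
  using off_mono[of "Suc i" j] by (simp add: off_Suc)

lemma blen_cases:
  assumes "k < blen b"
  obtains (item) "b < m" "k < s b" | (wall) j where "b = m + j" "j \<le> n" "k < La"
proof (cases "b < m")
  case True
  then show thesis using assms item by (simp add: blen_def)
next
  case False
  then have "b = m + (b - m)" "b - m \<le> n" "k < La" using assms by (auto simp: blen_def split: if_splits)
  then show thesis using wall by blast
qed

lemma item_pos:
  assumes "i < m" "k < s i"
  shows "off (\<beta> i) + La \<le> start i + k" "start i + k < off (\<beta> i) + La + B (\<beta> i)"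
proof -
  have "(\<Sum>i' | i' < i \<and> \<beta> i' = \<beta> i. s i') + s i = (\<Sum>i'\<in>insert i {i'. i' < i \<and> \<beta> i' = \<beta> i}. s i')"
    by simp
  also have "\<dots> \<le> (\<Sum>i' | i' < m \<and> \<beta> i' = \<beta> i. s i')"
    using assms by (intro sum_mono2) auto
  also have "\<dots> \<le> B (\<beta> i)" using fits bin assms by simp
  finally show "start i + k < off (\<beta> i) + La + B (\<beta> i)" using assms by (simp add: start_def)
qed (simp add: start_def)

lemma start_less:
  assumes "i < i'" "\<beta> i = \<beta> i'"
  shows "start i + s i \<le> start i'"
proof -
  have "(\<Sum>l | l < i \<and> \<beta> l = \<beta> i. s l) + s i = (\<Sum>l\<in>insert i {l. l < i \<and> \<beta> l = \<beta> i}. s l)"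
    by simp
  also have "\<dots> \<le> (\<Sum>l | l < i' \<and> \<beta> l = \<beta> i'. s l)" using assms by (intro sum_mono2) auto
  finally show ?thesis using assms by (simp add: start_def)
qed

lemma pos_inj:
  assumes "k < blen b" "k' < blen b'" "pos b k = pos b' k'"
  shows "b = b' \<and> k = k'"
  using assms(1)
proof (cases rule: blen_cases)
  case item
  note I = item
  show ?thesis using assms(2)
  proof (cases rule: blen_cases)
    case item
    have e: "start b + k = start b' + k'" using assms(3) I item by (simp add: pos_def)
    have "\<beta> b = \<beta> b'"
      using item_pos[OF I] item_pos[OF item] off_less[of "\<beta> b" "\<beta> b'"] off_less[of "\<beta> b'" "\<beta> b"] e
      by (cases "\<beta> b" "\<beta> b'" rule: linorder_cases) auto
    then show ?thesis
      using start_less[of b b'] start_less[of b' b] e I item by (cases b b' rule: linorder_cases) auto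
  next
    case (wall j)
    then have e: "start b + k = off j + k'" using assms(3) I by (simp add: pos_def)
    show ?thesis
      using item_pos[OF I] off_less[of "\<beta> b" j] off_less[of j "\<beta> b"] e wall
      by (cases j "\<beta> b" rule: linorder_cases) auto
  qed
next
  case (wall j)
  note W = wall
  show ?thesis using assms(2)
  proof (cases rule: blen_cases)
    case item
    then have e: "start b' + k' = off j + k" using assms(3) W by (simp add: pos_def)
    show ?thesis
      using item_pos[OF item] off_less[of "\<beta> b'" j] off_less[of j "\<beta> b'"] e W
      by (cases j "\<beta> b'" rule: linorder_cases) auto
  next
    case (wall j')
    then have e: "off j + k = off j' + k'" using assms(3) W by (simp add: pos_def)
    then show ?thesis
      using off_less[of j j'] off_less[of j' j] W wall by (cases j j' rule: linorder_cases) auto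
  qed
qed

lemma pos_less:
  assumes "k < blen b"
  shows "pos b k < total"
  using assms
proof (cases rule: blen_cases)
  case item
  then show ?thesis using item_pos[OF item] off_less[OF bin[OF item(1)]] by (simp add: pos_def total_def)
next
  case (wall j)
  then show ?thesis using off_mono[of j n] by (simp add: pos_def total_def)
qed

lemma pos_Suc: "pos b (k + 1) = pos b k + 1"
  by (simp add: pos_def)

lemma pos_ends:
  "pos m 0 = 0" "pos (m + n) (La - 1) = total - 1" "total \<ge> 4"
  using off_less[of 0 n] n1 La2 by (auto simp: pos_def total_def off_def)

lemma pos_cell: "pos (m + j) (La - 1) = cell j 0" "pos (m + j + 1) 0 = cell j (B j) + 1"
  using La2 off_Suc[of j] by (auto simp: pos_def cell_def)

lemma cell_less: "j < n \<Longrightarrow> k \<le> B j \<Longrightarrow> cell j k + 1 < total"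
  using off_less[of j n] La2 by (simp add: cell_def total_def)

lemma cell_inj:
  assumes "k \<le> B j" "k' \<le> B j'" "cell j k = cell j' k'" shows "j = j' \<and> k = k'"
  using assms off_less[of j j'] off_less[of j' j] La2
  by (cases j j' rule: linorder_cases) (auto simp: cell_def)

text \<open>Doubled positions: layers are even, and the vertices between two consecutive positions
  get the odd number in between.\<close>

definition lev :: "vert \<Rightarrow> nat" where
  "lev x = (case x of (t, b, k, r) \<Rightarrow> if t = 2 then 2 * pos b k else if t = 3 then 2 * pos b k + 1 else 2 * cell b k + 1)"

lemma lev_simps: "lev (Lay b k) = 2 * pos b k" "lev (Th b k r) = 2 * pos b k + 1" "lev (Pt j k) = 2 * cell j k + 1"
  by (simp_all add: lev_def vert_defs)

definition path_edge :: "vert \<Rightarrow> vert \<Rightarrow> bool" where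
  "path_edge x y \<longleftrightarrow> (\<exists>j<n. (\<exists>k<B j. x = Pt j k \<and> y = Pt j (k + 1)) \<or>
     (x = Lay (m + j) (La - 1) \<and> y = Pt j 0) \<or> (x = Pt j (B j) \<and> y = Lay (m + j + 1) 0))"

text \<open>The intervals of levels covered by the edges of path \<open>j\<close>: from odd to the
  next odd level, except for the two end edges, which cover one step from or to a wall.\<close>

definition path_levels :: "nat \<Rightarrow> nat \<Rightarrow> nat \<Rightarrow> bool" where
  "path_levels j a b \<longleftrightarrow> 2 * cell j 0 \<le> a \<and> a < b \<and> b \<le> 2 * cell j (B j) + 2 \<and>
     (b = a + 1 \<or> b = a + 2 \<and> odd a) \<and> (even a \<longrightarrow> a = 2 * cell j 0) \<and> (even b \<longrightarrow> b = 2 * cell j (B j) + 2)"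

lemma path_edge_levels:
  assumes "path_edge x y"
  obtains j where "j < n" "path_levels j (lev x) (lev y)"
proof -
  obtain j where j: "j < n" "(\<exists>k<B j. x = Pt j k \<and> y = Pt j (k + 1)) \<or>
     (x = Lay (m + j) (La - 1) \<and> y = Pt j 0) \<or> (x = Pt j (B j) \<and> y = Lay (m + j + 1) 0)"
    using assms by (auto simp: path_edge_def)
  have c: "cell j k = cell j 0 + k" for k by (simp add: cell_def)
  from j(2) have "path_levels j (lev x) (lev y)"
  proof (elim disjE exE conjE)
    fix k assume "k < B j" "x = Pt j k" "y = Pt j (k + 1)"
    then show ?thesis using c[of k] c[of "k + 1"] c[of "B j"] by (simp add: lev_simps path_levels_def)
  next
    assume "x = Lay (m + j) (La - 1)" "y = Pt j 0"
    then show ?thesis using c[of "B j"] by (simp only: lev_simps path_levels_def pos_cell) simp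
  next
    assume "x = Pt j (B j)" "y = Lay (m + j + 1) 0"
    then show ?thesis using c[of "B j"] by (simp only: lev_simps path_levels_def pos_cell) simp
  qed
  then show thesis using that j(1) by blast
qed

lemma path_levels_less:
  assumes "path_levels j a b" "path_levels j a' b'" "a < a'"
  shows "b \<le> a'"
proof (rule ccontr)
  assume "\<not> b \<le> a'"
  then have "a' = a + 1" "odd a" using assms unfolding path_levels_def by auto
  then have "even a'" by simp
  then show False using assms unfolding path_levels_def by auto
qed

lemma path_levels_eq:
  assumes "path_levels j a b" "path_levels j a b'"
  shows "b = b'"
proof (rule ccontr)
  assume "b \<noteq> b'"
  then consider "b = a + 1" "b' = a + 2" "odd a" | "b = a + 2" "b' = a + 1" "odd a"
    using assms unfolding path_levels_def by auto
  then show False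
  proof cases
    case 1
    then have "even b" by simp
    then show False using assms 1 unfolding path_levels_def by auto
  next
    case 2
    then have "even b'" by simp
    then show False using assms 2 unfolding path_levels_def by auto
  qed
qed

lemma path_edge_order:
  assumes "path_edge x y" "path_edge x' y'"
  shows "lev y \<le> lev x' \<or> lev y' \<le> lev x \<or> (lev x = lev x' \<and> lev y = lev y')"
proof -
  obtain j where j: "j < n" "path_levels j (lev x) (lev y)" using path_edge_levels[OF assms(1)] by metis
  obtain j' where j': "j' < n" "path_levels j' (lev x') (lev y')" using path_edge_levels[OF assms(2)] by metis
  consider "j < j'" | "j' < j" | "j = j'" by linarith
  then show ?thesis
  proof cases
    case 1
    then have "cell j (B j) + 1 \<le> cell j' 0" using off_less[of j j'] La2 by (simp add: cell_def)
    then show ?thesis using j j' unfolding path_levels_def by linarith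
  next
    case 2
    then have "cell j' (B j') + 1 \<le> cell j 0" using off_less[of j' j] La2 by (simp add: cell_def)
    then show ?thesis using j j' unfolding path_levels_def by linarith
  next
    case 3
    then show ?thesis
      using path_levels_less[of j "lev x" "lev y" "lev x'" "lev y'"] path_levels_less[of j "lev x'" "lev y'" "lev x" "lev y"]
        path_levels_eq[of j "lev x" "lev y" "lev y'"] j j' by (cases "lev x" "lev x'" rule: linorder_cases) auto
  qed
qed

end

section \<open>Coordinates of the drawing\<close>

context packed
begin

text \<open>So small that slopes stay below 1 / 2 in absolute value and the abscissae
  \<open>xc\<close> stay within \<open>de / 4\<close> of 1 / 2.\<close>

definition de :: real where
  "de = 1 / (2 * (real total + 1)\<^sup>2)"

text \<open>The shift by 1 puts the first layer, and no other, below the real axis. The edges from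
  the first and the last wall to the vertices left of \<open>HubU\<close> on the axis then pass
  below and above everything else on that side.\<close>

definition slope :: "nat \<Rightarrow> real" where
  "slope l = (real l / 2 - 1) * de"

definition xc :: "nat \<Rightarrow> real" where
  "xc c = 1 / 2 - de / 2 * (\<Sum>i\<le>c. slope (2 * i))"

text \<open>The abscissae \<open>xc\<close> are chosen such that consecutive path points differ by a vector
  perpendicular to the spoke between them.\<close>

definition dr :: "vert \<Rightarrow> complex" where
  "dr x = (case x of (t, b, k, r) \<Rightarrow>
     if t = 0 then 0 else if t = 1 then 2
     else if t = 2 then Complex 1 (slope (2 * pos b k))
     else if t = 3 then
       (if b \<le> m + n then Complex (1 + (real r + 1) / 10) ((1 - (real r + 1) / 10) * slope (2 * pos b k + 1))
        else Complex (- 1 - real r) 0)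
     else Complex (xc (cell b k)) (slope (2 * cell b k + 1) / 2))"

lemma dr_simps:
  "dr HubU = 0" "dr HubV = 2" "dr (Lay b k) = Complex 1 (slope (2 * pos b k))"
  "b \<le> m + n \<Longrightarrow> dr (Th b k r) = Complex (1 + (real r + 1) / 10) ((1 - (real r + 1) / 10) * slope (2 * pos b k + 1))"
  "dr (Th (m + n + 1) k r) = Complex (- 1 - real r) 0"
  "dr (Pt j k) = Complex (xc (cell j k)) (slope (2 * cell j k + 1) / 2)"
  by (simp_all add: dr_def vert_defs)

lemma dr_wrap: "dr (Th (Suc (m + n)) k r) = Complex (- 1 - real r) 0"
  using dr_simps(5) by simp

lemma de: "de > 0" "(real total + 1)\<^sup>2 * de = 1 / 2" "de \<le> 1 / 2"
proof -
  have p: "(real total + 1)\<^sup>2 \<ge> 1" by simp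
  then show "de > 0" "(real total + 1)\<^sup>2 * de = 1 / 2" by (auto simp: de_def)
  show "de \<le> 1 / 2" unfolding de_def using p by (simp add: field_simps)
qed

lemma slope_less: "slope a < slope b \<longleftrightarrow> a < b"
  using de(1) by (simp add: slope_def mult_less_cancel_right)

lemma slope_inj: "slope a = slope b \<longleftrightarrow> a = b"
  using slope_less[of a b] slope_less[of b a] by (metis less_irrefl linorder_neqE_nat)

lemma slope_bound: "i \<le> total \<Longrightarrow> \<bar>slope (2 * i)\<bar> \<le> (real total + 1) * de"
  using de(1) unfolding slope_def abs_mult by (intro mult_mono) auto

lemma slope_half: "i \<le> total \<Longrightarrow> \<bar>slope (2 * i)\<bar> \<le> 1 / 2"
proof -
  assume "i \<le> total"
  then have "\<bar>slope (2 * i)\<bar> \<le> (real total + 1) * de" by (rule slope_bound)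
  also have "\<dots> \<le> (real total + 1)\<^sup>2 * de"
    using de(1) by (intro mult_right_mono) (auto simp: power2_eq_square)
  finally show ?thesis using de(2) by simp
qed

lemma xc_bound:
  assumes "c < total"
  shows "\<bar>xc c - 1 / 2\<bar> \<le> de / 4"
proof -
  have "\<bar>\<Sum>i\<le>c. slope (2 * i)\<bar> \<le> (\<Sum>i\<le>c. \<bar>slope (2 * i)\<bar>)" by (rule sum_abs)
  also have "\<dots> \<le> (\<Sum>i\<le>c. (real total + 1) * de)" using assms by (intro sum_mono slope_bound) auto
  also have "\<dots> = real (c + 1) * ((real total + 1) * de)" by simp
  also have "\<dots> \<le> (real total + 1) * ((real total + 1) * de)" using assms de(1) by (intro mult_right_mono) auto
  also have "\<dots> = 1 / 2" using de(2) by (simp add: power2_eq_square mult.assoc)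
  finally have "de / 2 * \<bar>\<Sum>i\<le>c. slope (2 * i)\<bar> \<le> de / 2 * (1 / 2)" using de(1) by (intro mult_left_mono) auto
  then show ?thesis using de(1) by (simp add: xc_def abs_mult)
qed

lemma xc_range: "c < total \<Longrightarrow> 1 / 4 < xc c \<and> xc c < 3 / 4"
  using xc_bound[of c] de by linarith

text \<open>At abscissa 1 / 2 the path point would be at vertical distance at least
  \<open>de / 4\<close> from each spoke line; the deviation of \<open>xc c\<close> from 1 / 2 moves
  the spoke by at most \<open>de / 8\<close>.\<close>

lemma xc_side:
  assumes "c < total" "j \<le> total"
  shows "j \<le> c \<Longrightarrow> slope (2 * j) * xc c < slope (2 * c + 1) / 2"
    "c < j \<Longrightarrow> slope (2 * c + 1) / 2 < slope (2 * j) * xc c"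
proof -
  have "\<bar>slope (2 * j) * (xc c - 1 / 2)\<bar> \<le> 1 / 2 * (de / 4)"
    unfolding abs_mult using slope_half[OF assms(2)] xc_bound[OF assms(1)] by (intro mult_mono) auto
  then have "slope (2 * j) * (xc c - 1 / 2) \<le> de / 8" "- (slope (2 * j) * (xc c - 1 / 2)) \<le> de / 8"
    unfolding abs_le_iff by simp_all
  then have b: "slope (2 * j) * xc c - slope (2 * j) / 2 \<le> de / 8" "slope (2 * j) / 2 - slope (2 * j) * xc c \<le> de / 8"
    by (simp_all add: right_diff_distrib)
  have d: "slope (2 * c + 1) - slope (2 * j) = (real c - real j + 1 / 2) * de"
    by (simp add: slope_def field_simps)
  show "slope (2 * j) * xc c < slope (2 * c + 1) / 2" if "j \<le> c"
  proof -
    have "1 / 2 * de \<le> (real c - real j + 1 / 2) * de" using that de(1) by (intro mult_right_mono) auto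
    then show ?thesis using b d de(1) by linarith
  qed
  show "slope (2 * c + 1) / 2 < slope (2 * j) * xc c" if "c < j"
  proof -
    have "(real c - real j + 1 / 2) * de \<le> (- 1 / 2) * de" using that de(1) by (intro mult_right_mono) auto
    then show ?thesis using b d de(1) by linarith
  qed
qed

text \<open>Not the half-planes of \<open>upper\<close>: here the line \<open>Re z = 1\<close> of
  the layers divides the drawing, "upper" being the side of \<open>HubU\<close> and "lower" that of
  \<open>HubV\<close>.\<close>

definition upper_vertex :: "vert \<Rightarrow> bool" where
  "upper_vertex x \<longleftrightarrow> (\<exists>b k. k < blen b \<and> x = Lay b k) \<or> (\<exists>j<n. \<exists>k\<le>B j. x = Pt j k)"

definition lower_vertex :: "vert \<Rightarrow> bool" where
  "lower_vertex x \<longleftrightarrow> (\<exists>b k. k < blen b \<and> x = Lay b k) \<or> (\<exists>b k r. k + 1 < blen b \<and> r < 9 \<and> x = Th b k r)"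

lemma vertexI:
  "k < blen b \<Longrightarrow> upper_vertex (Lay b k)" "j < n \<Longrightarrow> k \<le> B j \<Longrightarrow> upper_vertex (Pt j k)"
  "k < blen b \<Longrightarrow> lower_vertex (Lay b k)" "k + 1 < blen b \<Longrightarrow> r < 9 \<Longrightarrow> lower_vertex (Th b k r)"
  unfolding upper_vertex_def lower_vertex_def by blast+

lemma blen_le: "k < blen b \<Longrightarrow> b \<le> m + n"
  by (auto simp: blen_def split: if_splits)

text \<open>Vanishes on the line from \<open>HubU\<close> through position \<open>j\<close>, as
  \<open>DV l\<close> does on the line from \<open>HubV\<close> through level \<open>l\<close>.
  Their signs show that levels order the vertices by angle around either hub.\<close>

definition DU :: "nat \<Rightarrow> complex \<Rightarrow> real" where
  "DU j z = Im z - slope (2 * j) * Re z"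

definition DV :: "nat \<Rightarrow> complex \<Rightarrow> real" where
  "DV l z = Im z - slope l * (2 - Re z)"

lemma functional_DU: "functional (DU j)"
  unfolding functional_def DU_def by (intro exI[of _ "- slope (2 * j)"] exI[of _ 1] exI[of _ 0]) simp

lemma functional_DV: "functional (DV l)"
  unfolding functional_def DV_def
  by (intro exI[of _ "slope l"] exI[of _ 1] exI[of _ "- 2 * slope l"]) (simp add: algebra_simps)

lemma DU_sign:
  assumes "upper_vertex x" "j \<le> total"
  shows "lev x < 2 * j \<Longrightarrow> DU j (dr x) < 0" "lev x = 2 * j \<Longrightarrow> DU j (dr x) = 0" "lev x > 2 * j \<Longrightarrow> DU j (dr x) > 0"
proof -
  have "(lev x < 2 * j \<longrightarrow> DU j (dr x) < 0) \<and> (lev x = 2 * j \<longrightarrow> DU j (dr x) = 0) \<and> (lev x > 2 * j \<longrightarrow> DU j (dr x) > 0)"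
    using assms(1) unfolding upper_vertex_def
  proof (elim disjE exE conjE)
    fix b k assume "x = Lay b k"
    then show ?thesis using slope_less[of "2 * pos b k" "2 * j"] slope_less[of "2 * j" "2 * pos b k"]
      by (auto simp: DU_def dr_simps lev_simps)
  next
    fix i k assume i: "i < n" "k \<le> B i" "x = Pt i k"
    then have "cell i k < total" using cell_less by fastforce
    then show ?thesis using i xc_side[of "cell i k" j] assms(2)
      by (cases "j \<le> cell i k") (auto simp: DU_def dr_simps lev_simps)
  qed
  then show "lev x < 2 * j \<Longrightarrow> DU j (dr x) < 0" "lev x = 2 * j \<Longrightarrow> DU j (dr x) = 0" "lev x > 2 * j \<Longrightarrow> DU j (dr x) > 0"
    by auto
qed

lemma DV_sign:
  assumes "lower_vertex x"
  shows "lev x < l \<Longrightarrow> DV l (dr x) < 0" "lev x = l \<Longrightarrow> DV l (dr x) = 0" "lev x > l \<Longrightarrow> DV l (dr x) > 0"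
proof -
  have "\<exists>c>0. DV l (dr x) = c * (slope (lev x) - slope l)"
    using assms unfolding lower_vertex_def
  proof (elim disjE exE conjE)
    fix b k assume "x = Lay b k"
    then show ?thesis by (intro exI[of _ 1]) (simp add: DV_def dr_simps lev_simps)
  next
    fix b k r assume x: "k + 1 < blen b" "r < 9" "x = Th b k r"
    then have "b \<le> m + n" using blen_le by blast
    then show ?thesis using x
      by (intro exI[of _ "1 - (real r + 1) / 10"]) (auto simp: DV_def dr_simps lev_simps algebra_simps)
  qed
  then show "lev x < l \<Longrightarrow> DV l (dr x) < 0" "lev x = l \<Longrightarrow> DV l (dr x) = 0" "lev x > l \<Longrightarrow> DV l (dr x) > 0"
    using slope_less[of "lev x" l] slope_less[of l "lev x"] by (auto simp: mult_pos_neg)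
qed

lemma lev_inj: "upper_vertex x \<Longrightarrow> upper_vertex y \<Longrightarrow> lev x = lev y \<Longrightarrow> x = y"
  unfolding upper_vertex_def
proof (elim disjE exE conjE)
  fix b k b' k' assume "k < blen b" "x = Lay b k" "k' < blen b'" "y = Lay b' k'" "lev x = lev y"
  then show ?thesis using pos_inj[of k b k' b'] by (simp add: lev_simps)
next
  fix j k j' k' assume "k \<le> B j" "x = Pt j k" "k' \<le> B j'" "y = Pt j' k'" "lev x = lev y"
  then show ?thesis using cell_inj[of k j k' j'] by (simp add: lev_simps)
qed (simp add: lev_simps; presburger)+

lemma lev_bound: "upper_vertex x \<Longrightarrow> lev x + 1 \<le> 2 * total"
  unfolding upper_vertex_def
proof (elim disjE exE conjE)
  fix b k assume "k < blen b" "x = Lay b k"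
  then show ?thesis using pos_less[of k b] by (simp add: lev_simps)
next
  fix j k assume "j < n" "k \<le> B j" "x = Pt j k"
  then show ?thesis using cell_less[of j k] by (simp add: lev_simps)
qed

lemma wall_blen: "j \<le> n \<Longrightarrow> blen (m + j) = La"
  by (simp add: blen_def)

lemma path_edge_upper:
  assumes "path_edge x y" shows "upper_vertex x" "upper_vertex y" "lev x < lev y"
proof -
  obtain j where j: "j < n" "(\<exists>k<B j. x = Pt j k \<and> y = Pt j (k + 1)) \<or>
     (x = Lay (m + j) (La - 1) \<and> y = Pt j 0) \<or> (x = Pt j (B j) \<and> y = Lay (m + j + 1) 0)"
    using assms by (auto simp: path_edge_def)
  have w: "La - 1 < blen (m + j)" "0 < blen (m + j + 1)"
    using wall_blen[of j] wall_blen[of "j + 1"] j(1) La2 by auto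
  show "upper_vertex x" "upper_vertex y"
    using j w by (auto intro!: vertexI)
  obtain j' where "path_levels j' (lev x) (lev y)" using path_edge_levels[OF assms] by metis
  then show "lev x < lev y" by (simp add: path_levels_def)
qed

lemma ok_path_path:
  assumes p: "path_edge x y" "path_edge x' y'" and d: "{x, y} \<inter> {x', y'} = {}"
    and ne: "dr y \<noteq> dr x'" "dr y' \<noteq> dr x"
  shows "ok (dr x) (dr y) (dr x') (dr y')"
proof -
  have key: "ok (dr x) (dr y) (dr x') (dr y')"
    if p: "path_edge x y" "path_edge x' y'" and l: "lev y \<le> lev x'" and ne: "dr y \<noteq> dr x'" and yx: "y \<noteq> x'" for x y x' y'
  proof -
    note u = path_edge_upper[OF p(1)] path_edge_upper[OF p(2)]
    \<comment> \<open>Rounding up to an even level gives a spoke line that runs between the two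
      edges.\<close>
    define j where "j = (lev y + 1) div 2"
    have "lev y < lev x'" using l yx lev_inj[OF u(2,4)] by (cases "lev y = lev x'") auto
    then have j: "lev y \<le> 2 * j" "2 * j \<le> lev x'" unfolding j_def by presburger+
    then have jt: "j \<le> total" using lev_bound[OF u(4)] by linarith
    have "DU j (dr x) < 0" using j u by (intro DU_sign jt) auto
    moreover have "DU j (dr y) \<le> 0" using j DU_sign[OF u(2) jt] by (cases "lev y = 2 * j") auto
    moreover have "DU j (dr x') \<ge> 0" using j DU_sign[OF u(4) jt] by (cases "lev x' = 2 * j") auto
    moreover have "DU j (dr y') > 0" using j u by (intro DU_sign jt) auto
    ultimately show ?thesis using ne by (intro separated_by[OF functional_DU]) auto
  qed
  note u = path_edge_upper[OF p(1)] path_edge_upper[OF p(2)]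
  have "lev y \<le> lev x' \<or> lev y' \<le> lev x"
    using path_edge_order[OF p] lev_inj[OF u(1,4)] d by auto
  then show ?thesis
    using key[OF p _ ne(1)] key[OF p(2,1) _ ne(2)] ok_sym(3) d by blast
qed

lemma not_on_segment:
  assumes "functional D" "D a = 0" "D c > 0 \<and> D d > 0 \<or> D c < 0 \<and> D d < 0"
  shows "a \<notin> closed_segment c d"
  using separated_strict[OF assms(1,2,2,3)] by (auto simp: ok_def)

lemma functional_Re: "functional (\<lambda>z. Re z - c)"
  unfolding functional_def by (intro exI[of _ 1] exI[of _ 0] exI[of _ "- c"]) simp

lemma Re_dr:
  "j < n \<Longrightarrow> k \<le> B j \<Longrightarrow> 1 / 4 < Re (dr (Pt j k)) \<and> Re (dr (Pt j k)) < 3 / 4"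
  using xc_range[of "cell j k"] cell_less[of j k] by (simp add: dr_simps)

text \<open>A path edge can jump over the even level of a layer only if it is an inner edge, and
  then it is perpendicular to the spoke. Otherwise both its ends lie on one side of the spoke
  line.\<close>

lemma ok_spoke_path:
  assumes b: "k < blen b" and p: "path_edge x z" and d: "Lay b k \<notin> {x, z}"
  shows "ok (dr HubU) (dr (Lay b k)) (dr x) (dr z)"
proof -
  let ?y = "Lay b k" and ?p = "pos b k"
  note u = path_edge_upper[OF p]
  have uy: "upper_vertex ?y" using b by (auto simp: upper_vertex_def)
  have pt: "?p \<le> total" using pos_less[OF b] by simp
  have ne: "lev x \<noteq> 2 * ?p" "lev z \<noteq> 2 * ?p" using lev_inj[OF uy u(1)] lev_inj[OF uy u(2)] d by (auto simp: lev_simps)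
  have y0: "DU ?p (dr HubU) = 0" "DU ?p (dr ?y) = 0" by (auto simp: DU_def dr_simps)
  show ?thesis
  proof (cases "lev x < 2 * ?p \<and> 2 * ?p < lev z")
    case False
    then have "lev x < 2 * ?p \<and> lev z < 2 * ?p \<or> lev x > 2 * ?p \<and> lev z > 2 * ?p" using ne u(3) by linarith
    then show ?thesis
      using DU_sign[OF u(1) pt] DU_sign[OF u(2) pt] by (intro separated_strict[OF functional_DU y0]) auto
  next
    case True
    obtain j where "path_levels j (lev x) (lev z)" using path_edge_levels[OF p] by metis
    then have l: "lev z = lev x + 2" "odd (lev x)" using True unfolding path_levels_def by auto
    obtain j where j: "j < n" "(\<exists>k<B j. x = Pt j k \<and> z = Pt j (k + 1)) \<or>
       (x = Lay (m + j) (La - 1) \<and> z = Pt j 0) \<or> (x = Pt j (B j) \<and> z = Lay (m + j + 1) 0)"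
      using p by (auto simp: path_edge_def)
    moreover have "odd (lev z)" using l by simp
    ultimately obtain i where i: "i < B j" "x = Pt j i" "z = Pt j (i + 1)"
      using l(2) by (auto simp: lev_simps)
    let ?c = "cell j i"
    have c: "cell j (i + 1) = ?c + 1" by (simp add: cell_def)
    have pc: "?p = ?c + 1" using True l i by (simp add: lev_simps c)
    \<comment> \<open>With \<open>\<sigma>\<close> the slope of the crossed spoke, the path advances
      by \<open>de / 2\<close> times the vector (- \<open>\<sigma>\<close>, 1), while the spoke has
      direction (1, \<open>\<sigma>\<close>).\<close>
    have "xc (?c + 1) = xc ?c - de / 2 * slope (2 * (?c + 1))"
      by (simp add: xc_def algebra_simps)
    moreover have "slope (2 * (?c + 1) + 1) = slope (2 * ?c + 1) + de"
      by (simp add: slope_def field_simps)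
    ultimately have perp: "inner (dr HubU - dr ?y) (dr x - dr z) = 0"
      unfolding i c dr_simps pc by (simp add: inner_complex_def field_simps)
    have r: "1 / 4 < Re (dr x) \<and> Re (dr x) < 3 / 4" "1 / 4 < Re (dr z) \<and> Re (dr z) < 3 / 4"
      using Re_dr[OF j(1), of i] Re_dr[OF j(1), of "i + 1"] i by auto
    have seg0: "DU ?p w = 0" if "w \<in> closed_segment (dr HubU) (dr ?y)" for w
      using functional_segment[OF functional_DU that, of ?p] y0 by (metis add_0 mult_zero_right)
    have "dr x \<notin> closed_segment (dr HubU) (dr ?y)" "dr z \<notin> closed_segment (dr HubU) (dr ?y)"
      using seg0 DU_sign[OF u(1) pt] DU_sign[OF u(2) pt] True by force+
    moreover have "dr HubU \<notin> closed_segment (dr x) (dr z)"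
      using r by (intro not_on_segment[OF functional_Re[of 0]]) (auto simp: dr_simps)
    moreover have "dr ?y \<notin> closed_segment (dr x) (dr z)"
      using r by (intro not_on_segment[OF functional_Re[of 1]]) (auto simp: dr_simps)
    ultimately show ?thesis using perp by (auto simp: ok_def)
  qed
qed

definition thick_edge :: "vert \<Rightarrow> vert \<Rightarrow> bool" where
  "thick_edge x y \<longleftrightarrow> (\<exists>b k r. k + 1 < blen b \<and> r < 9 \<and>
     (x = Lay b k \<and> y = Th b k r \<or> x = Th b k r \<and> y = Lay b (k + 1)))"

lemma thick_edge_lower:
  assumes "thick_edge x y" shows "lower_vertex x" "lower_vertex y" "lev y = lev x + 1"
  using assms unfolding thick_edge_def by (auto simp: lev_simps pos_Suc[simplified] intro!: vertexI)

lemma ok_thick_thick: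
  assumes t: "thick_edge x y" "thick_edge x' y'" and d: "{x, y} \<inter> {x', y'} = {}"
    and ne: "dr y \<noteq> dr x'" "dr y' \<noteq> dr x"
  shows "ok (dr x) (dr y) (dr x') (dr y')"
proof -
  have key: "ok (dr x) (dr y) (dr x') (dr y')"
    if t: "thick_edge x y" "thick_edge x' y'" and l: "lev x < lev x'" and ne: "dr y \<noteq> dr x'" for x y x' y'
  proof -
    note u = thick_edge_lower[OF t(1)] thick_edge_lower[OF t(2)]
    have "DV (lev x') (dr x) < 0" using l u by (intro DV_sign) auto
    moreover have "DV (lev x') (dr y) \<le> 0" using l u DV_sign[OF u(2), of "lev x'"] by (cases "lev y = lev x'") auto
    moreover have "DV (lev x') (dr x') \<ge> 0" using DV_sign(2)[OF u(4)] by simp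
    moreover have "DV (lev x') (dr y') > 0" using u by (intro DV_sign) auto
    ultimately show ?thesis using ne by (intro separated_by[OF functional_DV]) auto
  qed
  \<comment> \<open>Edges starting at equal levels belong to the same consecutive pair of layers and
    to the same end of it, so they would share that layer.\<close>
  have "lev x \<noteq> lev x'"
  proof
    assume e: "lev x = lev x'"
    obtain b k r where b: "k + 1 < blen b" "x = Lay b k \<and> y = Th b k r \<or> x = Th b k r \<and> y = Lay b (k + 1)"
      using t(1) unfolding thick_edge_def by blast
    obtain b' k' r' where b': "k' + 1 < blen b'" "x' = Lay b' k' \<and> y' = Th b' k' r' \<or> x' = Th b' k' r' \<and> y' = Lay b' (k' + 1)"
      using t(2) unfolding thick_edge_def by blast
    have "pos b k = pos b' k'" using e b(2) b'(2) by (auto simp: lev_simps; presburger)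
    then have "b = b' \<and> k = k'" using pos_inj b(1) b'(1) by (metis add_lessD1)
    then show False using b(2) b'(2) d e by (auto simp: lev_simps)
  qed
  then show ?thesis using key[OF t _ ne(1)] key[OF t(2,1) _ ne(2)] ok_sym(3) by (meson linorder_neqE_nat)
qed

lemma ok_spoke_thick:
  assumes b: "k < blen b" and t: "thick_edge x z" and d: "Lay b k \<notin> {x, z}"
  shows "ok (dr HubV) (dr (Lay b k)) (dr x) (dr z)"
proof -
  let ?l = "2 * pos b k"
  note u = thick_edge_lower[OF t]
  have y0: "DV ?l (dr HubV) = 0" "DV ?l (dr (Lay b k)) = 0" by (auto simp: DV_def dr_simps)
  obtain b' k' r where t': "k' + 1 < blen b'" "x = Lay b' k' \<and> z = Th b' k' r \<or> x = Th b' k' r \<and> z = Lay b' (k' + 1)"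
    using t unfolding thick_edge_def by blast
  have "lev x \<noteq> ?l \<and> lev z \<noteq> ?l"
    using t'(2)
  proof
    assume a: "x = Lay b' k' \<and> z = Th b' k' r"
    then have "pos b' k' \<noteq> pos b k" using pos_inj[of k' b' k b] b t'(1) d by auto
    then show ?thesis using a by (auto simp: lev_simps; presburger)
  next
    assume a: "x = Th b' k' r \<and> z = Lay b' (k' + 1)"
    then have "pos b' (k' + 1) \<noteq> pos b k" using pos_inj[of "k' + 1" b' k b] b t'(1) d by auto
    then show ?thesis using a by (auto simp: lev_simps; presburger)
  qed
  then have "lev x < ?l \<and> lev z < ?l \<or> lev x > ?l \<and> lev z > ?l" using u(3) by linarith
  then show ?thesis
    using DV_sign[OF u(1)] DV_sign[OF u(2)] by (intro separated_strict[OF functional_DV y0]) auto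
qed


lemma wrap_levels: "0 < blen m" "La - 1 < blen (m + n)" "lev (Lay m 0) = 0" "lev (Lay (m + n) (La - 1)) = 2 * (total - 1)"
  using wall_blen[of 0] wall_blen[of n] La2 pos_ends by (auto simp: lev_simps)

lemma wrap_points:
  "dr (Lay m 0) = Complex 1 (- de)" "dr (Lay (m + n) (La - 1)) = Complex 1 (slope (2 * (total - 1)))"
  "slope (2 * (total - 1)) > 0"
  using pos_ends slope_less[of 2 "2 * (total - 1)"] by (auto simp: dr_simps slope_def)

text \<open>The real axis separates the edges: the first layer is below it, the last one above, and
  their other ends are distinct points on it.\<close>

lemma ok_wrap_wrap:
  assumes "r \<noteq> r'"
  shows "ok (dr (Lay m 0)) (dr (Th (m + n + 1) 0 r)) (dr (Lay (m + n) (La - 1))) (dr (Th (m + n + 1) 0 r'))"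
proof -
  have f: "functional Im" unfolding functional_def by (intro exI[of _ 0] exI[of _ 1]) simp
  have "ok (dr (Lay m 0)) (dr (Th (m + n + 1) 0 r)) (dr (Th (m + n + 1) 0 r')) (dr (Lay (m + n) (La - 1)))"
    unfolding wrap_points(1,2) dr_simps(5) using wrap_points(3) de(1) assms
    by (intro separated_by[OF f]) auto
  then show ?thesis by (rule ok_sym)
qed

text \<open>The expression vanishes on the line through \<open>Lay m 0\<close> and the point (- 1 -
  r, 0), the lower boundary of this side of the drawing. \<open>upper_vertex_high\<close> does the
  same for the last layer.\<close>

lemma upper_vertex_low:
  assumes "upper_vertex x" "x \<noteq> Lay m 0"
  shows "Im (dr x) + de * (Re (dr x) + 1 + real r) / (2 + real r) > 0"
  using assms(1) unfolding upper_vertex_def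
proof (elim disjE exE conjE)
  fix b k assume x: "k < blen b" "x = Lay b k"
  then have "pos b k \<noteq> 0" using pos_inj[of k b 0 m] wrap_levels(1) pos_ends(1) assms(2) by auto
  then have "slope (2 * pos b k) > slope 0" by (simp add: slope_less)
  moreover have "de * (1 + 1 + real r) / (2 + real r) = de" by simp
  ultimately show ?thesis unfolding x dr_simps by (simp add: slope_def)
next
  fix j k assume x: "j < n" "k \<le> B j" "x = Pt j k"
  have "slope (2 * cell j k + 1) \<ge> - de / 2" using de(1) by (simp add: slope_def field_simps)
  moreover have "de * (1 / 2) \<le> de * ((Re (dr x) + 1 + real r) / (2 + real r))"
    using Re_dr[OF x(1,2)] x de(1) by (intro mult_left_mono) (auto simp: field_simps)
  ultimately show ?thesis unfolding x dr_simps using de(1) by simp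
qed

lemma upper_vertex_high:
  assumes "upper_vertex x" "x \<noteq> Lay (m + n) (La - 1)"
  shows "slope (2 * (total - 1)) * (Re (dr x) + 1 + real r) / (2 + real r) - Im (dr x) > 0"
  using assms(1) unfolding upper_vertex_def
proof (elim disjE exE conjE)
  fix b k assume x: "k < blen b" "x = Lay b k"
  then have "pos b k \<noteq> total - 1"
    using pos_inj[of k b "La - 1" "m + n"] wrap_levels(2) pos_ends(2) assms(2) by auto
  then have "slope (2 * pos b k) < slope (2 * (total - 1))" using pos_less[OF x(1)] by (simp add: slope_less)
  moreover have "\<sigma> * (1 + 1 + real r) / (2 + real r) = \<sigma>" for \<sigma> by simp
  ultimately show ?thesis unfolding x dr_simps by simp
next
  fix j k assume x: "j < n" "k \<le> B j" "x = Pt j k"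
  have "slope (2 * cell j k + 1) < slope (2 * (total - 1))" using cell_less[OF x(1,2)] by (simp add: slope_less)
  moreover have "slope (2 * (total - 1)) * (1 / 2) \<le> slope (2 * (total - 1)) * ((Re (dr x) + 1 + real r) / (2 + real r))"
    using Re_dr[OF x(1,2)] x wrap_points(3) by (intro mult_left_mono) (auto simp: field_simps)
  ultimately show ?thesis unfolding x dr_simps by simp
qed

lemma ok_wrap_low:
  assumes "x = HubU \<or> upper_vertex x \<and> x \<noteq> Lay m 0" "y = HubU \<or> upper_vertex y \<and> y \<noteq> Lay m 0"
  shows "ok (dr (Lay m 0)) (dr (Th (m + n + 1) 0 r)) (dr x) (dr y)"
proof -
  let ?D = "\<lambda>z. Im z + de * (Re z + 1 + real r) / (2 + real r)"
  have f: "functional ?D"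
    unfolding functional_def
    by (intro exI[of _ "de / (2 + real r)"] exI[of _ 1] exI[of _ "de * (1 + real r) / (2 + real r)"])
       (simp add: add_divide_distrib algebra_simps)
  have p: "?D (dr x) > 0" if "x = HubU \<or> upper_vertex x \<and> x \<noteq> Lay m 0" for x
    using that upper_vertex_low[of x r] de(1) by (auto simp: dr_simps(1))
  show ?thesis
    using p[OF assms(1)] p[OF assms(2)] unfolding wrap_points(1) dr_simps(5)
    by (intro separated_strict[OF f]) auto
qed

lemma ok_wrap_high:
  assumes "x = HubU \<or> upper_vertex x \<and> x \<noteq> Lay (m + n) (La - 1)" "y = HubU \<or> upper_vertex y \<and> y \<noteq> Lay (m + n) (La - 1)"
  shows "ok (dr (Lay (m + n) (La - 1))) (dr (Th (m + n + 1) 0 r)) (dr x) (dr y)"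
proof -
  let ?s = "slope (2 * (total - 1))"
  let ?D = "\<lambda>z. ?s * (Re z + 1 + real r) / (2 + real r) - Im z"
  have f: "functional ?D"
    unfolding functional_def
    by (intro exI[of _ "?s / (2 + real r)"] exI[of _ "- 1"] exI[of _ "?s * (1 + real r) / (2 + real r)"])
       (simp add: add_divide_distrib algebra_simps)
  have p: "?D (dr x) > 0" if "x = HubU \<or> upper_vertex x \<and> x \<noteq> Lay (m + n) (La - 1)" for x
    using that upper_vertex_high[of x r] wrap_points(3) by (auto simp: dr_simps(1))
  show ?thesis
    using p[OF assms(1)] p[OF assms(2)] unfolding wrap_points(2) dr_simps(5)
    by (intro separated_strict[OF f]) auto
qed

section \<open>Case analysis over pairs of edges\<close>

definition spoke :: "vert \<Rightarrow> vert \<Rightarrow> vert \<Rightarrow> bool" where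
  "spoke h x y \<longleftrightarrow> x = h \<and> (\<exists>b k. k < blen b \<and> y = Lay b k)"

definition wrap_edge :: "vert \<Rightarrow> vert \<Rightarrow> vert \<Rightarrow> bool" where
  "wrap_edge l x y \<longleftrightarrow> x = l \<and> (\<exists>r<9. y = Th (m + n + 1) 0 r)"

definition upper_edge :: "vert \<Rightarrow> vert \<Rightarrow> bool" where
  "upper_edge x y \<longleftrightarrow> spoke HubU x y \<or> path_edge x y \<or> wrap_edge (Lay m 0) x y \<or> wrap_edge (Lay (m + n) (La - 1)) x y"

definition lower_edge :: "vert \<Rightarrow> vert \<Rightarrow> bool" where
  "lower_edge x y \<longleftrightarrow> spoke HubV x y \<or> thick_edge x y"

lemma gadj_edge:
  assumes "gadj x y"
  shows "upper_edge x y \<or> upper_edge y x \<or> lower_edge x y \<or> lower_edge y x"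
  using assms unfolding gadj_def
proof (elim disjE)
  assume "\<exists>b k r. k + 1 < blen b \<and> r < 9 \<and> (x = Lay b k \<or> x = Lay b (k + 1)) \<and> y = Th b k r"
  then have "thick_edge x y \<or> thick_edge y x" unfolding thick_edge_def by blast
  then show ?thesis by (auto simp: lower_edge_def)
next
  assume "\<exists>r<9. (x = Lay m 0 \<or> x = Lay (m + n) (La - 1)) \<and> y = Th (m + n + 1) 0 r"
  then show ?thesis unfolding upper_edge_def wrap_edge_def by blast
next
  assume "\<exists>b k. k < blen b \<and> x = Lay b k \<and> (y = HubU \<or> y = HubV)"
  then show ?thesis unfolding upper_edge_def lower_edge_def spoke_def by blast
next
  assume "\<exists>j<n. \<exists>k<B j. x = Pt j k \<and> y = Pt j (k + 1)"
  then show ?thesis unfolding upper_edge_def path_edge_def by blast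
next
  assume "\<exists>j<n. x = Lay (m + j) (La - 1) \<and> y = Pt j 0"
  then show ?thesis unfolding upper_edge_def path_edge_def by blast
next
  assume "\<exists>j<n. x = Lay (m + j + 1) 0 \<and> y = Pt j (B j)"
  then show ?thesis unfolding upper_edge_def path_edge_def by blast
qed

lemma upper_edge_Re:
  assumes "upper_edge x y"
  shows "Re (dr x) < 1 \<and> Re (dr y) \<le> 1 \<or> Re (dr y) < 1 \<and> Re (dr x) \<le> 1"
  using assms unfolding upper_edge_def
proof (elim disjE)
  assume "path_edge x y"
  then obtain j where j: "j < n" "(\<exists>k<B j. x = Pt j k \<and> y = Pt j (k + 1)) \<or>
     (x = Lay (m + j) (La - 1) \<and> y = Pt j 0) \<or> (x = Pt j (B j) \<and> y = Lay (m + j + 1) 0)"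
    by (auto simp: path_edge_def)
  have "Re (dr (Pt j k)) < 1" if "k \<le> B j" for k using Re_dr[OF j(1) that] by simp
  then show ?thesis using j(2) by (auto simp: dr_simps(3) less_imp_le)
qed (auto simp: spoke_def wrap_edge_def dr_simps dr_wrap)

lemma lower_edge_Re:
  assumes "lower_edge x y"
  shows "Re (dr x) > 1 \<and> Re (dr y) \<ge> 1 \<or> Re (dr y) > 1 \<and> Re (dr x) \<ge> 1"
  using assms blen_le unfolding lower_edge_def by (auto simp: spoke_def thick_edge_def dr_simps)

text \<open>The line \<open>Re z = 1\<close> separates the two edges, and each has at most one end
  on it.\<close>

lemma ok_upper_lower:
  assumes e: "upper_edge a b" "lower_edge c d" and ne: "{dr a, dr b} \<inter> {dr c, dr d} = {}"
  shows "ok (dr a) (dr b) (dr c) (dr d)"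
proof -
  have key: "ok a b c d" if "Re a < 1" "Re b \<le> 1" "Re d > 1" "Re c \<ge> 1" "b \<noteq> c" for a b d c
    using that by (intro separated_by[OF functional_Re[of 1]]) auto
  show ?thesis
    using upper_edge_Re[OF e(1)] lower_edge_Re[OF e(2)] ne key[of "dr a" "dr b" "dr d" "dr c"]
      ok_sym(2)[OF key[of "dr a" "dr b" "dr c" "dr d"]] ok_sym(1)[OF key[of "dr b" "dr a" "dr d" "dr c"]]
      ok_sym(1)[OF ok_sym(2)[OF key[of "dr b" "dr a" "dr c" "dr d"]]] by blast
qed

lemma ok_lower_lower:
  assumes "lower_edge a b" "lower_edge c d" "{a, b} \<inter> {c, d} = {}" "{dr a, dr b} \<inter> {dr c, dr d} = {}"
  shows "ok (dr a) (dr b) (dr c) (dr d)"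
proof -
  have st: "ok (dr x) (dr y) (dr z) (dr w)" if "spoke HubV x y" "thick_edge z w" "{x, y} \<inter> {z, w} = {}" for x y z w
    using that ok_spoke_thick[of _ _ z w] by (auto simp: spoke_def)
  show ?thesis
    using assms(1,2) unfolding lower_edge_def
  proof (elim disjE)
    assume "spoke HubV a b" "spoke HubV c d"
    then show ?thesis using assms(3) by (auto simp: spoke_def)
  next
    assume "spoke HubV a b" "thick_edge c d"
    then show ?thesis using st assms(3) by blast
  next
    assume "thick_edge a b" "spoke HubV c d"
    then show ?thesis using st[of c d a b] assms(3) ok_sym(3) by blast
  next
    assume t: "thick_edge a b" "thick_edge c d"
    have "dr b \<noteq> dr c" "dr d \<noteq> dr a" using assms(4) by auto
    then show ?thesis by (rule ok_thick_thick[OF t assms(3)])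
  qed
qed

lemma ok_upper_upper:
  assumes "upper_edge a b" "upper_edge c d" "{a, b} \<inter> {c, d} = {}" "{dr a, dr b} \<inter> {dr c, dr d} = {}"
  shows "ok (dr a) (dr b) (dr c) (dr d)"
proof -
  let ?f = "Lay m 0" and ?l = "Lay (m + n) (La - 1)"
  have sp: "ok (dr x) (dr y) (dr z) (dr w)" if "spoke HubU x y" "path_edge z w" "{x, y} \<inter> {z, w} = {}" for x y z w
    using that ok_spoke_path[of _ _ z w] by (auto simp: spoke_def)
  have wl: "ok (dr x) (dr y) (dr z) (dr w)"
    if e: "wrap_edge ?f x y" "spoke HubU z w \<or> path_edge z w" "{x, y} \<inter> {z, w} = {}" for x y z w
  proof -
    have x: "x = ?f" and "\<exists>r<9. y = Th (m + n + 1) 0 r" using e(1) by (auto simp: wrap_edge_def)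
    then obtain r where y: "y = Th (m + n + 1) 0 r" by blast
    have "z = HubU \<or> upper_vertex z" "upper_vertex w"
      using e(2) path_edge_upper[of z w] vertexI(1) unfolding spoke_def by blast+
    then show ?thesis unfolding x y using e(3) x by (intro ok_wrap_low) auto
  qed
  have wh: "ok (dr x) (dr y) (dr z) (dr w)"
    if e: "wrap_edge ?l x y" "spoke HubU z w \<or> path_edge z w" "{x, y} \<inter> {z, w} = {}" for x y z w
  proof -
    have x: "x = ?l" and "\<exists>r<9. y = Th (m + n + 1) 0 r" using e(1) by (auto simp: wrap_edge_def)
    then obtain r where y: "y = Th (m + n + 1) 0 r" by blast
    have "z = HubU \<or> upper_vertex z" "upper_vertex w"
      using e(2) path_edge_upper[of z w] vertexI(1) unfolding spoke_def by blast+
    then show ?thesis unfolding x y using e(3) x by (intro ok_wrap_high) auto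
  qed
  have ww: "ok (dr x) (dr y) (dr z) (dr w)"
    if e: "wrap_edge ?f x y" "wrap_edge ?l z w" "{x, y} \<inter> {z, w} = {}" for x y z w
  proof -
    obtain r r' where y: "x = ?f" "y = Th (m + n + 1) 0 r" "z = ?l" "w = Th (m + n + 1) 0 r'"
      using e(1,2) unfolding wrap_edge_def by blast
    then have "r \<noteq> r'" using e(3) by auto
    then show ?thesis unfolding y by (rule ok_wrap_wrap)
  qed
  have same: False if "wrap_edge x' x y" "wrap_edge x' z w" "{x, y} \<inter> {z, w} = {}" for x' x y z w
    using that by (auto simp: wrap_edge_def)
  have same': False if "spoke h x y" "spoke h z w" "{x, y} \<inter> {z, w} = {}" for h x y z w
    using that by (auto simp: spoke_def)
  have d': "{c, d} \<inter> {a, b} = {}" using assms(3) by blast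
  note d = assms(3)
  consider "spoke HubU a b" | "path_edge a b" | "wrap_edge ?f a b" | "wrap_edge ?l a b"
    using assms(1) unfolding upper_edge_def by blast
  then show ?thesis
  proof cases
    case 1
    then show ?thesis using assms(2) same'[OF _ _ d] sp[OF _ _ d] wl[OF _ _ d'] wh[OF _ _ d'] ok_sym(3)
      unfolding upper_edge_def by blast
  next
    case 2
    have "ok (dr a) (dr b) (dr c) (dr d)" if "path_edge c d" using ok_path_path[OF 2 that d] assms(4) by auto
    then show ?thesis using 2 assms(2) sp[OF _ _ d'] wl[OF _ _ d'] wh[OF _ _ d'] ok_sym(3)
      unfolding upper_edge_def by blast
  next
    case 3
    then show ?thesis using assms(2) wl[OF _ _ d] ww[OF _ _ d] same[OF _ _ d] unfolding upper_edge_def by blast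
  next
    case 4
    then show ?thesis using assms(2) wh[OF _ _ d] ww[OF _ _ d'] same[OF _ _ d] ok_sym(3) unfolding upper_edge_def by blast
  qed
qed

end

lemma (in rac_drawn) adjacent_edges_meet:
  assumes e: "{a, b} \<in> E" "{a, c} \<in> E" "b \<noteq> c"
    and p: "p \<in> closed_segment (g a) (g b)" "p \<in> closed_segment (g a) (g c)"
  shows "p = g a"
proof (rule ccontr)
  assume ne: "p \<noteq> g a"
  obtain s where s: "0 \<le> s" "p = g a + s *\<^sub>R (g b - g a)" using in_segmentE[OF p(1)] by metis
  obtain t where t: "0 \<le> t" "p = g a + t *\<^sub>R (g c - g a)" using in_segmentE[OF p(2)] by metis
  have pos: "s > 0" "t > 0" using s t ne by (auto simp: less_le)
  have "s *\<^sub>R (g b - g a) = t *\<^sub>R (g c - g a)" using s t by simp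
  then have "g c - g a = (s / t) *\<^sub>R (g b - g a)"
    using pos by (metis (no_types, lifting) divide_inverse_commute inverse_eq_divide mult.commute nonzero_divide_eq_eq
        order_less_irrefl scaleR_one scaleR_scaleR times_divide_eq_right)
  then show False using same_ray[OF e(1,2) _ divide_pos_pos[OF pos]] e(3) by blast
qed

context packed
begin

lemma gadjI:
  "k < blen b \<Longrightarrow> gadj (Lay b k) HubU" "k < blen b \<Longrightarrow> gadj (Lay b k) HubV"
  "k + 1 < blen b \<Longrightarrow> r < 9 \<Longrightarrow> gadj (Lay b k) (Th b k r)"
  "k + 1 < blen b \<Longrightarrow> r < 9 \<Longrightarrow> gadj (Lay b (k + 1)) (Th b k r)"
  "r < 9 \<Longrightarrow> gadj (Lay m 0) (Th (m + n + 1) 0 r)" "r < 9 \<Longrightarrow> gadj (Lay (m + n) (La - 1)) (Th (m + n + 1) 0 r)"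
  "j < n \<Longrightarrow> k < B j \<Longrightarrow> gadj (Pt j k) (Pt j (k + 1))"
  "j < n \<Longrightarrow> gadj (Lay (m + j) (La - 1)) (Pt j 0)" "j < n \<Longrightarrow> gadj (Lay (m + j + 1) 0) (Pt j (B j))"
  unfolding gadj_def by blast+

text \<open>The ranges of abscissae are disjoint for the different kinds of vertices, so injectivity
  needs checking only within one kind.\<close>

lemma gvert_cases:
  assumes "x \<in> \<Union> gedges"
  obtains (hubU) "x = HubU" "Re (dr x) = 0" | (hubV) "x = HubV" "Re (dr x) = 2" |
    (lay) b k where "k < blen b" "x = Lay b k" "Re (dr x) = 1" |
    (th) b k r where "k + 1 < blen b" "r < 9" "x = Th b k r" "1 < Re (dr x)" "Re (dr x) < 2" |
    (wrap) r where "r < 9" "x = Th (m + n + 1) 0 r" "Re (dr x) \<le> - 1" |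
    (pt) j k where "j < n" "k \<le> B j" "x = Pt j k" "1 / 4 < Re (dr x)" "Re (dr x) < 3 / 4"
proof -
  have w: "La - 1 < blen (m + n)" "0 < blen m" "\<And>j. j < n \<Longrightarrow> La - 1 < blen (m + j)" "\<And>j. j < n \<Longrightarrow> 0 < blen (m + j + 1)"
    using wall_blen[of n] wall_blen[of 0] wall_blen wall_blen[of "_ + 1"] La2 by (auto simp: add.assoc)
  define P where "P x \<longleftrightarrow> x = HubU \<or> x = HubV \<or> (\<exists>b k. k < blen b \<and> x = Lay b k) \<or>
    (\<exists>b k r. k + 1 < blen b \<and> r < 9 \<and> x = Th b k r) \<or>
    (\<exists>r<9. x = Th (m + n + 1) 0 r) \<or> (\<exists>j<n. \<exists>k\<le>B j. x = Pt j k)" for x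
  have PI: "P HubU" "P HubV" "\<And>b k. k < blen b \<Longrightarrow> P (Lay b k)" "\<And>b k r. k + 1 < blen b \<Longrightarrow> r < 9 \<Longrightarrow> P (Th b k r)"
    "\<And>r. r < 9 \<Longrightarrow> P (Th (m + n + 1) 0 r)" "\<And>j k. j < n \<Longrightarrow> k \<le> B j \<Longrightarrow> P (Pt j k)"
    unfolding P_def by blast+
  have "P x \<and> P y" if "gadj x y" for x y
    using that unfolding gadj_def
  proof (elim disjE exE conjE)
    fix b k r assume "k + 1 < blen b" "r < 9" "x = Lay b k" "y = Th b k r"
    then show ?thesis using PI(3)[of k b] PI(4)[of k b r] by simp
  qed (use w PI(1,2) in \<open>auto intro!: PI(3,4) PI(5)[simplified] PI(6) simp: less_imp_le Suc_leI\<close>)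
  moreover obtain y where "gadj x y \<or> gadj y x" using assms unfolding gedges_def by auto
  ultimately have "P x" by blast
  then show thesis
    unfolding P_def
  proof (elim disjE exE conjE)
    assume "x = HubU" then show thesis using hubU by (simp add: dr_simps)
  next
    assume "x = HubV" then show thesis using hubV by (simp add: dr_simps)
  next
    fix b k assume "k < blen b" "x = Lay b k" then show thesis using lay by (simp add: dr_simps)
  next
    fix b k r assume x: "k + 1 < blen b" "r < 9" "x = Th b k r"
    then show thesis using th[OF x] blen_le[OF x(1)] by (simp add: dr_simps)
  next
    fix r :: nat assume "r < 9" "x = Th (m + n + 1) 0 r" then show thesis using wrap by (simp add: dr_wrap)
  next
    fix j k assume "j < n" "k \<le> B j" "x = Pt j k" then show thesis using pt Re_dr by blast
  qed
qed

lemma dr_inj: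
  assumes "x \<in> \<Union> gedges" "y \<in> \<Union> gedges" "dr x = dr y"
  shows "x = y"
proof -
  have T: "Re (dr (Th b k r)) = 1 + (real r + 1) / 10 \<and> Im (dr (Th b k r)) = (1 - (real r + 1) / 10) * slope (2 * pos b k + 1)"
    if "k + 1 < blen b" for b k r using blen_le[OF that] by (simp add: dr_simps)
  have L: "Im (dr (Lay b k)) = slope (2 * pos b k)" for b k by (simp add: dr_simps)
  have I: "Im (dr (Pt j k)) = slope (2 * cell j k + 1) / 2" for j k by (simp add: dr_simps)
  have e: "Re (dr x) = Re (dr y)" "Im (dr x) = Im (dr y)" using assms(3) by auto
  show ?thesis using assms(1)
  proof (cases rule: gvert_cases)
    case hubU
    note X = hubU
    show ?thesis using assms(2) by (cases rule: gvert_cases) (use e(1) X in auto)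
  next
    case hubV
    note X = hubV
    show ?thesis using assms(2) by (cases rule: gvert_cases) (use e(1) X in auto)
  next
    case (lay b k)
    note X = lay
    show ?thesis using assms(2)
    proof (cases rule: gvert_cases)
      case (lay b' k')
      then have "pos b k = pos b' k'" using e(2) X L by (simp add: slope_inj)
      then show ?thesis using pos_inj X lay by metis
    qed (use e(1) X in auto)
  next
    case (th b k r)
    note X = th
    show ?thesis using assms(2)
    proof (cases rule: gvert_cases)
      case (th b' k' r')
      then have r: "r = r'" using e(1) X(1,3) T[of k b r] T[of k' b' r'] by simp
      then have "(1 - (real r + 1) / 10) * slope (2 * pos b k + 1) = (1 - (real r + 1) / 10) * slope (2 * pos b' k' + 1)"
        using e(2) X(3) th(3) conjunct2[OF T[OF X(1), of r]] conjunct2[OF T[OF th(1), of r']] by metis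
      moreover have "1 - (real r + 1) / 10 \<noteq> 0" using X(2) by simp
      ultimately have "pos b k = pos b' k'" by (simp add: slope_inj)
      then show ?thesis using pos_inj[of k b k' b'] X(1,3) th(1,3) r by auto
    qed (use e(1) X(4,5) in auto)
  next
    case (wrap r)
    note X = wrap
    show ?thesis using assms(2)
    proof (cases rule: gvert_cases)
      case (wrap r')
      then show ?thesis using e(1) X(2) by (simp add: dr_wrap)
    qed (use e(1) X(3) in auto)
  next
    case (pt j k)
    note X = pt
    show ?thesis using assms(2)
    proof (cases rule: gvert_cases)
      case (pt j' k')
      then have "cell j k = cell j' k'" using e(2) X(3) I by (simp add: slope_inj)
      then show ?thesis using cell_inj[of k j k' j'] X(2,3) pt(2,3) by auto
    qed (use e(1) X(4,5) in auto)
  qed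
qed

lemma gedges_ok:
  assumes e: "{a, b} \<in> gedges" "{c, d} \<in> gedges" and disj: "{a, b} \<inter> {c, d} = {}"
  shows "ok (dr a) (dr b) (dr c) (dr d)"
proof -
  have V: "a \<in> \<Union> gedges" "b \<in> \<Union> gedges" "c \<in> \<Union> gedges" "d \<in> \<Union> gedges" using e by blast+
  have key: "ok (dr a) (dr b) (dr c) (dr d)"
    if t: "upper_edge a b \<or> lower_edge a b" "upper_edge c d \<or> lower_edge c d" and disj: "{a, b} \<inter> {c, d} = {}"
     and V: "a \<in> \<Union> gedges" "b \<in> \<Union> gedges" "c \<in> \<Union> gedges" "d \<in> \<Union> gedges" for a b c d
  proof -
    have ne: "{dr a, dr b} \<inter> {dr c, dr d} = {}"
      using dr_inj[OF V(1,3)] dr_inj[OF V(1,4)] dr_inj[OF V(2,3)] dr_inj[OF V(2,4)] disj by auto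
    then have ne': "{dr c, dr d} \<inter> {dr a, dr b} = {}" by blast
    show ?thesis
      using t ok_upper_upper[OF _ _ disj ne] ok_lower_lower[OF _ _ disj ne] ok_upper_lower[OF _ _ ne]
        ok_sym(3)[OF ok_upper_lower[OF _ _ ne']] by blast
  qed
  have "upper_edge a b \<or> lower_edge a b \<or> upper_edge b a \<or> lower_edge b a"
    "upper_edge c d \<or> lower_edge c d \<or> upper_edge d c \<or> lower_edge d c"
    using e gadj_edge unfolding gedges_iff by blast+
  then consider "upper_edge a b \<or> lower_edge a b" "upper_edge c d \<or> lower_edge c d" |
    "upper_edge b a \<or> lower_edge b a" "upper_edge c d \<or> lower_edge c d" |
    "upper_edge a b \<or> lower_edge a b" "upper_edge d c \<or> lower_edge d c" |
    "upper_edge b a \<or> lower_edge b a" "upper_edge d c \<or> lower_edge d c" by blast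
  then show ?thesis
  proof cases
    case 1 then show ?thesis using key[of a b c d] disj V by blast
  next
    case 2 then show ?thesis using ok_sym(1)[OF key[of b a c d]] disj V by blast
  next
    case 3 then show ?thesis using ok_sym(2)[OF key[of a b d c]] disj V by blast
  next
    case 4 then show ?thesis using ok_sym(1)[OF ok_sym(2)[OF key[of b a d c]]] disj V by blast
  qed
qed

lemma gedges_nbr:
  assumes "c \<in> \<Union> gedges"
  shows "\<exists>d d'. {c, d} \<in> gedges \<and> {c, d'} \<in> gedges \<and> d \<noteq> d' \<and> d \<noteq> c \<and> d' \<noteq> c \<and> {d, d'} \<notin> gedges"
proof -
  have *: ?thesis if "gadj c d \<or> gadj d c" "gadj c d' \<or> gadj d' c" "d \<noteq> d'" "\<not> gadj d d'" "\<not> gadj d' d" for d d'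
    using that gadj_neq unfolding gedges_iff by blast
  have LL: "\<not> gadj (Lay b k) (Lay b' k')" for b k b' k' by (auto simp: gadj_def vert_defs)
  have bm: "1 < blen m" "0 < blen m" using wall_blen[of 0] La2 by auto
  show ?thesis using assms
  proof (cases rule: gvert_cases)
    case hubU
    show ?thesis
      by (rule *[of "Lay m 0" "Lay m 1"]) (use LL bm hubU gadjI(1,2) in \<open>auto simp: Lay_def\<close>)
  next
    case hubV
    show ?thesis
      by (rule *[of "Lay m 0" "Lay m 1"]) (use LL bm hubV gadjI(1,2) in \<open>auto simp: Lay_def\<close>)
  next
    case (lay b k)
    show ?thesis
    proof (rule *[of HubU HubV])
      show "gadj c HubU \<or> gadj HubU c" "gadj c HubV \<or> gadj HubV c" using lay gadjI by blast+
    qed (auto simp: gadj_def vert_defs)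
  next
    case (th b k r)
    show ?thesis
    proof (rule *[of "Lay b k" "Lay b (k + 1)"])
      show "gadj c (Lay b k) \<or> gadj (Lay b k) c" "gadj c (Lay b (k + 1)) \<or> gadj (Lay b (k + 1)) c"
        using th gadjI by blast+
    qed (use LL in \<open>auto simp: vert_defs\<close>)
  next
    case (wrap r)
    show ?thesis
    proof (rule *[of "Lay m 0" "Lay (m + n) (La - 1)"])
      show "gadj c (Lay m 0) \<or> gadj (Lay m 0) c" "gadj c (Lay (m + n) (La - 1)) \<or> gadj (Lay (m + n) (La - 1)) c"
        using wrap gadjI by blast+
    qed (use LL n1 in \<open>auto simp: vert_defs\<close>)
  next
    case (pt j k)
    define d where "d = (if k = 0 then Lay (m + j) (La - 1) else Pt j (k - 1))"
    define d' where "d' = (if k = B j then Lay (m + j + 1) 0 else Pt j (k + 1))"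
    show ?thesis
    proof (rule *[of d d'])
      show "gadj c d \<or> gadj d c"
      proof (cases "k = 0")
        case True
        then show ?thesis using pt gadjI(8)[of j] unfolding d_def by auto
      next
        case False
        then have "k - 1 < B j" "k = k - 1 + 1" using pt by auto
        then show ?thesis using pt False gadjI(7)[of j "k - 1"] unfolding d_def by auto
      qed
      show "gadj c d' \<or> gadj d' c"
      proof (cases "k = B j")
        case True
        then show ?thesis using pt gadjI(9)[of j] unfolding d'_def by auto
      next
        case False
        then have "k < B j" using pt by auto
        then show ?thesis using pt False gadjI(7)[of j k] unfolding d'_def by auto
      qed
      show "d \<noteq> d'" using La2 by (auto simp: d_def d'_def vert_defs)
      show "\<not> gadj d d'" "\<not> gadj d' d" using La2 pt(2) by (auto simp: d_def d'_def gadj_def vert_defs)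
    qed
  qed
qed

theorem packed_rac: "rac (\<Union> gedges) gedges dr"
proof (rule racI)
  show "inj_on dr (\<Union> gedges)" using dr_inj by (rule inj_onI)
qed (rule gedges_ok gedges_nbr; assumption)+

end

section \<open>Drawings in the plane and in the complex numbers\<close>

definition to_complex :: "real ^ 2 \<Rightarrow> complex" where
  "to_complex p = Complex (p $ 1) (p $ 2)"

definition to_plane :: "complex \<Rightarrow> real ^ 2" where
  "to_plane z = vector [Re z, Im z]"

lemma to_plane_inverse [simp]: "to_complex (to_plane z) = z" "to_plane (to_complex p) = p"
  by (simp_all add: to_complex_def to_plane_def vec_eq_iff forall_2)

lemma to_complex_eq [simp]: "to_complex p = to_complex q \<longleftrightarrow> p = q"
  by (metis to_plane_inverse(2))

lemma to_complex_diff: "to_complex (p - q) = to_complex p - to_complex q"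
  by (simp add: to_complex_def complex_eq_iff)

lemma inner_to_complex: "inner (to_complex p) (to_complex q) = inner p q"
  by (simp add: to_complex_def inner_complex_def inner_vec_def sum_2)

lemma segment_image:
  fixes f :: "'a::real_vector \<Rightarrow> 'b::real_vector"
  assumes "\<And>u a b. f ((1 - u) *\<^sub>R a + u *\<^sub>R b) = (1 - u) *\<^sub>R f a + u *\<^sub>R f b"
  shows "closed_segment (f a) (f b) = f ` closed_segment a b"
  unfolding closed_segment_def using assms[symmetric] by auto

lemma to_complex_segment: "closed_segment (to_complex a) (to_complex b) = to_complex ` closed_segment a b"
  by (rule segment_image) (simp add: to_complex_def complex_eq_iff)

lemma to_complex_mem: "to_complex p \<in> closed_segment (to_complex a) (to_complex b) \<longleftrightarrow> p \<in> closed_segment a b"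
  unfolding to_complex_segment by auto

lemma RAC_drawing_rac:
  assumes f: "RAC_drawing V E f" and G: "simple_graph V E"
  shows "rac V E (\<lambda>x. to_complex (f x))"
  unfolding rac_def
proof (intro conjI allI impI)
  show "inj_on (\<lambda>x. to_complex (f x)) V"
    using f by (simp add: RAC_drawing_def straight_line_drawing_def inj_on_def)
next
  fix a b c assume "{a, b} \<in> E \<and> c \<in> V - {a, b}"
  then show "to_complex (f c) \<notin> closed_segment (to_complex (f a)) (to_complex (f b))"
    unfolding to_complex_mem using f by (simp add: RAC_drawing_def straight_line_drawing_def)
next
  fix a b c d assume e: "{a, b} \<in> E \<and> {c, d} \<in> E \<and> {a, b} \<inter> {c, d} = {} \<and>
      closed_segment (to_complex (f a)) (to_complex (f b)) \<inter> closed_segment (to_complex (f c)) (to_complex (f d)) \<noteq> {}"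
  then obtain z where z: "z \<in> closed_segment (f a) (f b)" "z \<in> closed_segment (f c) (f d)"
    unfolding to_complex_segment by auto
  have V: "a \<in> V" "b \<in> V" "c \<in> V" "d \<in> V" using e G by (auto simp: simple_graph_def)
  have off: "f w \<notin> closed_segment (f x) (f y)" if "{x, y} \<in> E" "w \<in> V" "w \<noteq> x" "w \<noteq> y" for x y w
    using f that by (auto simp: RAC_drawing_def straight_line_drawing_def)
  \<comment> \<open>Ends of one edge do not lie on the other, so a common point of the closed
    segments is a crossing in the sense of open segments.\<close>
  have "z \<noteq> f a" "z \<noteq> f b" "z \<noteq> f c" "z \<noteq> f d"
    using off[of c d a] off[of c d b] off[of a b c] off[of a b d] e z V by auto
  then have "z \<in> open_segment (f a) (f b)" "z \<in> open_segment (f c) (f d)" using z by (auto simp: open_segment_def)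
  moreover have "{a, b} \<noteq> {c, d}" using e by auto
  ultimately have "orthogonal (f a - f b) (f c - f d)"
    using f e unfolding RAC_drawing_def by blast
  then show "inner (to_complex (f a) - to_complex (f b)) (to_complex (f c) - to_complex (f d)) = 0"
    by (simp add: orthogonal_def inner_to_complex flip: to_complex_diff)
qed

lemma (in rac_drawn) distinct_edges_meet:
  assumes e: "{a, b} \<in> E" "{c, d} \<in> E" "{a, b} \<noteq> {c, d}" "{a, b} \<inter> {c, d} \<noteq> {}"
  obtains x where "x \<in> {a, b}" "x \<in> {c, d}"
    "\<And>p. p \<in> closed_segment (g a) (g b) \<Longrightarrow> p \<in> closed_segment (g c) (g d) \<Longrightarrow> p = g x"
proof -
  have *: "\<exists>x. x \<in> {a, b} \<and> x \<in> {c, d} \<and>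
      (\<forall>p. p \<in> closed_segment (g a) (g b) \<longrightarrow> p \<in> closed_segment (g c) (g d) \<longrightarrow> p = g x)"
    if "{a, b} \<in> E" "{c, d} \<in> E" "{a, b} \<noteq> {c, d}" "a = c" for a b c d
    using adjacent_edges_meet[of a b d] that by auto
  consider "a = c" | "a = d" | "b = c" | "b = d" using e(4) by auto
  then have "\<exists>x. x \<in> {a, b} \<and> x \<in> {c, d} \<and>
      (\<forall>p. p \<in> closed_segment (g a) (g b) \<longrightarrow> p \<in> closed_segment (g c) (g d) \<longrightarrow> p = g x)"
  proof cases
    case 1 then show ?thesis using *[of a b c d] e by blast
  next
    case 2 then show ?thesis using *[of a b d c] e by (simp add: insert_commute closed_segment_commute)
  next
    case 3 then show ?thesis using *[of b a c d] e by (simp add: insert_commute closed_segment_commute)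
  next
    case 4 then show ?thesis using *[of b a d c] e by (simp add: insert_commute closed_segment_commute)
  qed
  then show thesis using that by blast
qed

lemma rac_RAC_drawing:
  assumes g: "rac V E g" and G: "simple_graph V E"
  shows "RAC_drawing V E (\<lambda>x. to_plane (g x))"
proof -
  interpret rac_drawn V E g using assms by unfold_locales
  let ?f = "\<lambda>x. to_plane (g x)"
  have mem: "p \<in> closed_segment (?f a) (?f b) \<longleftrightarrow> to_complex p \<in> closed_segment (g a) (g b)" for p a b
    using to_complex_mem[of p "?f a" "?f b"] by simp
  have tp: "to_complex p = g z \<longleftrightarrow> p = ?f z" for p z by (metis to_plane_inverse)
  show ?thesis
    unfolding RAC_drawing_def straight_line_drawing_def
  proof (intro conjI allI impI)
    show "inj_on ?f V" using g_inj by (auto simp: inj_on_def) (metis to_plane_inverse(1))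
  next
    fix u v w assume "{u, v} \<in> E \<and> w \<in> V - {u, v}"
    then show "?f w \<notin> closed_segment (?f u) (?f v)" unfolding mem using not_on_edge[of u v w] by simp
  next
    fix u v x y assume e: "{u, v} \<in> E \<and> {x, y} \<in> E \<and> {u, v} \<noteq> {x, y}"
    show "\<not> (\<exists>a b. a \<noteq> b \<and> closed_segment a b \<subseteq> closed_segment (?f u) (?f v) \<inter> closed_segment (?f x) (?f y))"
    proof
      assume "\<exists>a b. a \<noteq> b \<and> closed_segment a b \<subseteq> closed_segment (?f u) (?f v) \<inter> closed_segment (?f x) (?f y)"
      then obtain a b where ab: "a \<noteq> b" "closed_segment a b \<subseteq> closed_segment (?f u) (?f v) \<inter> closed_segment (?f x) (?f y)"
        by blast
      let ?a = "to_complex a" and ?b = "to_complex b"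
      have p: "?a \<in> closed_segment (g u) (g v)" "?a \<in> closed_segment (g x) (g y)"
        "?b \<in> closed_segment (g u) (g v)" "?b \<in> closed_segment (g x) (g y)"
        using ab(2) ends_in_segment[of a b] mem by blast+
      have ne: "?a \<noteq> ?b" using ab(1) by simp
      show False
      proof (cases "{u, v} \<inter> {x, y} = {}")
        case True
        then have i: "inner (g u - g v) (g x - g y) = 0" using meets_perp[of u v x y] e p by blast
        obtain s s' where s: "?a = g u + s *\<^sub>R (g v - g u)" "?b = g u + s' *\<^sub>R (g v - g u)"
          using in_segmentE[OF p(1)] in_segmentE[OF p(3)] by metis
        obtain t t' where t: "?a = g x + t *\<^sub>R (g y - g x)" "?b = g x + t' *\<^sub>R (g y - g x)"
          using in_segmentE[OF p(2)] in_segmentE[OF p(4)] by metis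
        \<comment> \<open>The difference of two common points is parallel to both of two
          perpendicular edges, hence orthogonal to itself.\<close>
        have "?a - ?b = (s' - s) *\<^sub>R (g u - g v)" unfolding s by (simp add: algebra_simps)
        moreover have "?a - ?b = (t' - t) *\<^sub>R (g x - g y)" unfolding t by (simp add: algebra_simps)
        ultimately have "inner (?a - ?b) (?a - ?b) = (s' - s) * ((t' - t) * inner (g u - g v) (g x - g y))"
          by (metis inner_scaleR_left inner_scaleR_right)
        then show False using i ne by simp
      next
        case False
        then obtain z where "\<And>p. p \<in> closed_segment (g u) (g v) \<Longrightarrow> p \<in> closed_segment (g x) (g y) \<Longrightarrow> p = g z"
          using distinct_edges_meet[of u v x y] e by blast
        then show False using p ne by metis
      qed
    qed
  next
    fix u v x y
    assume e: "{u, v} \<in> E \<and> {x, y} \<in> E \<and> {u, v} \<noteq> {x, y} \<and> open_segment (?f u) (?f v) \<inter> open_segment (?f x) (?f y) \<noteq> {}"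
    then obtain p where p: "p \<in> open_segment (?f u) (?f v)" "p \<in> open_segment (?f x) (?f y)" by blast
    then have q: "to_complex p \<in> closed_segment (g u) (g v)" "to_complex p \<in> closed_segment (g x) (g y)"
      "to_complex p \<noteq> g u" "to_complex p \<noteq> g v"
      using tp by (auto simp: open_segment_def mem)
    show "orthogonal (?f u - ?f v) (?f x - ?f y)"
    proof (cases "{u, v} \<inter> {x, y} = {}")
      case True
      then have "inner (g u - g v) (g x - g y) = 0" using meets_perp[of u v x y] e q by blast
      then show ?thesis
        unfolding orthogonal_def inner_to_complex[symmetric] to_complex_diff by simp
    next
      case False
      then obtain z where "z \<in> {u, v}" "\<And>p. p \<in> closed_segment (g u) (g v) \<Longrightarrow> p \<in> closed_segment (g x) (g y) \<Longrightarrow> p = g z"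
        using distinct_edges_meet[of u v x y] e by blast
      then show ?thesis using q by blast
    qed
  qed
qed

section \<open>Similarities, isolated vertices and relabelling\<close>

lemma rac_perp:
  assumes "rac V E g" "{a, b} \<in> E" "{c, d} \<in> E" "{a, b} \<inter> {c, d} = {}"
    "closed_segment (g a) (g b) \<inter> closed_segment (g c) (g d) \<noteq> {}"
  shows "inner (g a - g b) (g c - g d) = 0"
  using assms unfolding rac_def by blast

lemma rac_similarity:
  assumes "rac V E g" "q \<noteq> 0"
  shows "rac V E (\<lambda>x. (g x - p) * q)"
proof -
  let ?h = "\<lambda>z. (z - p) * q"
  have inj: "?h z = ?h w \<longleftrightarrow> z = w" for z w using assms(2) by simp
  then have hi: "inj ?h" by (auto intro!: injI)
  have seg: "closed_segment (?h a) (?h b) = ?h ` closed_segment a b" for a b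
    by (rule segment_image) (simp add: algebra_simps)
  have mem: "?h z \<in> closed_segment (?h a) (?h b) \<longleftrightarrow> z \<in> closed_segment a b" for z a b
    unfolding seg by (rule inj_image_mem_iff[OF hi])
  have meet: "closed_segment (?h a) (?h b) \<inter> closed_segment (?h c) (?h d) \<noteq> {} \<longleftrightarrow>
      closed_segment a b \<inter> closed_segment c d \<noteq> {}" for a b c d
    unfolding seg image_Int[OF hi, symmetric] by simp
  have inn: "inner (?h a - ?h b) (?h c - ?h d) = 0 \<longleftrightarrow> inner (a - b) (c - d) = 0" for a b c d
  proof -
    have "inner (z * q) (w * q) = (norm q)\<^sup>2 * inner z w" for z w
      unfolding cmod_power2 inner_complex_def by (simp add: algebra_simps power2_eq_square)
    moreover have "?h a - ?h b = (a - b) * q" "?h c - ?h d = (c - d) * q" by (simp_all add: algebra_simps)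
    ultimately show ?thesis using assms(2) by simp
  qed
  show ?thesis
    using assms(1) unfolding rac_def mem meet inn inj_on_def inj by blast
qed

text \<open>Not every number below the size of the coded graph is the code of a vertex with an edge.
  The remaining ones are placed on the real axis, to the right of the drawing.\<close>

lemma rac_extend:
  fixes V :: "nat set"
  assumes g: "rac V E g" and G: "simple_graph V E" and V: "V \<subseteq> V'"
  shows "\<exists>g'. rac V' E g'"
proof -
  have fin: "finite V" using G by (simp add: simple_graph_def)
  define R where "R = Max (insert 0 ((\<lambda>x. Re (g x)) ` V)) + 1"
  have R: "Re (g x) < R" if "x \<in> V" for x
  proof -
    have "Re (g x) \<le> Max (insert 0 ((\<lambda>x. Re (g x)) ` V))" using fin that by (intro Max_ge) auto
    then show ?thesis unfolding R_def by linarith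
  qed
  define g' where "g' x = (if x \<in> V then g x else of_real (R + real x))" for x
  have ev: "a \<in> V" "b \<in> V" if "{a, b} \<in> E" for a b using G that by (auto simp: simple_graph_def)
  have ge: "g' a = g a" "g' b = g b" if "{a, b} \<in> E" for a b using ev[OF that] by (simp_all add: g'_def)
  have i1: "inj_on g' V'"
  proof (rule inj_onI)
    fix x y assume "g' x = g' y"
    then show "x = y"
      using R[of x] R[of y] g by (auto simp: g'_def rac_def inj_on_def split: if_splits dest!: arg_cong[of _ _ Re])
  qed
  have i2: "g' c \<notin> closed_segment (g' a) (g' b)" if e: "{a, b} \<in> E" "c \<in> V' - {a, b}" for a b c
  proof (cases "c \<in> V")
    case True
    then show ?thesis using g e ge[OF e(1)] by (auto simp: rac_def g'_def)
  next
    case False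
    show ?thesis
    proof
      assume "g' c \<in> closed_segment (g' a) (g' b)"
      then obtain t where t: "0 \<le> t" "t \<le> 1" "g' c = (1 - t) *\<^sub>R g a + t *\<^sub>R g b"
        using ge[OF e(1)] by (auto simp: in_segment)
      then have "Re (g' c) = (1 - t) * Re (g a) + t * Re (g b)" by simp
      also have "\<dots> \<le> max (Re (g a)) (Re (g b))"
        using t convex_bound_le[of "Re (g a)" "max (Re (g a)) (Re (g b))" "Re (g b)" "1 - t" t] by simp
      also have "\<dots> < R" using R ev[OF e(1)] by simp
      finally show False using False by (simp add: g'_def)
    qed
  qed
  have i3: "inner (g' a - g' b) (g' c - g' d) = 0"
    if "{a, b} \<in> E" "{c, d} \<in> E" "{a, b} \<inter> {c, d} = {}" "closed_segment (g' a) (g' b) \<inter> closed_segment (g' c) (g' d) \<noteq> {}" for a b c d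
    using that rac_perp[OF g that(1-3)] unfolding ge[OF that(1)] ge[OF that(2)] by blast
  show ?thesis
    unfolding rac_def
    by (intro exI[of _ g'] conjI allI impI i1; elim conjE) (rule i2 i3; assumption)+
qed


lemma rac_relabel:
  assumes g: "rac V E g" and c: "inj_on c V" and G: "simple_graph V E"
  shows "rac (c ` V) ((`) c ` E) (\<lambda>y. g (the_inv_into V c y))"
proof -
  let ?i = "the_inv_into V c"
  have i: "?i (c x) = x" if "x \<in> V" for x using the_inv_into_f_f[OF c that] .
  have edge: "\<exists>x y. a = c x \<and> b = c y \<and> x \<in> V \<and> y \<in> V \<and> {x, y} \<in> E" if ab: "{a, b} \<in> (`) c ` E" for a b
  proof -
    obtain e where e: "e \<in> E" "{a, b} = c ` e" using ab by auto
    then have "e \<subseteq> V" "card e = 2" using G by (auto simp: simple_graph_def)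
    then obtain x y where xy: "e = {x, y}" "x \<in> V" "y \<in> V" by (auto simp: card_2_iff)
    then have "a = c x \<and> b = c y \<or> a = c y \<and> b = c x" using e by (simp add: doubleton_eq_iff)
    then show ?thesis
    proof (elim disjE)
      assume "a = c x \<and> b = c y"
      then show ?thesis using e(1) xy by (intro exI[of _ x] exI[of _ y]) simp
    next
      assume "a = c y \<and> b = c x"
      then show ?thesis using e(1) xy by (intro exI[of _ y] exI[of _ x]) (simp add: insert_commute)
    qed
  qed
  have off: "g w \<notin> closed_segment (g x) (g y)" if "{x, y} \<in> E" "w \<in> V" "w \<noteq> x" "w \<noteq> y" for x y w
    using g that by (auto simp: rac_def)
  show ?thesis
    unfolding rac_def
  proof (intro conjI allI impI)
    show "inj_on (\<lambda>y. g (?i y)) (c ` V)" using g i by (auto simp: rac_def inj_on_def)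
  next
    fix a b d assume e: "{a, b} \<in> (`) c ` E \<and> d \<in> c ` V - {a, b}"
    then obtain x y w where "a = c x" "b = c y" "d = c w" "x \<in> V" "y \<in> V" "w \<in> V" "{x, y} \<in> E"
      using edge[of a b] by auto
    then show "g (?i d) \<notin> closed_segment (g (?i a)) (g (?i b))" using off[of x y w] i e by auto
  next
    fix a b d e assume h: "{a, b} \<in> (`) c ` E \<and> {d, e} \<in> (`) c ` E \<and> {a, b} \<inter> {d, e} = {} \<and>
       closed_segment (g (?i a)) (g (?i b)) \<inter> closed_segment (g (?i d)) (g (?i e)) \<noteq> {}"
    obtain x y where x: "a = c x" "b = c y" "x \<in> V" "y \<in> V" "{x, y} \<in> E" using edge[of a b] h by auto
    obtain z w where z: "d = c z" "e = c w" "z \<in> V" "w \<in> V" "{z, w} \<in> E" using edge[of d e] h by auto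
    have "{x, y} \<inter> {z, w} = {}" using h x z by auto
    then show "inner (g (?i a) - g (?i b)) (g (?i d) - g (?i e)) = 0"
      using rac_perp[OF g x(5) z(5)] h x z i by simp
  qed
qed

lemma rac_pullback:
  assumes g: "rac V' ((`) c ` E) g" and c: "inj_on c V" "c ` V \<subseteq> V'" and G: "\<And>e. e \<in> E \<Longrightarrow> e \<subseteq> V"
  shows "rac V E (\<lambda>x. g (c x))"
proof -
  have ed: "{c x, c y} \<in> (`) c ` E" "x \<in> V" "y \<in> V" if "{x, y} \<in> E" for x y
    using that G[OF that] by (auto intro!: image_eqI[of _ _ "{x, y}"])
  have ci: "c x = c y \<longleftrightarrow> x = y" if "x \<in> V" "y \<in> V" for x y using c(1) that by (auto simp: inj_on_def)
  show ?thesis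
    unfolding rac_def
  proof (intro conjI allI impI)
    have "inj_on g V'" using g by (simp add: rac_def)
    then show "inj_on (\<lambda>x. g (c x)) V"
      using comp_inj_on[OF c(1) inj_on_subset[OF _ c(2)]] by (simp add: comp_def)
  next
    fix a b d assume e: "{a, b} \<in> E \<and> d \<in> V - {a, b}"
    then have "c d \<in> V' - {c a, c b}" using ed[of a b] ci c(2) by auto
    then show "g (c d) \<notin> closed_segment (g (c a)) (g (c b))" using g e ed[of a b] unfolding rac_def by blast
  next
    fix a b d e assume h: "{a, b} \<in> E \<and> {d, e} \<in> E \<and> {a, b} \<inter> {d, e} = {} \<and>
       closed_segment (g (c a)) (g (c b)) \<inter> closed_segment (g (c d)) (g (c e)) \<noteq> {}"
    then have "{c a, c b} \<inter> {c d, c e} = {}" using ed[of a b] ed[of d e] ci by auto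
    then show "inner (g (c a) - g (c b)) (g (c d) - g (c e)) = 0"
      using rac_perp[OF g ed(1)[of a b] ed(1)[of d e]] h by blast
  qed
qed

section \<open>Drawability of the graph and packings\<close>

lemma (in packing_graph) packing_from_rac:
  assumes g: "rac (\<Union> gedges) gedges g" and G: "simple_graph (\<Union> gedges) gedges"
    and n: "n \<ge> 1" and La: "La \<ge> 3 * ((\<Sum>j<n. B j + 4) + 6)"
  shows "\<exists>\<beta>. (\<forall>i<m. \<beta> i < n) \<and> (\<forall>j<n. (\<Sum>i | i < m \<and> \<beta> i = j. s i) \<le> B j + 9)"
proof -
  have La0: "La \<ge> 18" using order_trans[OF _ La, of 18] by simp
  have bl: "blen (m + j) = La" if "j \<le> n" for j using that by (simp add: blen_def)
  have bi: "blen i = s i" if "i < m" for i using that by (simp add: blen_def)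
  have thb: "gadj (Lay b k) (Th b k r) \<and> gadj (Lay b (Suc k)) (Th b k r)" if "Suc k < blen b" "r < 9" for b k r
    using that unfolding gadj_def Suc_eq_plus1 by blast
  have hub: "{Lay b k, HubU} \<in> gedges" "{Lay b k, HubV} \<in> gedges" if "k < blen b" for b k
    unfolding gedges_iff gadj_def using that by auto
  have V: "HubU \<in> \<Union> gedges" "HubV \<in> \<Union> gedges" using hub[of 0 m] bl[of 0] La0 by auto
  define q where "q = 1 / (g HubV - g HubU)"
  have "g HubV \<noteq> g HubU" using g V by (auto simp: rac_def inj_on_def HubU_def HubV_def)
  then have q: "q \<noteq> 0" "(g HubV - g HubU) * q = 1" by (auto simp: q_def)
  interpret hub_drawing "\<Union> gedges" gedges "\<lambda>x. (g x - g HubU) * q" HubU HubV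
    using rac_similarity[OF g q(1)] G V q(2) by unfold_locales auto
  have lay: "lay x \<longleftrightarrow> (\<exists>b k. k < blen b \<and> x = Lay b k)" for x
    unfolding lay_def gedges_iff by (auto simp: gadj_def vert_defs)
  have th: "thick (Lay b k) (Lay b' k')"
    if "\<And>r. r < 9 \<Longrightarrow> gadj (Lay b k) (Th a l r) \<and> gadj (Lay b' k') (Th a l r)" for b k b' k' a l
    unfolding thick_def
  proof (intro exI[of _ "Th a l ` {..<9}"] conjI ballI)
    show "card (Th a l ` {..<9}) = 9" by (subst card_image) (auto simp: inj_on_def Th_def)
    fix t assume "t \<in> Th a l ` {..<9}"
    then obtain r where r: "r < 9" "t = Th a l r" by auto
    then show "{Lay b k, t} \<in> gedges" "{Lay b' k', t} \<in> gedges" using that[of r] by (auto simp: gedges_iff)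
    show "t \<notin> {HubU, HubV}" using r by (auto simp: vert_defs)
    show "\<not> lay t" unfolding lay r by (auto simp: vert_defs)
  qed
  interpret frame "\<Union> gedges" gedges "\<lambda>x. (g x - g HubU) * q" HubU HubV n m La B s
      "\<lambda>j. Lay (m + j)" Lay Pt
  proof
    show "n \<ge> 1" by (rule n)
    have layI: "lay (Lay b k)" if "k < blen b" for b k unfolding lay using that by blast
    show "lay (Lay (m + j) k)" if "j \<le> n" "k < La" for j k using that bl layI by simp
    show "lay (Lay i k)" if "i < m" "k < s i" for i k using that bi layI by simp
    show "thick (Lay (m + j) k) (Lay (m + j) (Suc k))" if "j \<le> n" "Suc k < La" for j k
    proof (rule th[of _ _ "m + j" k])
      show "gadj (Lay (m + j) k) (Th (m + j) k r) \<and> gadj (Lay (m + j) (Suc k)) (Th (m + j) k r)" if "r < 9" for r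
        using that thb[of k "m + j" r] bl \<open>j \<le> n\<close> \<open>Suc k < La\<close> by simp
    qed
    show "thick (Lay i k) (Lay i (Suc k))" if "i < m" "Suc k < s i" for i k
    proof (rule th[of _ _ i k])
      show "gadj (Lay i k) (Th i k r) \<and> gadj (Lay i (Suc k)) (Th i k r)" if "r < 9" for r
        using that thb[of k i r] bi \<open>i < m\<close> \<open>Suc k < s i\<close> by simp
    qed
    show "thick (Lay (m + n) (La - 1)) (Lay (m + 0) 0)"
    proof (rule th[of _ _ "m + n + 1" 0])
      show "gadj (Lay (m + n) (La - 1)) (Th (m + n + 1) 0 r) \<and> gadj (Lay (m + 0) 0) (Th (m + n + 1) 0 r)" if "r < 9" for r
        using that unfolding gadj_def add_0_right by blast
    qed
    show "{Pt j k, Pt j (Suc k)} \<in> gedges" if "j < n" "k < B j" for j k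
      using that unfolding gedges_iff gadj_def Suc_eq_plus1 by blast
    show "{Lay (m + j) (La - 1), Pt j 0} \<in> gedges" if "j < n" for j
      using that unfolding gedges_iff gadj_def by blast
    show "{Pt j (B j), Lay (m + Suc j) 0} \<in> gedges" if "j < n" for j
      using that unfolding gedges_iff gadj_def Suc_eq_plus1 add.assoc[symmetric] by blast
    show "La \<ge> 3 * ((\<Sum>j<n. B j + 4) + 6)" by (rule La)
    show "Pt j k \<notin> {HubU, HubV} \<and> \<not> lay (Pt j k)" for j k
      unfolding lay by (auto simp: vert_defs)
  qed (auto simp: Lay_def)
  show ?thesis by (rule packing)
qed

theorem (in packing_graph) admits_RAC_packing:
  fixes c :: "vert \<Rightarrow> nat"
  assumes n: "n \<ge> 1" and La: "La \<ge> 3 * ((\<Sum>j<n. B j + 4) + 6)"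
    and c: "inj_on c (\<Union> gedges)" "c ` \<Union> gedges \<subseteq> {..<N}"
  shows "simple_graph {..<N} ((`) c ` gedges)"
    and "\<forall>i<m. \<beta> i < n \<Longrightarrow> \<forall>j<n. (\<Sum>i | i < m \<and> \<beta> i = j. s i) \<le> B j \<Longrightarrow> admits_RAC_drawing {..<N} ((`) c ` gedges)"
    and "admits_RAC_drawing {..<N} ((`) c ` gedges) \<Longrightarrow>
      \<exists>\<beta>. (\<forall>i<m. \<beta> i < n) \<and> (\<forall>j<n. (\<Sum>i | i < m \<and> \<beta> i = j. s i) \<le> B j + 9)"
proof -
  have fin: "finite (\<Union> gedges)" by (rule inj_on_finite[OF c]) (rule finite_lessThan)
  have card2: "card e = 2" if e: "e \<in> gedges" for e
  proof -
    obtain x y where "e = {x, y}" "gadj x y" using e unfolding gedges_def by blast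
    then show ?thesis using gadj_neq[of x y] by simp
  qed
  have G: "simple_graph (\<Union> gedges) gedges"
    using fin card2 by (auto simp: simple_graph_def)
  have "card (c ` e) = 2" if "e \<in> gedges" for e
    using card2[OF that] card_image[OF inj_on_subset[OF c(1) Union_upper[OF that]]] by simp
  then show G': "simple_graph {..<N} ((`) c ` gedges)"
    using c(2) by (auto simp: simple_graph_def)
  have G'': "simple_graph (c ` \<Union> gedges) ((`) c ` gedges)"
    using G' fin by (auto simp: simple_graph_def)
  show "admits_RAC_drawing {..<N} ((`) c ` gedges)"
    if fit: "\<forall>i<m. \<beta> i < n" "\<forall>j<n. (\<Sum>i | i < m \<and> \<beta> i = j. s i) \<le> B j"
  proof -
    interpret packed n m La B s \<beta>
      by unfold_locales (use fit n order_trans[OF _ La, of 2] in auto)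
    have "rac (c ` \<Union> gedges) ((`) c ` gedges) (\<lambda>y. dr (the_inv_into (\<Union> gedges) c y))"
      by (rule rac_relabel[OF packed_rac c(1) G])
    then obtain g where "rac {..<N} ((`) c ` gedges) g" using rac_extend[OF _ G'' c(2)] by blast
    then show ?thesis unfolding admits_RAC_drawing_def using rac_RAC_drawing[OF _ G'] by blast
  qed
  show "\<exists>\<beta>. (\<forall>i<m. \<beta> i < n) \<and> (\<forall>j<n. (\<Sum>i | i < m \<and> \<beta> i = j. s i) \<le> B j + 9)"
    if adm: "admits_RAC_drawing {..<N} ((`) c ` gedges)"
  proof -
    obtain f where "RAC_drawing {..<N} ((`) c ` gedges) f" using adm by (auto simp: admits_RAC_drawing_def)
    then have "rac {..<N} ((`) c ` gedges) (\<lambda>x. to_complex (f x))" by (rule RAC_drawing_rac[OF _ G'])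
    then have "rac (\<Union> gedges) gedges (\<lambda>x. to_complex (f (c x)))"
      by (rule rac_pullback[OF _ c]) auto
    then show ?thesis by (rule packing_from_rac[OF _ G n La])
  qed
qed

section \<open>Satisfiability as bin packing\<close>

definition literal :: "(nat \<Rightarrow> bool) \<Rightarrow> nat \<Rightarrow> bool" where
  "literal \<alpha> l \<longleftrightarrow> (if even l then \<alpha> (l div 2) else \<not> \<alpha> (l div 2))"

text \<open>Literals \<open>2 x\<close> and \<open>2 x + 1\<close> are the variable \<open>x\<close> and its negation; rows of \<open>occ\<close> without
  literals are not clauses. Both literals and clauses are bins. The two items of an ordered pair of
  adjacent bins \<open>p\<close>, \<open>q\<close> must be put into these two bins, one carrying the weight \<open>wt p q\<close>; the
  digits of \<open>high\<close> enforce this, since they determine the sum of \<open>((p - o) * (q - o))\<^sup>2\<close> over bin \<open>o\<close>.\<close>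

locale cnf =
  fixes nv nc :: nat and occ :: "nat \<Rightarrow> nat \<Rightarrow> bool"
begin

definition sat :: bool where
  "sat \<longleftrightarrow> (\<exists>\<alpha>. \<forall>c<nc. (\<exists>l<2 * nv. occ l c) \<longrightarrow> (\<exists>l<2 * nv. occ l c \<and> literal \<alpha> l))"

definition nn :: nat where "nn = 2 * nv + nc"

text \<open>Each weight is received by one of its two bins. A literal has room for
  \<open>nn\<close>, that is, for the weight of its variable or for all its occurrences, but not for
  both when it occurs somewhere. The literal that takes the weight of the variable is the false one,
  and it must pass its occurrences on to the clauses; a clause has room for all but one of its
  literals.\<close>

definition wt :: "nat \<Rightarrow> nat \<Rightarrow> nat" where
  "wt p q = (if p < 2 * nv \<and> q < 2 * nv then (if p div 2 = q div 2 \<and> p \<noteq> q then nn else 0)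
     else if p < 2 * nv \<and> 2 * nv \<le> q then (if occ p (q - 2 * nv) then 1 else 0)
     else if q < 2 * nv \<and> 2 * nv \<le> p then (if occ q (p - 2 * nv) then 1 else 0) else 0)"

text \<open>Exceeds the sum of any one digit over any set of pairs, and every slack, so that no
  carries occur.\<close>

definition RR :: nat where "RR = 13 * (nn + 1) ^ 6"

text \<open>Up to signs and factors 2, the digits are the coefficients of ((p - X) * (q - X))^2 as a
  polynomial in X.\<close>

definition high :: "nat \<Rightarrow> nat \<Rightarrow> nat" where
  "high p q = ((((p * q) * (p * q) * RR + (p + q) * (p * q)) * RR + ((p + q) * (p + q) + 2 * (p * q))) * RR + (p + q)) * RR + 1"

text \<open>Only one of the twins (p, q) and (q, p) carries the weight. Pairs without weight give
  items of size 0, so that all pairs can serve as indices.\<close>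

definition size_of :: "nat \<Rightarrow> nat \<Rightarrow> nat" where
  "size_of p q = (if wt p q = 0 then 0 else high p q * RR + (if p < q then wt p q else 0))"

text \<open>For a row without literals the truncated difference is 0; no item of positive size
  belongs to such a bin.\<close>

definition slack :: "nat \<Rightarrow> nat" where
  "slack k = (if k < 2 * nv then nn else (\<Sum>l<2 * nv. wt l k) - 1)"

definition cap :: "nat \<Rightarrow> nat" where
  "cap k = (\<Sum>q<nn. if wt k q = 0 then 0 else high k q) * RR + slack k"

definition pairs :: "(nat \<times> nat) set" where "pairs = {..<nn} \<times> {..<nn}"

lemma wt_sym: "wt p q = wt q p"
  by (auto simp: wt_def)

lemma high_sym: "high p q = high q p"
  by (simp add: high_def add.commute mult.commute)

lemma wt_self: "wt p p = 0"
  by (simp add: wt_def)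

lemma wt_le: "nn \<ge> 1 \<Longrightarrow> wt p q \<le> nn"
  by (auto simp: wt_def)

lemma wt_clause_le: "2 * nv \<le> k \<Longrightarrow> wt l k \<le> 1"
  by (auto simp: wt_def)

lemma digits_eq:
  fixes a b c d R :: nat
  assumes "a * R + b = c * R + d" "b < R" "d < R"
  shows "a = c" "b = d"
proof -
  show "b = d" using arg_cong[OF assms(1), of "\<lambda>x. x mod R"] assms(2,3) by simp
  then show "a = c" using assms by simp
qed

lemma slack_less: "slack k < RR"
proof -
  have "nn < RR"
  proof -
    have "nn + 1 \<le> (nn + 1) ^ 6" by (rule self_le_power) auto
    then show ?thesis unfolding RR_def by linarith
  qed
  moreover have "(\<Sum>l<2 * nv. wt l k) \<le> nn" if "\<not> k < 2 * nv"
  proof -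
    have "(\<Sum>l<2 * nv. wt l k) \<le> (\<Sum>l<2 * nv. 1)" using that by (intro sum_mono wt_clause_le) auto
    then show ?thesis by (simp add: nn_def)
  qed
  ultimately show ?thesis by (auto simp: slack_def)
qed

lemma digit_sum_less:
  assumes X: "X \<subseteq> pairs" and f: "\<And>p q. p < nn \<Longrightarrow> q < nn \<Longrightarrow> f (p, q) \<le> 6 * (nn + 1) ^ 4"
  shows "sum f X < RR"
proof -
  have fin: "finite pairs" by (simp add: pairs_def)
  have "sum f X \<le> (\<Sum>x\<in>X. 6 * (nn + 1) ^ 4)" using X f by (intro sum_mono) (auto simp: pairs_def)
  also have "\<dots> = card X * (6 * (nn + 1) ^ 4)" by simp
  also have "\<dots> \<le> (nn + 1) ^ 2 * (6 * (nn + 1) ^ 4)"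
  proof (rule mult_right_mono)
    have "card X \<le> card pairs" using X fin by (rule card_mono[rotated])
    also have "\<dots> \<le> (nn + 1) ^ 2" by (simp add: pairs_def card_cartesian_product power2_eq_square)
    finally show "card X \<le> (nn + 1) ^ 2" .
  qed simp
  also have "\<dots> = 6 * (nn + 1) ^ 6" by (simp add: power_add[symmetric])
  also have "\<dots> < RR" unfolding RR_def by simp
  finally show ?thesis .
qed

lemma digit_bounds:
  assumes "p < nn" "q < nn"
  shows "(p * q) * (p * q) \<le> 6 * (nn + 1) ^ 4" "(p + q) * (p * q) \<le> 6 * (nn + 1) ^ 4"
    "(p + q) * (p + q) + 2 * (p * q) \<le> 6 * (nn + 1) ^ 4" "p + q \<le> 6 * (nn + 1) ^ 4" "(1::nat) \<le> 6 * (nn + 1) ^ 4"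
proof -
  let ?N = "nn + 1"
  have pw: "?N ^ i \<le> ?N ^ 4" if "i \<le> 4" for i using that by (intro power_increasing) auto
  have m: "p * q \<le> ?N ^ 2" using mult_mono[of p ?N q ?N] assms by (simp add: power2_eq_square)
  have s: "p + q \<le> 2 * ?N" using assms by simp
  show "(p * q) * (p * q) \<le> 6 * ?N ^ 4"
    using mult_mono[OF m m] by (simp add: power_add[symmetric])
  have "(p + q) * (p * q) \<le> 2 * ?N * ?N ^ 2" using mult_mono[OF s m] by simp
  also have "\<dots> = 2 * ?N ^ 3" by (simp add: numeral_3_eq_3 power2_eq_square)
  also have "\<dots> \<le> 6 * ?N ^ 4" using pw[of 3] by linarith
  finally show "(p + q) * (p * q) \<le> 6 * ?N ^ 4" .
  have "(p + q) * (p + q) \<le> 2 * ?N * (2 * ?N)" using mult_mono[OF s s] by simp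
  also have "\<dots> = 4 * ?N ^ 2" by (simp add: power2_eq_square)
  finally show "(p + q) * (p + q) + 2 * (p * q) \<le> 6 * ?N ^ 4" using m pw[of 2] by linarith
  show "p + q \<le> 6 * ?N ^ 4" using s pw[of 1] by simp
  show "1 \<le> 6 * ?N ^ 4" using pw[of 0] by simp
qed

lemma high_sum:
  "(\<Sum>(p, q)\<in>X. high p q) = (((\<Sum>(p, q)\<in>X. (p * q) * (p * q)) * RR + (\<Sum>(p, q)\<in>X. (p + q) * (p * q))) * RR
     + (\<Sum>(p, q)\<in>X. (p + q) * (p + q) + 2 * (p * q))) * RR * RR + (\<Sum>(p, q)\<in>X. p + q) * RR + card X"
proof -
  have "(\<Sum>(p, q)\<in>X. high p q) = (\<Sum>x\<in>X. (\<lambda>(p, q). (p * q) * (p * q)) x * (RR * RR * RR * RR) + (\<lambda>(p, q). (p + q) * (p * q)) x * (RR * RR * RR)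
     + (\<lambda>(p, q). (p + q) * (p + q) + 2 * (p * q)) x * (RR * RR) + (\<lambda>(p, q). p + q) x * RR + 1)"
    by (intro sum.cong refl) (auto simp: high_def algebra_simps)
  also have "\<dots> = (\<Sum>x\<in>X. (\<lambda>(p, q). (p * q) * (p * q)) x) * (RR * RR * RR * RR) + (\<Sum>x\<in>X. (\<lambda>(p, q). (p + q) * (p * q)) x) * (RR * RR * RR)
     + (\<Sum>x\<in>X. (\<lambda>(p, q). (p + q) * (p + q) + 2 * (p * q)) x) * (RR * RR) + (\<Sum>x\<in>X. (\<lambda>(p, q). p + q) x) * RR + card X"
    by (simp only: sum.distrib sum_distrib_right[symmetric]) simp
  finally show ?thesis by (simp add: algebra_simps)
qed

text \<open>The five digits determine the sum of \<open>((p - k) * (q - k))\<^sup>2 = (p q - k (p + q) + k\<^sup>2)\<^sup>2\<close>, which is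
  zero over \<open>Y\<close>.\<close>

lemma high_confines:
  assumes X: "X \<subseteq> pairs" and Y: "Y \<subseteq> pairs" and eq: "(\<Sum>(p, q)\<in>X. high p q) = (\<Sum>(p, q)\<in>Y. high p q)"
    and Yk: "\<And>p q. (p, q) \<in> Y \<Longrightarrow> p = k"
  shows "(p, q) \<in> X \<Longrightarrow> p = k \<or> q = k"
proof -
  assume pq: "(p, q) \<in> X"
  let ?d4 = "\<lambda>(p, q). (p * q) * (p * q) :: nat" and ?d3 = "\<lambda>(p, q). (p + q) * (p * q) :: nat"
  let ?d2 = "\<lambda>(p, q). (p + q) * (p + q) + 2 * (p * q) :: nat" and ?d1 = "\<lambda>(p, q). p + q :: nat"
  have finX: "finite X" "finite Y" using X Y finite_subset[of _ pairs] by (auto simp: pairs_def)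
  have lt: "sum ?d4 Z < RR" "sum ?d3 Z < RR" "sum ?d2 Z < RR" "sum ?d1 Z < RR" "card Z < RR" if "Z \<subseteq> pairs" for Z
  proof -
    show "sum ?d4 Z < RR" "sum ?d3 Z < RR" "sum ?d2 Z < RR" "sum ?d1 Z < RR"
      using digit_bounds by (auto intro!: digit_sum_less[OF that])
    show "card Z < RR" using digit_sum_less[OF that, of "\<lambda>_. 1"] digit_bounds(5) by simp
  qed
  have E: "(((sum ?d4 X * RR + sum ?d3 X) * RR + sum ?d2 X) * RR + sum ?d1 X) * RR + card X =
      (((sum ?d4 Y * RR + sum ?d3 Y) * RR + sum ?d2 Y) * RR + sum ?d1 Y) * RR + card Y"
    using eq unfolding high_sum by (simp add: algebra_simps)
  note e0 = digits_eq[OF E lt(5)[OF X] lt(5)[OF Y]]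
  note e1 = digits_eq[OF e0(1) lt(4)[OF X] lt(4)[OF Y]]
  note e2 = digits_eq[OF e1(1) lt(3)[OF X] lt(3)[OF Y]]
  note e3 = digits_eq[OF e2(1) lt(2)[OF X] lt(2)[OF Y]]
  let ?f = "\<lambda>(p, q). ((int p - int k) * (int q - int k))\<^sup>2"
  have "sum ?f Z = int (sum ?d4 Z) - 2 * int k * int (sum ?d3 Z) + int k ^ 2 * int (sum ?d2 Z) - 2 * int k ^ 3 * int (sum ?d1 Z) + int k ^ 4 * int (card Z)" for Z
  proof -
    have "sum ?f Z = (\<Sum>x\<in>Z. int (?d4 x) - 2 * int k * int (?d3 x) + int k ^ 2 * int (?d2 x) - 2 * int k ^ 3 * int (?d1 x) + int k ^ 4 * 1)"
    proof (intro sum.cong refl)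
      fix x :: "nat \<times> nat"
      obtain p q where x: "x = (p, q)" by force
      have "((P - K) * (Q - K))\<^sup>2 = (P * Q) * (P * Q) - 2 * K * ((P + Q) * (P * Q)) + K ^ 2 * ((P + Q) * (P + Q) + 2 * (P * Q))
          - 2 * K ^ 3 * (P + Q) + K ^ 4 * 1" for P Q K :: int by algebra
      then show "?f x = int (?d4 x) - 2 * int k * int (?d3 x) + int k ^ 2 * int (?d2 x) - 2 * int k ^ 3 * int (?d1 x) + int k ^ 4 * 1"
        by (simp add: x)
    qed
    also have "\<dots> = int (sum ?d4 Z) - 2 * int k * int (sum ?d3 Z) + int k ^ 2 * int (sum ?d2 Z) - 2 * int k ^ 3 * int (sum ?d1 Z) + int k ^ 4 * int (card Z)"
      by (simp only: sum.distrib sum_subtractf sum_distrib_left[symmetric] of_nat_sum) simp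
    finally show ?thesis .
  qed
  then have "sum ?f X = sum ?f Y" using e0 e1 e2 e3 by presburger
  also have "\<dots> = 0" using Yk by (intro sum.neutral) auto
  finally have z: "sum ?f X = 0" .
  have nonneg: "\<And>x. x \<in> X \<Longrightarrow> 0 \<le> ?f x" by (auto split: prod.split)
  have "\<forall>x\<in>X. ?f x = 0" by (rule iffD1[OF sum_nonneg_eq_0_iff[OF finX(1)] z]) (rule nonneg)
  from bspec[OF this pq] show "p = k \<or> q = k" by simp
qed

section \<open>Packings and satisfying assignments\<close>

definition edges :: "(nat \<times> nat) set" where
  "edges = {(p, q) \<in> pairs. wt p q \<noteq> 0}"

lemma edges_iff: "(p, q) \<in> edges \<longleftrightarrow> p < nn \<and> q < nn \<and> wt p q \<noteq> 0"
  by (auto simp: edges_def pairs_def)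

lemma finite_edges: "finite edges"
  by (rule finite_subset[of _ pairs]) (auto simp: edges_def pairs_def)

lemma edges_sub: "edges \<subseteq> pairs"
  by (auto simp: edges_def)

lemma cap_edges:
  assumes "k < nn"
  shows "cap k = (\<Sum>(p, q)\<in>{x \<in> edges. fst x = k}. high p q) * RR + slack k"
proof -
  have "(\<Sum>q<nn. if wt k q = 0 then 0 else high k q) = (\<Sum>q | q < nn \<and> wt k q \<noteq> 0. high k q)"
    by (rule sum.mono_neutral_cong_right) auto
  also have "\<dots> = (\<Sum>(p, q)\<in>{x \<in> edges. fst x = k}. high p q)"
    by (rule sum.reindex_bij_witness[of _ snd "\<lambda>q. (k, q)"]) (use assms in \<open>auto simp: edges_iff\<close>)
  finally show ?thesis by (simp add: cap_def)
qed

lemma size_edges: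
  "(\<Sum>x | x \<in> pairs \<and> \<beta> x = k. size_of (fst x) (snd x)) =
   (\<Sum>(p, q)\<in>{x \<in> edges. \<beta> x = k}. high p q) * RR + (\<Sum>(p, q)\<in>{x \<in> edges. \<beta> x = k}. if p < q then wt p q else 0)"
proof -
  have "(\<Sum>x | x \<in> pairs \<and> \<beta> x = k. size_of (fst x) (snd x)) = (\<Sum>x\<in>{x \<in> edges. \<beta> x = k}. size_of (fst x) (snd x))"
    by (rule sum.mono_neutral_right) (auto simp: edges_def pairs_def size_of_def)
  also have "\<dots> = (\<Sum>x\<in>{x \<in> edges. \<beta> x = k}. (\<lambda>(p, q). high p q) x * RR + (\<lambda>(p, q). if p < q then wt p q else 0) x)"
    by (rule sum.cong) (auto simp: edges_def size_of_def)
  also have "\<dots> = (\<Sum>x\<in>{x \<in> edges. \<beta> x = k}. (\<lambda>(p, q). high p q) x) * RR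
      + (\<Sum>x\<in>{x \<in> edges. \<beta> x = k}. (\<lambda>(p, q). if p < q then wt p q else 0) x)"
    by (simp only: sum.distrib sum_distrib_right[symmetric])
  finally show ?thesis .
qed

theorem packing_sat:
  assumes \<beta>: "\<And>x. x \<in> pairs \<Longrightarrow> \<beta> x < nn"
    and fit: "\<And>k. k < nn \<Longrightarrow> (\<Sum>x | x \<in> pairs \<and> \<beta> x = k. size_of (fst x) (snd x)) \<le> cap k"
  shows sat
proof -
  let ?X = "\<lambda>k. {x \<in> edges. \<beta> x = k}" and ?Y = "\<lambda>k. {x \<in> edges. fst x = k}"
  let ?h = "\<lambda>(p, q). high p q" and ?v = "\<lambda>(p, q). if p < q then wt p q else 0"
  have ineq: "sum ?h (?X k) * RR + sum ?v (?X k) \<le> sum ?h (?Y k) * RR + slack k" if "k < nn" for k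
    using fit[OF that] unfolding size_edges cap_edges[OF that] .
  \<comment> \<open>The slack is below \<open>RR\<close>, so the weights cannot make up for one unit
    of the high parts.\<close>
  have le: "sum ?h (?X k) \<le> sum ?h (?Y k)" if "k < nn" for k
  proof (rule ccontr)
    assume "\<not> ?thesis"
    then have "(sum ?h (?Y k) + 1) * RR \<le> sum ?h (?X k) * RR" by (intro mult_right_mono) auto
    then show False using ineq[OF that] slack_less[of k] by (simp add: algebra_simps)
  qed
  \<comment> \<open>Summed over all bins, both sides give the total over all edges, so the
    inequalities \<open>le\<close> are equalities and \<open>high_confines\<close> becomes
    applicable.\<close>
  have "(\<Sum>k<nn. sum ?h (?X k)) = sum ?h edges" "(\<Sum>k<nn. sum ?h (?Y k)) = sum ?h edges"
    using edges_sub \<beta> by (auto intro!: sum.group finite_edges simp: pairs_def)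
  then have eq: "sum ?h (?X k) = sum ?h (?Y k)" if "k < nn" for k
    using sum_mono_inv[of "\<lambda>k. sum ?h (?X k)" "{..<nn}" "\<lambda>k. sum ?h (?Y k)" k] le that by simp
  have conf: "p = \<beta> (p, q) \<or> q = \<beta> (p, q)" if e: "(p, q) \<in> edges" for p q
  proof -
    have k: "\<beta> (p, q) < nn" using \<beta> e edges_sub by blast
    show ?thesis
      by (rule high_confines[OF _ _ eq[OF k]]) (use edges_sub e in auto)
  qed
  have val: "sum ?v (?X k) \<le> slack k" if "k < nn" for k
    using ineq[OF that] eq[OF that] by simp
  \<comment> \<open>The heavy item of a variable lies in the bin of its false literal.\<close>
  define \<alpha> where "\<alpha> x \<longleftrightarrow> \<beta> (2 * x, 2 * x + 1) = 2 * x + 1" for x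
  show sat
    unfolding sat_def
  proof (intro exI[of _ \<alpha>] allI impI, rule ccontr)
    fix c assume c: "c < nc" and ex: "\<exists>l<2 * nv. occ l c" and no: "\<not> (\<exists>l<2 * nv. occ l c \<and> literal \<alpha> l)"
    let ?k = "2 * nv + c"
    have k: "?k < nn" using c by (simp add: nn_def)
    \<comment> \<open>All literals of the clause are false, so their bins are filled up by heavy
      items and the occurrences must be in the bin of the clause.\<close>
    have inC: "\<beta> (l, ?k) = ?k" if l: "l < 2 * nv" "occ l c" for l
    proof (rule ccontr)
      assume "\<beta> (l, ?k) \<noteq> ?k"
      moreover have e1: "(l, ?k) \<in> edges" using l k c by (auto simp: edges_iff wt_def nn_def)
      ultimately have bl: "\<beta> (l, ?k) = l" using conf by metis
      define x where "x = l div 2"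
      have ln: "l < nn" "2 * x + 1 < 2 * nv" using l by (auto simp: nn_def x_def) presburger
      have e2: "(2 * x, 2 * x + 1) \<in> edges" using ln by (auto simp: edges_iff wt_def nn_def)
      have "\<not> literal \<alpha> l" using no l by blast
      then have b2: "\<beta> (2 * x, 2 * x + 1) = l"
        using conf[OF e2] unfolding literal_def \<alpha>_def x_def
        by (cases "even l") (auto elim!: evenE oddE)
      have "sum ?v {(l, ?k), (2 * x, 2 * x + 1)} \<le> sum ?v (?X l)"
        using bl b2 e1 e2 finite_edges by (intro sum_mono2) auto
      moreover have "sum ?v {(l, ?k), (2 * x, 2 * x + 1)} = 1 + nn"
        using l ln by (auto simp: wt_def)
      ultimately show False using val[OF ln(1)] l by (simp add: slack_def)
    qed
    let ?O = "{l. l < 2 * nv \<and> occ l c}"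
    have "card ?O = sum ?v ((\<lambda>l. (l, ?k)) ` ?O)"
      by (subst sum.reindex) (auto simp: inj_on_def wt_def)
    also have "\<dots> \<le> sum ?v (?X ?k)"
      using inC k finite_edges by (intro sum_mono2) (auto simp: edges_iff wt_def nn_def)
    also have "\<dots> \<le> (\<Sum>l<2 * nv. wt l ?k) - 1" using val[OF k] by (simp add: slack_def)
    also have "(\<Sum>l<2 * nv. wt l ?k) = (\<Sum>l<2 * nv. if occ l c then 1 else 0)"
      by (rule sum.cong) (auto simp: wt_def)
    also have "\<dots> = card ?O" by (simp add: sum.If_cases Int_def)
    \<comment> \<open>The bin of the clause would hold all its literals, one more than it has room
      for.\<close>
    finally have "card ?O \<le> card ?O - 1" .
    moreover have "card ?O > 0" using ex by (auto simp: card_gt_0_iff)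
    ultimately show False by linarith
  qed
qed

theorem sat_packing:
  assumes sat
  shows "\<exists>\<beta>. (\<forall>x\<in>pairs. \<beta> x < nn) \<and> (\<forall>k<nn. (\<Sum>x | x \<in> pairs \<and> \<beta> x = k. size_of (fst x) (snd x)) \<le> cap k)"
proof -
  obtain \<alpha> where \<alpha>: "\<And>c. c < nc \<Longrightarrow> \<exists>l<2 * nv. occ l c \<Longrightarrow> \<exists>l<2 * nv. occ l c \<and> literal \<alpha> l"
    using assms unfolding sat_def by blast
  \<comment> \<open>The bin of the weighted item of a pair with \<open>p < q\<close>: the false
    literal of a variable, and for an occurrence the literal if it is true and the clause
    otherwise.\<close>
  define T where "T p q = (if q < 2 * nv then (if literal \<alpha> p then q else p) else (if literal \<alpha> p then p else q))" for p q
  \<comment> \<open>The weightless twin goes to the other bin.\<close>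
  define \<beta> where "\<beta> = (\<lambda>(p, q). if p < q then T p q else if T q p = q then p else q)"
  have \<beta>_in: "\<beta> (p, q) = p \<or> \<beta> (p, q) = q" for p q by (auto simp: \<beta>_def T_def)
  have \<beta>_other: "\<beta> (q, p) = q \<longleftrightarrow> \<beta> (p, q) \<noteq> q" if "p \<noteq> q" for p q
    using that by (auto simp: \<beta>_def T_def)
  let ?h = "\<lambda>(p, q). high p q" and ?v = "\<lambda>(p, q). if p < q then wt p q else 0"
  let ?X = "\<lambda>k. {x \<in> edges. \<beta> x = k}" and ?Y = "\<lambda>k. {x \<in> edges. fst x = k}"
  have ne: "p \<noteq> q" if "(p, q) \<in> edges" for p q using that wt_self by (auto simp: edges_iff)
  have symE: "(q, p) \<in> edges" if "(p, q) \<in> edges" for p q using that wt_sym by (auto simp: edges_iff)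
  \<comment> \<open>Every bin receives exactly one of the twins of each adjacent pair it belongs to.
    Exchanging twins maps its contents to the pairs that start with it, and \<open>high\<close> is
    symmetric.\<close>
  have trans: "sum f (?X k) = (\<Sum>x\<in>?Y k. if \<beta> x = k then f x else f (snd x, fst x))" for f :: "nat \<times> nat \<Rightarrow> nat" and k
  proof (rule sum.reindex_bij_witness[of _ "\<lambda>x. if \<beta> x = k then x else (snd x, fst x)" "\<lambda>x. if fst x = k then x else (snd x, fst x)"])
    fix x assume x: "x \<in> ?X k"
    obtain p q where pq: "x = (p, q)" by force
    have "p = k \<or> q = k" using x pq \<beta>_in[of p q] by auto
    then show "(if \<beta> (if fst x = k then x else (snd x, fst x)) = k then (if fst x = k then x else (snd x, fst x))
        else (snd (if fst x = k then x else (snd x, fst x)), fst (if fst x = k then x else (snd x, fst x)))) = x"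
      "(if fst x = k then x else (snd x, fst x)) \<in> ?Y k"
      "(if \<beta> (if fst x = k then x else (snd x, fst x)) = k then f (if fst x = k then x else (snd x, fst x))
        else f (snd (if fst x = k then x else (snd x, fst x)), fst (if fst x = k then x else (snd x, fst x)))) = f x"
      using x pq ne[of p q] \<beta>_other[of p q] symE[of p q] by auto
  next
    fix x assume x: "x \<in> ?Y k"
    obtain p q where pq: "x = (p, q)" by force
    then show "(if fst (if \<beta> x = k then x else (snd x, fst x)) = k then (if \<beta> x = k then x else (snd x, fst x))
        else (snd (if \<beta> x = k then x else (snd x, fst x)), fst (if \<beta> x = k then x else (snd x, fst x)))) = x"
      "(if \<beta> x = k then x else (snd x, fst x)) \<in> ?X k"
      using x ne[of p q] \<beta>_other[of q p] \<beta>_in[of q p] symE[of p q] by auto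
  qed
  have hi: "sum ?h (?X k) = sum ?h (?Y k)" for k
    unfolding trans by (rule sum.cong) (auto simp: high_sym)
  have vl: "sum ?v (?X k) \<le> slack k" if k: "k < nn" for k
  proof (cases "k < 2 * nv")
    case True
    let ?p = "if even k then k + 1 else k - 1"
    have pk: "?p < 2 * nv" "?p div 2 = k div 2" "?p \<noteq> k" using True by (auto elim!: evenE oddE)
    show ?thesis
    proof (cases "literal \<alpha> k")
      \<comment> \<open>The bin of a true literal contains no heavy item, only occurrences of weight
        1, fewer than \<open>nn\<close> possible bins apart.\<close>
      case lit: True
      have "sum ?v (?X k) \<le> (\<Sum>x\<in>?X k. if snd x \<ge> 2 * nv then 1 else 0)"
      proof (rule sum_mono)
        fix x assume x: "x \<in> ?X k"
        obtain p q where pq: "x = (p, q)" by force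
        show "?v x \<le> (if snd x \<ge> 2 * nv then 1 else 0)"
        proof (cases "p < q \<and> q < 2 * nv")
          case True
          then have "p div 2 = q div 2" using x pq by (auto simp: edges_iff wt_def split: if_splits)
          then have "even p" "q = p + 1" using True by presburger+
          then have "literal \<alpha> p \<noteq> literal \<alpha> q" by (simp add: literal_def)
          moreover have "T p q = k" using x pq True by (simp add: \<beta>_def)
          ultimately show ?thesis using lit True by (auto simp: T_def split: if_splits)
        next
          case False
          then show ?thesis using pq by (auto simp: wt_def)
        qed
      qed
      also have "\<dots> \<le> card {x \<in> ?X k. snd x \<ge> 2 * nv \<and> fst x = k}"
      proof -
        have "(\<Sum>x\<in>?X k. if snd x \<ge> 2 * nv then 1 else 0) = card {x \<in> ?X k. snd x \<ge> 2 * nv}"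
          using finite_edges by (simp add: sum.If_cases Int_def)
        also have "{x \<in> ?X k. snd x \<ge> 2 * nv} = {x \<in> ?X k. snd x \<ge> 2 * nv \<and> fst x = k}"
          using \<beta>_in True by (auto simp: not_less) (metis leD)
        finally show ?thesis by simp
      qed
      also have "\<dots> \<le> card ((\<lambda>q. (k, q)) ` {..<nn})"
        by (rule card_mono) (auto simp: edges_iff)
      also have "\<dots> \<le> nn" using card_image_le[of "{..<nn}" "\<lambda>q. (k, q)"] by simp
      finally show ?thesis using True by (simp add: slack_def)
    next
      \<comment> \<open>The only item of positive weight in the bin of a false literal is the heavy
        one.\<close>
      case lit: False
      have "sum ?v (?X k) \<le> (\<Sum>x\<in>?X k. if x = (min k ?p, max k ?p) then nn else 0)"
      proof (rule sum_mono)
        fix x assume x: "x \<in> ?X k"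
        obtain p q where pq: "x = (p, q)" by force
        show "?v x \<le> (if x = (min k ?p, max k ?p) then nn else 0)"
        proof (cases "p < q \<and> wt p q \<noteq> 0")
          case True
          have T: "T p q = k" using x pq True by (simp add: \<beta>_def)
          have k: "k = p \<or> k = q" using x pq \<beta>_in[of p q] by auto
          have "q < 2 * nv"
          proof (rule ccontr)
            assume "\<not> q < 2 * nv"
            then show False using T lit k \<open>k < 2 * nv\<close> by (auto simp: T_def split: if_splits)
          qed
          then have "p div 2 = q div 2" using True by (auto simp: wt_def split: if_splits)
          then have "even p" "q = p + 1" using True by presburger+
          then have "x = (min k ?p, max k ?p)" using k pq by auto
          moreover have "wt p q \<le> nn" using True wt_le[of p q] k \<open>k < nn\<close> by simp
          ultimately show ?thesis using pq by simp
        qed (use pq in auto)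
      qed
      also have "\<dots> \<le> nn" using finite_edges by simp
      finally show ?thesis using True by (simp add: slack_def)
    qed
  next
    case False
    define c where "c = k - 2 * nv"
    have c: "k = 2 * nv + c" "c < nc" using False k by (auto simp: c_def nn_def)
    have "sum ?v (?X k) \<le> (\<Sum>x\<in>(\<lambda>l. (l, k)) ` {l. l < 2 * nv \<and> occ l c \<and> \<not> literal \<alpha> l}. 1)"
    proof -
      have "sum ?v (?X k) = sum ?v {x \<in> ?X k. fst x < snd x}"
        by (rule sum.mono_neutral_right) (auto simp: finite_edges split: if_splits)
      also have "\<dots> \<le> sum ?v ((\<lambda>l. (l, k)) ` {l. l < 2 * nv \<and> occ l c \<and> \<not> literal \<alpha> l})"
      proof (rule sum_mono2)
        show "{x \<in> ?X k. fst x < snd x} \<subseteq> (\<lambda>l. (l, k)) ` {l. l < 2 * nv \<and> occ l c \<and> \<not> literal \<alpha> l}"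
        proof
          fix x assume x: "x \<in> {x \<in> ?X k. fst x < snd x}"
          obtain p q where pq: "x = (p, q)" by force
          have k': "k = p \<or> k = q" "p < q" "wt p q \<noteq> 0" "T p q = k" using x pq \<beta>_in[of p q] by (auto simp: edges_iff \<beta>_def)
          then have "p < 2 * nv" "k = q" using False by (auto simp: wt_def split: if_splits)
          moreover have "occ p c" using k' calculation False by (auto simp: wt_def c split: if_splits)
          moreover have "\<not> literal \<alpha> p" using k' calculation False by (auto simp: T_def split: if_splits)
          ultimately show "x \<in> (\<lambda>l. (l, k)) ` {l. l < 2 * nv \<and> occ l c \<and> \<not> literal \<alpha> l}" using pq by auto
        qed
      qed auto
      also have "\<dots> \<le> (\<Sum>x\<in>(\<lambda>l. (l, k)) ` {l. l < 2 * nv \<and> occ l c \<and> \<not> literal \<alpha> l}. 1)"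
        using False by (intro sum_mono) (auto simp: wt_def)
      finally show ?thesis .
    qed
    also have "\<dots> = card {l. l < 2 * nv \<and> occ l c \<and> \<not> literal \<alpha> l}"
      by (simp add: card_image inj_on_def)
    also have "\<dots> \<le> card {l. l < 2 * nv \<and> occ l c} - 1"
    proof (cases "\<exists>l<2 * nv. occ l c")
      case True
      then obtain l where l: "l < 2 * nv" "occ l c" "literal \<alpha> l" using \<alpha>[OF c(2)] by blast
      have "card {l. l < 2 * nv \<and> occ l c \<and> \<not> literal \<alpha> l} \<le> card ({l. l < 2 * nv \<and> occ l c} - {l})"
        using l by (intro card_mono) auto
      then show ?thesis using l by simp
    next
      case False
      then have "{l. l < 2 * nv \<and> occ l c \<and> \<not> literal \<alpha> l} = {}" by auto
      then show ?thesis by (metis card.empty zero_le)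
    qed
    also have "card {l. l < 2 * nv \<and> occ l c} = (\<Sum>l<2 * nv. if occ l c then 1 else 0)" by (simp add: sum.If_cases Int_def)
    also have "\<dots> = (\<Sum>l<2 * nv. wt l k)" by (rule sum.cong) (auto simp: wt_def c)
    finally show ?thesis using False by (simp add: slack_def)
  qed
  have "(\<Sum>x | x \<in> pairs \<and> \<beta> x = k. size_of (fst x) (snd x)) \<le> cap k" if "k < nn" for k
    unfolding size_edges cap_edges[OF that] hi using vl[OF that] by simp
  moreover have "\<beta> x < nn" if "x \<in> pairs" for x
    using that \<beta>_in[of "fst x" "snd x"] by (auto simp: pairs_def)
  ultimately show ?thesis by blast
qed

end

section \<open>Computations as satisfying assignments\<close>

locale ntm =
  fixes M :: turing_machine and tr :: "((nat \<times> nat list) \<times> (nat \<times> (nat \<times> head_move) list)) list" and D :: nat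
  assumes wf: "well_formed M" and tr: "set tr = trans M" and D3: "D \<ge> 3"
    and bounds: "\<And>q rs q' ws. ((q, rs), (q', ws)) \<in> set tr \<Longrightarrow> q < D \<and> q' < D \<and> set rs \<subseteq> {..<D} \<and> fst ` set ws \<subseteq> {..<D}"
begin

abbreviation kk :: nat where "kk \<equiv> tapes M"
abbreviation rho :: nat where "rho \<equiv> length tr"

text \<open>The state is treated as a further tape \<open>kk\<close>, and all tapes are viewed relative to their heads;
  transition \<open>rho\<close> is idling. Moves are encoded by \<open>0\<close>, \<open>1\<close>, \<open>2\<close>.\<close>

definition rd :: "nat \<Rightarrow> nat \<Rightarrow> nat" where
  "rd r i = (if r < rho then case tr ! r of ((q, rs), _) \<Rightarrow> if i < kk then rs ! i else q else 0)"

definition wr :: "nat \<Rightarrow> nat \<Rightarrow> nat" where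
  "wr r i = (if r < rho then case tr ! r of (_, (q', ws)) \<Rightarrow> if i < kk then fst (ws ! i) else q' else 0)"

definition mv :: "nat \<Rightarrow> nat \<Rightarrow> nat" where
  "mv r i = (if r < rho \<and> i < kk then nat (shift (snd (snd (snd (tr ! r)) ! i)) + 1) else 1)"

text \<open>With the scanned cell always at distance 0, no variables for head positions are needed,
  and a transition shifts all cells of a tape alike.\<close>

definition view :: "config \<Rightarrow> nat \<Rightarrow> int \<Rightarrow> nat" where
  "view c i p = (if i < kk then fst (snd c ! i) (snd (snd c ! i) + p) else if p = 0 then fst c else 0)"

lemma tr_lengths:
  assumes "r < rho" "tr ! r = ((q, rs), (q', ws))"
  shows "length rs = kk" "length ws = kk" "((q, rs), (q', ws)) \<in> trans M"
proof -
  show t: "((q, rs), (q', ws)) \<in> trans M" using assms tr by (metis nth_mem)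
  then show "length rs = kk" "length ws = kk" using wf unfolding well_formed_def by auto
qed

lemma kk1: "kk \<ge> 1" using wf by (simp add: well_formed_def)

lemma rd_less: assumes "r < rho" shows "rd r i < D"
proof -
  obtain q rs q' ws where t: "tr ! r = ((q, rs), (q', ws))" by (metis prod.exhaust)
  then have "((q, rs), (q', ws)) \<in> set tr" using assms by (metis nth_mem)
  then have "q < D" "set rs \<subseteq> {..<D}" using bounds by blast+
  moreover have "rs ! i \<in> set rs" if "i < kk" using that tr_lengths[OF assms t] by simp
  ultimately show ?thesis using t by (auto simp: rd_def)
qed

lemma wr_less: assumes "r < rho" shows "wr r i < D"
proof -
  obtain q rs q' ws where t: "tr ! r = ((q, rs), (q', ws))" by (metis prod.exhaust)
  then have "((q, rs), (q', ws)) \<in> set tr" using assms by (metis nth_mem)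
  then have "q' < D" "fst ` set ws \<subseteq> {..<D}" using bounds by blast+
  moreover have "ws ! i \<in> set ws" if "i < kk" using that tr_lengths[OF assms t] by simp
  ultimately show ?thesis using t by (auto simp: wr_def)
qed

lemma mv_le: "mv r i \<le> 2"
proof -
  have "shift h \<le> 1" for h by (cases h) auto
  then show ?thesis by (simp add: mv_def nat_le_iff)
qed

lemma mv_idle: "mv rho i = 1"
  by (simp add: mv_def)

lemma shift_mv:
  assumes "r < rho" "tr ! r = ((q, rs), (q', ws))" "i < kk"
  shows "shift (snd (ws ! i)) = int (mv r i) - 1"
proof -
  have "shift h \<ge> - 1" for h by (cases h) auto
  from this[of "snd (ws ! i)"] show ?thesis using assms by (simp add: mv_def)
qed

lemma step_view:
  assumes "(c, c') \<in> step M" "length (snd c) = kk"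
  shows "length (snd c') = kk \<and> (\<exists>r<rho. (\<forall>i\<le>kk. view c i 0 = rd r i) \<and>
    (\<forall>i\<le>kk. \<forall>p. view c' i p = (if p + int (mv r i) - 1 = 0 then wr r i else view c i (p + int (mv r i) - 1))))"
proof -
  obtain q ts q' ws where c: "c = (q, ts)" "c' = (q', map2 update_tape ws ts)" "((q, map read_tape ts), (q', ws)) \<in> trans M"
    using assms(1) by (auto simp: step_def)
  then obtain r where r: "r < rho" "tr ! r = ((q, map read_tape ts), (q', ws))"
    using tr by (metis in_set_conv_nth)
  note l = tr_lengths[OF r]
  have ts: "length ts = kk" using assms(2) c by simp
  have "view c i 0 = rd r i" if "i \<le> kk" for i
    using r ts c by (cases "ts ! i") (auto simp: view_def rd_def)
  moreover have "view c' i p = (if p + int (mv r i) - 1 = 0 then wr r i else view c i (p + int (mv r i) - 1))" if "i \<le> kk" for i p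
  proof (cases "i < kk")
    case True
    obtain t h where th: "ts ! i = (t, h)" by force
    obtain a d where ad: "ws ! i = (a, d)" by force
    have e: "p + int (mv r i) - 1 = p + shift d" using shift_mv[OF r True] ad by simp
    have "map2 update_tape ws ts ! i = (t(h := a), h + shift d)"
      using True l ts th ad by simp
    then show ?thesis unfolding e using True r th ad c by (auto simp: view_def wr_def ac_simps)
  next
    case False
    then show ?thesis using r c by (auto simp: view_def wr_def mv_def)
  qed
  ultimately show ?thesis using r l ts c by auto
qed

lemma step_exists:
  assumes "r < rho" "length (snd c) = kk" "\<And>i. i \<le> kk \<Longrightarrow> view c i 0 = rd r i"
  shows "\<exists>c'. (c, c') \<in> step M \<and> length (snd c') = kk \<and>
    (\<forall>i\<le>kk. \<forall>p. view c' i p = (if p + int (mv r i) - 1 = 0 then wr r i else view c i (p + int (mv r i) - 1)))"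
proof -
  obtain q rs q' ws where t: "tr ! r = ((q, rs), (q', ws))" by (metis prod.exhaust)
  note l = tr_lengths[OF assms(1) t]
  obtain q0 ts where c: "c = (q0, ts)" by force
  have "q0 = q" using assms(1) assms(3)[of kk] c t by (simp add: view_def rd_def)
  moreover have "map read_tape ts = rs"
  proof (rule nth_equalityI)
    fix i assume "i < length (map read_tape ts)"
    then show "map read_tape ts ! i = rs ! i"
      using assms(1,2) assms(3)[of i] c t by (cases "ts ! i") (auto simp: view_def rd_def)
  qed (use l assms c in simp)
  ultimately have "(c, (q', map2 update_tape ws ts)) \<in> step M" using l(3) c by (auto simp: step_def)
  moreover have "view (q', map2 update_tape ws ts) i p =
      (if p + int (mv r i) - 1 = 0 then wr r i else view c i (p + int (mv r i) - 1))" if "i \<le> kk" for i p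
  proof (cases "i < kk")
    case True
    obtain u h where th: "ts ! i = (u, h)" by force
    obtain a d where ad: "ws ! i = (a, d)" by force
    have e: "p + int (mv r i) - 1 = p + shift d" using shift_mv[OF assms(1) t True] ad by simp
    have "map2 update_tape ws ts ! i = (u(h := a), h + shift d)"
      using True l assms(2) c th ad by simp
    then show ?thesis unfolding e using assms(1) True t th ad c by (auto simp: view_def wr_def ac_simps)
  next
    case False
    then show ?thesis using assms(1) t c by (auto simp: view_def wr_def mv_def)
  qed
  moreover have "length (snd (q', map2 update_tape ws ts)) = kk" using l assms(2) c by simp
  ultimately show ?thesis by blast
qed

section \<open>The tableau of a computation\<close>

definition start_symbol :: "bool list \<Rightarrow> nat \<Rightarrow> nat \<Rightarrow> nat \<Rightarrow> nat" where
  "start_symbol w C i p = (if i = 0 \<and> C \<le> p then word_content w (int (p - C)) else 0)"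

text \<open>\<open>R t r\<close>: transition \<open>r\<close> is taken at time \<open>t\<close>; \<open>S t i p a\<close>: at time \<open>t\<close> tape \<open>i\<close> has symbol \<open>a\<close>
  at distance \<open>p - C\<close> from its head. Only the cells that can still reach the head by time \<open>N\<close> matter.\<close>

definition tableau :: "bool list \<Rightarrow> nat \<Rightarrow> nat \<Rightarrow> (nat \<Rightarrow> nat \<Rightarrow> bool) \<Rightarrow> (nat \<Rightarrow> nat \<Rightarrow> nat \<Rightarrow> nat \<Rightarrow> bool) \<Rightarrow> bool" where
  "tableau w N C R S \<longleftrightarrow>
     (\<forall>t<N. \<exists>r\<le>rho. R t r) \<and>
     (\<forall>t<N. \<forall>r<rho. \<forall>i\<le>kk. R t r \<longrightarrow> S t i C (rd r i)) \<and>
     (\<forall>t<N. \<forall>r<rho. \<forall>i\<le>kk. R t r \<longrightarrow> S (t + 1) i (C + 1 - mv r i) (wr r i)) \<and>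
     (\<forall>t<N. \<forall>r\<le>rho. \<forall>i\<le>kk. \<forall>p a. 1 \<le> p \<and> p \<le> 2 * C \<and> (p \<noteq> C \<or> r = rho) \<and> a < D \<longrightarrow>
        R t r \<longrightarrow> S t i p a \<longrightarrow> S (t + 1) i (p + 1 - mv r i) a) \<and>
     (\<forall>t\<le>N. \<forall>i\<le>kk. \<forall>p\<le>2 * C. \<forall>a<D. \<forall>b<D. a \<noteq> b \<longrightarrow> \<not> S t i p a \<or> \<not> S t i p b) \<and>
     (\<forall>i\<le>kk. \<forall>p\<le>2 * C. S 0 i p (start_symbol w C i p)) \<and>
     S N kk C 1 \<and>
     (\<forall>r<rho. \<exists>i\<le>kk. \<not> S N i C (rd r i))"

lemma view_initial:
  assumes "i \<le> kk"
  shows "view (initial M w) i (int p - int C) = start_symbol w C i p"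
proof -
  have v: "snd (initial M w) ! i = (if i = 0 then word_content w else (\<lambda>_. 0), 0)" if "i < kk"
    using that by (cases i) (auto simp: initial_def)
  show ?thesis
  proof (cases "i < kk")
    case True
    then show ?thesis using v[OF True] by (auto simp: view_def start_symbol_def word_content_def of_nat_diff)
  next
    case False
    then show ?thesis using assms kk1 by (auto simp: view_def initial_def start_symbol_def)
  qed
qed

lemma length_initial: "length (snd (initial M w)) = kk"
  using kk1 by (simp add: initial_def)

lemma accepts_tableau:
  assumes acc: "accepts M w" and time: "\<And>j c. (initial M w, c) \<in> step M ^^ j \<Longrightarrow> j \<le> N" and C: "C \<ge> 1"
  shows "\<exists>R S. tableau w N C R S"
proof -
  obtain c where c: "(initial M w, c) \<in> (step M)\<^sup>*" "c \<notin> Domain (step M)" "fst c = 1"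
    using acc by (auto simp: accepts_def halts_in_def)
  obtain j where j: "(initial M w, c) \<in> step M ^^ j" using c(1) rtrancl_imp_relpow by blast
  then have jN: "j \<le> N" using time by blast
  obtain f where f: "f 0 = initial M w" "f j = c" "\<And>t. t < j \<Longrightarrow> (f t, f (Suc t)) \<in> step M"
    using j unfolding relpow_fun_conv by blast
  \<comment> \<open>An accepting run may be shorter than \<open>N\<close>; it idles in its last
    configuration.\<close>
  define g where "g t = f (min t j)" for t
  have len: "length (snd (g t)) = kk" for t
  proof (induction t)
    case 0
    then show ?case using f length_initial by (simp add: g_def)
  next
    case (Suc t)
    then show ?case
    proof (cases "t < j")
      case True
      then show ?thesis using step_view[OF f(3)[OF True]] Suc by (simp add: g_def)
    next
      case False
      then have "g (Suc t) = g t" by (simp add: g_def)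
      then show ?thesis using Suc by simp
    qed
  qed
  have "\<exists>r\<le>rho. (r < rho \<longrightarrow> (\<forall>i\<le>kk. view (g t) i 0 = rd r i)) \<and>
      (\<forall>i\<le>kk. \<forall>p. view (g (Suc t)) i p =
        (if r < rho \<and> p + int (mv r i) - 1 = 0 then wr r i else view (g t) i (p + int (mv r i) - 1)))" for t
  proof (cases "t < j")
    case True
    then have "(g t, g (Suc t)) \<in> step M" using f(3)[OF True] by (simp add: g_def)
    then obtain r where "r < rho" "\<forall>i\<le>kk. view (g t) i 0 = rd r i"
      "\<forall>i\<le>kk. \<forall>p. view (g (Suc t)) i p = (if p + int (mv r i) - 1 = 0 then wr r i else view (g t) i (p + int (mv r i) - 1))"
      using step_view[OF _ len] by blast
    then show ?thesis by (intro exI[of _ r]) auto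
  next
    case False
    then have "g (Suc t) = g t" by (simp add: g_def)
    then show ?thesis by (intro exI[of _ rho]) (simp add: mv_idle)
  qed
  then obtain r where r: "\<And>t. r t \<le> rho" "\<And>t i. r t < rho \<Longrightarrow> i \<le> kk \<Longrightarrow> view (g t) i 0 = rd (r t) i"
    "\<And>t i p. i \<le> kk \<Longrightarrow> view (g (Suc t)) i p =
        (if r t < rho \<and> p + int (mv (r t) i) - 1 = 0 then wr (r t) i else view (g t) i (p + int (mv (r t) i) - 1))"
    by metis
  define R where "R t x \<longleftrightarrow> x = r t" for t x
  define S where "S t i p a \<longleftrightarrow> view (g t) i (int p - int C) = a" for t i p a
  have gN: "g N = c" "g 0 = initial M w" using jN f by (auto simp: g_def)
  have "tableau w N C R S"
    unfolding tableau_def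
  proof (intro conjI allI impI)
    show "\<exists>x\<le>rho. R t x" for t using r(1) by (auto simp: R_def)
    show "S t i C (rd x i)" if "x < rho" "i \<le> kk" "R t x" for t x i using that r(2) by (auto simp: R_def S_def)
    show "S (t + 1) i (C + 1 - mv x i) (wr x i)" if "x < rho" "i \<le> kk" "R t x" for t x i
      using that r(3)[of i t "int (C + 1 - mv x i) - int C"] mv_le[of x i] C by (auto simp: R_def S_def of_nat_diff)
    show "S (t + 1) i (p + 1 - mv x i) a" if "i \<le> kk" "1 \<le> p \<and> p \<le> 2 * C \<and> (p \<noteq> C \<or> x = rho) \<and> a < D" "R t x" "S t i p a" for t x i p a
      using that r(3)[of i t "int (p + 1 - mv x i) - int C"] mv_le[of x i] by (auto simp: R_def S_def of_nat_diff)
    show "\<not> S t i p a \<or> \<not> S t i p b" if "a \<noteq> b" for t i p a b using that by (auto simp: S_def)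
    show "S 0 i p (start_symbol w C i p)" if "i \<le> kk" for i p using view_initial[OF that] gN by (simp add: S_def)
    show "S N kk C 1" using gN c by (simp add: S_def view_def)
    show "\<exists>i\<le>kk. \<not> S N i C (rd x i)" if "x < rho" for x
    proof (rule ccontr)
      assume "\<not> ?thesis"
      then have "view c i 0 = rd x i" if "i \<le> kk" for i using that gN by (auto simp: S_def)
      then have "\<exists>c'. (c, c') \<in> step M" using step_exists[OF \<open>x < rho\<close>, of c] len[of N] gN by auto
      then show False using c by blast
    qed
  qed
  then show ?thesis by blast
qed

text \<open>Idling may occur at any time, and several \<open>R t r\<close> may hold at once; any
  choice yields a legal run, because symbols are unique in the tableau. Cells are known up to
  distance \<open>N - t\<close> from the head at time \<open>t\<close>, since every step can bring
  in one unknown cell.\<close>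

lemma tableau_accepts:
  assumes tab: "tableau w N C R S" and C: "C \<ge> N + 1"
  shows "accepts M w"
proof -
  note T = tab[unfolded tableau_def]
  have K0: "\<exists>r\<le>rho. R t r" if "t < N" for t using conjunct1[OF T] that by blast
  have K1: "S t i C (rd r i)" if "t < N" "r < rho" "i \<le> kk" "R t r" for t r i
    using conjunct1[OF conjunct2[OF T]] that by blast
  have K2: "S (t + 1) i (C + 1 - mv r i) (wr r i)" if "t < N" "r < rho" "i \<le> kk" "R t r" for t r i
    using conjunct1[OF conjunct2[OF conjunct2[OF T]]] that by blast
  have K3: "S (t + 1) i (p + 1 - mv r i) a" if "t < N" "r \<le> rho" "i \<le> kk" "1 \<le> p" "p \<le> 2 * C" "p \<noteq> C \<or> r = rho" "a < D" "R t r" "S t i p a" for t r i p a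
    using conjunct1[OF conjunct2[OF conjunct2[OF conjunct2[OF T]]]] that by blast
  have K4: "a = b" if "t \<le> N" "i \<le> kk" "p \<le> 2 * C" "a < D" "b < D" "S t i p a" "S t i p b" for t i p a b
    using conjunct1[OF conjunct2[OF conjunct2[OF conjunct2[OF conjunct2[OF T]]]]] that by blast
  have K5: "S 0 i p (start_symbol w C i p)" if "i \<le> kk" "p \<le> 2 * C" for i p using conjunct1[OF conjunct2[OF conjunct2[OF conjunct2[OF conjunct2[OF conjunct2[OF T]]]]]] that by blast
  have K6: "S N kk C 1" using conjunct1[OF conjunct2[OF conjunct2[OF conjunct2[OF conjunct2[OF conjunct2[OF conjunct2[OF T]]]]]]] by blast
  have K7: "\<exists>i\<le>kk. \<not> S N i C (rd r i)" if "r < rho" for r using conjunct2[OF conjunct2[OF conjunct2[OF conjunct2[OF conjunct2[OF conjunct2[OF conjunct2[OF T]]]]]]] that by blast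
  have inv: "\<exists>c. (initial M w, c) \<in> (step M)\<^sup>* \<and> length (snd c) = kk \<and> (\<forall>i\<le>kk. \<forall>p. view c i p < D) \<and>
      (\<forall>i\<le>kk. \<forall>p. \<bar>p\<bar> \<le> int N - int t \<longrightarrow> S t i (nat (int C + p)) (view c i p))" if "t \<le> N" for t
    using that
  proof (induction t)
    case 0
    have v: "view (initial M w) i p < D" if "i \<le> kk" for i p
      using that D3 kk1 by (cases i) (auto simp: view_def initial_def word_content_def)
    have "S 0 i (nat (int C + p)) (view (initial M w) i p)" if "i \<le> kk" "\<bar>p\<bar> \<le> int N" for i p
    proof -
      have "int (nat (int C + p)) - int C = p" "nat (int C + p) \<le> 2 * C" using that(2) C by auto
      then show ?thesis using K5[OF that(1), of "nat (int C + p)"] view_initial[OF that(1), of w "nat (int C + p)" C] by simp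
    qed
    then show ?case using v length_initial by (intro exI[of _ "initial M w"]) simp
  next
    case (Suc t)
    then obtain c where c: "(initial M w, c) \<in> (step M)\<^sup>*" "length (snd c) = kk" "\<And>i p. i \<le> kk \<Longrightarrow> view c i p < D"
      "\<And>i p. i \<le> kk \<Longrightarrow> \<bar>p\<bar> \<le> int N - int t \<Longrightarrow> S t i (nat (int C + p)) (view c i p)" by auto
    obtain r where r: "r \<le> rho" "R t r" using K0[of t] Suc by auto
    show ?case
    proof (cases "r < rho")
      case True
      have "view c i 0 = rd r i" if "i \<le> kk" for i
        using K4[of t i C "view c i 0" "rd r i"] K1[of t r i] c(3)[OF that] c(4)[OF that, of 0] rd_less[OF True] that r True Suc by auto
      then obtain c' where c': "(c, c') \<in> step M" "length (snd c') = kk"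
        "\<And>i p. i \<le> kk \<Longrightarrow> view c' i p = (if p + int (mv r i) - 1 = 0 then wr r i else view c i (p + int (mv r i) - 1))"
        using step_exists[OF True c(2)] by blast
      have "S (Suc t) i (nat (int C + p)) (view c' i p)" if i: "i \<le> kk" and p: "\<bar>p\<bar> \<le> int N - int (Suc t)" for i p
      proof (cases "p + int (mv r i) - 1 = 0")
        case eq: True
        then have "nat (int C + p) = C + 1 - mv r i" using C mv_le[of r i] by simp
        then show ?thesis using K2[of t r i] c'(3)[OF i, of p] eq i r True Suc by simp
      next
        case False
        define p0 where "p0 = nat (int C + p + int (mv r i) - 1)"
        have b: "int p0 = int C + p + int (mv r i) - 1" "1 \<le> p0" "p0 \<le> 2 * C" "p0 \<noteq> C"
          using C p mv_le[of r i] False Suc by (auto simp: p0_def)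
        have "S t i p0 (view c i (p + int (mv r i) - 1))"
        proof -
          have "\<bar>p + int (mv r i) - 1\<bar> \<le> int N - int t" using p mv_le[of r i] by linarith
          moreover have "p0 = nat (int C + (p + int (mv r i) - 1))" by (simp add: p0_def algebra_simps)
          ultimately show ?thesis using c(4)[OF i] by simp
        qed
        then have "S (t + 1) i (p0 + 1 - mv r i) (view c i (p + int (mv r i) - 1))"
          using K3[of t r i p0] b i r True Suc c(3)[OF i] by auto
        moreover have "p0 + 1 - mv r i = nat (int C + p)" using b mv_le[of r i] by linarith
        ultimately show ?thesis using c'(3)[OF i, of p] False by simp
      qed
      moreover have "view c' i p < D" if "i \<le> kk" for i p using c'(3)[OF that, of p] c(3)[OF that] wr_less[OF True] by auto
      moreover have "(initial M w, c') \<in> (step M)\<^sup>*" using c(1) c'(1) by (rule rtrancl_into_rtrancl)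
      ultimately show ?thesis using c'(2) by blast
    next
      case False
      then have rr: "r = rho" using r by simp
      have "S (Suc t) i (nat (int C + p)) (view c i p)" if i: "i \<le> kk" and p: "\<bar>p\<bar> \<le> int N - int (Suc t)" for i p
        using K3[of t rho i "nat (int C + p)" "view c i p"] c(3)[OF i] c(4)[OF i, of p] i p r rr Suc C by (simp add: mv_idle)
      then show ?thesis using c by blast
    qed
  qed
  obtain c where c: "(initial M w, c) \<in> (step M)\<^sup>*" "length (snd c) = kk" "\<And>i p. i \<le> kk \<Longrightarrow> view c i p < D"
    "\<And>i. i \<le> kk \<Longrightarrow> S N i C (view c i 0)"
    using inv[of N] by force
  have "fst c = 1" using K4[of N kk C "view c kk 0" 1] c(3)[of kk 0] c(4)[of kk] K6 D3 by (simp add: view_def)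
  moreover have "c \<notin> Domain (step M)"
  proof
    assume "c \<in> Domain (step M)"
    then obtain r where r: "r < rho" "\<forall>i\<le>kk. view c i 0 = rd r i" using step_view[OF _ c(2)] by blast
    then show False using K7[OF r(1)] c(4) by auto
  qed
  ultimately show ?thesis unfolding accepts_def halts_in_def using c(1) by blast
qed

end

section \<open>Coding of variables and clauses\<close>

fun encode :: "nat \<Rightarrow> nat list \<Rightarrow> nat" where
  "encode F [] = 0"
| "encode F (x # xs) = x + F * encode F xs"

definition digit :: "nat \<Rightarrow> nat \<Rightarrow> nat \<Rightarrow> nat" where
  "digit F j x = x div F ^ j mod F"

lemma encode_less: "\<forall>x\<in>set xs. x < F \<Longrightarrow> encode F xs < F ^ length xs"
proof (induction xs)
  case (Cons x xs)
  then have "encode F xs + 1 \<le> F ^ length xs" by simp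
  then have "F * (encode F xs + 1) \<le> F * F ^ length xs" by (rule mult_le_mono2)
  then show ?case using Cons.prems by simp
qed simp

lemma digit_encode: "\<forall>x\<in>set xs. x < F \<Longrightarrow> j < length xs \<Longrightarrow> digit F j (encode F xs) = xs ! j"
proof (induction xs arbitrary: j)
  case (Cons x xs)
  have x: "x < F" using Cons.prems by simp
  show ?case
  proof (cases j)
    case 0
    then show ?thesis using x by (simp add: digit_def)
  next
    case (Suc i)
    have "(x + F * encode F xs) div F ^ Suc i = encode F xs div F ^ i"
      using x by (simp add: div_mult2_eq)
    then show ?thesis using Cons Suc by (simp add: digit_def)
  qed
qed simp

text \<open>Propositional variables are numbers with five digits in base \<open>F\<close>. The
  lowest digit distinguishes \<open>R\<close> from \<open>S\<close>, and the zeros are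
  padding.\<close>

definition vR :: "nat \<Rightarrow> nat \<Rightarrow> nat \<Rightarrow> nat" where
  "vR F t r = encode F [0, t, r, 0, 0]"

definition vS :: "nat \<Rightarrow> nat \<Rightarrow> nat \<Rightarrow> nat \<Rightarrow> nat \<Rightarrow> nat" where
  "vS F t i p a = encode F [1, t, i, p, a]"

context ntm
begin

text \<open>\<open>kd\<close> numbers the conjuncts of \<open>tableau\<close>. The ranges of the
  indices are part of each disjunct, so that indices out of range give rows without literals, which
  \<open>sat\<close> ignores.\<close>

definition clause :: "bool list \<Rightarrow> nat \<Rightarrow> nat \<Rightarrow> nat \<Rightarrow> nat \<Rightarrow> nat \<Rightarrow> nat \<Rightarrow> nat \<Rightarrow> nat \<Rightarrow> nat \<Rightarrow> nat \<Rightarrow> nat \<Rightarrow> bool" where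
  "clause w N C F l kd t r i p a b \<longleftrightarrow>
     (kd = 0 \<and> t < N \<and> (\<exists>r'<rho + 1. l = 2 * vR F t r')) \<or>
     (kd = 1 \<and> t < N \<and> r < rho \<and> i \<le> kk \<and> (l = 2 * vR F t r + 1 \<or> l = 2 * vS F t i C (rd r i))) \<or>
     (kd = 2 \<and> t < N \<and> r < rho \<and> i \<le> kk \<and> (l = 2 * vR F t r + 1 \<or> l = 2 * vS F (t + 1) i (C + 1 - mv r i) (wr r i))) \<or>
     (kd = 3 \<and> t < N \<and> r \<le> rho \<and> i \<le> kk \<and> 1 \<le> p \<and> p \<le> 2 * C \<and> (p \<noteq> C \<or> r = rho) \<and> a < D \<and>
        (l = 2 * vR F t r + 1 \<or> l = 2 * vS F t i p a + 1 \<or> l = 2 * vS F (t + 1) i (p + 1 - mv r i) a)) \<or>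
     (kd = 4 \<and> t \<le> N \<and> i \<le> kk \<and> p \<le> 2 * C \<and> a < D \<and> b < D \<and> a \<noteq> b \<and>
        (l = 2 * vS F t i p a + 1 \<or> l = 2 * vS F t i p b + 1)) \<or>
     (kd = 5 \<and> i \<le> kk \<and> p \<le> 2 * C \<and> l = 2 * vS F 0 i p (start_symbol w C i p)) \<or>
     (kd = 6 \<and> l = 2 * vS F N kk C 1) \<or>
     (kd = 7 \<and> r < rho \<and> (\<exists>i'<kk + 1. l = 2 * vS F N i' C (rd r i') + 1))"

definition occurs :: "bool list \<Rightarrow> nat \<Rightarrow> nat \<Rightarrow> nat \<Rightarrow> nat \<Rightarrow> nat \<Rightarrow> bool" where
  "occurs w N C F l c = clause w N C F l (digit F 0 c) (digit F 1 c) (digit F 2 c) (digit F 3 c) (digit F 4 c) (digit F 5 c) (digit F 6 c)"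

lemma start_symbol_less: "start_symbol w C i p < D"
  using D3 by (auto simp: start_symbol_def word_content_def)

lemma literal_simps: "literal \<alpha> (2 * x) = \<alpha> x" "literal \<alpha> (2 * x + 1) = (\<not> \<alpha> x)"
  by (simp_all add: literal_def)

text \<open>\<open>F\<close> exceeds every time, cell, symbol, tape, transition and kind of clause,
  so five digits name all variables and seven digits all clauses.\<close>

theorem accepts_iff_sat:
  assumes time: "\<And>j c. (initial M w, c) \<in> step M ^^ j \<Longrightarrow> j \<le> N" and C: "C = N + 2"
    and F: "F = N + 2 * C + D + rho + kk + 10"
  shows "accepts M w \<longleftrightarrow> cnf.sat (F ^ 5) (F ^ 7) (occurs w N C F)"
proof -
  have l5: "length [a, b, c, d, e :: nat] = 5" for a b c d e by simp
  have vR: "vR F t r < F ^ 5" "2 * vR F t r < 2 * F ^ 5" "2 * vR F t r + 1 < 2 * F ^ 5" if "t < F" "r < F" for t r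
  proof -
    show "vR F t r < F ^ 5" unfolding vR_def by (rule encode_less[of "[0, t, r, 0, 0]" F, unfolded l5]) (use that in auto)
    then show "2 * vR F t r < 2 * F ^ 5" "2 * vR F t r + 1 < 2 * F ^ 5" by auto
  qed
  have vS: "vS F t i p a < F ^ 5" "2 * vS F t i p a < 2 * F ^ 5" "2 * vS F t i p a + 1 < 2 * F ^ 5"
    if "t < F" "i < F" "p < F" "a < F" for t i p a
  proof -
    show "vS F t i p a < F ^ 5" unfolding vS_def by (rule encode_less[of "[1, t, i, p, a]" F, unfolded l5]) (use that F in auto)
    then show "2 * vS F t i p a < 2 * F ^ 5" "2 * vS F t i p a + 1 < 2 * F ^ 5" by auto
  qed
  have rdF: "rd r i < F" "wr r i < F" if "r < rho" for r i
    using rd_less[OF that, of i] wr_less[OF that, of i] F by auto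
  have ssF: "start_symbol w C i p < F" for i p using start_symbol_less[of w C i p] F by auto
  show ?thesis
  proof
    assume acc: "accepts M w"
    then obtain R S where T: "tableau w N C R S" using accepts_tableau[of w N C] time C by auto
    define \<alpha> where "\<alpha> x = (if digit F 0 x = 0 then R (digit F 1 x) (digit F 2 x)
        else S (digit F 1 x) (digit F 2 x) (digit F 3 x) (digit F 4 x))" for x
    have aR: "\<alpha> (vR F t r) = R t r" if "t < F" "r < F" for t r
    proof -
      have d: "digit F j (vR F t r) = [0, t, r, 0, 0] ! j" if "j < 5" for j
        unfolding vR_def using that \<open>t < F\<close> \<open>r < F\<close> by (intro digit_encode) auto
      show ?thesis using d[of 0] d[of 1] d[of 2] by (simp add: \<alpha>_def)
    qed
    have aS: "\<alpha> (vS F t i p a) = S t i p a" if "t < F" "i < F" "p < F" "a < F" for t i p a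
    proof -
      have d: "digit F j (vS F t i p a) = [1, t, i, p, a] ! j" if "j < 5" for j
        unfolding vS_def using that \<open>t < F\<close> \<open>i < F\<close> \<open>p < F\<close> \<open>a < F\<close> F by (intro digit_encode) auto
      show ?thesis using d[of 0] d[of 1] d[of 2] d[of 3] d[of 4] by (simp add: \<alpha>_def eval_nat_numeral)
    qed
    have "\<exists>l<2 * F ^ 5. clause w N C F l kd t r i p a b \<and> literal \<alpha> l"
      if c: "clause w N C F l kd t r i p a b" for l kd t r i p a b
    proof -
      have lit: ?thesis if "clause w N C F l kd t r i p a b" "l < 2 * F ^ 5" "literal \<alpha> l" for l
        using that by blast
      note T' = T[unfolded tableau_def]
      have "kd = 0 \<and> t < N \<or> kd = 1 \<and> t < N \<and> r < rho \<and> i \<le> kk \<or> kd = 2 \<and> t < N \<and> r < rho \<and> i \<le> kk \<or>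
          kd = 3 \<and> t < N \<and> r \<le> rho \<and> i \<le> kk \<and> 1 \<le> p \<and> p \<le> 2 * C \<and> (p = C \<longrightarrow> r = rho) \<and> a < D \<or>
          kd = 4 \<and> t \<le> N \<and> i \<le> kk \<and> p \<le> 2 * C \<and> a < D \<and> b < D \<and> a \<noteq> b \<or>
          kd = 5 \<and> i \<le> kk \<and> p \<le> 2 * C \<or> kd = 6 \<or> kd = 7 \<and> r < rho"
        using c unfolding clause_def by (elim disjE conjE) simp_all
      then show ?thesis
      proof (elim disjE conjE)
        assume h: "kd = 0" "t < N"
        then obtain r' where r': "r' \<le> rho" "R t r'" using conjunct1[OF T'] by blast
        show ?thesis
          by (rule lit[of "2 * vR F t r'"]) (use h r' vR(2)[of t r'] aR[of t r'] F in \<open>auto simp: clause_def literal_simps intro!: exI[of _ r']\<close>)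
      next
        assume h: "kd = 1" "t < N" "r < rho" "i \<le> kk"
        have "R t r \<longrightarrow> S t i C (rd r i)" using conjunct1[OF conjunct2[OF T']] h by blast
        moreover have b: "t < F" "r < F" "i < F" "C < F" "rd r i < F" using h F C rdF[OF h(3)] by auto
        ultimately show ?thesis
          using h lit[of "2 * vR F t r + 1"] lit[of "2 * vS F t i C (rd r i)"] vR[OF b(1,2)] vS[OF b(1,3,4,5)] aR[OF b(1,2)] aS[OF b(1,3,4,5)]
          by (auto simp: clause_def literal_simps literal_simps[simplified])
      next
        assume h: "kd = 2" "t < N" "r < rho" "i \<le> kk"
        have "R t r \<longrightarrow> S (t + 1) i (C + 1 - mv r i) (wr r i)" using conjunct1[OF conjunct2[OF conjunct2[OF T']]] h by blast
        moreover have b: "t < F" "r < F" "t + 1 < F" "i < F" "C + 1 - mv r i < F" "wr r i < F" using h F C rdF[OF h(3)] by auto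
        ultimately show ?thesis
          using h lit[of "2 * vR F t r + 1"] lit[of "2 * vS F (t + 1) i (C + 1 - mv r i) (wr r i)"] vR[OF b(1,2)] vS[OF b(3-6)] aR[OF b(1,2)] aS[OF b(3-6)]
          by (auto simp: clause_def literal_simps literal_simps[simplified])
      next
        assume h: "kd = 3" "t < N" "r \<le> rho" "i \<le> kk" "1 \<le> p" "p \<le> 2 * C" "p = C \<longrightarrow> r = rho" "a < D"
        have "R t r \<longrightarrow> S t i p a \<longrightarrow> S (t + 1) i (p + 1 - mv r i) a"
          using conjunct1[OF conjunct2[OF conjunct2[OF conjunct2[OF T']]]] h by blast
        moreover have b: "t < F" "r < F" "i < F" "p < F" "a < F" "t + 1 < F" "p + 1 - mv r i < F" using h F C by auto
        ultimately show ?thesis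
          using h lit[of "2 * vR F t r + 1"] lit[of "2 * vS F t i p a + 1"] lit[of "2 * vS F (t + 1) i (p + 1 - mv r i) a"]
            vR[OF b(1,2)] vS[OF b(1,3,4,5)] vS[OF b(6,3,7,5)] aR[OF b(1,2)] aS[OF b(1,3,4,5)] aS[OF b(6,3,7,5)]
          by (auto simp: clause_def literal_simps literal_simps[simplified])
      next
        assume h: "kd = 4" "t \<le> N" "i \<le> kk" "p \<le> 2 * C" "a < D" "b < D" "a \<noteq> b"
        have "\<not> S t i p a \<or> \<not> S t i p b"
          using conjunct1[OF conjunct2[OF conjunct2[OF conjunct2[OF conjunct2[OF T']]]]] h by blast
        moreover have b: "t < F" "i < F" "p < F" "a < F" "b < F" using h F C by auto
        ultimately show ?thesis
          using h lit[of "2 * vS F t i p a + 1"] lit[of "2 * vS F t i p b + 1"]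
            vS[OF b(1-4)] vS[OF b(1-3,5)] aS[OF b(1-4)] aS[OF b(1-3,5)]
          by (auto simp: clause_def literal_simps literal_simps[simplified])
      next
        assume h: "kd = 5" "i \<le> kk" "p \<le> 2 * C"
        have "S 0 i p (start_symbol w C i p)"
          using conjunct1[OF conjunct2[OF conjunct2[OF conjunct2[OF conjunct2[OF conjunct2[OF T']]]]]] h by blast
        moreover have b: "0 < F" "i < F" "p < F" using h F C by auto
        ultimately show ?thesis
          using h lit[of "2 * vS F 0 i p (start_symbol w C i p)"] vS[OF b ssF] aS[OF b ssF]
          by (auto simp: clause_def literal_simps literal_simps[simplified])
      next
        assume h: "kd = 6"
        have "S N kk C 1"
          using conjunct1[OF conjunct2[OF conjunct2[OF conjunct2[OF conjunct2[OF conjunct2[OF conjunct2[OF T']]]]]]] .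
        moreover have b: "N < F" "kk < F" "C < F" "1 < F" using F C by auto
        ultimately show ?thesis
          using h lit[of "2 * vS F N kk C 1"] vS[OF b] aS[OF b] by (auto simp: clause_def literal_simps literal_simps[simplified])
      next
        assume h: "kd = 7" "r < rho"
        obtain i' where i': "i' \<le> kk" "\<not> S N i' C (rd r i')"
          using conjunct2[OF conjunct2[OF conjunct2[OF conjunct2[OF conjunct2[OF conjunct2[OF conjunct2[OF T']]]]]]] h by blast
        have b: "N < F" "i' < F" "C < F" "rd r i' < F" using i' F C rdF[OF h(2)] by auto
        show ?thesis
          by (rule lit[of "2 * vS F N i' C (rd r i') + 1"]) (use h i' vS[OF b] aS[OF b] in \<open>auto simp: clause_def literal_simps[simplified] intro!: exI[of _ i']\<close>)
      qed
    qed
    then show "cnf.sat (F ^ 5) (F ^ 7) (occurs w N C F)"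
      unfolding cnf.sat_def occurs_def by (intro exI[of _ \<alpha>] allI impI) blast
  next
    assume "cnf.sat (F ^ 5) (F ^ 7) (occurs w N C F)"
    then obtain \<alpha> where \<alpha>: "\<And>c. c < F ^ 7 \<Longrightarrow> \<exists>l<2 * F ^ 5. occurs w N C F l c \<Longrightarrow>
        \<exists>l<2 * F ^ 5. occurs w N C F l c \<and> literal \<alpha> l"
      unfolding cnf.sat_def by blast
    have sat: "\<exists>l. clause w N C F l kd t r i p a b \<and> literal \<alpha> l"
      if b: "kd < F" "t < F" "r < F" "i < F" "p < F" "a < F" "b < F" and l: "clause w N C F l kd t r i p a b" "l < 2 * F ^ 5"
      for l kd t r i p a b
    proof -
      let ?xs = "[kd, t, r, i, p, a, b]"
      have d: "digit F j (encode F ?xs) = ?xs ! j" if "j < 7" for j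
        using that b by (intro digit_encode) auto
      have l7: "length ?xs = 7" by simp
      have "encode F ?xs < F ^ 7" by (rule encode_less[of ?xs F, unfolded l7]) (use b in auto)
      moreover have o: "occurs w N C F l (encode F ?xs) \<longleftrightarrow> clause w N C F l kd t r i p a b" for l
        using d[of 0] d[of 1] d[of 2] d[of 3] d[of 4] d[of 5] d[of 6] unfolding occurs_def by (simp add: eval_nat_numeral)
      ultimately show ?thesis using \<alpha>[of "encode F ?xs"] l unfolding o by blast
    qed
    have z: "0 < F" using F by simp
    define R where "R t r = \<alpha> (vR F t r)" for t r
    define S where "S t i p a = \<alpha> (vS F t i p a)" for t i p a
    have "tableau w N C R S"
      unfolding tableau_def
    proof (intro conjI allI impI)
      fix t assume h: "t < N"
      have "\<exists>l. clause w N C F l 0 t 0 0 0 0 0 \<and> literal \<alpha> l"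
        by (rule sat[of _ _ _ _ _ _ _ "2 * vR F t 0"]) (use h F vR(2)[of t 0] in \<open>auto simp: clause_def intro!: exI[of _ 0]\<close>)
      then show "\<exists>r\<le>rho. R t r"
        by (auto simp: clause_def literal_simps literal_simps[simplified] R_def less_Suc_eq_le)
    next
      fix t r i assume h: "t < N" "r < rho" "i \<le> kk" "R t r"
      have "\<exists>l. clause w N C F l 1 t r i 0 0 0 \<and> literal \<alpha> l"
        by (rule sat[of _ _ _ _ _ _ _ "2 * vR F t r + 1"]) (use h F vR(3)[of t r] in \<open>auto simp: clause_def\<close>)
      then show "S t i C (rd r i)" using h by (auto simp: clause_def literal_simps literal_simps[simplified] R_def S_def)
    next
      fix t r i assume h: "t < N" "r < rho" "i \<le> kk" "R t r"
      have "\<exists>l. clause w N C F l 2 t r i 0 0 0 \<and> literal \<alpha> l"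
        by (rule sat[of _ _ _ _ _ _ _ "2 * vR F t r + 1"]) (use h F vR(3)[of t r] in \<open>auto simp: clause_def\<close>)
      then show "S (t + 1) i (C + 1 - mv r i) (wr r i)" using h by (auto simp: clause_def literal_simps literal_simps[simplified] R_def S_def)
    next
      fix t r i p a assume h: "t < N" "r \<le> rho" "i \<le> kk" "1 \<le> p \<and> p \<le> 2 * C \<and> (p \<noteq> C \<or> r = rho) \<and> a < D" "R t r" "S t i p a"
      have "\<exists>l. clause w N C F l 3 t r i p a 0 \<and> literal \<alpha> l"
        by (rule sat[of _ _ _ _ _ _ _ "2 * vR F t r + 1"]) (use h F vR(3)[of t r] in \<open>auto simp: clause_def\<close>)
      then show "S (t + 1) i (p + 1 - mv r i) a" using h by (auto simp: clause_def literal_simps literal_simps[simplified] R_def S_def)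
    next
      fix t i p a b assume h: "t \<le> N" "i \<le> kk" "p \<le> 2 * C" "a < D" "b < D" "a \<noteq> b"
      have "\<exists>l. clause w N C F l 4 t 0 i p a b \<and> literal \<alpha> l"
        by (rule sat[of _ _ _ _ _ _ _ "2 * vS F t i p a + 1"]) (use h F vS(3)[of t i p a] in \<open>auto simp: clause_def\<close>)
      then show "\<not> S t i p a \<or> \<not> S t i p b" by (auto simp: clause_def literal_simps literal_simps[simplified] S_def)
    next
      fix i p assume h: "i \<le> kk" "p \<le> 2 * C"
      have "\<exists>l. clause w N C F l 5 0 0 i p 0 0 \<and> literal \<alpha> l"
        by (rule sat[of _ _ _ _ _ _ _ "2 * vS F 0 i p (start_symbol w C i p)"])
           (use h F ssF vS(2)[of 0 i p "start_symbol w C i p"] in \<open>auto simp: clause_def\<close>)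
      then show "S 0 i p (start_symbol w C i p)" by (auto simp: clause_def literal_simps literal_simps[simplified] S_def)
    next
      have "\<exists>l. clause w N C F l 6 0 0 0 0 0 0 \<and> literal \<alpha> l"
        by (rule sat[of _ _ _ _ _ _ _ "2 * vS F N kk C 1"]) (use F C vS(2)[of N kk C 1] in \<open>auto simp: clause_def\<close>)
      then show "S N kk C 1" by (auto simp: clause_def literal_simps literal_simps[simplified] S_def)
    next
      fix r assume h: "r < rho"
      have "\<exists>l. clause w N C F l 7 0 r 0 0 0 0 \<and> literal \<alpha> l"
        by (rule sat[of _ _ _ _ _ _ _ "2 * vS F N 0 C (rd r 0) + 1"])
           (use h F C rdF[OF h, of 0] vS(3)[of N 0 C "rd r 0"] in \<open>auto simp: clause_def intro!: exI[of _ 0]\<close>)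
      then show "\<exists>i\<le>kk. \<not> S N i C (rd r i)" by (auto simp: clause_def literal_simps literal_simps[simplified] S_def less_Suc_eq_le)
    qed
    then show "accepts M w" using tableau_accepts C by auto
  qed
qed

end

section \<open>Closure properties of polynomial-time functions\<close>

text \<open>With \<open>\<sigma>\<close> the successor, this is the weakening needed to use an outer
  expression inside the summand of \<open>feasible_sum\<close>.\<close>

lemma feasible_rename:
  assumes "feasible f"
  shows "feasible (\<lambda>w e. f w (\<lambda>j. e (\<sigma> j)))"
proof (rule feasibleI)
  fix \<rho> :: "nat \<Rightarrow> nat" and d assume r: "\<And>j. \<rho> j < d"
  obtain P m q where P: "prog_below m P" "poly_bounded q" "realizes f (\<lambda>j. \<rho> (\<sigma> j)) d P q"
    using feasibleE[where \<rho> = "\<lambda>j. \<rho> (\<sigma> j)" and d = d, OF assms r] by blast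
  then have "realizes (\<lambda>w e. f w (\<lambda>j. e (\<sigma> j))) \<rho> d P q" unfolding realizes_def by blast
  then show "\<exists>P m q. prog_below m P \<and> poly_bounded q \<and> realizes (\<lambda>w e. f w (\<lambda>j. e (\<sigma> j))) \<rho> d P q"
    using P by blast
qed

lemma feasible_mult:
  assumes "feasible f" "feasible g" shows "feasible (\<lambda>w e. f w e * g w e)"
proof -
  have "feasible (\<lambda>w e. \<Sum>i<f w e. g w e)"
    by (rule feasible_sum[OF assms(1)]) (rule feasible_rename[OF assms(2)])
  then show ?thesis by simp
qed

definition feasibleb :: "(bool list \<Rightarrow> (nat \<Rightarrow> nat) \<Rightarrow> bool) \<Rightarrow> bool" where
  "feasibleb P \<longleftrightarrow> feasible (\<lambda>w e. if P w e then 1 else 0)"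

lemma feasibleb_not: "feasibleb P \<Longrightarrow> feasibleb (\<lambda>w e. \<not> P w e)"
  unfolding feasibleb_def
proof -
  assume "feasible (\<lambda>w e. if P w e then 1 else 0)"
  then have "feasible (\<lambda>w e. 1 - (if P w e then 1 else 0))" by (intro feasible_diff feasible_1)
  moreover have "(\<lambda>w e. 1 - (if P w e then 1 else (0::nat))) = (\<lambda>w e. if \<not> P w e then 1 else 0)" by (intro ext) simp
  ultimately show "feasible (\<lambda>w e. if \<not> P w e then 1 else 0)" by simp
qed

lemma feasibleb_conj: "feasibleb P \<Longrightarrow> feasibleb Q \<Longrightarrow> feasibleb (\<lambda>w e. P w e \<and> Q w e)"
  unfolding feasibleb_def
proof -
  assume "feasible (\<lambda>w e. if P w e then 1 else 0)" "feasible (\<lambda>w e. if Q w e then 1 else 0)"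
  then have "feasible (\<lambda>w e. (if P w e then 1 else 0) * (if Q w e then 1 else 0))" by (rule feasible_mult)
  moreover have "(\<lambda>w e. (if P w e then 1 else 0) * (if Q w e then 1 else (0::nat))) =
      (\<lambda>w e. if P w e \<and> Q w e then 1 else 0)" by (intro ext) simp
  ultimately show "feasible (\<lambda>w e. if P w e \<and> Q w e then 1 else 0)" by simp
qed

lemma feasibleb_disj: "feasibleb P \<Longrightarrow> feasibleb Q \<Longrightarrow> feasibleb (\<lambda>w e. P w e \<or> Q w e)"
  using feasibleb_not[OF feasibleb_conj[OF feasibleb_not[of P] feasibleb_not[of Q]]] by simp

lemma feasibleb_le: "feasible f \<Longrightarrow> feasible g \<Longrightarrow> feasibleb (\<lambda>w e. f w e \<le> g w e)"
  unfolding feasibleb_def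
proof -
  assume "feasible f" "feasible g"
  then have "feasible (\<lambda>w e. 1 - (f w e - g w e))" by (intro feasible_diff feasible_1)
  moreover have "(\<lambda>w e. 1 - (f w e - g w e)) = (\<lambda>w e. if f w e \<le> g w e then 1 else 0)" by (intro ext) simp
  ultimately show "feasible (\<lambda>w e. if f w e \<le> g w e then 1 else 0)" by simp
qed

lemma feasibleb_less: "feasible f \<Longrightarrow> feasible g \<Longrightarrow> feasibleb (\<lambda>w e. f w e < g w e)"
  using feasibleb_not[OF feasibleb_le[of g f]] by (simp add: not_le)

lemma feasibleb_eq: "feasible f \<Longrightarrow> feasible g \<Longrightarrow> feasibleb (\<lambda>w e. f w e = g w e)"
  using feasibleb_conj[OF feasibleb_le[of f g] feasibleb_le[of g f]] by (simp add: order_eq_iff)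

lemma feasible_if:
  assumes "feasibleb P" "feasible f" "feasible g"
  shows "feasible (\<lambda>w e. if P w e then f w e else g w e)"
proof -
  have "feasible (\<lambda>w e. (if P w e then 1 else 0) * f w e + (if \<not> P w e then 1 else 0) * g w e)"
    using assms feasibleb_not[OF assms(1)] unfolding feasibleb_def by (intro feasible_add feasible_mult)
  moreover have "(\<lambda>w e. (if P w e then 1 else 0) * f w e + (if \<not> P w e then 1 else 0) * g w e) =
      (\<lambda>w e. if P w e then f w e else g w e)" by (auto intro!: ext)
  ultimately show ?thesis by simp
qed

lemma feasibleb_ex:
  assumes "feasible f" "feasibleb (\<lambda>w e. P w (e 0) (\<lambda>j. e (Suc j)))"
  shows "feasibleb (\<lambda>w e. \<exists>i<f w e. P w i e)"
proof -
  have "feasible (\<lambda>w e. \<Sum>i<f w e. if P w i e then 1 else 0)"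
    using assms(2) unfolding feasibleb_def by (rule feasible_sum[OF assms(1)])
  then have "feasibleb (\<lambda>w e. 0 < (\<Sum>i<f w e. if P w i e then 1 else (0::nat)))"
    by (rule feasibleb_less[OF feasible_0])
  moreover have "0 < (\<Sum>i<f w e. if P w i e then 1 else (0::nat)) \<longleftrightarrow> (\<exists>i<f w e. P w i e)" for w e
  proof -
    have "(\<Sum>i<f w e. if P w i e then 1 else (0::nat)) = 0 \<longleftrightarrow> (\<forall>i\<in>{..<f w e}. (if P w i e then 1 else (0::nat)) = 0)"
      by (rule sum_eq_0_iff) simp
    also have "\<dots> \<longleftrightarrow> \<not> (\<exists>i<f w e. P w i e)" by auto
    finally have "(\<Sum>i<f w e. if P w i e then 1 else (0::nat)) \<noteq> 0 \<longleftrightarrow> (\<exists>i<f w e. P w i e)" by (simp only: not_not)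
    then show ?thesis unfolding zero_less_iff_neq_zero .
  qed
  ultimately show ?thesis by (simp only:)
qed

lemma feasible_div:
  assumes f: "feasible f" and g: "feasible g" shows "feasible (\<lambda>w e. f w e div g w e)"
proof -
  \<comment> \<open>The quotient counts the positive multiples of \<open>y\<close> up to
    \<open>x\<close>; the guard gives 0 for division by zero.\<close>
  have "x div y = (\<Sum>i<x. if 0 < y \<and> (i + 1) * y \<le> x then 1 else 0)" for x y :: nat
  proof (cases "y = 0")
    case False
    have eq: "(i + 1) * y \<le> x \<longleftrightarrow> i < x div y" for i using False less_eq_div_iff_mult_less_eq[of y "i + 1" x] by auto
    have "(\<Sum>i<x. if 0 < y \<and> (i + 1) * y \<le> x then 1 else 0) = (\<Sum>i<x. if i \<in> {..<x div y} then 1 else (0::nat))"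
      by (intro sum.cong refl if_cong) (use False in \<open>simp add: eq[unfolded Suc_eq_plus1[symmetric]] del: mult_Suc\<close>)
    also have "\<dots> = (\<Sum>i<x div y. 1)"
      by (rule sum.mono_neutral_cong_right) (use div_le_dividend[of x y] in auto)
    finally show ?thesis by simp
  qed simp
  moreover have "feasible (\<lambda>w e. \<Sum>i<f w e. if 0 < g w e \<and> (i + 1) * g w e \<le> f w e then 1 else 0)"
    by (rule feasible_sum[OF f])
       (intro feasible_if feasibleb_conj feasibleb_less feasibleb_le feasible_mult feasible_add feasible_var
          feasible_const feasible_rename[OF f] feasible_rename[OF g])
  ultimately show ?thesis by simp
qed

lemma feasible_mod:
  assumes "feasible f" "feasible g" shows "feasible (\<lambda>w e. f w e mod g w e)"
  using feasible_diff[OF assms(1) feasible_mult[OF feasible_div[OF assms] assms(2)]]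
  by (simp add: minus_div_mult_eq_mod)

lemma feasible_power: "feasible f \<Longrightarrow> feasible (\<lambda>w e. f w e ^ k)"
  by (induction k) (simp_all add: feasible_1[unfolded One_nat_def] feasible_mult)

lemma feasible_poly: "feasible f \<Longrightarrow> feasible (\<lambda>w e. poly p (f w e))"
  by (induction p) (simp_all add: feasible_0 feasible_add feasible_mult feasible_const)

text \<open>A finite table costs one case distinction per entry. This is how the transitions of the
  fixed machine enter the programs.\<close>

lemma feasible_table1: "feasible f \<Longrightarrow> feasible (\<lambda>w e. if f w e < n then T (f w e) else 0)"
proof (induction n)
  case (Suc n)
  have "feasible (\<lambda>w e. (if f w e < n then T (f w e) else 0) + (if f w e = n then T n else 0))"
    using Suc by (intro feasible_add feasible_if[OF feasibleb_eq] feasible_const) auto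
  moreover have "(\<lambda>w e. (if f w e < n then T (f w e) else 0) + (if f w e = n then T n else 0)) =
      (\<lambda>w e. if f w e < Suc n then T (f w e) else 0)" by (auto intro!: ext simp: less_Suc_eq)
  ultimately show ?case by simp
qed (simp add: feasible_0)

lemma feasible_table2:
  assumes f: "feasible f" and g: "feasible g"
  shows "feasible (\<lambda>w e. if f w e < n \<and> g w e < m then T (f w e) (g w e) else 0)"
proof (induction n)
  case (Suc n)
  have "feasible (\<lambda>w e. (if f w e < n \<and> g w e < m then T (f w e) (g w e) else 0) +
      (if f w e = n then (if g w e < m then T n (g w e) else 0) else 0))"
    by (intro feasible_add feasible_if Suc feasible_table1 feasibleb_eq f g feasible_const)
  moreover have "(\<lambda>w e. (if f w e < n \<and> g w e < m then T (f w e) (g w e) else 0) +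
      (if f w e = n then (if g w e < m then T n (g w e) else 0) else 0)) =
      (\<lambda>w e. if f w e < Suc n \<and> g w e < m then T (f w e) (g w e) else 0)" by (auto intro!: ext simp: less_Suc_eq)
  ultimately show ?case by simp
qed (simp add: feasible_0)

section \<open>The reduction\<close>

lemma feasible_min: "feasible f \<Longrightarrow> feasible g \<Longrightarrow> feasible (\<lambda>w e. min (f w e) (g w e))"
  unfolding min_def by (intro feasible_if feasibleb_le)

lemma feasible_digit:
  assumes "feasible g" "feasible f" shows "feasible (\<lambda>w e. digit (g w e) j (f w e))"
  unfolding digit_def using assms by (intro feasible_mod feasible_div feasible_power)

lemma feasible_vR:
  assumes "feasible F" "feasible t" "feasible r" shows "feasible (\<lambda>w e. vR (F w e) (t w e) (r w e))"
  unfolding vR_def encode.simps using assms by (intro feasible_add feasible_mult feasible_const)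

lemma feasible_vS:
  assumes "feasible F" "feasible t" "feasible i" "feasible p" "feasible a"
  shows "feasible (\<lambda>w e. vS (F w e) (t w e) (i w e) (p w e) (a w e))"
  unfolding vS_def encode.simps using assms by (intro feasible_add feasible_mult feasible_const)

text \<open>\<open>gadj\<close> without quantifiers, as a condition on the digits of two codes to
  which the feasibility rules apply.\<close>

definition component_adjacency ::
  "nat \<Rightarrow> nat \<Rightarrow> nat \<Rightarrow> (nat \<Rightarrow> nat) \<Rightarrow> (nat \<Rightarrow> nat) \<Rightarrow>
   nat \<Rightarrow> nat \<Rightarrow> nat \<Rightarrow> nat \<Rightarrow> nat \<Rightarrow> nat \<Rightarrow> nat \<Rightarrow> nat \<Rightarrow> bool" where
  "component_adjacency n m La B s t b k r t' b' k' r' \<longleftrightarrow>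
     (t = 2 \<and> r = 0 \<and> k < packing_graph.blen n m La s b \<and> t' \<le> 1 \<and> b' = 0 \<and> k' = 0 \<and> r' = 0) \<or>
     (t = 2 \<and> r = 0 \<and> t' = 3 \<and> b' = b \<and> (k = k' \<or> k = k' + 1) \<and> k' + 1 < packing_graph.blen n m La s b \<and> r' < 9) \<or>
     (t = 2 \<and> r = 0 \<and> t' = 3 \<and> b' = m + n + 1 \<and> k' = 0 \<and> r' < 9 \<and> (b = m \<and> k = 0 \<or> b = m + n \<and> k = La - 1)) \<or>
     (t = 4 \<and> r = 0 \<and> t' = 4 \<and> b' = b \<and> k' = k + 1 \<and> r' = 0 \<and> b < n \<and> k < B b) \<or>
     (t = 2 \<and> r = 0 \<and> t' = 4 \<and> b' < n \<and> b = m + b' \<and> k = La - 1 \<and> k' = 0 \<and> r' = 0) \<or>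
     (t = 2 \<and> r = 0 \<and> t' = 4 \<and> b' < n \<and> b = m + b' + 1 \<and> k = 0 \<and> k' = B b' \<and> r' = 0)"

lemma (in packing_graph) gadj_components:
  "gadj (t, b, k, r) (t', b', k', r') \<longleftrightarrow> component_adjacency n m La B s t b k r t' b' k' r'"
  unfolding gadj_def component_adjacency_def vert_defs prod.inject by fastforce

context ntm
begin

lemma feasible_rd:
  assumes f: "feasible f" and g: "feasible g" shows "feasible (\<lambda>w e. rd (f w e) (g w e))"
proof -
  \<comment> \<open>From \<open>kk\<close> on, \<open>rd\<close> does not depend on the second
    index, so clipping the index makes the table finite.\<close>
  have "feasible (\<lambda>w e. if f w e < rho \<and> min (g w e) kk < kk + 1 then rd (f w e) (min (g w e) kk) else 0)"
    by (rule feasible_table2) (intro f g feasible_min feasible_const)+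
  moreover have "(\<lambda>w e. if f w e < rho \<and> min (g w e) kk < kk + 1 then rd (f w e) (min (g w e) kk) else 0) = (\<lambda>w e. rd (f w e) (g w e))"
    by (intro ext) (auto simp: rd_def min_def)
  ultimately show ?thesis by simp
qed

lemma feasible_wr:
  assumes f: "feasible f" and g: "feasible g" shows "feasible (\<lambda>w e. wr (f w e) (g w e))"
proof -
  have "feasible (\<lambda>w e. if f w e < rho \<and> min (g w e) kk < kk + 1 then wr (f w e) (min (g w e) kk) else 0)"
    by (rule feasible_table2) (intro f g feasible_min feasible_const)+
  moreover have "(\<lambda>w e. if f w e < rho \<and> min (g w e) kk < kk + 1 then wr (f w e) (min (g w e) kk) else 0) = (\<lambda>w e. wr (f w e) (g w e))"
    by (intro ext) (auto simp: wr_def min_def)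
  ultimately show ?thesis by simp
qed

lemma feasible_mv:
  assumes f: "feasible f" and g: "feasible g" shows "feasible (\<lambda>w e. mv (f w e) (g w e))"
proof -
  have "feasible (\<lambda>w e. if f w e < rho \<and> g w e < kk then (if f w e < rho \<and> g w e < kk then mv (f w e) (g w e) else 0) else 1)"
    by (intro feasible_if[OF _ feasible_table2] feasibleb_conj feasibleb_less f g feasible_const)
  moreover have "(\<lambda>w e. if f w e < rho \<and> g w e < kk then (if f w e < rho \<and> g w e < kk then mv (f w e) (g w e) else 0) else 1) = (\<lambda>w e. mv (f w e) (g w e))"
    by (intro ext) (auto simp: mv_def)
  ultimately show ?thesis by simp
qed

lemma feasibleb_clause:
  assumes N: "feasible N" and C: "feasible C" and F: "feasible F" and l: "feasible l"
    and x: "feasible kd" "feasible t" "feasible r" "feasible i" "feasible p" "feasible a" "feasible b"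
  shows "feasibleb (\<lambda>w e. clause w (N w e) (C w e) (F w e) (l w e) (kd w e) (t w e) (r w e) (i w e) (p w e) (a w e) (b w e))"
proof -
  have R: "feasibleb (\<lambda>w e. \<exists>r'<rho + 1. l w e = 2 * vR (F w e) (t w e) r')"
    by (rule feasibleb_ex[OF feasible_const])
       (intro feasibleb_eq feasible_mult feasible_const feasible_vR feasible_var feasible_rename[OF F] feasible_rename[OF l] feasible_rename[OF x(2)])
  have S: "feasibleb (\<lambda>w e. \<exists>i'<kk + 1. l w e = 2 * vS (F w e) (N w e) i' (C w e) (rd (r w e) i') + 1)"
    by (rule feasibleb_ex[OF feasible_const])
       (intro feasibleb_eq feasible_add feasible_mult feasible_const feasible_vS feasible_rd feasible_var feasible_rename[OF F]
          feasible_rename[OF l] feasible_rename[OF N] feasible_rename[OF C] feasible_rename[OF x(3)])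
  show ?thesis unfolding clause_def start_symbol_def
    by (intro feasibleb_disj feasibleb_conj R S feasibleb_eq feasibleb_le feasibleb_less feasibleb_not feasible_vR feasible_vS feasible_rd
        feasible_wr feasible_mv feasible_if feasible_symbol feasible_add feasible_diff feasible_mult feasible_const N C F l x)
qed

lemma feasibleb_occurs:
  assumes "feasible N" "feasible C" "feasible F" "feasible l" "feasible c"
  shows "feasibleb (\<lambda>w e. occurs w (N w e) (C w e) (F w e) (l w e) (c w e))"
  unfolding occurs_def using assms by (intro feasibleb_clause feasible_digit)

end

section \<open>Parameters of the reduction\<close>

locale reduction = ntm +
  fixes p :: "nat poly"
  assumes time: "\<And>w k c. (initial M w, c) \<in> step M ^^ k \<Longrightarrow> k \<le> poly p (length w)"
begin

text \<open>\<open>L\<close> stands for the length of the input. It is a separate argument because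
  it is the number that the programs find in register 0.\<close>

definition FF :: "nat \<Rightarrow> nat" where
  "FF L = poly p L + 2 * (poly p L + 2) + D + rho + kk + 10"

definition occ :: "bool list \<Rightarrow> nat \<Rightarrow> nat \<Rightarrow> nat \<Rightarrow> bool" where
  "occ w L = occurs w (poly p L) (poly p L + 2) (FF L)"

definition bins :: "nat \<Rightarrow> nat" where "bins L = cnf.nn (FF L ^ 5) (FF L ^ 7)"

definition items :: "nat \<Rightarrow> nat" where "items L = bins L * bins L"

definition isize :: "bool list \<Rightarrow> nat \<Rightarrow> nat \<Rightarrow> nat" where
  "isize w L i = 10 * cnf.size_of (FF L ^ 5) (FF L ^ 7) (occ w L) (i div bins L) (i mod bins L)"

definition bcap :: "bool list \<Rightarrow> nat \<Rightarrow> nat \<Rightarrow> nat" where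
  "bcap w L j = 10 * cnf.cap (FF L ^ 5) (FF L ^ 7) (occ w L) j"

definition wall :: "bool list \<Rightarrow> nat \<Rightarrow> nat" where
  "wall w L = 3 * ((\<Sum>j<bins L. bcap w L j + 4) + 6)"

text \<open>The base of the vertex codes. It exceeds every component of a vertex
  (\<open>gadj_code_box\<close>), the sums serving as crude bounds for their members.\<close>

definition base :: "bool list \<Rightarrow> nat \<Rightarrow> nat" where
  "base w L = items L + bins L + wall w L + (\<Sum>i<items L. isize w L i) + (\<Sum>j<bins L. bcap w L j) + 20"

definition entry :: "bool list \<Rightarrow> nat \<Rightarrow> nat \<Rightarrow> nat \<Rightarrow> bool" where
  "entry w L x y = component_adjacency (bins L) (items L) (wall w L) (bcap w L) (isize w L)
     (digit (base w L) 0 x) (digit (base w L) 1 x) (digit (base w L) 2 x) (digit (base w L) 3 x)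
     (digit (base w L) 0 y) (digit (base w L) 1 y) (digit (base w L) 2 y) (digit (base w L) 3 y)"

context
  fixes f :: "bool list \<Rightarrow> (nat \<Rightarrow> nat) \<Rightarrow> nat"
  assumes f: "feasible f"
begin

lemma feasible_FF: "feasible (\<lambda>w e. FF (f w e))"
  unfolding FF_def by (intro feasible_add feasible_mult feasible_const feasible_poly f)

lemma feasible_bins: "feasible (\<lambda>w e. bins (f w e))"
  unfolding bins_def cnf.nn_def by (intro feasible_add feasible_mult feasible_const feasible_power feasible_FF)

lemma feasible_items: "feasible (\<lambda>w e. items (f w e))"
  unfolding items_def by (intro feasible_mult feasible_bins)

lemma feasible_RR: "feasible (\<lambda>w e. cnf.RR (FF (f w e) ^ 5) (FF (f w e) ^ 7))"
  unfolding cnf.RR_def bins_def[symmetric] by (intro feasible_mult feasible_const feasible_power feasible_add feasible_bins)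

lemma feasible_high:
  assumes "feasible x" "feasible y" shows "feasible (\<lambda>w e. cnf.high (FF (f w e) ^ 5) (FF (f w e) ^ 7) (x w e) (y w e))"
  unfolding cnf.high_def using assms by (intro feasible_add feasible_mult feasible_const feasible_RR)

lemma feasible_wt:
  assumes "feasible x" "feasible y"
  shows "feasible (\<lambda>w e. cnf.wt (FF (f w e) ^ 5) (FF (f w e) ^ 7) (occ w (f w e)) (x w e) (y w e))"
  unfolding cnf.wt_def occ_def bins_def[symmetric] using assms
  by (intro feasible_if feasibleb_conj feasibleb_less feasibleb_le feasibleb_eq feasibleb_not feasibleb_occurs feasible_poly
      feasible_add feasible_diff feasible_mult feasible_div feasible_const feasible_power feasible_FF feasible_bins f)

lemma feasible_isize:
  assumes "feasible x" shows "feasible (\<lambda>w e. isize w (f w e) (x w e))"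
  unfolding isize_def cnf.size_of_def using assms
  by (intro feasible_if feasibleb_less feasibleb_eq feasible_wt feasible_high feasible_RR
      feasible_add feasible_mult feasible_div feasible_mod feasible_const feasible_bins)

end

lemma feasible_bcap:
  assumes f: "feasible f" and x: "feasible x" shows "feasible (\<lambda>w e. bcap w (f w e) (x w e))"
proof -
  have s1: "feasible (\<lambda>w e. \<Sum>l<2 * FF (f w e) ^ 5. cnf.wt (FF (f w e) ^ 5) (FF (f w e) ^ 7) (occ w (f w e)) l (x w e))"
    by (rule feasible_sum) (intro feasible_wt feasible_mult feasible_const feasible_power feasible_FF f feasible_var
      feasible_rename[OF f] feasible_rename[OF x])+
  have s2: "feasible (\<lambda>w e. \<Sum>q<bins (f w e). if cnf.wt (FF (f w e) ^ 5) (FF (f w e) ^ 7) (occ w (f w e)) (x w e) q = 0 then 0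
      else cnf.high (FF (f w e) ^ 5) (FF (f w e) ^ 7) (x w e) q)"
    by (rule feasible_sum) (intro feasible_if feasibleb_eq feasible_wt feasible_high feasible_const feasible_bins f feasible_var
      feasible_rename[OF f] feasible_rename[OF x])+
  show ?thesis unfolding bcap_def cnf.cap_def cnf.slack_def bins_def[symmetric]
    by (intro feasible_if feasibleb_less s1 s2 feasible_RR feasible_add feasible_diff feasible_mult feasible_const
        feasible_power feasible_FF feasible_bins f x)
qed

lemma feasible_wall:
  assumes f: "feasible f" shows "feasible (\<lambda>w e. wall w (f w e))"
proof -
  have "feasible (\<lambda>w e. \<Sum>j<bins (f w e). bcap w (f w e) j + 4)"
    by (rule feasible_sum) (intro feasible_bins f feasible_add feasible_bcap feasible_const feasible_var feasible_rename[OF f])+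
  then show ?thesis unfolding wall_def by (intro feasible_add feasible_mult feasible_const)
qed

lemma feasible_base:
  assumes f: "feasible f" shows "feasible (\<lambda>w e. base w (f w e))"
proof -
  have s1: "feasible (\<lambda>w e. \<Sum>j<bins (f w e). bcap w (f w e) j)"
    by (rule feasible_sum) (intro feasible_bins f feasible_bcap feasible_var feasible_rename[OF f])+
  have s2: "feasible (\<lambda>w e. \<Sum>i<items (f w e). isize w (f w e) i)"
    by (rule feasible_sum) (intro feasible_items f feasible_isize feasible_var feasible_rename[OF f])+
  show ?thesis unfolding base_def by (intro feasible_add feasible_const s1 s2 feasible_wall feasible_items feasible_bins f)
qed

lemma feasibleb_entry:
  assumes f: "feasible f" and x: "feasible x" and y: "feasible y" shows "feasibleb (\<lambda>w e. entry w (f w e) (x w e) (y w e))"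
  unfolding entry_def component_adjacency_def packing_graph.blen_def
  by (intro feasibleb_disj feasibleb_conj feasibleb_eq feasibleb_le feasibleb_less feasible_if feasible_digit feasible_wall feasible_bcap
      feasible_isize feasible_items feasible_bins feasible_base feasible_add feasible_diff feasible_const f x y)

end

section \<open>Coding of the graph\<close>

lemma length_adjacency_word: "length (adjacency_word n E) = n * n"
  by (simp add: adjacency_word_def length_concat comp_def sum_list_triv)

text \<open>Used for the converse direction of the reduction: no other graph is represented by the
  same word.\<close>

lemma adjacency_word_inj:
  assumes "simple_graph {..<n} E" "simple_graph {..<n'} E'" "adjacency_word n E = adjacency_word n' E'"
  shows "n = n'" "E = E'"
proof -
  have "n * n = n' * n'" using arg_cong[OF assms(3), of length] by (simp add: length_adjacency_word)
  then show n: "n = n'" using power2_eq_imp_eq[of n n'] by (simp add: power2_eq_square)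
  have "map (\<lambda>i. map (\<lambda>j. {i, j} \<in> E) [0..<n]) [0..<n] = map (\<lambda>i. map (\<lambda>j. {i, j} \<in> E') [0..<n]) [0..<n]"
    using assms(3) unfolding n adjacency_word_def by (rule concat_injective) (auto simp: set_zip)
  then have iff: "{i, j} \<in> E \<longleftrightarrow> {i, j} \<in> E'" if "i < n" "j < n" for i j using that by simp
  have same: "e \<in> E \<longleftrightarrow> e \<in> E'" if e: "e \<subseteq> {..<n}" "card e = 2" for e
  proof -
    obtain i j where "e = {i, j}" using e(2) by (auto simp: card_2_iff)
    then show ?thesis using iff[of i j] e(1) by simp
  qed
  show "E = E'"
  proof (intro set_eqI iffI)
    fix e assume "e \<in> E"
    then show "e \<in> E'" using assms(1) same[of e] unfolding simple_graph_def by blast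
  next
    fix e assume "e \<in> E'"
    then show "e \<in> E" using assms(2) same[of e] unfolding simple_graph_def n by blast
  qed
qed

text \<open>The programs count down, so the entries are computed at mirrored indices.\<close>

lemma map_upt_rev: "map g [0..<N] = map (\<lambda>i. g (N - 1 - i)) (rev [0..<N])"
  by (rule nth_equalityI) (simp_all add: rev_nth)

lemma sum_div_mod:
  fixes n :: nat
  shows "(\<Sum>i | i < n * n \<and> P (i div n, i mod n). g (i div n, i mod n)) = (\<Sum>x | x \<in> {..<n} \<times> {..<n} \<and> P x. g x)"
proof (rule sum.reindex_bij_witness[where i = "\<lambda>x. fst x * n + snd x" and j = "\<lambda>i. (i div n, i mod n)"])
  fix x assume x: "x \<in> {x. x \<in> {..<n} \<times> {..<n} \<and> P x}"
  then obtain p q where pq: "x = (p, q)" "p < n" "q < n" by auto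
  have "p * n + q < (p + 1) * n" using pq by simp
  also have "\<dots> \<le> n * n" using pq by (intro mult_right_mono) auto
  finally have "p * n + q < n * n" .
  then show "((fst x * n + snd x) div n, (fst x * n + snd x) mod n) = x"
    "fst x * n + snd x \<in> {i. i < n * n \<and> P (i div n, i mod n)}" using pq x by auto
next
  fix i assume i: "i \<in> {i. i < n * n \<and> P (i div n, i mod n)}"
  then have "n > 0" by (cases n) auto
  then show "(i div n, i mod n) \<in> {x. x \<in> {..<n} \<times> {..<n} \<and> P x}" using i by (simp add: less_mult_imp_div_less)
qed simp_all

definition code_box :: "nat \<Rightarrow> vert set" where
  "code_box G = {(t, b, k, r). t < G \<and> b < G \<and> k < G \<and> r < G}"

definition vcode :: "nat \<Rightarrow> vert \<Rightarrow> nat" where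
  "vcode G v = (case v of (t, b, k, r) \<Rightarrow> encode G [t, b, k, r])"

definition vdecode :: "nat \<Rightarrow> nat \<Rightarrow> vert" where
  "vdecode G x = (digit G 0 x, digit G 1 x, digit G 2 x, digit G 3 x)"

lemma vcode_less: "v \<in> code_box G \<Longrightarrow> vcode G v < G ^ 4"
  using encode_less[of "[fst v, fst (snd v), fst (snd (snd v)), snd (snd (snd v))]" G]
  by (auto simp: code_box_def vcode_def eval_nat_numeral split: prod.splits)

lemma vdecode_vcode: assumes "v \<in> code_box G" shows "vdecode G (vcode G v) = v"
proof -
  obtain t b k r where v: "v = (t, b, k, r)" by (cases v) auto
  have "digit G j (encode G [t, b, k, r]) = [t, b, k, r] ! j" if "j < 4" for j
    using assms that v by (intro digit_encode) (auto simp: code_box_def)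
  from this[of 0] this[of 1] this[of 2] this[of 3] show ?thesis
    by (simp add: v vdecode_def vcode_def eval_nat_numeral del: encode.simps)
qed

lemma vcode_vdecode: assumes "x < G ^ 4" shows "vcode G (vdecode G x) = x"
proof -
  have G: "G > 0" using assms by (cases G) auto
  have "x < G ^ 3 * G" using assms by (simp add: eval_nat_numeral ac_simps)
  then have "x div G ^ 3 < G" by (simp add: less_mult_imp_div_less ac_simps)
  then have 3: "digit G 3 x = x div G ^ 2 div G" by (simp add: digit_def div_mult2_eq[symmetric] eval_nat_numeral ac_simps)
  have 2: "digit G 2 x = x div G div G mod G" "x div G ^ 2 = x div G div G"
    by (simp_all add: digit_def div_mult2_eq[symmetric] power2_eq_square)
  have "y mod G + G * (y div G) = y" for y :: nat by simp
  note this[of x] this[of "x div G"] this[of "x div G div G"]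
  then show ?thesis unfolding vcode_def vdecode_def 3 2 by (simp add: digit_def)
qed

context packing_graph
begin

lemma gadj_code_box:
  assumes G: "m + n + La + (\<Sum>i<m. s i) + (\<Sum>j<n. B j) + 20 \<le> G" and a: "gadj x y"
  shows "x \<in> code_box G" "y \<in> code_box G"
proof -
  have bl: "b \<le> m + n \<and> blen b < G" if "k < blen b" for b k
  proof -
    have "s b \<le> (\<Sum>i<m. s i)" if "b < m" using that by (intro member_le_sum) auto
    then show ?thesis using that G unfolding blen_def by (auto split: if_splits)
  qed
  have B: "B j < G" if "j < n" for j
  proof -
    have "B j \<le> (\<Sum>j<n. B j)" using that by (intro member_le_sum) auto
    then show ?thesis using G by linarith
  qed
  obtain t b k r t' b' k' r' where xy: "x = (t, b, k, r)" "y = (t', b', k', r')" by (cases x, cases y) auto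
  have "(t < G \<and> b < G \<and> k < G \<and> r < G) \<and> (t' < G \<and> b' < G \<and> k' < G \<and> r' < G)"
    using a unfolding xy gadj_components component_adjacency_def
  proof (elim disjE conjE, goal_cases)
    case 1 then show ?case using bl[of k b] G by auto
  next
    case 2 then show ?case using bl[of "k' + 1" b] G by auto
  next
    case 3 then show ?case using bl[of "k' + 1" b] G by auto
  next
    case 6 then show ?case using B[of b] G by auto
  next
    case 8 then show ?case using B[of b'] G by auto
  qed (use G in auto)
  then show "x \<in> code_box G" "y \<in> code_box G" unfolding xy code_box_def by auto
qed

lemma coded_edge_iff:
  assumes G: "m + n + La + (\<Sum>i<m. s i) + (\<Sum>j<n. B j) + 20 \<le> G" and xy: "x < G ^ 4" "y < G ^ 4"
  shows "{x, y} \<in> (`) (vcode G) ` gedges \<longleftrightarrow> gadj (vdecode G x) (vdecode G y) \<or> gadj (vdecode G y) (vdecode G x)"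
proof
  assume "{x, y} \<in> (`) (vcode G) ` gedges"
  then obtain u v where uv: "{x, y} = {vcode G u, vcode G v}" "gadj u v" unfolding gedges_def by auto
  have "vdecode G (vcode G u) = u" "vdecode G (vcode G v) = v" using gadj_code_box[OF G uv(2)] by (simp_all add: vdecode_vcode)
  then show "gadj (vdecode G x) (vdecode G y) \<or> gadj (vdecode G y) (vdecode G x)"
    using uv unfolding doubleton_eq_iff by auto
next
  assume "gadj (vdecode G x) (vdecode G y) \<or> gadj (vdecode G y) (vdecode G x)"
  then have "{vdecode G x, vdecode G y} \<in> gedges" by (simp add: gedges_iff)
  then have "vcode G ` {vdecode G x, vdecode G y} \<in> (`) (vcode G) ` gedges" by (rule imageI)
  then show "{x, y} \<in> (`) (vcode G) ` gedges" using xy by (simp add: vcode_vdecode)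
qed

end

section \<open>Correctness of the reduction\<close>

context reduction
begin

definition graph :: "bool list \<Rightarrow> nat set set" where
  "graph w = (`) (vcode (base w (length w))) ` packing_graph.gedges (bins (length w)) (items (length w))
     (wall w (length w)) (bcap w (length w)) (isize w (length w))"

definition reduct :: "bool list \<Rightarrow> bool list" where
  "reduct w = adjacency_word (base w (length w) ^ 4) (graph w)"

lemma graph_iff:
  assumes "x < base w (length w) ^ 4" "y < base w (length w) ^ 4"
  shows "{x, y} \<in> graph w \<longleftrightarrow> entry w (length w) x y \<or> entry w (length w) y x"
  using packing_graph.coded_edge_iff[OF _ assms, of "items (length w)" "bins (length w)" "wall w (length w)" "isize w (length w)" "bcap w (length w)"]
  unfolding graph_def entry_def packing_graph.gadj_components[symmetric] vdecode_def base_def by simp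

lemma reduct_computable: "polynomial_time_computable reduct"
proof -
  let ?n = "\<lambda>w L. base w L ^ 4"
  let ?h = "\<lambda>w j i L. if entry w L (?n w L - 1 - i) (?n w L - 1 - j) \<or> entry w L (?n w L - 1 - j) (?n w L - 1 - i) then 1 else (0::nat)"
  have n: "feasible (\<lambda>w e. ?n w (e j))" for j by (intro feasible_power feasible_base feasible_var)
  have "feasible (\<lambda>w e. ?h w (e 0) (e 1) (e 2))"
    by (intro feasible_if feasibleb_disj feasibleb_entry feasible_diff n feasible_var feasible_const)
  note feasible_matrix_computable[OF n[of 0] this]
  moreover have "reduct w = (let L = length w; N = ?n w L in
      concat (map (\<lambda>i. map (\<lambda>j. ?h w j i L \<noteq> 0) (rev [0..<N])) (rev [0..<N])))" for w
  proof -
    let ?L = "length w" let ?N = "?n w ?L"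
    have "reduct w = concat (map (\<lambda>i. map (\<lambda>j. entry w ?L i j \<or> entry w ?L j i) [0..<?N]) [0..<?N])"
      unfolding reduct_def adjacency_word_def by (intro arg_cong[of _ _ concat] map_cong refl graph_iff) auto
    also have "\<dots> = concat (map (\<lambda>i. map (\<lambda>j. entry w ?L (?N - 1 - i) (?N - 1 - j) \<or> entry w ?L (?N - 1 - j) (?N - 1 - i))
        (rev [0..<?N])) (rev [0..<?N]))"
      by (subst map_upt_rev, subst map_upt_rev) (rule refl)
    finally show ?thesis unfolding Let_def by (simp only: if_split_eq1) simp
  qed
  ultimately show ?thesis by presburger
qed

lemma bins_pos: "bins L \<ge> 1"
  by (simp add: bins_def cnf.nn_def FF_def Suc_le_eq)

lemma graph_simple: "simple_graph {..<base w (length w) ^ 4} (graph w)"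
  and reduct_correct: "accepts M w \<longleftrightarrow> admits_RAC_drawing {..<base w (length w) ^ 4} (graph w)"
proof -
  let ?L = "length w" let ?G = "base w ?L"
  let ?occ = "occ w ?L" let ?V = "FF ?L ^ 5" let ?C = "FF ?L ^ 7" let ?n = "bins ?L"
  interpret P: packing_graph ?n "items ?L" "wall w ?L" "bcap w ?L" "isize w ?L" .
  interpret C: cnf ?V ?C ?occ .
  have nn: "C.nn = ?n" by (simp add: bins_def)
  have G: "items ?L + ?n + wall w ?L + (\<Sum>i<items ?L. isize w ?L i) + (\<Sum>j<?n. bcap w ?L j) + 20 \<le> ?G" by (simp add: base_def)
  have sub: "\<Union> P.gedges \<subseteq> code_box ?G" using P.gadj_code_box[OF G] unfolding P.gedges_def by auto
  have inj: "inj_on (vcode ?G) (\<Union> P.gedges)" using sub by (intro inj_on_inverseI[of _ "vdecode ?G"]) (auto simp: vdecode_vcode)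
  have im: "vcode ?G ` \<Union> P.gedges \<subseteq> {..<?G ^ 4}" using sub vcode_less by blast
  have La: "3 * ((\<Sum>j<?n. bcap w ?L j + 4) + 6) \<le> wall w ?L" by (simp add: wall_def)
  note R = P.admits_RAC_packing[OF bins_pos La inj im, folded graph_def]
  have acc: "accepts M w \<longleftrightarrow> C.sat" unfolding occ_def by (rule accepts_iff_sat[OF time]) (simp_all add: FF_def)
  have fit: "(\<Sum>i | i < items ?L \<and> \<beta> (i div ?n, i mod ?n) = j. isize w ?L i) =
      10 * (\<Sum>x | x \<in> C.pairs \<and> \<beta> x = j. C.size_of (fst x) (snd x))" for \<beta> :: "nat \<times> nat \<Rightarrow> nat" and j
    using sum_div_mod[where n = ?n and P = "\<lambda>x. \<beta> x = j" and g = "\<lambda>x. 10 * C.size_of (fst x) (snd x)"]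
    by (simp add: items_def isize_def C.pairs_def nn sum_distrib_left)
  have div: "i div ?n < ?n" "i mod ?n < ?n" if "i < items ?L" for i
    using that bins_pos[of ?L] by (auto simp: items_def less_mult_imp_div_less)
  have "C.sat \<longleftrightarrow> admits_RAC_drawing {..<?G ^ 4} (graph w)"
  proof
    assume C.sat
    then obtain \<beta> where \<beta>: "\<forall>x\<in>C.pairs. \<beta> x < ?n" "\<forall>k<?n. (\<Sum>x | x \<in> C.pairs \<and> \<beta> x = k. C.size_of (fst x) (snd x)) \<le> C.cap k"
      using C.sat_packing nn by auto
    show "admits_RAC_drawing {..<?G ^ 4} (graph w)"
    proof (rule R(2)[of "\<lambda>i. \<beta> (i div ?n, i mod ?n)"])
      show "\<forall>i<items ?L. \<beta> (i div ?n, i mod ?n) < ?n" using \<beta>(1) div by (auto simp: C.pairs_def nn)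
      show "\<forall>j<?n. (\<Sum>i | i < items ?L \<and> \<beta> (i div ?n, i mod ?n) = j. isize w ?L i) \<le> bcap w ?L j"
        unfolding fit bcap_def using \<beta>(2) by auto
    qed
  next
    assume "admits_RAC_drawing {..<?G ^ 4} (graph w)"
    then obtain \<beta> where \<beta>: "\<forall>i<items ?L. \<beta> i < ?n" "\<forall>j<?n. (\<Sum>i | i < items ?L \<and> \<beta> i = j. isize w ?L i) \<le> bcap w ?L j + 9"
      using R(3) by blast
    let ?\<beta> = "\<lambda>x. \<beta> (fst x * ?n + snd x)"
    show C.sat
    proof (rule C.packing_sat[of ?\<beta>])
      fix x assume "x \<in> C.pairs"
      then have x: "fst x + 1 \<le> ?n" "snd x < ?n" by (auto simp: C.pairs_def nn)
      have "fst x * ?n + snd x < (fst x + 1) * ?n" using x by simp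
      also have "\<dots> \<le> items ?L" unfolding items_def using x(1) by (rule mult_right_mono) simp
      finally show "?\<beta> x < C.nn" using \<beta>(1) nn by auto
    next
      fix j assume j: "j < C.nn"
      have "10 * (\<Sum>x | x \<in> C.pairs \<and> ?\<beta> x = j. C.size_of (fst x) (snd x)) = (\<Sum>i | i < items ?L \<and> \<beta> i = j. isize w ?L i)"
        using fit[of ?\<beta> j] by simp
      \<comment> \<open>Sizes and capacities are multiples of ten, so the excess of 9 disappears on
        division.\<close>
      also have "\<dots> \<le> 10 * C.cap j + 9" using \<beta>(2) j nn by (simp add: bcap_def)
      finally show "(\<Sum>x | x \<in> C.pairs \<and> ?\<beta> x = j. C.size_of (fst x) (snd x)) \<le> C.cap j" by linarith
    qed
  qed
  then show "accepts M w \<longleftrightarrow> admits_RAC_drawing {..<?G ^ 4} (graph w)" using acc by blast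
  show "simple_graph {..<?G ^ 4} (graph w)" by (rule R(1))
qed

lemma reduces:
  "polynomial_time_reducible {w. accepts M w} {adjacency_word n E | n E. simple_graph {..<n} E \<and> admits_RAC_drawing {..<n} E}"
  unfolding polynomial_time_reducible_def
proof (intro exI[of _ reduct] conjI reduct_computable allI)
  fix w
  have s: "simple_graph {..<base w (length w) ^ 4} (graph w)" by (rule graph_simple)
  show "w \<in> {w. accepts M w} \<longleftrightarrow> reduct w \<in> {adjacency_word n E | n E. simple_graph {..<n} E \<and> admits_RAC_drawing {..<n} E}"
  proof
    assume "w \<in> {w. accepts M w}"
    then show "reduct w \<in> {adjacency_word n E | n E. simple_graph {..<n} E \<and> admits_RAC_drawing {..<n} E}"
      using reduct_correct[of w] s unfolding reduct_def by blast
  next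
    assume "reduct w \<in> {adjacency_word n E | n E. simple_graph {..<n} E \<and> admits_RAC_drawing {..<n} E}"
    then obtain n E where E: "adjacency_word (base w (length w) ^ 4) (graph w) = adjacency_word n E" "simple_graph {..<n} E" "admits_RAC_drawing {..<n} E"
      unfolding reduct_def by blast
    then show "w \<in> {w. accepts M w}" using adjacency_word_inj[OF s E(2,1)] E(3) reduct_correct[of w] by simp
  qed
qed

end

theorem theorem4:
  "NP_hard {adjacency_word n E | n E. simple_graph {..<n} E \<and> admits_RAC_drawing {..<n} E}"
  unfolding NP_hard_def
proof
  fix A assume "A \<in> NP"
  then obtain M where M: "well_formed M" "polynomial_time M" "A = {w. accepts M w}" unfolding NP_def by blast
  obtain p :: "nat poly" where p: "\<And>w k c. (initial M w, c) \<in> step M ^^ k \<Longrightarrow> k \<le> poly p (length w)"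
    using M(2) unfolding polynomial_time_def by blast
  obtain tr where tr: "set tr = trans M" using M(1) finite_list unfolding well_formed_def by blast
  let ?S = "\<lambda>t. {fst (fst t), fst (snd t)} \<union> set (snd (fst t)) \<union> fst ` set (snd (snd t))"
  have "finite (\<Union>t\<in>set tr. ?S t)" by simp
  then obtain D where D: "\<forall>x\<in>(\<Union>t\<in>set tr. ?S t). x < D" unfolding finite_nat_set_iff_bounded ..
  \<comment> \<open>The 3 makes room for the input symbols and the accepting state, which need not
    occur in the transitions.\<close>
  interpret reduction M tr "D + 3" p
  proof
    fix q rs q' ws assume t: "((q, rs), (q', ws)) \<in> set tr"
    have "x < D + 3" if "x \<in> ?S ((q, rs), (q', ws))" for x using D t that by (meson UN_I trans_less_add1)
    then show "q < D + 3 \<and> q' < D + 3 \<and> set rs \<subseteq> {..<D + 3} \<and> fst ` set ws \<subseteq> {..<D + 3}" by auto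
  next
    fix w k c assume "(initial M w, c) \<in> step M ^^ k"
    then show "k \<le> poly p (length w)" by (rule p)
  qed (rule M(1), rule tr, rule le_add2)
  show "polynomial_time_reducible A {adjacency_word n E | n E. simple_graph {..<n} E \<and> admits_RAC_drawing {..<n} E}"
    using reduces M(3) by simp
qed

end
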